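(* Let $N\ge1$, $T>0$, $Q_T=\mathbb{R}^N\times(0,T]$, $\bar Q_T=\mathbb{R}^N\times[0,T]$, $\sigma\in(0,1)$. Let $a:\mathbb{R}^N\times\mathbb{R}^N\to\mathbb{R}$ be uniformly continuous, $H\in C(\mathbb{R}^N\times\mathbb{R}^N\times\mathbb{R}^N)$, and $K^\sigma:\mathbb{R}^N\to\mathbb{R}$ nonnegative and measurable. Assume: (1) there is $a_0>0$ with $a_0\le a(x,y)\le a_0^{-1}$ for all $x,y$; the function $\bar k(z):=K^\sigma(z)|z|^{N+\sigma}$ is bounded on $\mathbb{R}^N$, continuous at the origin, and $\bar k(0)=C_{N,\sigma}>0$; (2) $|H(\cdot,\cdot,0)|_\infty<+\infty$, $|a|_\infty<+\infty$, and $a(x,\cdot)$, $H(x,\cdot,p)$ are $\mathbb{Z}^N$-periodic for all $x,p\in\mathbb{R}^N$; (3) there exist $b_0,C_0>0$, $m>1$ such that $\mu H(x,y,\mu^{-1}p)-H(x,y,p)\ge(1-\mu)(b_0|p|^m-C_0)$ for all $\mu\in(0,1)$ and all $x,y,p\in\mathbb{R}^N$; (4) there is a modulus of continuity $\omega$ such that for all $R>0$, all $x,x',y,y'\in\mathbb{R}^N$ and all $p,p'\in\mathbb{R}^N$ with $|p|,|p'|\le R$, $$|H(x,y,p)-H(x',y',p')|\le\omega(|x-x'|+|y-y'|)(1+R^m)+\omega(|p-p'|)(1+R^{m-1}).$$ Let $u_0$ be bounded and uniformly continuous on $\mathbb{R}^N$, and for $\epsilon>0$ let $u^\epsilon$ be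 the unique bounded continuous viscosity solution of $$u^\epsilon_t-a\left(x,\tfrac x\epsilon\right)\mathcal{I}(u^\epsilon,x)+H\left(x,\tfrac x\epsilon,Du^\epsilon\right)=0\ \text{ in }Q_T,\qquad u^\epsilon(x,0)=u_0(x),\ x\in\mathbb{R}^N,$$ where $\mathcal{I}(u,x)=\int_{\mathbb{R}^N}[u(x+z)-u(x)]K^\sigma(z)\,dz$. Let $\bar H(x,p,l)$ be the unique constant $c$ such that the cell problem $-a(x,y)l+H(x,y,p+D\psi(y))=c$, $y\in\mathbb{T}^N$, has a Lipschitz continuous viscosity solution $\psi$. Then, as $\epsilon\to0$, the family $u^\epsilon$ converges locally uniformly in $\bar Q_T$ to a viscosity solution $u$ of the effective problem $$u_t+\bar H(x,Du,\mathcal{I}(u,x))=0\ \text{ in }Q_T,\qquad u(x,0)=u_0(x),\ x\in\mathbb{R}^N.$$ Moreover $u$ is the unique viscosity solution of $u_t+\bar H(x,Du,\mathcal{I}(u,x))=0$ in $Q_T$ attaining uniformly continuously the initial data $u_0$, i.e. satisfying $\sup_{x\in\mathbb{R}^N}|u(x,t)-u_0(x)|\le\omega_0(t)$ for $t\in[0,T]$ for some modulus of continuity $\omega_0$.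
   Context: A modulus of continuity is a nondecreasing function $\omega:[0,\infty)\to[0,\infty)$ with $\omega(t)\to\omega(0)=0$ as $t\to0^+$. $\mathbb{T}^N=\mathbb{R}^N/\mathbb{Z}^N$; functions on $\mathbb{T}^N$ are identified with $\mathbb{Z}^N$-periodic functions. $C_{N,\sigma}>0$ is the standard normalizing constant of the fractional Laplacian $(-\Delta)^{\sigma/2}$ (so that $-C_{N,\sigma}\int_{\mathbb{R}^N}[u(x+z)-u(x)]|z|^{-N-\sigma}dz$ has Fourier symbol $|\xi|^\sigma$). $B_\delta$ is the ball of radius $\delta$ centered at $0$, $B_\delta(x)$ the ball centered at $x$. The operator $\mathcal{I}$ acts in space at fixed time. It is known that under the stated hypotheses $u^\epsilon$ exists and is unique, and that $\bar H(x,p,l)$ is well defined, continuous and decreasing in $l$. Viscosity solutions. For $\delta\in(0,1)$, $\phi\in C^2$ and bounded $u$ set $\mathcal{I}[B_\delta](\phi,x)=\int_{B_\delta}[\phi(x+z,t)-\phi(x,t)]K^\sigma(z)dz$ and $\mathcal{I}[B_\delta^c](u,x)=\int_{B_\delta^c}[u(x+z,t)-u(x,t)]K^\sigma(z)dz$. For $u_t+F(x,Du,\mathcal{I}(u,x))=0$ in $Q_T$, with $F$ continuous and nonincreasing in its last variable, a bounded upper semicontinuous (resp. lower semicontinuous) $u$ is a viscosity subsolution (resp. supersolution) if for every $(x,t)\in\mathbb{R}^N\times(0,T]$ and every $\phi\in C^2(\mathbb{R}^N\times(0,T])$ such that $(x,t)$ is a maximum (resp. minimum) point of $u-\phi$ in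 $B_\delta(x)\times(t-\delta,t+\delta)$ (intersected with $Q_T$) for a small $\delta>0$, one has $$\phi_t(x,t)+F\big(x,D\phi(x,t),\mathcal{I}[B_\delta](\phi,x)+\mathcal{I}[B_\delta^c](u,x)\big)\le0\quad(\text{resp. }\ge0).$$ A bounded continuous function is a viscosity solution if it is both a sub- and a supersolution. The $\epsilon$-problem corresponds to $F(x,p,l)=-a(x,x/\epsilon)l+H(x,x/\epsilon,p)$, the effective one to $F=\bar H$. Viscosity solutions of the cell problem are in the usual first-order sense. *)

theory Defs
  imports "HOL-Analysis.Analysis"
begin

definition modulus_of_continuity :: "(real \<Rightarrow> real) \<Rightarrow> bool" where
  "modulus_of_continuity \<omega> \<longleftrightarrow>
     mono_on {0..} \<omega> \<and> (\<forall>t\<ge>0. 0 \<le> \<omega> t) \<and> \<omega> 0 = 0 \<and> (\<omega> \<longlongrightarrow> 0) (at_right 0)"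

definition Z_periodic :: "(real^'n \<Rightarrow> 'b) \<Rightarrow> bool" where
  "Z_periodic f \<longleftrightarrow> (\<forall>y k. (\<forall>i. k $ i \<in> \<int>) \<longrightarrow> f (y + k) = f y)"

text \<open>
  The constant \<open>C\<close> for which \<open>u \<mapsto> - C \<integral> (u (x + z) - u x) |z|\<^sup>-\<^sup>N\<^sup>-\<^sup>\<sigma> dz\<close> has Fourier symbol
  \<open>|\<xi>|\<^sup>\<sigma>\<close>, that is, multiplies each plane wave \<open>x \<mapsto> cis (\<xi> \<bullet> x)\<close> by \<open>|\<xi>|\<^sup>\<sigma>\<close>. The integral converges
  absolutely for \<open>0 < \<sigma> < 1\<close>. The dimension is that of the type \<open>real^'n\<close>.
\<close>
definition frac_laplacian_const :: "'n::finite itself \<Rightarrow> real \<Rightarrow> real" where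
  "frac_laplacian_const _ \<sigma> =
     (THE C. \<forall>\<xi> :: real^'n.
        - of_real C * (LINT z|lebesgue. (cis (\<xi> \<bullet> z) - 1) * of_real (norm z powr - (real CARD('n) + \<sigma>)))
        = of_real (norm \<xi> powr \<sigma>))"

definition QT :: "real \<Rightarrow> ((real^'n) \<times> real) set" where
  "QT T = UNIV \<times> {0<..T}"

definition QT_bar :: "real \<Rightarrow> ((real^'n) \<times> real) set" where
  "QT_bar T = UNIV \<times> {0..T}"

text \<open>
  The derivatives are taken within the set, so that on \<open>QT T\<close> they are one-sided in time at the
  final time \<open>T\<close>. They are uniquely determined there, and on open sets they are the usual ones.
\<close>
definition C1_on :: "'a::real_normed_vector set \<Rightarrow> ('a \<Rightarrow> 'b::real_normed_vector) \<Rightarrow> bool" where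
  "C1_on S f \<longleftrightarrow>
     (\<exists>f'. (\<forall>x\<in>S. (f has_derivative blinfun_apply (f' x)) (at x within S)) \<and> continuous_on S f')"

definition C2_on :: "'a::real_normed_vector set \<Rightarrow> ('a \<Rightarrow> 'b::real_normed_vector) \<Rightarrow> bool" where
  "C2_on S f \<longleftrightarrow>
     (\<exists>f'. (\<forall>x\<in>S. (f has_derivative blinfun_apply (f' x)) (at x within S)) \<and> C1_on S f')"

definition upper_semicontinuous_on :: "'a::topological_space set \<Rightarrow> ('a \<Rightarrow> real) \<Rightarrow> bool" where
  "upper_semicontinuous_on S u \<longleftrightarrow> (\<forall>x\<in>S. \<forall>c. u x < c \<longrightarrow> (\<forall>\<^sub>F y in at x within S. u y < c))"

definition lower_semicontinuous_on :: "'a::topological_space set \<Rightarrow> ('a \<Rightarrow> real) \<Rightarrow> bool" where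
  "lower_semicontinuous_on S u \<longleftrightarrow> (\<forall>x\<in>S. \<forall>c. c < u x \<longrightarrow> (\<forall>\<^sub>F y in at x within S. c < u y))"

definition nonlocal_on ::
  "(real^'n) set \<Rightarrow> (real^'n \<Rightarrow> real) \<Rightarrow> ((real^'n) \<times> real \<Rightarrow> real) \<Rightarrow> real^'n \<Rightarrow> real \<Rightarrow> real" where
  "nonlocal_on S K v x t = (LINT z:S|lebesgue. (v (x + z, t) - v (x, t)) * K z)"

text \<open>
  Viscosity sub- and supersolutions of \<open>u\<^sub>t + F (x, Du, \<I>(u, x)) = 0\<close> in \<open>QT T\<close>, where \<open>K\<close> is
  the kernel of \<open>\<I>\<close>. In the test condition, \<open>p\<close> and \<open>q\<close> are the spatial gradient and the time
  derivative of the test function \<open>\<phi>\<close> at \<open>(x, t)\<close>. For \<open>F\<close> nonincreasing in its last argument the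
  inequality for one \<open>\<delta>\<close> follows from the one for any smaller \<open>\<delta>\<close>, so quantifying over all
  \<open>\<delta> \<in> (0, 1)\<close> is the same as quantifying over all small \<open>\<delta>\<close>.
\<close>
definition viscosity_subsolution ::
  "real \<Rightarrow> (real^'n \<Rightarrow> real) \<Rightarrow> (real^'n \<Rightarrow> real^'n \<Rightarrow> real \<Rightarrow> real)
    \<Rightarrow> ((real^'n) \<times> real \<Rightarrow> real) \<Rightarrow> bool" where
  "viscosity_subsolution T K F u \<longleftrightarrow>
     bounded (u ` QT T) \<and> upper_semicontinuous_on (QT T) u \<and>
     (\<forall>x t \<phi> \<delta> p q.
        (x, t) \<in> QT T \<longrightarrow> C2_on (QT T) \<phi> \<longrightarrow> 0 < \<delta> \<longrightarrow> \<delta> < 1 \<longrightarrow>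
        (\<phi> has_derivative (\<lambda>(h, s). p \<bullet> h + q * s)) (at (x, t) within QT T) \<longrightarrow>
        (\<forall>w \<in> (ball x \<delta> \<times> {t - \<delta><..<t + \<delta>}) \<inter> QT T. u w - \<phi> w \<le> u (x, t) - \<phi> (x, t)) \<longrightarrow>
        q + F x p (nonlocal_on (ball 0 \<delta>) K \<phi> x t + nonlocal_on (- ball 0 \<delta>) K u x t) \<le> 0)"

definition viscosity_supersolution ::
  "real \<Rightarrow> (real^'n \<Rightarrow> real) \<Rightarrow> (real^'n \<Rightarrow> real^'n \<Rightarrow> real \<Rightarrow> real)
    \<Rightarrow> ((real^'n) \<times> real \<Rightarrow> real) \<Rightarrow> bool" where
  "viscosity_supersolution T K F u \<longleftrightarrow>
     bounded (u ` QT T) \<and> lower_semicontinuous_on (QT T) u \<and>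
     (\<forall>x t \<phi> \<delta> p q.
        (x, t) \<in> QT T \<longrightarrow> C2_on (QT T) \<phi> \<longrightarrow> 0 < \<delta> \<longrightarrow> \<delta> < 1 \<longrightarrow>
        (\<phi> has_derivative (\<lambda>(h, s). p \<bullet> h + q * s)) (at (x, t) within QT T) \<longrightarrow>
        (\<forall>w \<in> (ball x \<delta> \<times> {t - \<delta><..<t + \<delta>}) \<inter> QT T. u w - \<phi> w \<ge> u (x, t) - \<phi> (x, t)) \<longrightarrow>
        q + F x p (nonlocal_on (ball 0 \<delta>) K \<phi> x t + nonlocal_on (- ball 0 \<delta>) K u x t) \<ge> 0)"

definition viscosity_solution ::
  "real \<Rightarrow> (real^'n \<Rightarrow> real) \<Rightarrow> (real^'n \<Rightarrow> real^'n \<Rightarrow> real \<Rightarrow> real)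
    \<Rightarrow> ((real^'n) \<times> real \<Rightarrow> real) \<Rightarrow> bool" where
  "viscosity_solution T K F u \<longleftrightarrow>
     bounded (u ` QT T) \<and> continuous_on (QT T) u \<and>
     viscosity_subsolution T K F u \<and> viscosity_supersolution T K F u"

text \<open>The solution of the initial value problem is continuous up to the initial time.\<close>
definition viscosity_solution_ivp ::
  "real \<Rightarrow> (real^'n \<Rightarrow> real) \<Rightarrow> (real^'n \<Rightarrow> real^'n \<Rightarrow> real \<Rightarrow> real) \<Rightarrow> (real^'n \<Rightarrow> real)
    \<Rightarrow> ((real^'n) \<times> real \<Rightarrow> real) \<Rightarrow> bool" where
  "viscosity_solution_ivp T K F u0 u \<longleftrightarrow>
     bounded (u ` QT_bar T) \<and> continuous_on (QT_bar T) u \<and>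
     viscosity_solution T K F u \<and> (\<forall>x. u (x, 0) = u0 x)"

text \<open>First-order viscosity solutions of \<open>G (y, D\<psi>) = 0\<close> on the whole space.\<close>
definition viscosity_solution_first_order ::
  "(real^'n \<Rightarrow> real^'n \<Rightarrow> real) \<Rightarrow> (real^'n \<Rightarrow> real) \<Rightarrow> bool" where
  "viscosity_solution_first_order G \<psi> \<longleftrightarrow>
     continuous_on UNIV \<psi> \<and>
     (\<forall>y \<phi> q. C1_on UNIV \<phi> \<longrightarrow> (\<phi> has_derivative (\<lambda>h. q \<bullet> h)) (at y) \<longrightarrow>
        ((\<forall>\<^sub>F z in nhds y. \<psi> z - \<phi> z \<le> \<psi> y - \<phi> y) \<longrightarrow> G y q \<le> 0) \<and>
        ((\<forall>\<^sub>F z in nhds y. \<psi> z - \<phi> z \<ge> \<psi> y - \<phi> y) \<longrightarrow> G y q \<ge> 0))"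

definition cell_problem_solvable ::
  "(real^'n \<Rightarrow> real^'n \<Rightarrow> real) \<Rightarrow> (real^'n \<Rightarrow> real^'n \<Rightarrow> real^'n \<Rightarrow> real)
    \<Rightarrow> real^'n \<Rightarrow> real^'n \<Rightarrow> real \<Rightarrow> real \<Rightarrow> bool" where
  "cell_problem_solvable a H x p l c \<longleftrightarrow>
     (\<exists>\<psi>. Z_periodic \<psi> \<and> (\<exists>L. L-lipschitz_on UNIV \<psi>) \<and>
          viscosity_solution_first_order (\<lambda>y q. - a x y * l + H x y (p + q) - c) \<psi>)"

definition effective_hamiltonian ::
  "(real^'n \<Rightarrow> real^'n \<Rightarrow> real) \<Rightarrow> (real^'n \<Rightarrow> real^'n \<Rightarrow> real^'n \<Rightarrow> real)
    \<Rightarrow> real^'n \<Rightarrow> real^'n \<Rightarrow> real \<Rightarrow> real" where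
  "effective_hamiltonian a H x p l = (THE c. cell_problem_solvable a H x p l c)"

definition attains_uniformly ::
  "real \<Rightarrow> (real^'n \<Rightarrow> real) \<Rightarrow> ((real^'n) \<times> real \<Rightarrow> real) \<Rightarrow> bool" where
  "attains_uniformly T u0 u \<longleftrightarrow>
     (\<exists>\<omega>0. modulus_of_continuity \<omega>0 \<and> (\<forall>t\<in>{0..T}. \<forall>x. \<bar>u (x, t) - u0 x\<bar> \<le> \<omega>0 t))"

end

theory Submission
  imports Defs "HOL-Complex_Analysis.Great_Picard"
begin

text \<open>
  The growth condition makes \<^term>\<open>H\<close> superlinear in the momentum. Penalizing with a multiple of a smoothed
  norm whose slope exceeds what superlinearity allows, one sees that maxima of such penalized functions
  sit at the tip of the cone: this makes subsolutions Lipschitz in space once their time derivative is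
  controlled, keeps momenta and nonlocal terms bounded in the doubling of variables, and so gives a
  comparison principle although \<^term>\<open>a\<close> is merely uniformly continuous. Barriers and comparison at a time
  lag make the family \<^term>\<open>ueps\<close> equicontinuous. Hence its pointwise upper and lower limits are continuous;
  the perturbed test function method shows that they are a sub- and a supersolution of the effective
  problem, and comparison identifies them. Since the order is below one, the nonlocal term does not see the
  corrector in the limit. Statements about supersolutions follow from those about subsolutions by
  negation; coercivity is never used in the perturbed test function argument, so it dualizes as well.
\<close>

section \<open>Calculus of test functions\<close>

text \<open>All quantitative constants come from bounds on the cell Hamiltonian
  \<open>H x y p - a x y * l\<close> that are uniform in \<open>y\<close>, hence uniform in
  \<epsilon>. Comparison may still use the modulus of continuity of the \<epsilon>-problem, which
  degenerates as \<epsilon> tends to 0, because its conclusion involves boundary values only. The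
  spatial modulus must be quantitative and therefore rests on coercivity alone.

  Order below one means that \<open>min 1 (norm z) * K z\<close> is integrable. Every nonlocal term
  is measured by the integral of \<open>min (A * norm z) B * K z\<close>, which is small as soon as
  the slope \<open>A\<close> or the height \<open>B\<close> is. Unboundedness of the domain is met
  by a bounded penalty of fixed height, stretched until its slope is negligible. Superlinearity
  absorbs nonlocal terms, since a penalty of slope \<open>L\<close> contributes at most a multiple
  of \<open>1 + L\<close>.

  Cell problems are solved by Perron's method for a discounted equation. Regularity of the effective
  Hamiltonian is read off from pairs of nearby points at which two cell problems are tested with the
  same gradient.\<close>

lemma C1_onI:
  assumes "\<And>x. x \<in> S \<Longrightarrow> (f has_derivative blinfun_apply (f' x)) (at x within S)"
    and "continuous_on S f'"
  shows "C1_on S f"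
  using assms unfolding C1_on_def by blast

lemma C2_onI:
  assumes "\<And>x. x \<in> S \<Longrightarrow> (f has_derivative blinfun_apply (f' x)) (at x within S)"
    and "C1_on S f'"
  shows "C2_on S f"
  using assms unfolding C2_on_def by blast

lemma C1_on_imp_continuous_on: "C1_on S f \<Longrightarrow> continuous_on S f"
  unfolding C1_on_def by (auto intro: has_derivative_continuous_on)

lemma C2_on_imp_C1_on: "C2_on S f \<Longrightarrow> C1_on S f"
  by (metis C1_on_def C1_on_imp_continuous_on C2_on_def)

lemma C1_on_const: "C1_on S (\<lambda>_. c)"
  by (rule C1_onI[where f' = "\<lambda>_. 0"]) (auto simp: zero_blinfun.rep_eq)

lemma C2_on_const: "C2_on S (\<lambda>_. c)"
  by (rule C2_onI[where f' = "\<lambda>_. 0"]) (auto simp: zero_blinfun.rep_eq C1_on_const)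

lemma C2_on_bounded_linear:
  assumes "bounded_linear A" shows "C2_on S A"
proof (rule C2_onI)
  show "C1_on S (\<lambda>_. Blinfun A)" by (rule C1_on_const)
  show "(A has_derivative blinfun_apply (Blinfun A)) (at x within S)" for x
    using assms by (simp add: bounded_linear_Blinfun_apply bounded_linear_imp_has_derivative)
qed

lemma C1_on_add:
  assumes "C1_on S f" "C1_on S g" shows "C1_on S (\<lambda>x. f x + g x)"
proof -
  obtain f' g' where
    "\<And>x. x \<in> S \<Longrightarrow> (f has_derivative blinfun_apply (f' x)) (at x within S)" "continuous_on S f'"
    "\<And>x. x \<in> S \<Longrightarrow> (g has_derivative blinfun_apply (g' x)) (at x within S)" "continuous_on S g'"
    using assms unfolding C1_on_def by blast
  then show ?thesis
    by (intro C1_onI[where f' = "\<lambda>x. f' x + g' x"])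
      (auto simp: plus_blinfun.rep_eq intro!: has_derivative_add continuous_intros)
qed

lemma C2_on_add:
  assumes "C2_on S f" "C2_on S g" shows "C2_on S (\<lambda>x. f x + g x)"
proof -
  obtain f' g' where
    "\<And>x. x \<in> S \<Longrightarrow> (f has_derivative blinfun_apply (f' x)) (at x within S)" "C1_on S f'"
    "\<And>x. x \<in> S \<Longrightarrow> (g has_derivative blinfun_apply (g' x)) (at x within S)" "C1_on S g'"
    using assms unfolding C2_on_def by blast
  then show ?thesis
    by (intro C2_onI[where f' = "\<lambda>x. f' x + g' x"])
      (auto simp: plus_blinfun.rep_eq intro!: has_derivative_add C1_on_add)
qed

lemma C1_on_scaleR:
  fixes f :: "'a::real_normed_vector \<Rightarrow> real"
  assumes "C1_on S f" "C1_on S g" shows "C1_on S (\<lambda>x. f x *\<^sub>R g x)"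
proof -
  obtain f' g' where f':
    "\<And>x. x \<in> S \<Longrightarrow> (f has_derivative blinfun_apply (f' x)) (at x within S)" "continuous_on S f'"
    and g':
    "\<And>x. x \<in> S \<Longrightarrow> (g has_derivative blinfun_apply (g' x)) (at x within S)" "continuous_on S g'"
    using assms unfolding C1_on_def by blast
  have c: "continuous_on S f" "continuous_on S g"
    using assms by (auto intro: C1_on_imp_continuous_on)
  show ?thesis
  proof (rule C1_onI)
    show "((\<lambda>x. f x *\<^sub>R g x) has_derivative
        blinfun_apply (f x *\<^sub>R g' x + (blinfun_scaleR_left (g x) o\<^sub>L f' x))) (at x within S)"
      if "x \<in> S" for x
      using has_derivative_scaleR[OF f'(1)[OF that] g'(1)[OF that]]
      by (simp add: plus_blinfun.rep_eq scaleR_blinfun.rep_eq blinfun_apply_blinfun_compose)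
    show "continuous_on S (\<lambda>x. f x *\<^sub>R g' x + (blinfun_scaleR_left (g x) o\<^sub>L f' x))"
      by (intro continuous_intros c f' g'
          bounded_linear.continuous_on[OF bounded_linear_blinfun_scaleR_left])
  qed
qed

lemma C2_on_mult:
  fixes f g :: "'a::real_normed_vector \<Rightarrow> real"
  assumes "C2_on S f" "C2_on S g" shows "C2_on S (\<lambda>x. f x * g x)"
proof -
  obtain f' g' where f':
    "\<And>x. x \<in> S \<Longrightarrow> (f has_derivative blinfun_apply (f' x)) (at x within S)" "C1_on S f'"
    and g':
    "\<And>x. x \<in> S \<Longrightarrow> (g has_derivative blinfun_apply (g' x)) (at x within S)" "C1_on S g'"
    using assms unfolding C2_on_def by blast
  have c: "C1_on S f" "C1_on S g"
    using assms by (auto intro: C2_on_imp_C1_on)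
  show ?thesis
  proof (rule C2_onI)
    show "((\<lambda>x. f x * g x) has_derivative
        blinfun_apply (f x *\<^sub>R g' x + g x *\<^sub>R f' x)) (at x within S)"
      if "x \<in> S" for x
      using has_derivative_mult[OF f'(1)[OF that] g'(1)[OF that]]
      by (simp add: plus_blinfun.rep_eq scaleR_blinfun.rep_eq algebra_simps)
    show "C1_on S (\<lambda>x. f x *\<^sub>R g' x + g x *\<^sub>R f' x)"
      by (intro C1_on_add C1_on_scaleR c f' g')
  qed
qed

lemma C2_on_sum:
  assumes "finite I" "\<And>i. i \<in> I \<Longrightarrow> C2_on S (f i)"
  shows "C2_on S (\<lambda>x. \<Sum>i\<in>I. f i x)"
  using assms by (induction I rule: finite_induct) (auto intro: C2_on_const C2_on_add)

lemma C1_on_real_compose: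
  fixes f :: "'a::real_normed_vector \<Rightarrow> real" and h h' :: "real \<Rightarrow> real"
  assumes "C1_on S f" "\<And>x. x \<in> S \<Longrightarrow> f x \<in> U"
    and "\<And>r. r \<in> U \<Longrightarrow> (h has_real_derivative h' r) (at r)" "continuous_on U h'"
  shows "C1_on S (\<lambda>x. h (f x))"
proof -
  obtain f' where f':
    "\<And>x. x \<in> S \<Longrightarrow> (f has_derivative blinfun_apply (f' x)) (at x within S)" "continuous_on S f'"
    using assms(1) unfolding C1_on_def by blast
  have c: "continuous_on S f"
    using assms(1) by (rule C1_on_imp_continuous_on)
  show ?thesis
  proof (rule C1_onI)
    show "((\<lambda>x. h (f x)) has_derivative blinfun_apply (h' (f x) *\<^sub>R f' x)) (at x within S)"
      if "x \<in> S" for x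
      using has_derivative_compose[OF f'(1)[OF that]
          assms(3)[OF assms(2)[OF that], unfolded has_field_derivative_def]]
      by (simp add: scaleR_blinfun.rep_eq)
    show "continuous_on S (\<lambda>x. h' (f x) *\<^sub>R f' x)"
      using assms(2) by (intro continuous_intros f' continuous_on_compose2[OF assms(4) c]) auto
  qed
qed

text \<open>The outer function matters only on a set \<open>U\<close> containing the values of
  \<open>f\<close>. With \<open>U = {0..}\<close> functions of the squared norm such as
  \<open>sqrt (e\<^sup>2 + r)\<close> become test functions, although they are singular at some
  negative \<open>r\<close>.\<close>

lemma C2_on_real_compose:
  fixes f :: "'a::real_normed_vector \<Rightarrow> real" and h h' h'' :: "real \<Rightarrow> real"
  assumes "C2_on S f" "\<And>x. x \<in> S \<Longrightarrow> f x \<in> U"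
    and "\<And>r. r \<in> U \<Longrightarrow> (h has_real_derivative h' r) (at r)"
    and "\<And>r. r \<in> U \<Longrightarrow> (h' has_real_derivative h'' r) (at r)" "continuous_on U h''"
  shows "C2_on S (\<lambda>x. h (f x))"
proof -
  obtain f' where f':
    "\<And>x. x \<in> S \<Longrightarrow> (f has_derivative blinfun_apply (f' x)) (at x within S)" "C1_on S f'"
    using assms(1) unfolding C2_on_def by blast
  show ?thesis
  proof (rule C2_onI)
    show "((\<lambda>x. h (f x)) has_derivative blinfun_apply (h' (f x) *\<^sub>R f' x)) (at x within S)"
      if "x \<in> S" for x
      using has_derivative_compose[OF f'(1)[OF that]
          assms(3)[OF assms(2)[OF that], unfolded has_field_derivative_def]]
      by (simp add: scaleR_blinfun.rep_eq)
    show "C1_on S (\<lambda>x. h' (f x) *\<^sub>R f' x)"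
      by (intro C1_on_scaleR f'(2)
          C1_on_real_compose[OF C2_on_imp_C1_on[OF assms(1)] assms(2) assms(4) assms(5)])
  qed
qed

lemma C2_on_cmult:
  fixes f :: "'a::real_normed_vector \<Rightarrow> real"
  assumes "C2_on S f" shows "C2_on S (\<lambda>x. c * f x)"
  by (intro C2_on_mult C2_on_const assms)

section \<open>Penalty functions: squared norm, smoothed norm and bounded bowl\<close>

lemma C2_on_norm_square:
  fixes A :: "'a::real_normed_vector \<Rightarrow> 'b::euclidean_space"
  assumes "bounded_linear A"
  shows "C2_on S (\<lambda>w. (norm (A w - x0))\<^sup>2)"
proof -
  have "C2_on S (\<lambda>w. (A w - x0) \<bullet> b)" for b
  proof -
    have "C2_on S (\<lambda>w. A w \<bullet> b + (- x0 \<bullet> b))"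
      by (intro C2_on_add C2_on_const C2_on_bounded_linear)
        (simp add: assms bounded_linear_compose[OF bounded_linear_inner_left])
    then show ?thesis by (simp add: inner_diff_left)
  qed
  then have "C2_on S (\<lambda>w. \<Sum>b\<in>Basis. ((A w - x0) \<bullet> b) * ((A w - x0) \<bullet> b))"
    by (intro C2_on_sum C2_on_mult) auto
  moreover have "(norm (A w - x0))\<^sup>2 = (\<Sum>b\<in>Basis. ((A w - x0) \<bullet> b) * ((A w - x0) \<bullet> b))" for w
    by (metis dot_square_norm euclidean_inner)
  ultimately show ?thesis by simp
qed

lemma has_derivative_norm_square:
  fixes A :: "'a::real_normed_vector \<Rightarrow> 'b::euclidean_space"
  assumes "bounded_linear A"
  shows "((\<lambda>w. (norm (A w - x0))\<^sup>2) has_derivative (\<lambda>h. 2 * ((A w - x0) \<bullet> A h))) (at w within S)"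
proof -
  have "((\<lambda>w. (A w - x0) \<bullet> (A w - x0)) has_derivative (\<lambda>h. 2 * ((A w - x0) \<bullet> A h))) (at w within S)"
    by (auto intro!: derivative_eq_intros bounded_linear_imp_has_derivative assms
        simp: inner_commute algebra_simps)
  then show ?thesis by (simp add: power2_norm_eq_inner)
qed

text \<open>This is the norm of the pair \<open>(e, x)\<close>: a substitute for the norm with a
  rounded tip of size \<open>e\<close>. It is Lipschitz with constant 1 for every \<open>e\<close>,
  so penalties built from it have slopes, and hence nonlocal terms, that stay bounded as
  \<open>e\<close> tends to 0.\<close>

definition smooth_norm :: "real \<Rightarrow> 'a::real_inner \<Rightarrow> real" where
  "smooth_norm e x = sqrt (e\<^sup>2 + (norm x)\<^sup>2)"

lemma smooth_norm_pos: "0 < e \<Longrightarrow> 0 < smooth_norm e x"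
  unfolding smooth_norm_def by (simp add: add_pos_nonneg)

lemma norm_le_smooth_norm: "norm x \<le> smooth_norm e x"
  unfolding smooth_norm_def by (simp add: real_le_rsqrt)

lemma smooth_norm_0: "0 \<le> e \<Longrightarrow> smooth_norm e 0 = e"
  unfolding smooth_norm_def by simp

lemma smooth_norm_nonneg: "0 \<le> smooth_norm e x"
  unfolding smooth_norm_def by simp

lemma smooth_norm_minus: "smooth_norm e (- x) = smooth_norm e x"
  unfolding smooth_norm_def by simp

lemma smooth_norm_lipschitz: "\<bar>smooth_norm e x - smooth_norm e y\<bar> \<le> norm (x - y)"
proof -
  have "smooth_norm e x = norm (e, x)" for x :: 'a
    by (simp add: smooth_norm_def norm_Pair)
  then show ?thesis
    using norm_triangle_ineq3[of "(e, x)" "(e, y)"] by (simp add: norm_Pair)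
qed

lemma smooth_norm_le: "0 \<le> e \<Longrightarrow> smooth_norm e x \<le> e + norm x"
  using smooth_norm_lipschitz[of e x 0] by (simp add: smooth_norm_0)

lemma continuous_on_smooth_norm [continuous_intros]:
  "continuous_on S f \<Longrightarrow> continuous_on S (\<lambda>x. smooth_norm e (f x))"
  unfolding smooth_norm_def by (intro continuous_intros)

lemma C2_on_smooth_norm:
  fixes A :: "'a::real_normed_vector \<Rightarrow> 'b::euclidean_space"
  assumes "bounded_linear A" "0 < e"
  shows "C2_on S (\<lambda>w. smooth_norm e (A w - x0))"
  unfolding smooth_norm_def
proof (rule C2_on_real_compose[OF C2_on_norm_square[OF assms(1)], where U = "{0..}"])
  fix r :: real assume "r \<in> {0..}"
  then have p: "0 < e\<^sup>2 + r" using assms(2) by (simp add: add_pos_nonneg)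
  then show "((\<lambda>r. sqrt (e\<^sup>2 + r)) has_real_derivative 1 / (2 * sqrt (e\<^sup>2 + r))) (at r)"
    by (auto intro!: derivative_eq_intros simp: field_simps)
  show "((\<lambda>r. 1 / (2 * sqrt (e\<^sup>2 + r))) has_real_derivative
        - 1 / (4 * (e\<^sup>2 + r) * sqrt (e\<^sup>2 + r))) (at r)"
    using p by (auto intro!: derivative_eq_intros simp: field_simps)
next
  show "continuous_on {0..} (\<lambda>r. - 1 / (4 * (e\<^sup>2 + r) * sqrt (e\<^sup>2 + r)))"
    using assms(2) by (intro continuous_intros ballI) (auto simp: add_nonneg_eq_0_iff)
qed auto

lemma has_derivative_smooth_norm:
  fixes A :: "'a::real_normed_vector \<Rightarrow> 'b::euclidean_space"
  assumes "bounded_linear A" "0 < e"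
  shows "((\<lambda>w. smooth_norm e (A w - x0)) has_derivative
    (\<lambda>h. ((1 / smooth_norm e (A w - x0)) *\<^sub>R (A w - x0)) \<bullet> A h)) (at w within S)"
proof -
  have p: "0 < e\<^sup>2 + (norm (A w - x0))\<^sup>2" using assms(2) by (simp add: add_pos_nonneg)
  let ?q = "(norm (A w - x0))\<^sup>2"
  have d: "((\<lambda>r. sqrt (e\<^sup>2 + r)) has_derivative (\<lambda>h. h / (2 * sqrt (e\<^sup>2 + ?q)))) (at ?q)"
    using p by (auto intro!: derivative_eq_intros simp: field_simps)
  have "(\<lambda>h. 2 * ((A w - x0) \<bullet> A h) / (2 * sqrt (e\<^sup>2 + ?q)))
      = (\<lambda>h. ((1 / smooth_norm e (A w - x0)) *\<^sub>R (A w - x0)) \<bullet> A h)"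
    by (simp add: smooth_norm_def)
  then show ?thesis
    using has_derivative_compose[OF has_derivative_norm_square[OF assms(1), of x0 w S] d]
    unfolding smooth_norm_def by simp
qed

lemma norm_smooth_norm_gradient_le:
  "0 < e \<Longrightarrow> norm ((1 / smooth_norm e x) *\<^sub>R x) \<le> 1"
  using norm_le_smooth_norm[of x e] smooth_norm_pos[of e x] by simp

text \<open>The smallest slope outside the tip is 1 / sqrt 2, attained at \<open>norm x = e\<close>.
  Coercivity is invoked at half the nominal slope; the excess of 2/3 over 1/2 leaves room for the
  gradient of a localizing penalty.\<close>

lemma norm_smooth_norm_gradient_ge:
  assumes "0 < e" "e \<le> norm x"
  shows "norm ((1 / smooth_norm e x) *\<^sub>R x) \<ge> 2 / 3"
proof -
  have "smooth_norm e x \<le> sqrt ((3 / 2 * norm x)\<^sup>2)"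
    unfolding smooth_norm_def
  proof (rule real_sqrt_le_mono)
    have "e\<^sup>2 \<le> (norm x)\<^sup>2" "0 \<le> (norm x)\<^sup>2"
      using power_mono[OF assms(2), of 2] assms(1) by auto
    moreover have "(3 / 2 * norm x)\<^sup>2 = 9 / 4 * (norm x)\<^sup>2"
      by (simp add: power_mult_distrib power_divide)
    ultimately show "e\<^sup>2 + (norm x)\<^sup>2 \<le> (3 / 2 * norm x)\<^sup>2" by linarith
  qed
  then have "smooth_norm e x \<le> 3 / 2 * norm x" by simp
  then show ?thesis using smooth_norm_pos[OF assms(1), of x] by (simp add: field_simps)
qed

text \<open>A bounded localizing penalty. Boundedness and the Lipschitz bound control its increments
  by \<open>min (norm z) 1\<close>, so its nonlocal term is finite; for an unbounded penalty such as
  the squared norm that term could diverge.\<close>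

definition bowl :: "'a::real_inner \<Rightarrow> real" where
  "bowl x = (norm x)\<^sup>2 / (1 + (norm x)\<^sup>2)"

lemma bowl_nonneg: "0 \<le> bowl x" and bowl_le_1: "bowl x \<le> 1" and bowl_0: "bowl 0 = 0"
  unfolding bowl_def by (simp_all add: add_pos_nonneg)

lemma bowl_lipschitz: "\<bar>bowl x - bowl y\<bar> \<le> norm (x - y)"
proof -
  let ?a = "norm x" and ?b = "norm y"
  have pos: "0 < 1 + ?a\<^sup>2" "0 < 1 + ?b\<^sup>2" by (simp_all add: add_pos_nonneg)
  have "bowl x - bowl y = (?a\<^sup>2 - ?b\<^sup>2) / ((1 + ?a\<^sup>2) * (1 + ?b\<^sup>2))"
    using pos unfolding bowl_def by (simp add: field_simps)
  also have "\<bar>\<dots>\<bar> = \<bar>?a - ?b\<bar> * (?a + ?b) / ((1 + ?a\<^sup>2) * (1 + ?b\<^sup>2))"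
    using pos by (simp add: abs_mult power2_eq_square square_diff_square_factored mult.commute)
  also have "\<dots> \<le> \<bar>?a - ?b\<bar> * 1"
  proof -
    have "2 * ?a \<le> 1 + ?a\<^sup>2" "2 * ?b \<le> 1 + ?b\<^sup>2"
      using sum_squares_bound[of 1 ?a] sum_squares_bound[of 1 ?b] by (simp_all add: power2_eq_square)
    then have "?a + ?b \<le> 1 + ?a\<^sup>2 + ?b\<^sup>2"
      using zero_le_power2[of ?a] zero_le_power2[of ?b] by linarith
    also have "\<dots> \<le> (1 + ?a\<^sup>2) * (1 + ?b\<^sup>2)" by (simp add: algebra_simps)
    finally have "(?a + ?b) / ((1 + ?a\<^sup>2) * (1 + ?b\<^sup>2)) \<le> 1" using pos by simp
    from mult_left_mono[OF this, of "\<bar>?a - ?b\<bar>"] show ?thesis by simp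
  qed
  also have "\<dots> \<le> norm (x - y)" using norm_triangle_ineq3 by simp
  finally show ?thesis .
qed

lemma continuous_on_bowl [continuous_intros]:
  "continuous_on S f \<Longrightarrow> continuous_on S (\<lambda>x. bowl (f x))"
  unfolding bowl_def by (intro continuous_intros) (auto simp: add_nonneg_eq_0_iff)

lemma C2_on_bowl:
  fixes A :: "'a::real_normed_vector \<Rightarrow> 'b::euclidean_space"
  assumes "bounded_linear A"
  shows "C2_on S (\<lambda>w. bowl (A w - x0))"
  unfolding bowl_def
proof (rule C2_on_real_compose[OF C2_on_norm_square[OF assms(1)], where U = "{0..}"])
  fix r :: real assume "r \<in> {0..}"
  then have p: "0 < 1 + r" by simp
  then show "((\<lambda>r. r / (1 + r)) has_real_derivative 1 / (1 + r) ^ 2) (at r)"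
    by (auto intro!: derivative_eq_intros simp: field_simps power2_eq_square)
  show "((\<lambda>r. 1 / (1 + r) ^ 2) has_real_derivative - 2 / (1 + r) ^ 3) (at r)"
  proof -
    have "((\<lambda>s. 1 / s ^ 2) has_real_derivative - 2 / s ^ 3) (at s)" if "s \<noteq> 0" for s :: real
      using that by (auto intro!: derivative_eq_intros simp: field_simps eval_nat_numeral)
    from this[of "r + 1", unfolded DERIV_shift] p show ?thesis
      by (simp add: add.commute)
  qed
next
  show "continuous_on {0..} (\<lambda>r::real. - 2 / (1 + r) ^ 3)"
    by (intro continuous_intros ballI) auto
qed auto

lemma has_derivative_bowl:
  fixes A :: "'a::real_normed_vector \<Rightarrow> 'b::euclidean_space"
  assumes "bounded_linear A"
  shows "\<exists>p. norm p \<le> 1 \<and> ((\<lambda>w. bowl (A w - x0)) has_derivative (\<lambda>h. p \<bullet> A h)) (at w within S)"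
proof -
  let ?r = "norm (A w - x0)"
  define p where "p = (2 / (1 + ?r\<^sup>2)\<^sup>2) *\<^sub>R (A w - x0)"
  have pos: "0 < 1 + ?r\<^sup>2" by (simp add: add_pos_nonneg)
  have d: "((\<lambda>r. r / (1 + r)) has_derivative (\<lambda>h. h / (1 + ?r\<^sup>2) ^ 2)) (at (?r\<^sup>2))"
    using pos by (auto intro!: derivative_eq_intros simp: field_simps power2_eq_square)
  have "((\<lambda>w. bowl (A w - x0)) has_derivative (\<lambda>h. p \<bullet> A h)) (at w within S)"
    using has_derivative_compose[OF has_derivative_norm_square[OF assms, of x0 w S] d]
    unfolding bowl_def p_def by (simp add: algebra_simps diff_divide_distrib)
  moreover have "norm p \<le> 1"
  proof -
    have "2 * ?r \<le> 1 + ?r\<^sup>2" using sum_squares_bound[of 1 ?r] by (simp add: power2_eq_square)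
    also have "\<dots> \<le> (1 + ?r\<^sup>2)\<^sup>2" by (simp add: power2_eq_square algebra_simps)
    finally show ?thesis using pos unfolding p_def norm_scaleR by (simp add: field_simps)
  qed
  ultimately show ?thesis by blast
qed

lemma C1_on_translate:
  assumes "C1_on UNIV f" shows "C1_on UNIV (\<lambda>x. f (x + k))"
proof -
  obtain f' where f': "\<And>x. (f has_derivative blinfun_apply (f' x)) (at x)" "continuous_on UNIV f'"
    using assms unfolding C1_on_def by auto
  show ?thesis
  proof (rule C1_onI)
    show "((\<lambda>x. f (x + k)) has_derivative blinfun_apply (f' (x + k))) (at x)" for x
    proof -
      have "((\<lambda>x. x + k) has_derivative (\<lambda>h. h)) (at x)"
        by (auto intro!: derivative_eq_intros)
      from has_derivative_compose[OF this f'(1)] show ?thesis by simp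
    qed
    show "continuous_on UNIV (\<lambda>x. f' (x + k))"
      by (intro continuous_on_compose2[OF f'(2)] continuous_intros) auto
  qed
qed

section \<open>Singular kernels\<close>

text \<open>Domination by the step function whose value at \<open>z\<close> is the sum of
  \<open>c k\<close> over all \<open>S k\<close> containing \<open>z\<close>. The sets may overlap,
  so balls can stand in for annuli and only volumes of balls are computed.\<close>

lemma integrable_by_cover:
  fixes f :: "'a \<Rightarrow> real" and c :: "nat \<Rightarrow> real"
  assumes [measurable]: "f \<in> borel_measurable M" "\<And>k. S k \<in> sets M"
    and "\<And>k. emeasure M (S k) < \<infinity>" "\<And>k. 0 \<le> c k"
    and summ: "summable (\<lambda>k. c k * measure M (S k))"
    and cover: "AE z in M. 0 \<le> f z \<and> (f z = 0 \<or> (\<exists>k. z \<in> S k \<and> f z \<le> c k))"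
  shows "integrable M f"
proof (rule integrableI_nonneg)
  show "AE z in M. 0 \<le> f z" using cover by auto
  have "(\<integral>\<^sup>+ z. ennreal (f z) \<partial>M) \<le> (\<integral>\<^sup>+ z. (\<Sum>k. ennreal (c k) * indicator (S k) z) \<partial>M)"
  proof (rule nn_integral_mono_AE)
    show "AE z in M. ennreal (f z) \<le> (\<Sum>k. ennreal (c k) * indicator (S k) z)"
      using cover
    proof eventually_elim
      case (elim z)
      show ?case
      proof (cases "f z = 0")
        case False
        then obtain k where k: "z \<in> S k" "f z \<le> c k" using elim by auto
        have "ennreal (f z) \<le> (\<Sum>j\<in>{k}. ennreal (c j) * indicator (S j) z)"
          using k by (auto intro: ennreal_leI)
        also have "\<dots> \<le> (\<Sum>j. ennreal (c j) * indicator (S j) z)"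
          by (rule sum_le_suminf) auto
        finally show ?thesis .
      qed simp
    qed
  qed
  also have "\<dots> = (\<Sum>k. \<integral>\<^sup>+ z. ennreal (c k) * indicator (S k) z \<partial>M)"
    by (rule nn_integral_suminf) simp
  also have "\<dots> = (\<Sum>k. ennreal (c k * measure M (S k)))"
  proof (rule arg_cong[where f = suminf], rule ext)
    fix k
    have "emeasure M (S k) = ennreal (measure M (S k))"
      using assms(3)[of k] by (intro emeasure_eq_ennreal_measure) auto
    then show "(\<integral>\<^sup>+ z. ennreal (c k) * indicator (S k) z \<partial>M) = ennreal (c k * measure M (S k))"
      using assms(4)[of k] by (simp add: nn_integral_cmult_indicator ennreal_mult)
  qed
  also have "\<dots> < \<infinity>"
  proof -
    have "(\<Sum>k. ennreal (c k * measure M (S k))) \<noteq> top"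
      by (rule ennreal_suminf_neq_top[OF summ]) (simp add: assms(4))
    then show ?thesis by (simp only: infinity_ennreal_def less_top)
  qed
  finally show "(\<integral>\<^sup>+ z. ennreal (f z) \<partial>M) < \<infinity>" .
qed simp

lemma measure_lebesgue_ball:
  "0 \<le> r \<Longrightarrow> measure lebesgue (ball (c::'a::euclidean_space) r) = unit_ball_vol (real DIM('a)) * r ^ DIM('a)"
  by (simp add: content_ball)

text \<open>Dyadic shells in place of polar coordinates. At distance about \<open>2 powr - k\<close>
  the integrand is of order \<open>2 powr (k * (N + \<sigma> - 1))\<close> and the volume of order
  \<open>2 powr (- k * N)\<close>; the products are summable because \<open>\<sigma> < 1\<close>.
  Far away the ratio is \<open>2 powr - \<sigma>\<close>, which is where \<open>0 < \<sigma>\<close>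
  enters.\<close>

lemma integrable_levy_kernel:
  fixes K :: "'a::euclidean_space \<Rightarrow> real"
  assumes [measurable]: "K \<in> borel_measurable lebesgue" and "\<And>z. 0 \<le> K z"
    and "0 < \<sigma>" "\<sigma> < 1" and "0 \<le> C"
    and K: "\<And>z. z \<noteq> 0 \<Longrightarrow> K z \<le> C * norm z powr - (real DIM('a) + \<sigma>)"
  shows "integrable lebesgue (\<lambda>z. min 1 (norm z) * K z)"
proof -
  define N where "N = real DIM('a)"
  have [measurable]: "(norm :: 'a \<Rightarrow> real) \<in> borel_measurable lebesgue"
    by (intro measurable_completion) simp
  have ball[measurable]: "ball (0::'a) r \<in> sets lebesgue" for r by simp
  have fin: "emeasure lebesgue (ball (0::'a) r) < \<infinity>" for r
    using fmeasurableD2[OF lmeasurable_ball] by (simp add: less_top)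
  have powN: "r ^ DIM('a) = r powr N" if "0 < r" for r :: real
    using that unfolding N_def by (simp add: powr_realpow)
  have near: "integrable lebesgue (\<lambda>z. indicator (ball 0 1) z * (min 1 (norm z) * K z))"
  proof (rule integrable_by_cover[where
        c = "\<lambda>k. C * 2 powr (N + \<sigma>) * 2 powr (real k * (N + \<sigma> - 1))"
        and S = "\<lambda>k. ball 0 (2 powr - real k)"])
    have eq: "C * 2 powr (N + \<sigma>) * 2 powr (real k * (N + \<sigma> - 1)) * measure lebesgue (ball (0::'a) (2 powr - real k))
      = C * 2 powr (N + \<sigma>) * unit_ball_vol N * (2 powr - (1 - \<sigma>)) ^ k" for k
    proof -
      have "2 powr (real k * (N + \<sigma> - 1)) * (2 powr - real k) powr N = (2 powr - (1 - \<sigma>)) ^ k"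
        by (simp add: powr_powr powr_add[symmetric] powr_realpow[symmetric] algebra_simps)
      moreover have "measure lebesgue (ball (0::'a) (2 powr - real k)) = unit_ball_vol N * (2 powr - real k) powr N"
        by (subst measure_lebesgue_ball) (auto simp: powN N_def)
      ultimately show ?thesis by (simp only: mult_ac)
    qed
    have "summable (\<lambda>k. (2 powr - (1 - \<sigma>)) ^ k)"
      using assms(4) by (intro summable_geometric) (simp add: powr_less_one)
    then show "summable (\<lambda>k. C * 2 powr (N + \<sigma>) * 2 powr (real k * (N + \<sigma> - 1))
        * measure lebesgue (ball (0::'a) (2 powr - real k)))"
      unfolding eq by (rule summable_mult)
    show "AE z in lebesgue. 0 \<le> indicator (ball 0 1) z * (min 1 (norm z) * K z) \<and>
      (indicator (ball 0 1) z * (min 1 (norm z) * K z) = 0 \<or>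
       (\<exists>k. z \<in> ball 0 (2 powr - real k) \<and> indicator (ball 0 1) z * (min 1 (norm z) * K z)
          \<le> C * 2 powr (N + \<sigma>) * 2 powr (real k * (N + \<sigma> - 1))))"
    proof (rule AE_I2, intro conjI)
      fix z :: 'a
      show "0 \<le> indicator (ball 0 1) z * (min 1 (norm z) * K z)" using assms(2) by simp
      show "indicator (ball 0 1) z * (min 1 (norm z) * K z) = 0 \<or>
       (\<exists>k. z \<in> ball 0 (2 powr - real k) \<and> indicator (ball 0 1) z * (min 1 (norm z) * K z)
          \<le> C * 2 powr (N + \<sigma>) * 2 powr (real k * (N + \<sigma> - 1)))"
      proof (cases "z = 0 \<or> norm z \<ge> 1")
        case False
        then have z: "0 < norm z" "norm z < 1" by auto
        \<comment> \<open>The ceiling minus one gives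
          \<open>2 powr - (k + 1) \<le> norm z < 2 powr - k\<close>. The upper bound has to be
          strict, since the balls are open; \<open>norm z < 1\<close> makes the integer
          nonnegative.\<close>
        define k where "k = nat (\<lceil>- log 2 (norm z)\<rceil> - 1)"
        have l: "0 < - log 2 (norm z)" using z by simp
        have k: "real k < - log 2 (norm z)" "- log 2 (norm z) \<le> real k + 1"
          using l unfolding k_def by linarith+
        have "norm z = 2 powr (log 2 (norm z))" using z by (subst powr_log_cancel) auto
        also have "\<dots> < 2 powr - real k" using k by (intro powr_less_mono) auto
        finally have 1: "norm z < 2 powr - real k" .
        have "norm z * norm z powr - (N + \<sigma>) \<le> 2 powr - real k * (2 powr (- (real k + 1))) powr - (N + \<sigma>)"
        proof (intro mult_mono)
          have "2 powr (log 2 (norm z)) = norm z" using z by (subst powr_log_cancel) auto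
          then have "2 powr (- (real k + 1)) \<le> norm z"
            using powr_mono[of "- (real k + 1)" "log 2 (norm z)" 2] k by simp
          then show "norm z powr - (N + \<sigma>) \<le> (2 powr (- (real k + 1))) powr - (N + \<sigma>)"
            using assms(3) by (intro powr_mono2') (auto simp: N_def)
        qed (use 1 in auto)
        also have "\<dots> = 2 powr (N + \<sigma>) * 2 powr (real k * (N + \<sigma> - 1))"
          by (simp add: powr_powr powr_add[symmetric] algebra_simps)
        finally have "C * (norm z * norm z powr - (N + \<sigma>)) \<le> C * (2 powr (N + \<sigma>) * 2 powr (real k * (N + \<sigma> - 1)))"
          using assms(5) by (rule mult_left_mono)
        moreover have "norm z * K z \<le> norm z * (C * norm z powr - (N + \<sigma>))"
          using K[of z] z unfolding N_def by (intro mult_left_mono) auto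
        ultimately have "norm z * K z \<le> C * 2 powr (N + \<sigma>) * 2 powr (real k * (N + \<sigma> - 1))"
          by (simp only: mult_ac)
        then have "indicator (ball 0 1) z * (min 1 (norm z) * K z)
          \<le> C * 2 powr (N + \<sigma>) * 2 powr (real k * (N + \<sigma> - 1))"
          using z by (simp add: min_def)
        then show ?thesis using 1 by auto
      qed auto
    qed
  qed (use assms fin in \<open>simp_all\<close>)
  have far: "integrable lebesgue (\<lambda>z. indicator (- ball 0 1) z * (min 1 (norm z) * K z))"
  proof (rule integrable_by_cover[where
        c = "\<lambda>k. C * 2 powr (- real k * (N + \<sigma>))" and S = "\<lambda>k. ball 0 (2 powr (real k + 1))"])
    have eq: "C * 2 powr (- real k * (N + \<sigma>)) * measure lebesgue (ball (0::'a) (2 powr (real k + 1)))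
      = C * 2 powr N * unit_ball_vol N * (2 powr - \<sigma>) ^ k" for k
    proof -
      have "2 powr (- real k * (N + \<sigma>)) * (2 powr (real k + 1)) powr N = 2 powr N * (2 powr - \<sigma>) ^ k"
        by (simp add: powr_powr powr_add[symmetric] powr_realpow[symmetric] algebra_simps)
      moreover have "measure lebesgue (ball (0::'a) (2 powr (real k + 1))) = unit_ball_vol N * (2 powr (real k + 1)) powr N"
        by (subst measure_lebesgue_ball) (auto simp: powN N_def)
      ultimately show ?thesis by (simp only: mult_ac)
    qed
    have "summable (\<lambda>k. (2 powr - \<sigma>) ^ k)"
      using assms(3) by (intro summable_geometric) (simp add: powr_less_one)
    then show "summable (\<lambda>k. C * 2 powr (- real k * (N + \<sigma>))
        * measure lebesgue (ball (0::'a) (2 powr (real k + 1))))"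
      unfolding eq by (rule summable_mult)
    show "AE z in lebesgue. 0 \<le> indicator (- ball 0 1) z * (min 1 (norm z) * K z) \<and>
      (indicator (- ball 0 1) z * (min 1 (norm z) * K z) = 0 \<or>
       (\<exists>k. z \<in> ball 0 (2 powr (real k + 1)) \<and> indicator (- ball 0 1) z * (min 1 (norm z) * K z)
          \<le> C * 2 powr (- real k * (N + \<sigma>))))"
    proof (rule AE_I2, intro conjI)
      fix z :: 'a
      show "0 \<le> indicator (- ball 0 1) z * (min 1 (norm z) * K z)" using assms(2) by simp
      show "indicator (- ball 0 1) z * (min 1 (norm z) * K z) = 0 \<or>
       (\<exists>k. z \<in> ball 0 (2 powr (real k + 1)) \<and> indicator (- ball 0 1) z * (min 1 (norm z) * K z)
          \<le> C * 2 powr (- real k * (N + \<sigma>)))"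
      proof (cases "norm z \<ge> 1")
        case True
        define k where "k = nat \<lfloor>log 2 (norm z)\<rfloor>"
        have l: "0 \<le> log 2 (norm z)" using True by (subst zero_le_log_cancel_iff) auto
        have k: "real k \<le> log 2 (norm z)" "log 2 (norm z) < real k + 1"
          using l unfolding k_def by linarith+
        have "norm z = 2 powr (log 2 (norm z))" using True by (subst powr_log_cancel) auto
        also have "\<dots> < 2 powr (real k + 1)" using k by (intro powr_less_mono) auto
        finally have 1: "norm z < 2 powr (real k + 1)" .
        have "2 powr (real k) \<le> 2 powr (log 2 (norm z))" using k by (intro powr_mono) auto
        also have "\<dots> = norm z" using True by (subst powr_log_cancel) auto
        finally have "norm z powr - (N + \<sigma>) \<le> (2 powr (real k)) powr - (N + \<sigma>)"
          using assms(3) by (intro powr_mono2') (auto simp: N_def)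
        also have "\<dots> = 2 powr (- real k * (N + \<sigma>))"
          by (simp add: powr_powr algebra_simps)
        finally have "C * norm z powr - (N + \<sigma>) \<le> C * 2 powr (- real k * (N + \<sigma>))"
          using assms(5) by (rule mult_left_mono)
        moreover have "K z \<le> C * norm z powr - (N + \<sigma>)"
          using K[of z] True unfolding N_def by (cases "z = 0") auto
        ultimately have "indicator (- ball 0 1) z * (min 1 (norm z) * K z) \<le> C * 2 powr (- real k * (N + \<sigma>))"
          using True by (simp add: min_def)
        then show ?thesis using 1 by auto
      qed auto
    qed
  qed (use assms fin in \<open>simp_all\<close>)
  have "(\<lambda>z. min 1 (norm z) * K z) = (\<lambda>z. indicator (ball 0 1) z * (min 1 (norm z) * K z)
      + indicator (- ball 0 1) z * (min 1 (norm z) * K z))"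
    by (auto simp: fun_eq_iff indicator_def)
  then show ?thesis using Bochner_Integration.integrable_add[OF near far] by simp
qed

text \<open>Integrability of \<open>min 1 (norm z) * K z\<close> encodes an order below one at the
  origin and finite mass away from it. Nonlocal terms then converge for bounded functions that are
  Lipschitz near the base point, without a correction by the gradient.\<close>

locale levy_kernel =
  fixes K :: "real^'n \<Rightarrow> real"
  assumes K_measurable [measurable]: "K \<in> borel_measurable lebesgue"
    and K_nonneg: "0 \<le> K z"
    and K_integrable: "integrable lebesgue (\<lambda>z. min 1 (norm z) * K z)"
begin

text \<open>The bound for the nonlocal term of a function whose increments are at most
  \<open>A * norm z\<close> and at most \<open>B\<close>.\<close>

definition levy_mass :: "real \<Rightarrow> real \<Rightarrow> real" where
  "levy_mass A B = (LINT z|lebesgue. min (A * norm z) B * K z)"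

lemma norm_measurable [measurable]: "(norm :: real^'n \<Rightarrow> real) \<in> borel_measurable lebesgue"
  by (intro measurable_completion) simp

lemma min_le_max_mult: "0 \<le> A \<Longrightarrow> 0 \<le> B \<Longrightarrow> min (A * norm z) B * K z \<le> max A B * (min 1 (norm z) * K z)"
proof -
  assume "0 \<le> A" "0 \<le> B"
  then have "min (A * norm z) B \<le> max A B * min 1 (norm z)"
  proof (cases "norm z \<le> 1")
    case True
    have "A * norm z \<le> max A B * norm z" by (intro mult_right_mono) auto
    then show ?thesis using True by (simp add: min_def)
  next
    case False
    have "min (A * norm z) B \<le> B" "B \<le> max A B" by auto
    then show ?thesis using False by simp
  qed
  then show ?thesis using K_nonneg by (simp only: mult.assoc[symmetric]) (rule mult_right_mono)
qed

lemma levy_mass_integrable: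
  assumes "0 \<le> A" "0 \<le> B"
  shows "integrable lebesgue (\<lambda>z. min (A * norm z) B * K z)"
proof (rule Bochner_Integration.integrable_bound)
  show "integrable lebesgue (\<lambda>z. max A B * (min 1 (norm z) * K z))"
    using K_integrable by simp
  show "AE z in lebesgue. norm (min (A * norm z) B * K z) \<le> norm (max A B * (min 1 (norm z) * K z))"
    using min_le_max_mult[OF assms] assms K_nonneg by (auto simp: abs_mult)
qed simp

lemma levy_mass_nonneg: "0 \<le> A \<Longrightarrow> 0 \<le> B \<Longrightarrow> 0 \<le> levy_mass A B"
  unfolding levy_mass_def using K_nonneg by (intro integral_nonneg_AE) auto

lemma levy_mass_mono:
  assumes "0 \<le> A" "0 \<le> B" "A \<le> A'" "B \<le> B'" shows "levy_mass A B \<le> levy_mass A' B'"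
  unfolding levy_mass_def
proof (intro integral_mono levy_mass_integrable)
  fix z :: "real^'n"
  have "A * norm z \<le> A' * norm z" using assms by (intro mult_right_mono) auto
  then show "min (A * norm z) B * K z \<le> min (A' * norm z) B' * K z"
    using K_nonneg assms by (intro mult_right_mono) auto
qed (use assms in auto)

lemma levy_mass_tendsto_0:
  assumes "\<And>k. 0 \<le> A k" "\<And>k. 0 \<le> B k" "\<And>k. A k \<le> A'" "\<And>k. B k \<le> B'"
    and lim: "A \<longlonglongrightarrow> 0 \<or> B \<longlonglongrightarrow> 0"
  shows "(\<lambda>k::nat. levy_mass (A k) (B k)) \<longlonglongrightarrow> 0"
proof -
  have nn: "0 \<le> A'" "0 \<le> B'" using assms(1-4) order_trans by blast+
  have "(\<lambda>k. LINT z|lebesgue. min (A k * norm z) (B k) * K z) \<longlonglongrightarrow> (LINT z|(lebesgue :: (real^'n) measure). 0)"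
  proof (rule integral_dominated_convergence)
    show "integrable lebesgue (\<lambda>z. min (A' * norm z) B' * K z)"
      by (rule levy_mass_integrable[OF nn])
    show "AE z in lebesgue. norm (min (A k * norm z) (B k) * K z) \<le> min (A' * norm z) B' * K z" for k
    proof (rule AE_I2)
      fix z :: "real^'n"
      have "A k * norm z \<le> A' * norm z" using assms by (intro mult_right_mono) auto
      then have "min (A k * norm z) (B k) * K z \<le> min (A' * norm z) B' * K z"
        using K_nonneg assms by (intro mult_right_mono) (auto simp: min_le_iff_disj)
      then show "norm (min (A k * norm z) (B k) * K z) \<le> min (A' * norm z) B' * K z"
        using K_nonneg[of z] assms(1,2)[of k] by (simp add: abs_mult)
    qed
    show "AE z in lebesgue. (\<lambda>k. min (A k * norm z) (B k) * K z) \<longlonglongrightarrow> 0"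
    proof (rule AE_I2)
      fix z :: "real^'n"
      have "(\<lambda>k. min (A k * norm z) (B k)) \<longlonglongrightarrow> 0"
        using lim
      proof
        assume "A \<longlonglongrightarrow> 0"
        then have "(\<lambda>k. A k * norm z) \<longlonglongrightarrow> 0" by (rule tendsto_mult_left_zero)
        then show ?thesis
          by (rule tendsto_sandwich[OF _ _ tendsto_const, rotated 2]) (use assms(1,2) in auto)
      next
        assume "B \<longlonglongrightarrow> 0"
        then show ?thesis
          by (rule tendsto_sandwich[OF _ _ tendsto_const, rotated 2]) (use assms(1,2) in auto)
      qed
      then show "(\<lambda>k. min (A k * norm z) (B k) * K z) \<longlonglongrightarrow> 0" by (rule tendsto_mult_left_zero)
    qed
  qed simp_all
  then show ?thesis unfolding levy_mass_def by simp
qed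

text \<open>Fixed height and small slope: the case of a localizing penalty stretched over a large
  region.\<close>

lemma levy_mass_small_left:
  assumes "0 \<le> B" "0 < \<kappa>" shows "\<exists>A>0. levy_mass A B < \<kappa>"
proof -
  have "(\<lambda>k. levy_mass (inverse (real (Suc k))) B) \<longlonglongrightarrow> 0"
    by (rule levy_mass_tendsto_0[where A' = 1 and B' = B])
      (use assms LIMSEQ_inverse_real_of_nat in \<open>auto simp: inverse_le_1_iff\<close>)
  then have "\<forall>\<^sub>F k in sequentially. levy_mass (inverse (real (Suc k))) B < \<kappa>"
    using assms(2) by (rule order_tendstoD)
  then obtain k where "levy_mass (inverse (real (Suc k))) B < \<kappa>"
    by (auto simp: eventually_sequentially)
  then show ?thesis by (intro exI[of _ "inverse (real (Suc k))"]) auto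
qed

text \<open>Fixed slope and small height: the case of an integral over a ball of small radius
  \<delta>, where increments are at most \<open>A * \<delta>\<close>.\<close>

lemma levy_mass_small_right:
  assumes "0 \<le> A" "0 < \<kappa>" shows "\<exists>B>0. levy_mass A B < \<kappa>"
proof -
  have "(\<lambda>k. levy_mass A (inverse (real (Suc k)))) \<longlonglongrightarrow> 0"
    by (rule levy_mass_tendsto_0[where B' = 1 and A' = A])
      (use assms LIMSEQ_inverse_real_of_nat in \<open>auto simp: inverse_le_1_iff\<close>)
  then have "\<forall>\<^sub>F k in sequentially. levy_mass A (inverse (real (Suc k))) < \<kappa>"
    using assms(2) by (rule order_tendstoD)
  then obtain k where "levy_mass A (inverse (real (Suc k))) < \<kappa>"
    by (auto simp: eventually_sequentially)
  then show ?thesis by (intro exI[of _ "inverse (real (Suc k))"]) auto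
qed

lemma levy_mass_set_integrable:
  "0 \<le> A \<Longrightarrow> 0 \<le> B \<Longrightarrow> S \<in> sets lebesgue \<Longrightarrow> set_integrable lebesgue S (\<lambda>z. min (A * norm z) B * K z)"
  unfolding set_integrable_def using levy_mass_integrable
  by (intro integrable_mult_indicator) auto

text \<open>If the left-hand side diverges, its Bochner integral is \<^term>\<open>0::real\<close> and the bound is trivial.\<close>
lemma set_integral_le_levy_mass:
  assumes S: "S \<in> sets lebesgue" and "0 \<le> A" "0 \<le> B"
    and le: "\<And>z. z \<in> S \<Longrightarrow> f z \<le> min (A * norm z) B"
  shows "(LINT z:S|lebesgue. f z * K z) \<le> (LINT z:S|lebesgue. min (A * norm z) B * K z)"
proof (cases "set_integrable lebesgue S (\<lambda>z. f z * K z)")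
  case True
  then show ?thesis
    by (rule set_integral_mono) (use assms levy_mass_set_integrable K_nonneg in \<open>auto intro!: mult_right_mono\<close>)
next
  case False
  then have "(LINT z:S|lebesgue. f z * K z) = 0"
    unfolding set_integrable_def set_lebesgue_integral_def by (rule not_integrable_integral_eq)
  also have "\<dots> \<le> (LINT z:S|lebesgue. min (A * norm z) B * K z)"
    unfolding set_lebesgue_integral_def using assms(2,3) K_nonneg
    by (intro integral_nonneg_AE) (auto simp: indicator_def)
  finally show ?thesis .
qed

lemma levy_mass_split:
  assumes "0 \<le> A" "0 \<le> B" "S \<in> sets lebesgue"
  shows "(LINT z:S|lebesgue. min (A * norm z) B * K z) + (LINT z:-S|lebesgue. min (A * norm z) B * K z)
    = levy_mass A B"
proof -
  have "(LINT z:S|lebesgue. min (A * norm z) B * K z) + (LINT z:-S|lebesgue. min (A * norm z) B * K z)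
    = (LINT z:(S \<union> - S)|lebesgue. min (A * norm z) B * K z)"
    using assms by (intro set_integral_Un[symmetric] levy_mass_set_integrable)
      (use Compl_in_sets_lebesgue in blast)+
  then show ?thesis unfolding levy_mass_def set_lebesgue_integral_def by simp
qed

lemma set_integral_le_levy_mass':
  assumes S: "S \<in> sets lebesgue" and "0 \<le> A" "0 \<le> B"
    and le: "\<And>z. z \<in> S \<Longrightarrow> f z \<le> min (A * norm z) B"
  shows "(LINT z:S|lebesgue. f z * K z) \<le> levy_mass A B"
proof -
  have "0 \<le> (LINT z:-S|lebesgue. min (A * norm z) B * K z)"
    unfolding set_lebesgue_integral_def using assms(2,3) K_nonneg
    by (intro integral_nonneg_AE) (auto simp: indicator_def)
  then show ?thesis
    using set_integral_le_levy_mass[OF assms] levy_mass_split[OF assms(2,3) S] by linarith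
qed

lemma set_integrable_bounded_far:
  assumes [measurable]: "f \<in> borel_measurable lebesgue" and S[measurable]: "S \<in> sets lebesgue"
    and bd: "\<And>z. z \<in> S \<Longrightarrow> \<bar>f z\<bar> \<le> B" and far: "\<And>z. z \<in> S \<Longrightarrow> \<delta> \<le> norm z" and "0 < \<delta>"
  shows "set_integrable lebesgue S (\<lambda>z. f z * K z)"
proof (rule set_integrable_bound)
  show "set_integrable lebesgue S (\<lambda>z. min (\<bar>B\<bar> / \<delta> * norm z) \<bar>B\<bar> * K z)"
    using assms by (intro levy_mass_set_integrable) auto
  show "set_borel_measurable lebesgue S (\<lambda>z. f z * K z)"
    unfolding set_borel_measurable_def by measurable
  show "AE z in lebesgue. z \<in> S \<longrightarrow> norm (f z * K z) \<le> norm (min (\<bar>B\<bar> / \<delta> * norm z) \<bar>B\<bar> * K z)"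
  proof (intro AE_I2 impI)
    fix z assume z: "z \<in> S"
    have "\<bar>f z\<bar> \<le> \<bar>B\<bar>" using bd[OF z] by simp
    moreover have "\<bar>B\<bar> \<le> \<bar>B\<bar> / \<delta> * norm z"
      using mult_right_mono[OF far[OF z], of "\<bar>B\<bar>"] \<open>0 < \<delta>\<close> by (simp add: field_simps)
    ultimately have "\<bar>f z\<bar> * K z \<le> min (\<bar>B\<bar> / \<delta> * norm z) \<bar>B\<bar> * K z"
      using K_nonneg by (intro mult_right_mono) auto
    also have "\<dots> \<le> norm (min (\<bar>B\<bar> / \<delta> * norm z) \<bar>B\<bar> * K z)" by simp
    finally show "norm (f z * K z) \<le> norm (min (\<bar>B\<bar> / \<delta> * norm z) \<bar>B\<bar> * K z)"
      using K_nonneg[of z] by (simp add: abs_mult)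
  qed
qed

end

section \<open>First-order viscosity subsolutions\<close>

definition fo_sub :: "('a::euclidean_space \<Rightarrow> 'a \<Rightarrow> real) \<Rightarrow> ('a \<Rightarrow> real) \<Rightarrow> bool" where
  "fo_sub G \<psi> \<longleftrightarrow> (\<forall>y \<phi> q. C1_on UNIV \<phi> \<longrightarrow> (\<phi> has_derivative (\<lambda>h. q \<bullet> h)) (at y) \<longrightarrow>
     (\<forall>\<^sub>F z in nhds y. \<psi> z - \<phi> z \<le> \<psi> y - \<phi> y) \<longrightarrow> G y q \<le> 0)"

text \<open>Negation turns supersolutions into subsolutions of the dual Hamiltonian.\<close>
definition fo_dual :: "('a::euclidean_space \<Rightarrow> 'a \<Rightarrow> real) \<Rightarrow> 'a \<Rightarrow> 'a \<Rightarrow> real" where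
  "fo_dual G = (\<lambda>y q. - G y (- q))"

lemma fo_subI:
  assumes "\<And>y \<phi> q. C1_on UNIV \<phi> \<Longrightarrow> (\<phi> has_derivative (\<lambda>h. q \<bullet> h)) (at y) \<Longrightarrow>
     (\<forall>\<^sub>F z in nhds y. \<psi> z - \<phi> z \<le> \<psi> y - \<phi> y) \<Longrightarrow> G y q \<le> 0"
  shows "fo_sub G \<psi>"
  using assms unfolding fo_sub_def by blast

lemma fo_subD:
  "fo_sub G \<psi> \<Longrightarrow> C1_on UNIV \<phi> \<Longrightarrow> (\<phi> has_derivative (\<lambda>h. q \<bullet> h)) (at y) \<Longrightarrow>
     (\<forall>\<^sub>F z in nhds y. \<psi> z - \<phi> z \<le> \<psi> y - \<phi> y) \<Longrightarrow> G y q \<le> 0"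
  unfolding fo_sub_def by blast

lemma C1_on_uminus: "C1_on S f \<Longrightarrow> C1_on S (\<lambda>x. - f x)"
  using C1_on_scaleR[OF C1_on_const[of S "-1"]] by simp

lemma viscosity_solution_first_order_iff:
  fixes \<psi> :: "real^'n \<Rightarrow> real"
  shows "viscosity_solution_first_order G \<psi> \<longleftrightarrow>
    continuous_on UNIV \<psi> \<and> fo_sub G \<psi> \<and> fo_sub (fo_dual G) (\<lambda>y. - \<psi> y)"
proof -
  have neg: "C1_on UNIV \<phi> \<and> (\<phi> has_derivative (\<lambda>h. q \<bullet> h)) (at y) \<longleftrightarrow>
      C1_on UNIV (\<lambda>z. - \<phi> z) \<and> ((\<lambda>z. - \<phi> z) has_derivative (\<lambda>h. (- q) \<bullet> h)) (at y)"
    for \<phi> :: "real^'n \<Rightarrow> real" and q y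
    using C1_on_uminus[of UNIV \<phi>] C1_on_uminus[of UNIV "\<lambda>z. - \<phi> z"]
      has_derivative_minus[of \<phi> "\<lambda>h. q \<bullet> h"] has_derivative_minus[of "\<lambda>z. - \<phi> z" "\<lambda>h. (- q) \<bullet> h"]
    by auto
  have "fo_sub (fo_dual G) (\<lambda>y. - \<psi> y) \<longleftrightarrow> (\<forall>y \<phi> q. C1_on UNIV \<phi> \<longrightarrow> (\<phi> has_derivative (\<lambda>h. q \<bullet> h)) (at y) \<longrightarrow>
     (\<forall>\<^sub>F z in nhds y. \<psi> z - \<phi> z \<ge> \<psi> y - \<phi> y) \<longrightarrow> G y q \<ge> 0)" (is "?L \<longleftrightarrow> ?R")
  proof
    assume L: ?L
    show ?R
    proof (intro allI impI)
      fix y \<phi> q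
      assume "C1_on UNIV \<phi>" "(\<phi> has_derivative (\<lambda>h. q \<bullet> h)) (at y)"
        "\<forall>\<^sub>F z in nhds y. \<psi> z - \<phi> z \<ge> \<psi> y - \<phi> y"
      then show "G y q \<ge> 0"
        using fo_subD[OF L, of "\<lambda>z. - \<phi> z" "- q" y] neg[of \<phi> q y]
        by (simp add: fo_dual_def algebra_simps)
    qed
  next
    assume R: ?R
    show ?L
    proof (rule fo_subI)
      fix y \<phi> q
      assume a: "C1_on UNIV \<phi>" "(\<phi> has_derivative (\<lambda>h. q \<bullet> h)) (at y)"
        "\<forall>\<^sub>F z in nhds y. - \<psi> z - \<phi> z \<le> - \<psi> y - \<phi> y"
      have "C1_on UNIV (\<lambda>z. - \<phi> z)" "((\<lambda>z. - \<phi> z) has_derivative (\<lambda>h. (- q) \<bullet> h)) (at y)"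
        using a neg by blast+
      moreover have "\<forall>\<^sub>F z in nhds y. \<psi> y - (- \<phi> y) \<le> \<psi> z - (- \<phi> z)"
        using a(3) by eventually_elim simp
      ultimately have "0 \<le> G y (- q)" using R by blast
      then show "fo_dual G y q \<le> 0" by (simp add: fo_dual_def)
    qed
  qed
  then show ?thesis
    unfolding viscosity_solution_first_order_def fo_sub_def[of G] by blast
qed

lemma fo_sub_add_const: "fo_sub G \<psi> \<Longrightarrow> fo_sub G (\<lambda>y. \<psi> y + c)"
  unfolding fo_sub_def by simp

lemma fo_sub_translate:
  assumes "fo_sub G \<psi>" shows "fo_sub (\<lambda>y. G (y + k)) (\<lambda>y. \<psi> (y + k))"
proof (rule fo_subI)
  fix y \<phi> q
  assume a: "C1_on UNIV \<phi>" "(\<phi> has_derivative (\<lambda>h. q \<bullet> h)) (at y)"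
    "\<forall>\<^sub>F z in nhds y. \<psi> (z + k) - \<phi> z \<le> \<psi> (y + k) - \<phi> y"
  have "((\<lambda>z. \<phi> (z - k)) has_derivative (\<lambda>h. q \<bullet> h)) (at (y + k))"
  proof -
    have "((\<lambda>z. z - k) has_derivative (\<lambda>h. h)) (at (y + k))"
      by (auto intro!: derivative_eq_intros)
    from has_derivative_compose[OF this, of \<phi> "\<lambda>h. q \<bullet> h"] a(2) show ?thesis by simp
  qed
  moreover have "\<forall>\<^sub>F z in nhds (y + k). \<psi> z - \<phi> (z - k) \<le> \<psi> (y + k) - \<phi> y"
  proof -
    have "filterlim (\<lambda>z. z - k) (nhds y) (nhds (y + k))"
    proof -
      have "((\<lambda>z. z - k) \<longlongrightarrow> (y + k) - k) (nhds (y + k))" by (intro tendsto_intros filterlim_ident)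
      then show ?thesis by (simp only: add_diff_cancel_right')
    qed
    from eventually_compose_filterlim[OF a(3) this] show ?thesis by simp
  qed
  moreover have "C1_on UNIV (\<lambda>z. \<phi> (z - k))"
    using C1_on_translate[OF a(1), of "- k"] by simp
  ultimately show "G (y + k) q \<le> 0"
    using fo_subD[OF assms, of "\<lambda>z. \<phi> (z - k)" q "y + k"] by simp
qed

section \<open>Stability and Lipschitz bounds for subsolutions\<close>

lemma continuous_attains_sup_coercive:
  fixes f :: "'a::heine_borel \<Rightarrow> real"
  assumes "closed S" "y \<in> S" "continuous_on S f"
    and far: "\<And>z. z \<in> S \<Longrightarrow> R < dist y z \<Longrightarrow> f z \<le> f y"
  shows "\<exists>m\<in>S. \<forall>z\<in>S. f z \<le> f m"
proof -
  have "compact (S \<inter> cball y \<bar>R\<bar>)" using assms(1) by (simp add: closed_Int_compact)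
  moreover have "y \<in> S \<inter> cball y \<bar>R\<bar>" using assms(2) by simp
  ultimately obtain m where m: "m \<in> S \<inter> cball y \<bar>R\<bar>" "\<forall>z\<in>S \<inter> cball y \<bar>R\<bar>. f z \<le> f m"
    using continuous_attains_sup[of "S \<inter> cball y \<bar>R\<bar>" f] continuous_on_subset[OF assms(3)]
    by (metis Int_lower1 empty_iff)
  have "f z \<le> f m" if "z \<in> S" for z
  proof (cases "R < dist y z")
    case True
    then show ?thesis using far[OF that True] bspec[OF m(2), of y] assms(2) by simp
  qed (use m that in auto)
  then show ?thesis using m by auto
qed

lemma C1_gradient:
  fixes \<phi> :: "'a::euclidean_space \<Rightarrow> real"
  assumes "C1_on UNIV \<phi>"
  obtains g where "continuous_on UNIV g" "\<And>x. (\<phi> has_derivative (\<lambda>h. g x \<bullet> h)) (at x)"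
proof -
  obtain f' where f': "\<And>x. (\<phi> has_derivative blinfun_apply (f' x)) (at x)" "continuous_on UNIV f'"
    using assms unfolding C1_on_def by auto
  let ?g = "\<lambda>x. \<Sum>b\<in>Basis. blinfun_apply (f' x) b *\<^sub>R b"
  have "blinfun_apply (f' x) h = ?g x \<bullet> h" for x h
  proof -
    have "blinfun_apply (f' x) h = blinfun_apply (f' x) (\<Sum>b\<in>Basis. (h \<bullet> b) *\<^sub>R b)"
      by (simp add: euclidean_representation)
    also have "\<dots> = ?g x \<bullet> h"
      by (simp add: blinfun.sum_right blinfun.scaleR_right inner_sum_left inner_commute[of h] mult.commute)
    finally show ?thesis .
  qed
  then have "(\<phi> has_derivative (\<lambda>h. ?g x \<bullet> h)) (at x)" for x
    by (intro has_derivative_eq_rhs[OF f'(1)[of x]] ext)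
  moreover have "continuous_on UNIV ?g"
    using f'(2) by (intro continuous_intros)
  ultimately show ?thesis using that by blast
qed

lemma gradient_unique:
  assumes "(f has_derivative (\<lambda>h. p \<bullet> h)) (at x)" "(f has_derivative (\<lambda>h. q \<bullet> h)) (at x)"
  shows "p = q"
  using has_derivative_unique[OF assms] by (metis vector_eq_rdot)

text \<open>The approximant \<open>w\<close> may depend on the point \<open>y0\<close>: it lies
  below \<open>v\<close> up to an error on a ball and nearly reaches it at \<open>y0\<close>. This
  covers suprema as well as uniform limits. The order of quantifiers matters: the radius is given
  first, and the accuracy can then be chosen small relative to it.\<close>

lemma fo_sub_stable:
  assumes contG: "continuous_on UNIV (\<lambda>(y, q). G y q)"
    and approx: "\<And>y0 \<eta> Q. 0 < \<eta> \<Longrightarrow> \<exists>\<rho>>0. \<forall>\<eta>'>0. \<exists>w G'. continuous_on UNIV w \<and> fo_sub G' w \<and>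
       (\<forall>z\<in>cball y0 \<rho>. w z \<le> v z + \<eta>') \<and> v y0 - \<eta>' \<le> w y0 \<and>
       (\<forall>z\<in>cball y0 \<rho>. \<forall>q. norm q \<le> Q \<longrightarrow> G z q \<le> G' z q + \<eta>)"
  shows "fo_sub G v"
proof (rule fo_subI, rule ccontr)
  fix y0 \<phi> q0
  assume \<phi>: "C1_on UNIV \<phi>" and q0: "(\<phi> has_derivative (\<lambda>h. q0 \<bullet> h)) (at y0)"
    and max: "\<forall>\<^sub>F z in nhds y0. v z - \<phi> z \<le> v y0 - \<phi> y0" and "\<not> G y0 q0 \<le> 0"
  define \<eta> where "\<eta> = G y0 q0 / 3"
  have \<eta>: "0 < \<eta>" "2 * \<eta> < G y0 q0" using \<open>\<not> G y0 q0 \<le> 0\<close> unfolding \<eta>_def by auto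
  obtain g where g: "continuous_on UNIV g" "\<And>x. (\<phi> has_derivative (\<lambda>h. g x \<bullet> h)) (at x)"
    using C1_gradient[OF \<phi>] by blast
  have gq: "g y0 = q0" using gradient_unique[OF g(2) q0] .
  \<comment> \<open>The gradient of the test function after adding
    \<open>(norm (z - y0))\<^sup>2\<close>, which makes the maximum at \<open>y0\<close>
    strict.\<close>
  define p where "p = (\<lambda>z. g z + 2 *\<^sub>R (z - y0))"
  have py0: "p y0 = q0" by (simp add: p_def gq)
  have p: "continuous_on UNIV p" unfolding p_def by (intro continuous_intros g)
  have "isCont (\<lambda>z. G z (p z)) y0"
  proof -
    have "continuous_on UNIV (\<lambda>z. (\<lambda>(y, q). G y q) (z, p z))"
      by (intro continuous_on_compose2[OF contG] continuous_intros p) auto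
    then show ?thesis by (simp add: continuous_on_eq_continuous_at)
  qed
  then have "((\<lambda>z. G z (p z)) \<longlongrightarrow> G y0 (p y0)) (nhds y0)"
    using tendsto_at_iff_tendsto_nhds[of "\<lambda>z. G z (p z)" y0] by (simp only: isCont_def)
  from order_tendstoD(1)[OF this, of "2 * \<eta>"] have ev1: "\<forall>\<^sub>F z in nhds y0. 2 * \<eta> < G z (p z)"
    using \<eta>(2) py0 by simp
  have "isCont (\<lambda>z. norm (p z)) y0"
    using p by (intro continuous_intros) (simp add: continuous_on_eq_continuous_at)
  then have "((\<lambda>z. norm (p z)) \<longlongrightarrow> norm (p y0)) (nhds y0)"
    using tendsto_at_iff_tendsto_nhds[of "\<lambda>z. norm (p z)" y0] by (simp only: isCont_def)
  from order_tendstoD(2)[OF this, of "norm q0 + 1"] have ev2: "\<forall>\<^sub>F z in nhds y0. norm (p z) < norm q0 + 1"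
    using py0 by simp
  obtain r0 where r0: "0 < r0" "\<And>z. dist z y0 < r0 \<Longrightarrow> 2 * \<eta> < G z (p z) \<and> norm (p z) < norm q0 + 1
      \<and> v z - \<phi> z \<le> v y0 - \<phi> y0"
    using eventually_conj[OF ev1 eventually_conj[OF ev2 max]] unfolding eventually_nhds_metric by blast
  obtain \<rho> where \<rho>: "0 < \<rho>" "\<And>\<eta>'. 0 < \<eta>' \<Longrightarrow> \<exists>w G'. continuous_on UNIV w \<and> fo_sub G' w \<and>
       (\<forall>z\<in>cball y0 \<rho>. w z \<le> v z + \<eta>') \<and> v y0 - \<eta>' \<le> w y0 \<and>
       (\<forall>z\<in>cball y0 \<rho>. \<forall>q. norm q \<le> norm q0 + 1 \<longrightarrow> G z q \<le> G' z q + \<eta>)"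
    using approx[OF \<eta>(1)] by blast
  define r where "r = min (r0 / 2) \<rho>"
  have r: "0 < r" "r < r0" "r \<le> \<rho>" using r0 \<rho> unfolding r_def by auto
  \<comment> \<open>Two errors of size \<open>r\<^sup>2 / 4\<close> displace the maximum by at most
    r / sqrt 2, so it stays in the interior of the ball of radius \<open>r\<close>.\<close>
  obtain w G' where w: "continuous_on UNIV w" "fo_sub G' w" "\<And>z. z \<in> cball y0 \<rho> \<Longrightarrow> w z \<le> v z + r\<^sup>2 / 4"
      "v y0 - r\<^sup>2 / 4 \<le> w y0"
      "\<And>z q. z \<in> cball y0 \<rho> \<Longrightarrow> norm q \<le> norm q0 + 1 \<Longrightarrow> G z q \<le> G' z q + \<eta>"
    using \<rho>(2)[of "r\<^sup>2 / 4"] r(1) by auto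
  let ?f = "\<lambda>z. \<phi> z + (norm (z - y0))\<^sup>2"
  have C1f: "C1_on UNIV ?f"
    using C2_on_imp_C1_on[OF C2_on_norm_square[OF bounded_linear_ident]] by (intro C1_on_add \<phi>) auto
  have "continuous_on (cball y0 r) (\<lambda>z. w z - ?f z)"
    using C1_on_imp_continuous_on[OF C1f] w(1)
    by (intro continuous_on_diff) (auto intro: continuous_on_subset)
  from continuous_attains_sup[OF _ _ this] r
  obtain z where z: "z \<in> cball y0 r" "\<And>z'. z' \<in> cball y0 r \<Longrightarrow> w z' - ?f z' \<le> w z - ?f z"
    by (auto simp: Ball_def)
  have z\<rho>: "z \<in> cball y0 \<rho>" "dist z y0 < r0" using z(1) r by (auto simp: dist_commute)
  have "w y0 - \<phi> y0 \<le> w z - ?f z" using z(2)[of y0] r by simp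
  then have "(norm (z - y0))\<^sup>2 \<le> r\<^sup>2 / 2"
    using w(3)[OF z\<rho>(1)] w(4) r0(2)[OF z\<rho>(2)] by linarith
  also have "\<dots> < r\<^sup>2" using r by simp
  finally have zr: "dist y0 z < r" using r
    by (simp add: dist_norm norm_minus_commute power_less_imp_less_base)
  have "\<forall>\<^sub>F z' in nhds z. w z' - ?f z' \<le> w z - ?f z"
    by (rule eventually_nhds_in_open[THEN eventually_mono, of "ball y0 r"])
      (use zr z(2) in auto)
  moreover have "(?f has_derivative (\<lambda>h. p z \<bullet> h)) (at z)"
    using has_derivative_add[OF g(2)[of z] has_derivative_norm_square[OF bounded_linear_ident, of y0 z UNIV]]
    by (simp add: p_def inner_add_left)
  ultimately have "G' z (p z) \<le> 0" by (intro fo_subD[OF w(2) C1f])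
  then show False using w(5)[OF z\<rho>(1), of "p z"] r0(2)[OF z\<rho>(2)] \<eta>(1) by auto
qed

text \<open>A cone of slope \<open>L\<close> with a rounded tip at \<open>y\<close> is lowered onto
  the graph of \<open>w\<close>. Outside the tip its gradient exceeds \<open>L / 2\<close>, which
  coercivity forbids at a point of contact; so contact occurs in the tip.\<close>

lemma fo_sub_lipschitz:
  assumes w: "continuous_on UNIV w" "\<And>y. \<bar>w y\<bar> \<le> M" "fo_sub G w" and "0 < L"
    and coercive: "\<And>y q. L / 2 \<le> norm q \<Longrightarrow> 0 < G y q"
  shows "L-lipschitz_on UNIV w"
proof -
  have key: "w x \<le> w y + L * norm (x - y)" for x y
  proof (rule field_le_epsilon)
    fix \<eta> :: real assume "0 < \<eta>"
    \<comment> \<open>The size of the tip is the continuity radius of \<open>w\<close> at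
      \<open>y\<close>, so that contact in the tip means a value of at most
      \<open>w y + \<eta>\<close>.\<close>
    obtain d where d: "0 < d" "\<And>z. dist z y < d \<Longrightarrow> dist (w z) (w y) < \<eta>"
      using w(1) \<open>0 < \<eta>\<close> unfolding continuous_on_iff by (meson UNIV_I)
    define e where "e = d"
    have e: "0 < e" "\<And>z. norm (z - y) < e \<Longrightarrow> w z \<le> w y + \<eta>"
      using d unfolding e_def by (force simp: dist_norm dist_real_def)+
    let ?f = "\<lambda>z. L * smooth_norm e (z - y)"
    have "\<exists>m\<in>UNIV. \<forall>z\<in>UNIV. w z - ?f z \<le> w m - ?f m"
    proof (rule continuous_attains_sup_coercive[where y = y and R = "2 * M / L + e"])
      fix z assume "2 * M / L + e < dist y z"
      then have "2 * M + L * e \<le> L * norm (z - y)"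
        using \<open>0 < L\<close> by (simp add: field_simps dist_norm norm_minus_commute)
      also have "\<dots> \<le> ?f z" using norm_le_smooth_norm \<open>0 < L\<close> by simp
      finally show "w z - ?f z \<le> w y - ?f y"
        using w(2)[of z] w(2)[of y] e(1) by (simp add: smooth_norm_0)
    qed (intro continuous_intros w | simp)+
    then obtain z where z: "\<And>z'. w z' - ?f z' \<le> w z - ?f z" by auto
    let ?p = "L *\<^sub>R ((1 / smooth_norm e (z - y)) *\<^sub>R (z - y))"
    have "C1_on UNIV ?f"
      by (rule C2_on_imp_C1_on[OF C2_on_cmult[OF C2_on_smooth_norm[OF bounded_linear_ident e(1)]]])
    moreover have "(?f has_derivative (\<lambda>h. ?p \<bullet> h)) (at z)"
      using has_derivative_mult_right[OF has_derivative_smooth_norm[OF bounded_linear_ident e(1), of y z UNIV], of L]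
      by simp
    ultimately have "G z ?p \<le> 0"
      by (rule fo_subD[OF w(3)]) (simp add: z always_eventually)
    then have "norm ?p < L / 2" using coercive by (metis not_le)
    then have "norm (z - y) < e"
    proof (rule contrapos_pp)
      assume "\<not> norm (z - y) < e"
      then have "L * (2 / 3) \<le> L * norm ((1 / smooth_norm e (z - y)) *\<^sub>R (z - y))"
        using \<open>0 < L\<close> e(1) by (intro mult_left_mono norm_smooth_norm_gradient_ge) auto
      also have "\<dots> = norm ?p" using \<open>0 < L\<close> by (simp only: norm_scaleR abs_of_pos)
      finally show "\<not> norm ?p < L / 2" using \<open>0 < L\<close> by linarith
    qed
    then have "w z \<le> w y + \<eta>" by (rule e(2))
    moreover have "w x - ?f x \<le> w z - ?f z" by (rule z)
    \<comment> \<open>This lower bound cancels the \<open>L * e\<close> lost in the upper bound for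
      \<open>?f x\<close>; only \<eta> remains as an error.\<close>
    moreover have "L * e \<le> ?f z"
      unfolding smooth_norm_def using \<open>0 < L\<close> e(1) by (auto intro!: mult_left_mono real_le_rsqrt)
    moreover have "?f x \<le> L * (e + norm (x - y))"
      using smooth_norm_le[of e] e(1) \<open>0 < L\<close> by (intro mult_left_mono) auto
    ultimately show "w x \<le> w y + L * norm (x - y) + \<eta>" by (simp add: algebra_simps)
  qed
  show ?thesis
  proof (rule lipschitz_onI)
    show "dist (w x) (w y) \<le> L * dist x y" for x y
      using key[of x y] key[of y x] by (simp add: dist_norm norm_minus_commute)
  qed (use \<open>0 < L\<close> in simp)
qed

section \<open>The cell problem\<close>

lemma gradient_zero_at_local_extremum:
  fixes \<phi> :: "'a::euclidean_space \<Rightarrow> real"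
  assumes "(\<phi> has_derivative (\<lambda>h. q \<bullet> h)) (at y)"
    and "(\<forall>\<^sub>F z in nhds y. \<phi> z \<le> \<phi> y) \<or> (\<forall>\<^sub>F z in nhds y. \<phi> y \<le> \<phi> z)"
  shows "q = 0"
proof -
  obtain S where S: "open S" "y \<in> S" "(\<forall>z\<in>S. \<phi> z \<le> \<phi> y) \<or> (\<forall>z\<in>S. \<phi> y \<le> \<phi> z)"
    using assms(2) unfolding eventually_nhds by metis
  have "(\<lambda>h. q \<bullet> h) = (\<lambda>h. 0)"
    by (rule differential_zero_maxmin[OF S(2,1) assms(1) S(3)])
  then have "q \<bullet> q = 0" by metis
  then show ?thesis by simp
qed

text \<open>The bump construction of Perron's method: where the supersolution test fails strictly, a
  subsolution can be raised locally. The bound \<open>M\<close> keeps the raised function in the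
  class over which the supremum is taken.\<close>

lemma fo_sub_bump:
  fixes v :: "'a::euclidean_space \<Rightarrow> real"
  assumes contv: "continuous_on UNIV v" and v: "fo_sub (\<lambda>y q. l * v y + G y q) v"
    and contG: "continuous_on UNIV (\<lambda>(y, q). G y q)"
    and \<phi>: "C1_on UNIV \<phi>" "(\<phi> has_derivative (\<lambda>h. q0 \<bullet> h)) (at y0)"
    and touch: "\<forall>\<^sub>F z in nhds y0. v y0 - \<phi> y0 \<le> v z - \<phi> z"
    and strict: "l * v y0 + G y0 q0 < 0" and "v y0 < M"
  shows "\<exists>w. continuous_on UNIV w \<and> fo_sub (\<lambda>y q. l * w y + G y q) w \<and> (\<forall>y. v y \<le> w y) \<and>
    v y0 < w y0 \<and> (\<forall>y. w y \<le> v y \<or> w y \<le> M)"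
proof -
  obtain g where g: "continuous_on UNIV g" "\<And>x. (\<phi> has_derivative (\<lambda>h. g x \<bullet> h)) (at x)"
    using C1_gradient[OF \<phi>(1)] by blast
  have gq: "g y0 = q0" using gradient_unique[OF g(2) \<phi>(2)] .
  \<comment> \<open>The test function is shifted to touch \<open>v\<close> at \<open>y0\<close> and
    lowered by a quadratic, so that near \<open>y0\<close> it lies below \<open>v\<close> by at
    least the squared distance.\<close>
  define f where "f = (\<lambda>z. \<phi> z + (v y0 - \<phi> y0) + (-1) * (norm (z - y0))\<^sup>2)"
  define p where "p = (\<lambda>z. g z - 2 *\<^sub>R (z - y0))"
  have f: "C1_on UNIV f"
    unfolding f_def using C2_on_imp_C1_on[OF C2_on_cmult[OF C2_on_norm_square[OF bounded_linear_ident]]]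
    by (intro C1_on_add \<phi> C1_on_const)
  have contf: "continuous_on UNIV f" by (rule C1_on_imp_continuous_on[OF f])
  have fp: "(f has_derivative (\<lambda>h. p z \<bullet> h)) (at z)" for z
    unfolding f_def p_def
    by (rule has_derivative_eq_rhs, (rule derivative_intros g(2)
        has_derivative_norm_square[OF bounded_linear_ident])+)
      (auto simp: inner_diff_left)
  have f0: "f y0 = v y0" "p y0 = q0" by (simp_all add: f_def p_def gq)
  have contp: "continuous_on UNIV p" unfolding p_def by (intro continuous_intros g)
  have "continuous_on UNIV (\<lambda>z. (z, p z))" by (intro continuous_intros contp)
  from continuous_on_compose2[OF contG this] have "continuous_on UNIV (\<lambda>z. G z (p z))" by simp
  then have "continuous_on UNIV (\<lambda>x :: 'a \<times> real. G (fst x) (p (fst x)))"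
    by (rule continuous_on_compose2[OF _ continuous_on_fst[OF continuous_on_id]]) simp
  moreover have "continuous_on UNIV (\<lambda>x :: 'a \<times> real. f (fst x))"
    by (rule continuous_on_compose2[OF contf continuous_on_fst[OF continuous_on_id]]) simp
  ultimately have "continuous_on UNIV (\<lambda>(z, k). (l * (f z + k) + G z (p z), f z + k))"
    unfolding case_prod_beta by (intro continuous_intros)
  then have "isCont (\<lambda>(z, k). (l * (f z + k) + G z (p z), f z + k)) (y0, 0)"
    by (simp add: continuous_on_eq_continuous_at)
  moreover have "open ({..<0::real} \<times> {..<M})" by (intro open_Times) auto
  ultimately have "\<forall>\<^sub>F zk in nhds (y0, 0). (\<lambda>(z, k). (l * (f z + k) + G z (p z), f z + k)) zk \<in> {..<0} \<times> {..<M}"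
    using strict \<open>v y0 < M\<close> f0 tendsto_at_iff_tendsto_nhds[of "\<lambda>(z, k). (l * (f z + k) + G z (p z), f z + k)" "(y0, 0::real)"]
    unfolding isCont_def by (intro topological_tendstoD) auto
  then obtain d where d: "0 < d" "\<And>z k. dist (z, k) (y0, 0) < d \<Longrightarrow> l * (f z + k) + G z (p z) < 0 \<and> f z + k < M"
    unfolding eventually_nhds_metric by auto
  obtain d' where d': "0 < d'" "\<And>z. dist z y0 < d' \<Longrightarrow> v y0 - \<phi> y0 \<le> v z - \<phi> z"
    using touch unfolding eventually_nhds_metric by auto
  define r where "r = min (min (d / 2) d') 1"
  \<comment> \<open>The square of \<open>r / 2\<close>: after raising by this amount the bump is
    still below \<open>v\<close> beyond distance \<open>r / 2\<close>, so the gluing takes place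
    well inside the ball.\<close>
  define \<kappa> where "\<kappa> = r\<^sup>2 / 4"
  have r: "0 < r" "r \<le> d / 2" "r \<le> d'" "r \<le> 1" using d d' unfolding r_def by auto
  have r2: "r\<^sup>2 \<le> r" using r by (simp add: power2_eq_square mult_left_le)
  have \<kappa>: "0 < \<kappa>" "\<kappa> < d / 2" "\<kappa> < r\<^sup>2"
    using r r2 zero_less_power[OF r(1), of 2] unfolding \<kappa>_def by linarith+
  have near: "l * (f z + \<kappa>) + G z (p z) < 0 \<and> f z + \<kappa> < M" if "dist z y0 < r" for z
  proof (rule d(2))
    have "dist (z, \<kappa>) (y0, 0) \<le> dist z y0 + \<bar>\<kappa>\<bar>"
      using sqrt_sum_squares_le_sum_abs[of "dist z y0" \<kappa>] by (simp add: dist_Pair_Pair dist_real_def)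
    also have "\<dots> < d" using that r \<kappa> by simp
    finally show "dist (z, \<kappa>) (y0, 0) < d" .
  qed
  have out: "f z + \<kappa> < v z" if "dist z y0 < r" "\<kappa> < (norm (z - y0))\<^sup>2" for z
    using d'(2)[of z] that r unfolding f_def by simp
  define w where "w = (\<lambda>z. if dist z y0 < r then max (v z) (f z + \<kappa>) else v z)"
  \<comment> \<open>On the open set \<open>U\<close> the glued function is \<open>v\<close> itself.
    Since \<open>U\<close> and the ball cover the space, continuity can be checked on the two
    pieces.\<close>
  define U where "U = {z. \<kappa> < (norm (z - y0))\<^sup>2}"
  have wU: "w z = v z" if "z \<in> U" for z
    using out[of z] that unfolding w_def U_def by auto
  have wB: "w z = max (v z) (f z + \<kappa>)" if "z \<in> ball y0 r" for z
    using that unfolding w_def by (simp add: dist_commute)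
  have openU: "open U" unfolding U_def by (intro open_Collect_less continuous_intros)
  have cover: "ball y0 r \<union> U = UNIV"
  proof -
    have "z \<in> U" if "z \<notin> ball y0 r" for z
    proof -
      have "r\<^sup>2 \<le> (norm (z - y0))\<^sup>2" using that r(1)
        by (intro power_mono) (auto simp: dist_norm norm_minus_commute)
      then show ?thesis using \<kappa>(3) unfolding U_def by simp
    qed
    then show ?thesis by blast
  qed
  have "continuous_on (ball y0 r) w"
    by (rule continuous_on_eq[of _ "\<lambda>z. max (v z) (f z + \<kappa>)"])
      (auto simp: wB intro!: continuous_intros continuous_on_subset[OF contv] continuous_on_subset[OF contf])
  moreover have "continuous_on U w"
    by (rule continuous_on_eq[of _ v]) (auto simp: wU intro!: continuous_on_subset[OF contv])
  ultimately have contw: "continuous_on UNIV w"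
    using continuous_on_open_Un[of "ball y0 r" U w] openU cover by simp
  have vw: "v z \<le> w z" for z unfolding w_def by simp
  have "fo_sub (\<lambda>y q. l * w y + G y q) w"
  proof (rule fo_subI)
    fix z \<zeta> q
    assume \<zeta>: "C1_on UNIV \<zeta>" "(\<zeta> has_derivative (\<lambda>h. q \<bullet> h)) (at z)"
      "\<forall>\<^sub>F x in nhds z. w x - \<zeta> x \<le> w z - \<zeta> z"
    show "l * w z + G z q \<le> 0"
    proof (cases "w z = v z")
      case True
      have "\<forall>\<^sub>F x in nhds z. v x - \<zeta> x \<le> v z - \<zeta> z"
        using \<zeta>(3) by eventually_elim (use True vw in \<open>smt (verit)\<close>)
      from fo_subD[OF v \<zeta>(1,2) this] show ?thesis using True by simp
    next
      case False
      then have z: "z \<in> ball y0 r" "w z = f z + \<kappa>"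
        unfolding w_def by (auto simp: dist_commute max_def split: if_splits)
      have "\<forall>\<^sub>F x in nhds z. x \<in> ball y0 r" by (rule eventually_nhds_in_open) (use z in auto)
      with \<zeta>(3) have "\<forall>\<^sub>F x in nhds z. f x - \<zeta> x \<le> f z - \<zeta> z"
        by eventually_elim (use z wB in \<open>auto simp: max_def split: if_splits\<close>)
      \<comment> \<open>Where the bump is active, \<zeta> touches it from above, so the two
        gradients agree and the strict inequality for \<open>f\<close> applies.\<close>
      moreover have "((\<lambda>x. f x - \<zeta> x) has_derivative (\<lambda>h. (p z - q) \<bullet> h)) (at z)"
        using has_derivative_diff[OF fp \<zeta>(2)] by (simp add: inner_diff_left)
      ultimately have "p z - q = 0" by (rule gradient_zero_at_local_extremum[OF _ disjI1, rotated])
      then show ?thesis using near[of z] z by (simp add: dist_commute)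
    qed
  qed
  moreover have "v y0 < w y0"
    using r \<kappa> f0 unfolding w_def by simp
  moreover have "w y \<le> v y \<or> w y \<le> M" for y
    using near[of y] unfolding w_def by (auto simp: max_def)
  ultimately show ?thesis using contw vw by blast
qed

text \<open>Perron's method. Coercivity makes all competitors Lipschitz with the same constant.\<close>
lemma discounted_problem_solution:
  fixes G :: "'a::euclidean_space \<Rightarrow> 'a \<Rightarrow> real"
  assumes contG: "continuous_on UNIV (\<lambda>(y, q). G y q)" and "0 < l" "0 < L"
    and C: "\<And>y. \<bar>G y 0\<bar> \<le> C" and coercive: "\<And>y q. L / 2 \<le> norm q \<Longrightarrow> C < G y q"
  shows "\<exists>v. L-lipschitz_on UNIV v \<and> (\<forall>y. \<bar>l * v y\<bar> \<le> C) \<and>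
    fo_sub (\<lambda>y q. l * v y + G y q) v \<and> fo_sub (fo_dual (\<lambda>y q. l * v y + G y q)) (\<lambda>y. - v y) \<and>
    (\<forall>k. (\<forall>y q. G (y + k) q = G y q) \<longrightarrow> (\<forall>y. v (y + k) = v y))"
proof -
  \<comment> \<open>The bounds are natural ones: since \<open>G y 0\<close> has absolute value at
    most \<open>C\<close>, the constants \<open>- C / l\<close> and \<open>C / l\<close> are a sub-
    and a supersolution.\<close>
  define S where "S = {w. continuous_on UNIV w \<and> (\<forall>y. \<bar>w y\<bar> \<le> C / l) \<and> fo_sub (\<lambda>y q. l * w y + G y q) w}"
  define v where "v = (\<lambda>y. SUP w\<in>S. w y)"
  have Cn: "0 \<le> C" using C[of 0] by linarith
  have lb: "\<bar>w y\<bar> \<le> C / l \<longleftrightarrow> \<bar>l * w y\<bar> \<le> C" for w :: "'a \<Rightarrow> real" and y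
    using \<open>0 < l\<close> by (simp add: abs_mult pos_le_divide_eq mult.commute)
  have "(\<lambda>_. - C / l) \<in> S"
    unfolding S_def
  proof (intro CollectI conjI allI fo_subI)
    fix y :: 'a and \<phi> q
    assume "(\<phi> has_derivative (\<lambda>h. q \<bullet> h)) (at y)" "\<forall>\<^sub>F z in nhds y. - C / l - \<phi> z \<le> - C / l - \<phi> y"
    then have "q = 0"
      by (intro gradient_zero_at_local_extremum[where \<phi> = \<phi>]) (auto elim: eventually_mono)
    then show "l * (- C / l) + G y q \<le> 0" using C[of y] \<open>0 < l\<close> by simp
  qed (use Cn \<open>0 < l\<close> in auto)
  then have S0: "S \<noteq> {}" by auto
  have bdd: "bdd_above ((\<lambda>w. w y) ` S)" for y
    unfolding S_def by (intro bdd_aboveI[of _ "C / l"]) (auto simp: abs_le_iff)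
  have vup: "w y \<le> v y" if "w \<in> S" for w y
    unfolding v_def by (rule cSUP_upper[OF that bdd])
  have vle: "v y \<le> c" if "\<And>w. w \<in> S \<Longrightarrow> w y \<le> c" for y c
    unfolding v_def by (rule cSUP_least[OF S0 that])
  have vapp: "\<exists>w\<in>S. v y - \<eta> < w y" if "0 < \<eta>" for y \<eta>
    using less_cSUP_iff[OF S0 bdd, of "v y - \<eta>" y] that unfolding v_def[symmetric] by (simp add: v_def)
  \<comment> \<open>As \<open>l * w\<close> is bounded by \<open>C\<close>, coercivity of
    \<open>G\<close> beyond \<open>L / 2\<close> makes the whole discounted Hamiltonian positive
    there. Thus \<open>L\<close> does not depend on \<open>l\<close>, which the vanishing discount
    limit requires.\<close>
  have lipS: "L-lipschitz_on UNIV w" if "w \<in> S" for w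
  proof (rule fo_sub_lipschitz[where M = "C / l" and G = "\<lambda>y q. l * w y + G y q"])
    show "0 < l * w y + G y q" if q: "L / 2 \<le> norm q" for y q
    proof -
      have "\<bar>l * w y\<bar> \<le> C" using \<open>w \<in> S\<close> lb unfolding S_def by auto
      then show ?thesis using coercive[OF q, of y] by linarith
    qed
  qed (use that \<open>0 < L\<close> in \<open>auto simp: S_def\<close>)
  have lipS': "w y \<le> w z + L * norm (y - z)" if "w \<in> S" for w y z
    using lipschitz_onD[OF lipS[OF that], of y z] by (auto simp: dist_norm abs_le_iff)
  have lipv: "v y \<le> v z + L * norm (y - z)" for y z
    by (rule vle) (use lipS' vup in \<open>smt (verit)\<close>)
  have lip: "L-lipschitz_on UNIV v"
  proof (rule lipschitz_onI)
    show "dist (v y) (v z) \<le> L * dist y z" for y z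
      using lipv[of y z] lipv[of z y] by (simp add: dist_norm norm_minus_commute)
  qed (use \<open>0 < L\<close> in simp)
  have contv: "continuous_on UNIV v" by (rule lipschitz_on_continuous_on[OF lip])
  have vbd: "\<bar>v y\<bar> \<le> C / l" for y
  proof -
    obtain w where "w \<in> S" using S0 by auto
    then have "- (C / l) \<le> v y" using vup[of w y] unfolding S_def by (auto simp: abs_le_iff) (smt (verit))
    moreover have "v y \<le> C / l" by (rule vle) (auto simp: S_def abs_le_iff)
    ultimately show ?thesis by simp
  qed
  have sub: "fo_sub (\<lambda>y q. l * v y + G y q) v"
  proof (rule fo_sub_stable)
    show "continuous_on UNIV (\<lambda>(y, q). l * v y + G y q)"
    proof -
      have "continuous_on UNIV (\<lambda>z. l * v (fst z) + (\<lambda>(y, q). G y q) z)"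
        by (intro continuous_intros contG continuous_on_compose2[OF contv]) auto
      then show ?thesis by (simp add: case_prod_beta)
    qed
    fix y0 :: 'a and \<eta> Q :: real assume "0 < \<eta>"
    \<comment> \<open>Both \<open>v\<close> and a competitor have Lipschitz constant
      \<open>L\<close>, so their difference changes by at most \<open>2 * L * \<rho>\<close> on the
      ball; multiplied by \<open>l\<close> this is \<open>\<eta> / 2\<close>.\<close>
    define \<rho> where "\<rho> = \<eta> / (4 * l * L)"
    have \<rho>: "0 < \<rho>" "l * (2 * L * \<rho>) = \<eta> / 2" using \<open>0 < \<eta>\<close> \<open>0 < l\<close> \<open>0 < L\<close> unfolding \<rho>_def by auto
    show "\<exists>\<rho>>0. \<forall>\<eta>'>0. \<exists>w G'. continuous_on UNIV w \<and> fo_sub G' w \<and>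
       (\<forall>z\<in>cball y0 \<rho>. w z \<le> v z + \<eta>') \<and> v y0 - \<eta>' \<le> w y0 \<and>
       (\<forall>z\<in>cball y0 \<rho>. \<forall>q. norm q \<le> Q \<longrightarrow> l * v z + G z q \<le> G' z q + \<eta>)"
    proof (intro exI[of _ \<rho>] conjI allI impI \<rho>)
      fix \<eta>' :: real assume "0 < \<eta>'"
      define \<eta>'' where "\<eta>'' = min \<eta>' (\<eta> / (2 * l))"
      have \<eta>'': "0 < \<eta>''" "\<eta>'' \<le> \<eta>'" "l * \<eta>'' \<le> \<eta> / 2"
        using \<open>0 < \<eta>\<close> \<open>0 < \<eta>'\<close> \<open>0 < l\<close> unfolding \<eta>''_def by (auto simp: min_def field_simps)
      obtain w where w: "w \<in> S" "v y0 - \<eta>'' < w y0" using vapp[OF \<eta>''(1)] by blast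
      have "l * v z + G z q \<le> l * w z + G z q + \<eta>" if "z \<in> cball y0 \<rho>" for z q
      proof -
        have "L * norm (y0 - z) \<le> L * \<rho>" "L * norm (z - y0) \<le> L * \<rho>"
          using that \<open>0 < L\<close> by (auto simp: dist_norm norm_minus_commute)
        then have "v z \<le> w z + \<eta>'' + 2 * L * \<rho>"
          using lipv[of z y0] lipS'[OF w(1), of y0 z] w(2) by linarith
        then have "l * v z \<le> l * (w z + \<eta>'' + 2 * L * \<rho>)" using \<open>0 < l\<close> by simp
        also have "\<dots> \<le> l * w z + \<eta>" using \<eta>''(3) \<rho>(2) by (simp add: distrib_left)
        finally show ?thesis by simp
      qed
      then show "\<exists>w G'. continuous_on UNIV w \<and> fo_sub G' w \<and>
         (\<forall>z\<in>cball y0 \<rho>. w z \<le> v z + \<eta>') \<and> v y0 - \<eta>' \<le> w y0 \<and>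
         (\<forall>z\<in>cball y0 \<rho>. \<forall>q. norm q \<le> Q \<longrightarrow> l * v z + G z q \<le> G' z q + \<eta>)"
      proof (intro exI[of _ w] exI[of _ "\<lambda>y q. l * w y + G y q"] conjI ballI allI impI)
        show "continuous_on UNIV w" "fo_sub (\<lambda>y q. l * w y + G y q) w"
          using w(1) unfolding S_def by auto
        show "w z \<le> v z + \<eta>'" for z using vup[OF w(1), of z] \<open>0 < \<eta>'\<close> by simp
        show "v y0 - \<eta>' \<le> w y0" using w(2) \<eta>''(2) by simp
      qed
    qed
  qed
  have super: "fo_sub (fo_dual (\<lambda>y q. l * v y + G y q)) (\<lambda>y. - v y)"
  proof (rule fo_subI, rule ccontr)
    fix y0 \<phi> q
    assume \<phi>: "C1_on UNIV \<phi>" "(\<phi> has_derivative (\<lambda>h. q \<bullet> h)) (at y0)"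
      "\<forall>\<^sub>F z in nhds y0. - v z - \<phi> z \<le> - v y0 - \<phi> y0"
      and "\<not> fo_dual (\<lambda>y q. l * v y + G y q) y0 q \<le> 0"
    then have strict: "l * v y0 + G y0 (- q) < 0" by (simp add: fo_dual_def)
    have d: "((\<lambda>z. - \<phi> z) has_derivative (\<lambda>h. (- q) \<bullet> h)) (at y0)"
      using has_derivative_minus[OF \<phi>(2)] by simp
    have touch: "\<forall>\<^sub>F z in nhds y0. v y0 - (- \<phi> y0) \<le> v z - (- \<phi> z)"
      using \<phi>(3) by eventually_elim simp
    \<comment> \<open>At the upper bound \<open>v\<close> would have a global maximum, the test
      gradient would vanish, and \<open>- C \<le> G y0 0\<close> would contradict the strict
      inequality.\<close>
    have "v y0 < C / l"
    proof (rule ccontr)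
      assume "\<not> v y0 < C / l"
      then have "v y0 = C / l" "\<And>z. v z \<le> v y0" using vbd by (smt (verit))+
      then have "\<forall>\<^sub>F z in nhds y0. - \<phi> z \<le> - \<phi> y0"
        using touch by (auto elim!: eventually_mono) (smt (verit))
      then have "- q = 0" by (rule gradient_zero_at_local_extremum[OF d disjI1])
      then show False using strict \<open>v y0 = C / l\<close> C[of y0] \<open>0 < l\<close> by simp
    qed
    from fo_sub_bump[OF contv sub contG C1_on_uminus[OF \<phi>(1)] d touch strict this]
    obtain w where w: "continuous_on UNIV w" "fo_sub (\<lambda>y q. l * w y + G y q) w"
      "\<And>y. v y \<le> w y" "v y0 < w y0" "\<And>y. w y \<le> v y \<or> w y \<le> C / l" by blast
    have "\<bar>w y\<bar> \<le> C / l" for y using vbd[of y] w(3)[of y] w(5)[of y] by linarith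
    then have "w \<in> S" using w unfolding S_def by auto
    then show False using vup[of w y0] w(4) by simp
  qed
  \<comment> \<open>Translation by a period, and by its negative, maps the class of competitors to
    itself, so the supremum is invariant.\<close>
  have per: "v (y + k) = v y" if k: "\<And>y q. G (y + k) q = G y q" for k y
  proof -
    have k': "G (y + - k) q = G y q" for y q using k[of "y + - k" q] by simp
    have shift: "(\<lambda>y. w (y + k)) \<in> S" if "w \<in> S" "\<And>y q. G (y + k) q = G y q" for w k
      using that fo_sub_translate[of "\<lambda>y q. l * w y + G y q" w k] unfolding S_def
      by (auto intro!: continuous_on_compose2[of UNIV w] continuous_intros)
    have "v (y + k) \<le> v y" if "\<And>y q. G (y + k) q = G y q" for y k
    proof (rule vle)
      fix w assume "w \<in> S"
      from vup[OF shift[OF this that], of y] show "w (y + k) \<le> v y" .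
    qed
    from this[OF k, of y] this[OF k', of "y + k"] show ?thesis by simp
  qed
  show ?thesis using lip vbd lb sub super per by (intro exI[of _ v]) auto
qed

section \<open>The vanishing discount limit on the torus\<close>

definition lattice_part :: "real^'n \<Rightarrow> real^'n" where
  "lattice_part y = (\<chi> i. of_int \<lfloor>y $ i\<rfloor>)"

lemma lattice_part_Ints: "lattice_part y $ i \<in> \<int>"
  by (simp add: lattice_part_def)

lemma diff_lattice_part: "y - lattice_part y \<in> cbox 0 1"
  unfolding mem_box_cart lattice_part_def
  by (auto simp: frac_ge_0 less_imp_le[OF frac_lt_1] frac_def[symmetric])

lemma Z_periodic_diff_lattice_part: "Z_periodic f \<Longrightarrow> f (y - lattice_part y) = f y"
  unfolding Z_periodic_def using lattice_part_Ints by (metis diff_add_cancel)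

text \<open>The discounted solutions \<open>v n\<close> share the Lipschitz constant
  \<open>L\<close>. Periodicity turns this into a bound for \<open>v n - v n 0\<close>, so a
  subsequence converges uniformly, while \<open>l n * v n\<close> oscillates by at most a multiple
  of \<open>l n\<close> and flattens to a constant.\<close>

lemma cell_problem_existence:
  fixes G :: "real^'n \<Rightarrow> real^'n \<Rightarrow> real"
  assumes contG: "continuous_on UNIV (\<lambda>(y, q). G y q)" and "0 < L"
    and C: "\<And>y. \<bar>G y 0\<bar> \<le> C" and coercive: "\<And>y q. L / 2 \<le> norm q \<Longrightarrow> C < G y q"
    and per: "Z_periodic G"
  shows "\<exists>c \<psi>. Z_periodic \<psi> \<and> L-lipschitz_on UNIV \<psi> \<and>
    viscosity_solution_first_order (\<lambda>y q. G y q - c) \<psi>"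
proof -
  define l where "l = (\<lambda>n. inverse (real (Suc n)))"
  have l: "0 < l n" for n by (simp add: l_def)
  define P where "P n v \<longleftrightarrow> L-lipschitz_on UNIV v \<and> (\<forall>y. \<bar>l n * v y\<bar> \<le> C) \<and>
    fo_sub (\<lambda>y q. l n * v y + G y q) v \<and> fo_sub (fo_dual (\<lambda>y q. l n * v y + G y q)) (\<lambda>y. - v y) \<and>
    (\<forall>k. (\<forall>y q. G (y + k) q = G y q) \<longrightarrow> (\<forall>y. v (y + k) = v y))" for n v
  have "\<forall>n. \<exists>v. P n v"
    unfolding P_def using discounted_problem_solution[OF contG l \<open>0 < L\<close> C coercive] by blast
  then obtain v where "\<forall>n. P n (v n)" using choice by blast
  then have v: "\<And>n. L-lipschitz_on UNIV (v n)" "\<And>n y. \<bar>l n * v n y\<bar> \<le> C"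
    "\<And>n. fo_sub (\<lambda>y q. l n * v n y + G y q) (v n)"
    "\<And>n. fo_sub (fo_dual (\<lambda>y q. l n * v n y + G y q)) (\<lambda>y. - v n y)"
    "\<And>n k. (\<forall>y q. G (y + k) q = G y q) \<Longrightarrow> (\<forall>y. v n (y + k) = v n y)"
    unfolding P_def by blast+
  define F where "F = (\<lambda>n y. v n y - v n 0)"
  have perF: "Z_periodic (F n)" for n
    using v(5) per unfolding Z_periodic_def F_def by metis
  have lipF: "\<bar>F n x - F n y\<bar> \<le> L * norm (x - y)" for n x y
    using lipschitz_onD[OF v(1), of x y n] by (simp add: F_def dist_norm)
  have "bounded (cbox 0 (1 :: real^'n))" by simp
  then obtain B where B: "\<And>y :: real^'n. y \<in> cbox 0 1 \<Longrightarrow> norm y \<le> B"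
    unfolding bounded_iff by blast
  define M where "M = L * B"
  have FM: "\<bar>F n y\<bar> \<le> M" for n y
  proof -
    let ?y = "y - lattice_part y"
    have "\<bar>F n ?y - F n 0\<bar> \<le> L * norm ?y" using lipF[of n ?y 0] by simp
    also have "\<dots> \<le> M" unfolding M_def using B[OF diff_lattice_part] \<open>0 < L\<close> by (intro mult_left_mono) auto
    finally show ?thesis
      using Z_periodic_diff_lattice_part[OF perF, of n y] by (simp add: F_def)
  qed
  obtain g k where g: "continuous_on (cbox 0 1) g" "strict_mono (k :: nat \<Rightarrow> nat)"
    "\<And>e. 0 < e \<Longrightarrow> \<exists>N. \<forall>n x. n \<ge> N \<and> x \<in> cbox 0 1 \<longrightarrow> norm (F (k n) x - g x) < e"
  proof (rule Arzela_Ascoli[of "cbox 0 (1 :: real^'n)" F M])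
    show "\<exists>d>0. \<forall>n y. y \<in> cbox 0 1 \<and> norm (x - y) < d \<longrightarrow> norm (F n x - F n y) < e" if "0 < e" for x e
    proof (intro exI[of _ "e / L"] conjI allI impI)
      fix n y assume "y \<in> cbox 0 1 \<and> norm (x - y) < e / L"
      then have "L * norm (x - y) < e" using \<open>0 < L\<close> by (simp add: pos_less_divide_eq mult.commute)
      then show "norm (F n x - F n y) < e" using lipF[of n x y] by simp
    qed (use that \<open>0 < L\<close> in simp)
  qed (use FM in auto)
  \<comment> \<open>A second extraction makes the discounted values at the origin converge. Their
    limit is minus the ergodic constant, because \<open>l * v + G = 0\<close>.\<close>
  have "\<forall>n. l (k n) * v (k n) 0 \<in> {-C..C}" using v(2) by (auto simp: abs_le_iff minus_le_iff)
  from seq_compactE[OF compact_imp_seq_compact[OF compact_Icc] this]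
  obtain c' r where r: "strict_mono (r :: nat \<Rightarrow> nat)" "((\<lambda>n. l (k n) * v (k n) 0) \<circ> r) \<longlonglongrightarrow> c'"
    by blast
  define s where "s = k \<circ> r"
  have smono: "strict_mono s" unfolding s_def by (intro strict_mono_o g r)
  define \<psi> where "\<psi> = (\<lambda>y. g (y - lattice_part y))"
  have conv: "\<exists>N. \<forall>n\<ge>N. \<forall>y. \<bar>F (s n) y - \<psi> y\<bar> < e" if e: "0 < e" for e
  proof -
    obtain N where N: "\<And>n x. n \<ge> N \<Longrightarrow> x \<in> cbox 0 1 \<Longrightarrow> norm (F (k n) x - g x) < e"
      using g(3)[OF e] by blast
    have "\<bar>F (s n) y - \<psi> y\<bar> < e" if "n \<ge> N" for n y
      using N[OF order_trans[OF that seq_suble[OF r(1)]] diff_lattice_part, of y]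
        Z_periodic_diff_lattice_part[OF perF, of "s n" y]
      unfolding \<psi>_def s_def by simp
    then show ?thesis by blast
  qed
  have lim0: "(\<lambda>n. l (s n) * M) \<longlonglongrightarrow> 0"
  proof -
    have "l \<longlonglongrightarrow> 0" unfolding l_def by (rule LIMSEQ_inverse_real_of_nat)
    from LIMSEQ_subseq_LIMSEQ[OF this smono] have "(\<lambda>n. l (s n)) \<longlonglongrightarrow> 0" by (simp add: o_def)
    then show ?thesis by (rule tendsto_mult_left_zero)
  qed
  have approx: "\<exists>n. (\<forall>y. \<bar>F (s n) y - \<psi> y\<bar> \<le> \<eta>) \<and> (\<forall>y. \<bar>l (s n) * v (s n) y - c'\<bar> \<le> \<eta>)" if "0 < \<eta>" for \<eta>
  proof -
    have "\<forall>\<^sub>F n in sequentially. \<forall>y. \<bar>F (s n) y - \<psi> y\<bar> < \<eta>"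
      using conv[OF that] unfolding eventually_sequentially .
    moreover have "\<forall>\<^sub>F n in sequentially. l (s n) * M < \<eta> / 2"
      using lim0 that by (intro order_tendstoD) auto
    moreover have "\<forall>\<^sub>F n in sequentially. dist (l (s n) * v (s n) 0) c' < \<eta> / 2"
      using tendstoD[OF r(2), of "\<eta> / 2"] that by (simp add: s_def o_def)
    ultimately have "\<forall>\<^sub>F n in sequentially. (\<forall>y. \<bar>F (s n) y - \<psi> y\<bar> < \<eta>) \<and> l (s n) * M < \<eta> / 2 \<and>
        dist (l (s n) * v (s n) 0) c' < \<eta> / 2"
      by eventually_elim auto
    then obtain n where n: "\<forall>y. \<bar>F (s n) y - \<psi> y\<bar> < \<eta>" "l (s n) * M < \<eta> / 2"
        "dist (l (s n) * v (s n) 0) c' < \<eta> / 2"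
      by (auto simp: eventually_sequentially)
    have "\<bar>l (s n) * v (s n) y - c'\<bar> \<le> \<eta>" for y
    proof -
      have "l (s n) * v (s n) y - c' = (l (s n) * v (s n) 0 - c') + l (s n) * F (s n) y"
        by (simp add: F_def algebra_simps)
      moreover have "\<bar>l (s n) * F (s n) y\<bar> \<le> l (s n) * M"
        using FM l[of "s n"] by (simp add: abs_mult)
      ultimately show ?thesis using n(2,3) unfolding dist_real_def by linarith
    qed
    then show ?thesis using n(1) less_imp_le by blast
  qed
  \<comment> \<open>Closed inequalities for \<open>F (s n)\<close> pass to \<psi>; the factor 2
    accounts for two evaluations, each replaced at the cost of the uniform distance.\<close>
  have limit: "A \<le> B'" if "\<And>n e. 0 < e \<Longrightarrow> (\<forall>y. \<bar>F (s n) y - \<psi> y\<bar> \<le> e) \<Longrightarrow> A \<le> B' + 2 * e" for A B'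
  proof (rule field_le_epsilon)
    fix e :: real assume "0 < e"
    then obtain n where "\<forall>y. \<bar>F (s n) y - \<psi> y\<bar> \<le> e / 2" using approx[of "e / 2"] by auto
    from that[OF _ this] \<open>0 < e\<close> show "A \<le> B' + e" by simp
  qed
  have lip\<psi>: "L-lipschitz_on UNIV \<psi>"
  proof (rule lipschitz_onI)
    fix x y :: "real^'n"
    show "dist (\<psi> x) (\<psi> y) \<le> L * dist x y"
    proof (rule limit)
      fix n e assume "0 < (e::real)" and n: "\<forall>y. \<bar>F (s n) y - \<psi> y\<bar> \<le> e"
      show "dist (\<psi> x) (\<psi> y) \<le> L * dist x y + 2 * e"
        using lipF[of "s n" x y] n[rule_format, of x] n[rule_format, of y]
        unfolding dist_norm real_norm_def by linarith
    qed
  qed (use \<open>0 < L\<close> in simp)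
  have per\<psi>: "Z_periodic \<psi>"
    unfolding Z_periodic_def
  proof (intro allI impI)
    fix y k' :: "real^'n" assume k': "\<forall>i. k' $ i \<in> \<int>"
    have "\<bar>\<psi> (y + k') - \<psi> y\<bar> \<le> 0"
    proof (rule limit)
      fix n e assume "0 < (e::real)" and n: "\<forall>y. \<bar>F (s n) y - \<psi> y\<bar> \<le> e"
      have "F (s n) (y + k') = F (s n) y" using perF k' unfolding Z_periodic_def by blast
      then show "\<bar>\<psi> (y + k') - \<psi> y\<bar> \<le> 0 + 2 * e"
        using n[rule_format, of "y + k'"] n[rule_format, of y] by linarith
    qed
    then show "\<psi> (y + k') = \<psi> y" by simp
  qed
  have contF: "continuous_on UNIV (F n)" for n
    unfolding F_def by (intro continuous_intros lipschitz_on_continuous_on[OF v(1)])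
  have "fo_sub (\<lambda>y q. G y q - (- c')) \<psi>"
  proof (rule fo_sub_stable)
    have "continuous_on UNIV (\<lambda>z. (\<lambda>(y, q). G y q) z - (- c'))" by (intro continuous_intros contG)
    then show "continuous_on UNIV (\<lambda>(y, q). G y q - (- c'))" by (simp add: case_prod_beta)
    fix y0 :: "real^'n" and \<eta> Q :: real assume "0 < \<eta>"
    show "\<exists>\<rho>>0. \<forall>\<eta>'>0. \<exists>w G'. continuous_on UNIV w \<and> fo_sub G' w \<and>
       (\<forall>z\<in>cball y0 \<rho>. w z \<le> \<psi> z + \<eta>') \<and> \<psi> y0 - \<eta>' \<le> w y0 \<and>
       (\<forall>z\<in>cball y0 \<rho>. \<forall>q. norm q \<le> Q \<longrightarrow> G z q - (- c') \<le> G' z q + \<eta>)"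
    proof (intro exI[of _ 1] conjI allI impI)
      fix \<eta>' :: real assume "0 < \<eta>'"
      then obtain n where n: "\<And>y. \<bar>F (s n) y - \<psi> y\<bar> \<le> min \<eta> \<eta>'"
        "\<And>y. \<bar>l (s n) * v (s n) y - c'\<bar> \<le> min \<eta> \<eta>'"
        using approx[of "min \<eta> \<eta>'"] \<open>0 < \<eta>\<close> by auto
      have "fo_sub (\<lambda>y q. l (s n) * v (s n) y + G y q) (F (s n))"
        using fo_sub_add_const[OF v(3), of "s n" "- v (s n) 0"] by (simp add: F_def)
      moreover have "F (s n) z \<le> \<psi> z + \<eta>'" "\<psi> z - \<eta>' \<le> F (s n) z"
        "G z q - (- c') \<le> (l (s n) * v (s n) z + G z q) + \<eta>" for z q
        using n(1)[of z] n(2)[of z] by linarith+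
      ultimately show "\<exists>w G'. continuous_on UNIV w \<and> fo_sub G' w \<and>
         (\<forall>z\<in>cball y0 1. w z \<le> \<psi> z + \<eta>') \<and> \<psi> y0 - \<eta>' \<le> w y0 \<and>
         (\<forall>z\<in>cball y0 1. \<forall>q. norm q \<le> Q \<longrightarrow> G z q - (- c') \<le> G' z q + \<eta>)"
        using contF by blast
    qed simp
  qed
  moreover have "fo_sub (fo_dual (\<lambda>y q. G y q - (- c'))) (\<lambda>y. - \<psi> y)"
  proof (rule fo_sub_stable)
    have "continuous_on UNIV (\<lambda>z :: (real^'n) \<times> (real^'n). (fst z, - snd z))" by (intro continuous_intros)
    from continuous_on_compose2[OF contG this]
    have "continuous_on UNIV (\<lambda>z. - (G (fst z) (- snd z) - (- c')))"
      by (intro continuous_intros) simp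
    then show "continuous_on UNIV (\<lambda>(y, q). fo_dual (\<lambda>y q. G y q - (- c')) y q)"
      by (simp add: case_prod_beta fo_dual_def)
    fix y0 :: "real^'n" and \<eta> Q :: real assume "0 < \<eta>"
    show "\<exists>\<rho>>0. \<forall>\<eta>'>0. \<exists>w G'. continuous_on UNIV w \<and> fo_sub G' w \<and>
       (\<forall>z\<in>cball y0 \<rho>. w z \<le> - \<psi> z + \<eta>') \<and> - \<psi> y0 - \<eta>' \<le> w y0 \<and>
       (\<forall>z\<in>cball y0 \<rho>. \<forall>q. norm q \<le> Q \<longrightarrow> fo_dual (\<lambda>y q. G y q - (- c')) z q \<le> G' z q + \<eta>)"
    proof (intro exI[of _ 1] conjI allI impI)
      fix \<eta>' :: real assume "0 < \<eta>'"
      then obtain n where n: "\<And>y. \<bar>F (s n) y - \<psi> y\<bar> \<le> min \<eta> \<eta>'"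
        "\<And>y. \<bar>l (s n) * v (s n) y - c'\<bar> \<le> min \<eta> \<eta>'"
        using approx[of "min \<eta> \<eta>'"] \<open>0 < \<eta>\<close> by auto
      have "fo_sub (fo_dual (\<lambda>y q. l (s n) * v (s n) y + G y q)) (\<lambda>y. - F (s n) y)"
        using fo_sub_add_const[OF v(4), of "s n" "v (s n) 0"] by (simp add: F_def)
      moreover have "- F (s n) z \<le> - \<psi> z + \<eta>'" "- \<psi> z - \<eta>' \<le> - F (s n) z"
        "fo_dual (\<lambda>y q. G y q - (- c')) z q \<le> fo_dual (\<lambda>y q. l (s n) * v (s n) y + G y q) z q + \<eta>" for z q
        using n(1)[of z] n(2)[of z] unfolding fo_dual_def by linarith+
      moreover have "continuous_on UNIV (\<lambda>y. - F (s n) y)" by (intro continuous_intros contF)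
      ultimately show "\<exists>w G'. continuous_on UNIV w \<and> fo_sub G' w \<and>
         (\<forall>z\<in>cball y0 1. w z \<le> - \<psi> z + \<eta>') \<and> - \<psi> y0 - \<eta>' \<le> w y0 \<and>
         (\<forall>z\<in>cball y0 1. \<forall>q. norm q \<le> Q \<longrightarrow> fo_dual (\<lambda>y q. G y q - (- c')) z q \<le> G' z q + \<eta>)"
        by blast
    qed simp
  qed
  ultimately have "viscosity_solution_first_order (\<lambda>y q. G y q - (- c')) \<psi>"
    unfolding viscosity_solution_first_order_iff using lipschitz_on_continuous_on[OF lip\<psi>] by blast
  then show ?thesis using lip\<psi> per\<psi> by blast
qed

lemma C1_on_norm_square_scaled:
  "C1_on UNIV (\<lambda>z :: 'a::euclidean_space. c * (norm (z - y))\<^sup>2)"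
  by (rule C2_on_imp_C1_on[OF C2_on_cmult[OF C2_on_norm_square[OF bounded_linear_ident]]])

lemma has_derivative_norm_square_scaled:
  "((\<lambda>z :: 'a::euclidean_space. c * (norm (z - y))\<^sup>2) has_derivative (\<lambda>h. ((2 * c) *\<^sub>R (z - y)) \<bullet> h)) (at z)"
  using has_derivative_mult_right[OF has_derivative_norm_square[OF bounded_linear_ident, of y z UNIV], of c]
  by (simp add: mult.assoc mult.left_commute)

text \<open>Doubling of variables on the torus. The outcome is a pair of nearby points at which both
  problems are tested with the same gradient; uniqueness, monotonicity and continuity of the ergodic
  constant all follow from such pairs. Writing the second point as \<open>y + d\<close> lets
  periodicity confine \<open>y\<close> to the unit cube while \<open>d\<close> stays small.\<close>

lemma cell_comparison:
  fixes \<psi>1 \<psi>2 :: "real^'n \<Rightarrow> real"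
  assumes per: "Z_periodic \<psi>1" "Z_periodic \<psi>2"
    and lip: "L-lipschitz_on UNIV \<psi>1" "L-lipschitz_on UNIV \<psi>2"
    and sub: "fo_sub G1 \<psi>1" and super: "fo_sub (fo_dual G2) (\<lambda>y. - \<psi>2 y)" and "0 < \<kappa>"
  shows "\<exists>y z q. norm (y - z) < \<kappa> \<and> norm q \<le> 2 * (L + 1) \<and> G1 y q \<le> 0 \<and> 0 \<le> G2 z q"
proof -
  have L: "0 < L + 1" using lipschitz_on_nonneg[OF lip(1)] by simp
  \<comment> \<open>The result of these choices is \<open>R = \<kappa> / 2\<close> and
    \<open>b * R = L + 1\<close>: beyond distance \<open>R\<close> the quadratic penalty outweighs
    any Lipschitz gain, and the gradient is bounded by \<open>2 * (L + 1)\<close> independently of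
    \<kappa>.\<close>
  define \<eta> where "\<eta> = \<kappa> / (4 * (L + 1))"
  define R where "R = 2 * (L + 1) * \<eta>"
  have \<eta>: "0 < \<eta>" "R < \<kappa>" "0 < R"
  proof -
    have "2 * (L + 1) * (\<kappa> / (4 * (L + 1))) = \<kappa> / 2" using L by (simp add: field_simps)
    then show "0 < \<eta>" "R < \<kappa>" "0 < R" using L \<open>0 < \<kappa>\<close> by (auto simp: \<eta>_def R_def)
  qed
  define b where "b = 1 / (2 * \<eta>)"
  have b: "0 < b" "b * R = L + 1" using \<eta> unfolding b_def R_def by auto
  define f where "f = (\<lambda>(y, d). \<psi>1 y - \<psi>2 (y + d) - b * (norm d)\<^sup>2)"
  have cont: "continuous_on UNIV \<psi>1" "continuous_on UNIV \<psi>2"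
    using lip by (auto intro: lipschitz_on_continuous_on)
  have "continuous_on (cbox 0 1 \<times> cball 0 R) f"
    unfolding f_def case_prod_beta
    by (intro continuous_intros continuous_on_compose2[OF cont(1)] continuous_on_compose2[OF cont(2)]) auto
  moreover have "compact (cbox 0 (1::real^'n) \<times> cball (0::real^'n) R)"
    by (intro compact_Times compact_cbox compact_cball)
  moreover have "cbox 0 (1::real^'n) \<times> cball (0::real^'n) R \<noteq> {}"
  proof -
    have "(0 - lattice_part 0, 0) \<in> cbox 0 (1::real^'n) \<times> cball (0::real^'n) R"
      using \<eta>(3) by (intro SigmaI diff_lattice_part) simp
    then show ?thesis by blast
  qed
  ultimately have "\<exists>m\<in>cbox 0 1 \<times> cball 0 R. \<forall>x\<in>cbox 0 1 \<times> cball 0 R. f x \<le> f m"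
    by (intro continuous_attains_sup)
  then obtain m where m: "m \<in> cbox 0 1 \<times> cball 0 R" "\<And>x. x \<in> cbox 0 1 \<times> cball 0 R \<Longrightarrow> f x \<le> f m"
    by blast
  obtain y d where yd: "m = (y, d)" by (cases m)
  \<comment> \<open>Maximality over the compact set is global: a lattice vector moves
    \<open>y'\<close> into the cube, and for \<open>d'\<close> longer than \<open>R\<close> passing
    to \<open>d' = 0\<close> does not decrease \<open>f\<close>.\<close>
  have glob: "f (y', d') \<le> f (y, d)" for y' d'
  proof -
    let ?y = "y' - lattice_part y'"
    have red: "f (y', d') = f (?y, d')" for d'
    proof -
      have "\<psi>2 (y' + d') = \<psi>2 ((y' + d' - lattice_part y') + lattice_part y')" by simp
      also have "\<dots> = \<psi>2 (y' + d' - lattice_part y')"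
        using per(2) lattice_part_Ints unfolding Z_periodic_def by blast
      finally show ?thesis
        using Z_periodic_diff_lattice_part[OF per(1), of y'] unfolding f_def by (simp add: algebra_simps)
    qed
    show ?thesis
    proof (cases "norm d' \<le> R")
      case True
      then show ?thesis using m(2)[of "(?y, d')"] diff_lattice_part[of y'] red yd by simp
    next
      case False
      have "\<psi>2 ?y - \<psi>2 (?y + d') \<le> (L + 1) * norm d'"
        using lipschitz_onD[OF lip(2), of ?y "?y + d'"]
        by (simp add: dist_norm algebra_simps) (smt (verit) norm_ge_zero)
      also have "\<dots> \<le> b * (norm d')\<^sup>2"
      proof -
        have "(b * R) * norm d' \<le> (b * norm d') * norm d'"
          using False b(1) by (intro mult_right_mono mult_left_mono) auto
        then show ?thesis using b(2) by (simp add: power2_eq_square mult.assoc)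
      qed
      finally have "f (?y, d') \<le> f (?y, 0)" unfolding f_def by simp
      also have "\<dots> \<le> f m" using diff_lattice_part[of y'] \<eta>(3) by (intro m(2)) auto
      finally show ?thesis using red yd by simp
    qed
  qed
  let ?z = "y + d" and ?q = "(2 * b) *\<^sub>R (- d)"
  have "G1 y ((2 * b) *\<^sub>R (y - ?z)) \<le> 0"
  proof (rule fo_subD[OF sub C1_on_norm_square_scaled has_derivative_norm_square_scaled], rule always_eventually, rule allI)
    fix y'
    show "\<psi>1 y' - b * (norm (y' - ?z))\<^sup>2 \<le> \<psi>1 y - b * (norm (y - ?z))\<^sup>2"
      using glob[of y' "?z - y'"] unfolding f_def by (simp add: norm_minus_commute)
  qed
  then have 1: "G1 y ?q \<le> 0" by simp
  have "fo_dual G2 ?z ((2 * b) *\<^sub>R (?z - y)) \<le> 0"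
  proof (rule fo_subD[OF super C1_on_norm_square_scaled has_derivative_norm_square_scaled], rule always_eventually, rule allI)
    fix z'
    show "- \<psi>2 z' - b * (norm (z' - y))\<^sup>2 \<le> - \<psi>2 ?z - b * (norm (?z - y))\<^sup>2"
      using glob[of y "z' - y"] unfolding f_def by simp
  qed
  then have 2: "0 \<le> G2 ?z ?q" by (simp add: fo_dual_def)
  have "norm d \<le> R" using m(1) yd by simp
  then have "norm ?q \<le> 2 * (b * R)" "norm (y - ?z) < \<kappa>"
    using b(1) \<eta>(2) by (auto simp: mult_left_mono)
  then show ?thesis using 1 2 b(2) by metis
qed

lemma Z_periodic_attains_sup:
  fixes \<psi> :: "real^'n \<Rightarrow> real"
  assumes "Z_periodic \<psi>" "continuous_on UNIV \<psi>" shows "\<exists>y. \<forall>z. \<psi> z \<le> \<psi> y"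
proof -
  have "cbox 0 (1::real^'n) \<noteq> {}" using diff_lattice_part by blast
  then obtain y where "\<forall>z\<in>cbox 0 1. \<psi> z \<le> \<psi> y"
    using continuous_attains_sup[OF compact_cbox _ continuous_on_subset[OF assms(2) subset_UNIV]] by blast
  then have "\<psi> z \<le> \<psi> y" for z
    using Z_periodic_diff_lattice_part[OF assms(1), of z] diff_lattice_part[of z] by metis
  then show ?thesis by blast
qed

lemma fo_sub_at_max:
  assumes "fo_sub G \<psi>" "\<forall>z. \<psi> z \<le> \<psi> y" shows "G y 0 \<le> 0"
  by (rule fo_subD[OF assms(1) C1_on_const[of _ 0]]) (use assms(2) in auto)

section \<open>The effective Hamiltonian\<close>

text \<open>What the comparison principle asks of a Hamiltonian, formulated so that both the
  oscillating and the effective one qualify. In the coercivity clause \<open>l\<close> may grow like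
  \<open>C * (1 + L)\<close>, because a penalty of slope \<open>L\<close> produces nonlocal terms of
  that size; growth in the momentum has to beat them.\<close>

definition admissible :: "(real^'n \<Rightarrow> real^'n \<Rightarrow> real \<Rightarrow> real) \<Rightarrow> bool" where
  "admissible F \<longleftrightarrow>
     (\<forall>x p l l'. l \<le> l' \<longrightarrow> F x p l' \<le> F x p l) \<and>
     (\<forall>R. \<forall>\<eta>>0. \<exists>\<kappa>>0. \<forall>x y p p' l l'. norm p \<le> R \<longrightarrow> norm p' \<le> R \<longrightarrow> \<bar>l\<bar> \<le> R \<longrightarrow> \<bar>l'\<bar> \<le> R \<longrightarrow>
        norm (x - y) \<le> \<kappa> \<longrightarrow> norm (p - p') \<le> \<kappa> \<longrightarrow> \<bar>l - l'\<bar> \<le> \<kappa> \<longrightarrow> F y p' l' \<le> F x p l + \<eta>) \<and>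
     (\<forall>C>0. \<exists>L0. \<forall>L\<ge>L0. \<forall>x p l. L / 2 \<le> norm p \<longrightarrow> l \<le> C * (1 + L) \<longrightarrow> C < F x p l)"

locale homogenization_data =
  fixes a :: "real^'n \<Rightarrow> real^'n \<Rightarrow> real" and H :: "real^'n \<Rightarrow> real^'n \<Rightarrow> real^'n \<Rightarrow> real"
    and amin amax :: real
  assumes a_bounds: "0 < amin" "\<And>x y. amin \<le> a x y" "\<And>x y. a x y \<le> amax"
    and a_uc: "\<And>\<eta>. 0 < \<eta> \<Longrightarrow> \<exists>\<kappa>>0. \<forall>x x' y y'. norm (x - x') \<le> \<kappa> \<longrightarrow> norm (y - y') \<le> \<kappa> \<longrightarrow>
          \<bar>a x y - a x' y'\<bar> \<le> \<eta>"
    and H_uc: "\<And>R \<eta>. 0 < \<eta> \<Longrightarrow> \<exists>\<kappa>>0. \<forall>x x' y y' p p'. norm p \<le> R \<longrightarrow> norm p' \<le> R \<longrightarrow>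
          norm (x - x') \<le> \<kappa> \<longrightarrow> norm (y - y') \<le> \<kappa> \<longrightarrow> norm (p - p') \<le> \<kappa> \<longrightarrow> \<bar>H x y p - H x' y' p'\<bar> \<le> \<eta>"
    and H_bounded: "\<And>R. \<exists>C. \<forall>x y p. norm p \<le> R \<longrightarrow> \<bar>H x y p\<bar> \<le> C"
    and H_superlinear: "\<And>A. \<exists>r>0. \<forall>x y p. r \<le> norm p \<longrightarrow> A * norm p \<le> H x y p"
    and a_periodic: "\<And>x. Z_periodic (a x)" and H_periodic: "\<And>x p. Z_periodic (\<lambda>y. H x y p)"
begin

lemma a_pos: "0 < a x y" using a_bounds(1) a_bounds(2)[of x y] by linarith

lemma amax_pos: "0 < amax" using a_pos[of 0 0] a_bounds(3)[of 0 0] by linarith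

lemma a_mult_abs_le: "\<bar>a x y * l\<bar> \<le> amax * \<bar>l\<bar>"
  using a_pos[of x y] a_bounds(3)[of x y] by (simp add: abs_mult mult_right_mono)

lemma H_uc_obtain:
  assumes "0 < \<eta>"
  obtains \<kappa> where "0 < \<kappa>" "\<And>x x' y y' p p'. norm p \<le> R \<Longrightarrow> norm p' \<le> R \<Longrightarrow>
    norm (x - x') \<le> \<kappa> \<Longrightarrow> norm (y - y') \<le> \<kappa> \<Longrightarrow> norm (p - p') \<le> \<kappa> \<Longrightarrow> \<bar>H x y p - H x' y' p'\<bar> \<le> \<eta>"
  using H_uc[OF assms, of R] by blast

lemma a_uc_obtain:
  assumes "0 < \<eta>"
  obtains \<kappa> where "0 < \<kappa>" "\<And>x x' y y'. norm (x - x') \<le> \<kappa> \<Longrightarrow> norm (y - y') \<le> \<kappa> \<Longrightarrow> \<bar>a x y - a x' y'\<bar> \<le> \<eta>"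
  using a_uc[OF assms] by blast

lemma continuous_on_H: "continuous_on UNIV (\<lambda>(y, q). H x y (p + q))"
  unfolding continuous_on_iff
proof (intro ballI allI impI)
  fix w :: "(real^'n) \<times> (real^'n)" and e :: real assume "0 < e"
  obtain y q where w: "w = (y, q)" by (cases w)
  obtain \<kappa> where \<kappa>: "0 < \<kappa>" "\<And>x x' y y' p' p''. norm p' \<le> norm (p + q) + 1 \<Longrightarrow> norm p'' \<le> norm (p + q) + 1 \<Longrightarrow>
    norm (x - x') \<le> \<kappa> \<Longrightarrow> norm (y - y') \<le> \<kappa> \<Longrightarrow> norm (p' - p'') \<le> \<kappa> \<Longrightarrow> \<bar>H x y p' - H x' y' p''\<bar> \<le> e / 2"
    using H_uc_obtain[of "e / 2" "norm (p + q) + 1"] \<open>0 < e\<close> by auto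
  have "dist (H x y' (p + q')) (H x y (p + q)) < e" if "dist (y', q') (y, q) < min \<kappa> 1" for y' q'
  proof -
    have d: "norm (y' - y) \<le> \<kappa>" "norm (q' - q) \<le> \<kappa>" "norm (q' - q) \<le> 1"
      using that dist_fst_le[of "(y', q')" "(y, q)"] dist_snd_le[of "(y', q')" "(y, q)"]
      by (auto simp: dist_norm)
    have "norm (p + q') \<le> norm (p + q) + norm (q' - q)"
      using norm_triangle_ineq[of "p + q" "q' - q"] by (simp add: algebra_simps)
    then have "norm (p + q') \<le> norm (p + q) + 1" using d(3) by simp
    then have "\<bar>H x y' (p + q') - H x y (p + q)\<bar> \<le> e / 2" using d \<kappa>(1) by (intro \<kappa>(2)) auto
    then show ?thesis using \<open>0 < e\<close> unfolding dist_real_def by linarith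
  qed
  then show "\<exists>d>0. \<forall>w'\<in>UNIV. dist w' w < d \<longrightarrow>
      dist (case w' of (y, q) \<Rightarrow> H x y (p + q)) (case w of (y, q) \<Rightarrow> H x y (p + q)) < e"
    unfolding w using \<kappa>(1) by (intro exI[of _ "min \<kappa> 1"]) auto
qed

lemma continuous_on_a: "continuous_on UNIV (a x)"
  unfolding continuous_on_iff
proof (intro ballI allI impI)
  fix y :: "real^'n" and e :: real assume "0 < e"
  then obtain \<kappa> where \<kappa>: "0 < \<kappa>" "\<And>x x' y y'. norm (x - x') \<le> \<kappa> \<Longrightarrow> norm (y - y') \<le> \<kappa> \<Longrightarrow> \<bar>a x y - a x' y'\<bar> \<le> e / 2"
    using a_uc_obtain[of "e / 2"] by auto
  have "dist (a x y') (a x y) < e" if "dist y' y < \<kappa>" for y'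
    using \<kappa>(2)[of x x y' y] that \<kappa>(1) \<open>0 < e\<close> unfolding dist_norm real_norm_def by simp
  then show "\<exists>d>0. \<forall>x'\<in>UNIV. dist x' y < d \<longrightarrow> dist (a x x') (a x y) < e"
    using \<kappa>(1) by blast
qed

lemma cell_problem_solvable_ex: "\<exists>c. cell_problem_solvable a H x p l c"
proof -
  define G where "G = (\<lambda>y q. - a x y * l + H x y (p + q))"
  obtain C0 where C0: "\<And>x y p'. norm p' \<le> norm p \<Longrightarrow> \<bar>H x y p'\<bar> \<le> C0" using H_bounded by blast
  define C where "C = \<bar>C0\<bar> + amax * \<bar>l\<bar>"
  obtain r where r: "0 < r" "\<And>x y p. r \<le> norm p \<Longrightarrow> 1 * norm p \<le> H x y p" using H_superlinear by blast
  \<comment> \<open>The factor 2 is due to the coercivity threshold \<open>L / 2\<close>. The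
    summands put \<open>p + q\<close> into the superlinear range and make \<open>H\<close> exceed
    \<open>C\<close> plus the largest possible size of \<open>a x y * l\<close>.\<close>
  define L where "L = 2 * (norm p + r + C + amax * \<bar>l\<bar> + 1)"
  have nn: "0 \<le> C" "0 \<le> amax * \<bar>l\<bar>" using amax_pos by (simp_all add: C_def)
  have "continuous_on UNIV (\<lambda>w. - a x (fst w) * l + (\<lambda>(y, q). H x y (p + q)) w)"
    by (intro continuous_intros continuous_on_H continuous_on_compose2[OF continuous_on_a]) auto
  then have cont: "continuous_on UNIV (\<lambda>(y, q). G y q)" by (simp add: G_def case_prod_beta)
  have "\<bar>G y 0\<bar> \<le> C" for y
    using C0[of p x y] a_mult_abs_le[of x y l] unfolding G_def C_def by simp
  moreover have "C < G y q" if "L / 2 \<le> norm q" for y q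
  proof -
    have "norm q - norm p \<le> norm (p + q)" using norm_diff_ineq[of q p] by (simp add: add.commute)
    then have n: "r + C + amax * \<bar>l\<bar> + 1 \<le> norm (p + q)" using that unfolding L_def by simp
    then have "norm (p + q) \<le> H x y (p + q)" using r(2)[of "p + q" x y] nn by simp
    then show ?thesis using n r(1) a_mult_abs_le[of x y l] unfolding G_def by simp
  qed
  moreover have "Z_periodic G"
    using a_periodic[of x] H_periodic[of x] unfolding Z_periodic_def G_def by auto
  moreover have "0 < L" using r(1) nn unfolding L_def by (simp add: add_pos_nonneg add_nonneg_pos)
  ultimately obtain c \<psi> where "Z_periodic \<psi>" "L-lipschitz_on UNIV \<psi>"
      "viscosity_solution_first_order (\<lambda>y q. G y q - c) \<psi>"
    using cell_problem_existence[OF cont, of L C] by blast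
  then show ?thesis unfolding cell_problem_solvable_def G_def by blast
qed

text \<open>The bound \<open>Q\<close> precedes \<kappa>, so that uniform continuity of
  \<open>H\<close> can be used on a fixed ball of momenta while the two points approach each
  other.\<close>

lemma cell_problem_points:
  assumes "cell_problem_solvable a H x p l c" "cell_problem_solvable a H x' p' l' c'"
  shows "\<exists>Q. \<forall>\<kappa>>0. \<exists>y z q. norm (y - z) \<le> \<kappa> \<and> norm q \<le> Q \<and>
    H x y (p + q) - a x y * l \<le> c \<and> c' \<le> H x' z (p' + q) - a x' z * l'"
proof -
  obtain \<psi>1 L1 where 1: "Z_periodic \<psi>1" "L1-lipschitz_on UNIV \<psi>1"
    "viscosity_solution_first_order (\<lambda>y q. - a x y * l + H x y (p + q) - c) \<psi>1"
    using assms(1) unfolding cell_problem_solvable_def by blast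
  obtain \<psi>2 L2 where 2: "Z_periodic \<psi>2" "L2-lipschitz_on UNIV \<psi>2"
    "viscosity_solution_first_order (\<lambda>y q. - a x' y * l' + H x' y (p' + q) - c') \<psi>2"
    using assms(2) unfolding cell_problem_solvable_def by blast
  define L where "L = max L1 L2"
  have L: "L-lipschitz_on UNIV \<psi>1" "L-lipschitz_on UNIV \<psi>2"
    using lipschitz_on_le[OF 1(2)] lipschitz_on_le[OF 2(2)] by (auto simp: L_def)
  show ?thesis
  proof (intro exI[of _ "2 * (L + 1)"] allI impI)
    fix \<kappa> :: real assume "0 < \<kappa>"
    from cell_comparison[OF 1(1) 2(1) L _ _ this]
    obtain y z q where "norm (y - z) < \<kappa>" "norm q \<le> 2 * (L + 1)"
      "- a x y * l + H x y (p + q) - c \<le> 0" "0 \<le> - a x' z * l' + H x' z (p' + q) - c'"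
      using 1(3) 2(3) unfolding viscosity_solution_first_order_iff by blast
    then show "\<exists>y z q. norm (y - z) \<le> \<kappa> \<and> norm q \<le> 2 * (L + 1) \<and>
        H x y (p + q) - a x y * l \<le> c \<and> c' \<le> H x' z (p' + q) - a x' z * l'"
      by (intro exI[of _ y] exI[of _ z] exI[of _ q]) auto
  qed
qed

text \<open>With \<open>l = l'\<close>, applied in both directions, this is also the uniqueness of
  the ergodic constant.\<close>

lemma cell_problem_mono:
  assumes "cell_problem_solvable a H x p l c" "cell_problem_solvable a H x p l' c'" "l \<le> l'"
  shows "c' \<le> c"
proof (rule field_le_epsilon)
  fix \<eta> :: real assume "0 < \<eta>"
  obtain Q where Q: "\<And>\<kappa>. 0 < \<kappa> \<Longrightarrow> \<exists>y z q. norm (y - z) \<le> \<kappa> \<and> norm q \<le> Q \<and>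
    H x y (p + q) - a x y * l \<le> c \<and> c' \<le> H x z (p + q) - a x z * l'"
    using cell_problem_points[OF assms(1,2)] by blast
  obtain \<kappa>1 where \<kappa>1: "0 < \<kappa>1" "\<And>x x' y y' p' p''. norm p' \<le> norm p + Q \<Longrightarrow> norm p'' \<le> norm p + Q \<Longrightarrow>
    norm (x - x') \<le> \<kappa>1 \<Longrightarrow> norm (y - y') \<le> \<kappa>1 \<Longrightarrow> norm (p' - p'') \<le> \<kappa>1 \<Longrightarrow> \<bar>H x y p' - H x' y' p''\<bar> \<le> \<eta> / 2"
    using H_uc_obtain[of "\<eta> / 2"] \<open>0 < \<eta>\<close> by (metis half_gt_zero)
  define e where "e = \<eta> / (2 * (\<bar>l\<bar> + 1))"
  have e: "0 < e" "e * \<bar>l\<bar> \<le> \<eta> / 2" using \<open>0 < \<eta>\<close> unfolding e_def by (auto simp: field_simps)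
  obtain \<kappa>2 where \<kappa>2: "0 < \<kappa>2" "\<And>x x' y y'. norm (x - x') \<le> \<kappa>2 \<Longrightarrow> norm (y - y') \<le> \<kappa>2 \<Longrightarrow> \<bar>a x y - a x' y'\<bar> \<le> e"
    using a_uc_obtain[OF e(1)] by blast
  obtain y z q where q: "norm (y - z) \<le> min \<kappa>1 \<kappa>2" "norm q \<le> Q"
    "H x y (p + q) - a x y * l \<le> c" "c' \<le> H x z (p + q) - a x z * l'"
    using Q[of "min \<kappa>1 \<kappa>2"] \<kappa>1(1) \<kappa>2(1) by auto
  have "norm (p + q) \<le> norm p + Q" using norm_triangle_ineq[of p q] q(2) by simp
  then have 1: "\<bar>H x z (p + q) - H x y (p + q)\<bar> \<le> \<eta> / 2"
    using q(1) \<kappa>1(1) by (intro \<kappa>1(2)) (auto simp: norm_minus_commute)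
  have "\<bar>(a x y - a x z) * l\<bar> \<le> e * \<bar>l\<bar>"
    using \<kappa>2(2)[of x x y z] q(1) \<kappa>2(1) by (simp add: abs_mult mult_right_mono)
  then have "a x y * l - a x z * l \<le> \<eta> / 2" using e(2) by (simp add: left_diff_distrib)
  moreover have "a x z * l \<le> a x z * l'" using assms(3) a_pos[of x z] by simp
  ultimately show "c' \<le> c + \<eta>" using q(3,4) 1 by linarith
qed

lemma effective_hamiltonian_solvable:
  "cell_problem_solvable a H x p l (effective_hamiltonian a H x p l)"
proof -
  obtain c where c: "cell_problem_solvable a H x p l c" using cell_problem_solvable_ex by blast
  have "c' = c" if "cell_problem_solvable a H x p l c'" for c'
    using cell_problem_mono[OF c that] cell_problem_mono[OF that c] by simp
  with c show ?thesis unfolding effective_hamiltonian_def by (metis theI)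
qed

text \<open>At a maximum or minimum of the corrector a constant serves as test function, so the
  gradient vanishes. The effective Hamiltonian thus lies between values of
  \<open>H x y p - a x y * l\<close>, and bounds and coercivity carry over from there.\<close>

lemma effective_hamiltonian_points:
  "\<exists>y. H x y p - a x y * l \<le> effective_hamiltonian a H x p l" (is ?A)
  "\<exists>y. effective_hamiltonian a H x p l \<le> H x y p - a x y * l" (is ?B)
proof -
  let ?c = "effective_hamiltonian a H x p l"
  obtain \<psi> L where \<psi>: "Z_periodic \<psi>" "L-lipschitz_on UNIV \<psi>"
    "viscosity_solution_first_order (\<lambda>y q. - a x y * l + H x y (p + q) - ?c) \<psi>"
    using effective_hamiltonian_solvable[of x p l] unfolding cell_problem_solvable_def by blast
  have cont: "continuous_on UNIV \<psi>" by (rule lipschitz_on_continuous_on[OF \<psi>(2)])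
  have sub: "fo_sub (\<lambda>y q. - a x y * l + H x y (p + q) - ?c) \<psi>"
    and super: "fo_sub (fo_dual (\<lambda>y q. - a x y * l + H x y (p + q) - ?c)) (\<lambda>y. - \<psi> y)"
    using \<psi>(3) unfolding viscosity_solution_first_order_iff by auto
  obtain y where "\<forall>z. \<psi> z \<le> \<psi> y" using Z_periodic_attains_sup[OF \<psi>(1) cont] by blast
  from fo_sub_at_max[OF sub this] show ?A by (intro exI[of _ y]) simp
  have "Z_periodic (\<lambda>y. - \<psi> y)" "continuous_on UNIV (\<lambda>y. - \<psi> y)"
    using \<psi>(1) cont by (auto simp: Z_periodic_def intro!: continuous_intros)
  from Z_periodic_attains_sup[OF this] obtain z where "\<forall>x. - \<psi> x \<le> - \<psi> z" by blast
  from fo_sub_at_max[OF super this] show ?B by (intro exI[of _ z]) (simp add: fo_dual_def)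
qed

section \<open>Bounds on the cell Hamiltonian, uniform in the fast variable\<close>

lemma cell_hamiltonian_coercive:
  assumes "0 < C"
  shows "\<exists>L0. \<forall>L\<ge>L0. \<forall>x y p l. L / 2 \<le> norm p \<longrightarrow> l \<le> C * (1 + L) \<longrightarrow> C < H x y p - a x y * l"
proof -
  \<comment> \<open>The first summand absorbs \<open>a x y * l\<close>, which is at most
    \<open>2 * amax * C * L\<close> for \<open>L \<ge> 1\<close>; the remaining
    \<open>(C + 1) * L\<close> exceeds \<open>C\<close>. The outer factor 2 compensates for
    \<open>norm p\<close> being only at least \<open>L / 2\<close>.\<close>
  define A where "A = 2 * (2 * amax * C + C + 1)"
  obtain r where r: "0 < r" "\<And>x y p. r \<le> norm p \<Longrightarrow> A * norm p \<le> H x y p" using H_superlinear by blast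
  show ?thesis
  proof (intro exI[of _ "max 1 (2 * r)"] allI impI)
    fix L x y p l assume L: "max 1 (2 * r) \<le> L" and p: "L / 2 \<le> norm (p :: real^'n)" and l: "l \<le> C * (1 + L)"
    have "0 \<le> A" using amax_pos assms unfolding A_def by simp
    then have "A * (L / 2) \<le> A * norm p" using p by (intro mult_left_mono)
    also have "\<dots> \<le> H x y p" using L p by (intro r(2)) simp
    finally have 1: "A * (L / 2) \<le> H x y p" .
    have "a x y * l \<le> a x y * (C * (1 + L))" using l a_pos[of x y] by simp
    also have "\<dots> \<le> amax * (C * (1 + L))" using a_bounds(3)[of x y] assms L by (intro mult_right_mono) auto
    also have "\<dots> \<le> amax * (C * (2 * L))" using amax_pos assms L by (intro mult_left_mono) auto
    finally have 2: "a x y * l \<le> 2 * amax * C * L" by (simp add: mult_ac)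
    have "A * (L / 2) = 2 * amax * C * L + (C + 1) * L" by (simp add: A_def algebra_simps)
    moreover have "C + 1 \<le> (C + 1) * L" using assms L by simp
    ultimately show "C < H x y p - a x y * l" using 1 2 by linarith
  qed
qed

text \<open>The bounds are one-sided in \<open>l\<close>, because a barrier controls the nonlocal
  term at a maximum only from above, and its dual only from below.\<close>

lemma cell_hamiltonian_bounds:
  assumes "0 \<le> \<Lambda>"
  shows "\<exists>C>0. \<forall>x y p l. norm p \<le> A \<longrightarrow> (l \<le> \<Lambda> \<longrightarrow> - C < H x y p - a x y * l) \<and> (- \<Lambda> \<le> l \<longrightarrow> H x y p - a x y * l < C)"
proof -
  obtain C0 where C0: "\<And>x y p. norm p \<le> A \<Longrightarrow> \<bar>H x y p\<bar> \<le> C0" using H_bounded by blast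
  show ?thesis
  proof (intro exI[of _ "\<bar>C0\<bar> + amax * \<Lambda> + 1"] conjI allI impI)
    show "0 < \<bar>C0\<bar> + amax * \<Lambda> + 1" using amax_pos assms by (simp add: add_nonneg_pos)
    fix x y and p :: "real^'n" and l assume p: "norm p \<le> A"
    show "- (\<bar>C0\<bar> + amax * \<Lambda> + 1) < H x y p - a x y * l" if l: "l \<le> \<Lambda>"
    proof -
      have "a x y * l \<le> a x y * \<Lambda>" using l a_pos[of x y] by simp
      also have "\<dots> \<le> amax * \<Lambda>" using a_bounds(3)[of x y] assms by (intro mult_right_mono)
      finally show ?thesis using C0[OF p, of x y] by linarith
    qed
    assume "- \<Lambda> \<le> l"
    then have "a x y * (- l) \<le> a x y * \<Lambda>" using a_pos[of x y] by (intro mult_left_mono) auto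
    also have "\<dots> \<le> amax * \<Lambda>" using a_bounds(3)[of x y] assms by (intro mult_right_mono)
    finally show "H x y p - a x y * l < \<bar>C0\<bar> + amax * \<Lambda> + 1" using C0[OF p, of x y] by simp
  qed
qed

lemma cell_hamiltonian_uc:
  assumes "0 < \<eta>"
  shows "\<exists>\<kappa>>0. \<forall>x x' y y' p p' l l'. norm p \<le> R \<longrightarrow> norm p' \<le> R \<longrightarrow> \<bar>l\<bar> \<le> R \<longrightarrow> \<bar>l'\<bar> \<le> R \<longrightarrow>
    norm (x - x') \<le> \<kappa> \<longrightarrow> norm (y - y') \<le> \<kappa> \<longrightarrow> norm (p - p') \<le> \<kappa> \<longrightarrow> \<bar>l - l'\<bar> \<le> \<kappa> \<longrightarrow>
    H x' y' p' - a x' y' * l' \<le> H x y p - a x y * l + \<eta>"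
proof -
  obtain \<kappa>1 where \<kappa>1: "0 < \<kappa>1" "\<And>x x' y y' p' p''. norm p' \<le> R \<Longrightarrow> norm p'' \<le> R \<Longrightarrow>
    norm (x - x') \<le> \<kappa>1 \<Longrightarrow> norm (y - y') \<le> \<kappa>1 \<Longrightarrow> norm (p' - p'') \<le> \<kappa>1 \<Longrightarrow> \<bar>H x y p' - H x' y' p''\<bar> \<le> \<eta> / 3"
    using H_uc_obtain[of "\<eta> / 3" R] assms by auto
  define e where "e = \<eta> / (3 * (\<bar>R\<bar> + 1))"
  have e: "0 < e" "e * \<bar>R\<bar> \<le> \<eta> / 3" using assms unfolding e_def by (auto simp: field_simps)
  obtain \<kappa>2 where \<kappa>2: "0 < \<kappa>2" "\<And>x x' y y'. norm (x - x') \<le> \<kappa>2 \<Longrightarrow> norm (y - y') \<le> \<kappa>2 \<Longrightarrow> \<bar>a x y - a x' y'\<bar> \<le> e"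
    using a_uc_obtain[OF e(1)] by blast
  define \<kappa> where "\<kappa> = min (min \<kappa>1 \<kappa>2) (\<eta> / (3 * amax))"
  have \<kappa>: "0 < \<kappa>" "\<kappa> \<le> \<kappa>1" "\<kappa> \<le> \<kappa>2" "amax * \<kappa> \<le> \<eta> / 3"
  proof -
    show "0 < \<kappa>" "\<kappa> \<le> \<kappa>1" "\<kappa> \<le> \<kappa>2" using \<kappa>1(1) \<kappa>2(1) assms amax_pos by (auto simp: \<kappa>_def)
    have "amax * \<kappa> \<le> amax * (\<eta> / (3 * amax))" using amax_pos by (intro mult_left_mono) (auto simp: \<kappa>_def)
    then show "amax * \<kappa> \<le> \<eta> / 3" using amax_pos by simp
  qed
  show ?thesis
  proof (intro exI[of _ \<kappa>] conjI allI impI)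
    fix x x' y y' :: "real^'n" and p p' :: "real^'n" and l l' :: real
    assume b: "norm p \<le> R" "norm p' \<le> R" "\<bar>l\<bar> \<le> R" "\<bar>l'\<bar> \<le> R"
      "norm (x - x') \<le> \<kappa>" "norm (y - y') \<le> \<kappa>" "norm (p - p') \<le> \<kappa>" "\<bar>l - l'\<bar> \<le> \<kappa>"
    have "\<bar>H x y p - H x' y' p'\<bar> \<le> \<eta> / 3" using b \<kappa> by (intro \<kappa>1(2)) auto
    moreover have "\<bar>(a x y - a x' y') * l\<bar> \<le> e * \<bar>R\<bar>"
      unfolding abs_mult using b \<kappa> \<kappa>2(2)[of x x' y y'] e(1) by (intro mult_mono) auto
    moreover have "\<bar>a x' y' * (l - l')\<bar> \<le> amax * \<kappa>"
      using a_mult_abs_le[of x' y' "l - l'"] b(8) amax_pos by (meson mult_left_mono order_trans less_imp_le)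
    moreover have "a x y * l - a x' y' * l' = (a x y - a x' y') * l + a x' y' * (l - l')"
      by (simp add: algebra_simps)
    ultimately show "H x' y' p' - a x' y' * l' \<le> H x y p - a x y * l + \<eta>"
      using e(2) \<kappa>(4) by linarith
  qed (rule \<kappa>(1))
qed

lemma admissible_effective_hamiltonian: "admissible (effective_hamiltonian a H)"
  unfolding admissible_def
proof (intro conjI allI impI)
  let ?F = "effective_hamiltonian a H"
  show "?F x p l' \<le> ?F x p l" if "l \<le> l'" for x p l l'
    using cell_problem_mono[OF effective_hamiltonian_solvable effective_hamiltonian_solvable that] .
  show "\<exists>L0. \<forall>L\<ge>L0. \<forall>x p l. L / 2 \<le> norm p \<longrightarrow> l \<le> C * (1 + L) \<longrightarrow> C < ?F x p l" if C: "0 < C" for C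
  proof -
    obtain L0 where L0: "\<And>L x y p l. L0 \<le> L \<Longrightarrow> L / 2 \<le> norm p \<Longrightarrow> l \<le> C * (1 + L) \<Longrightarrow> C < H x y p - a x y * l"
      using cell_hamiltonian_coercive[OF C] by blast
    have "C < ?F x p l" if "L0 \<le> L" "L / 2 \<le> norm p" "l \<le> C * (1 + L)" for L x p l
      using effective_hamiltonian_points(1)[of x p l] L0[OF that, of x] by (meson less_le_trans)
    then show ?thesis by blast
  qed
  show "\<exists>\<kappa>>0. \<forall>x y p p' l l'. norm p \<le> R \<longrightarrow> norm p' \<le> R \<longrightarrow> \<bar>l\<bar> \<le> R \<longrightarrow> \<bar>l'\<bar> \<le> R \<longrightarrow>
        norm (x - y) \<le> \<kappa> \<longrightarrow> norm (p - p') \<le> \<kappa> \<longrightarrow> \<bar>l - l'\<bar> \<le> \<kappa> \<longrightarrow> ?F y p' l' \<le> ?F x p l + \<eta>" if \<eta>: "0 < \<eta>" for R \<eta>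
  proof -
    obtain C where C: "0 < C" "\<And>x y p l. norm p \<le> R \<Longrightarrow> \<bar>l\<bar> \<le> \<bar>R\<bar> \<Longrightarrow> H x y p - a x y * l < C"
      using cell_hamiltonian_bounds[of "\<bar>R\<bar>" R] by (auto simp: abs_le_iff)
    obtain r where r: "0 < r" "\<And>x y p. r \<le> norm p \<Longrightarrow> 1 * norm p \<le> H x y p" using H_superlinear by blast
    define R' where "R' = max r (C + amax * \<bar>R\<bar>) + 1 + \<bar>R\<bar>"
    obtain \<kappa> where \<kappa>: "0 < \<kappa>" "\<And>x x' y y' p p' l l'. norm p \<le> R' \<Longrightarrow> norm p' \<le> R' \<Longrightarrow> \<bar>l\<bar> \<le> R' \<Longrightarrow> \<bar>l'\<bar> \<le> R' \<Longrightarrow>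
      norm (x - x') \<le> \<kappa> \<Longrightarrow> norm (y - y') \<le> \<kappa> \<Longrightarrow> norm (p - p') \<le> \<kappa> \<Longrightarrow> \<bar>l - l'\<bar> \<le> \<kappa> \<Longrightarrow>
      H x' y' p' - a x' y' * l' \<le> H x y p - a x y * l + \<eta>"
      using cell_hamiltonian_uc[OF \<eta>, of R'] by blast
    have "?F y p' l' \<le> ?F x p l + \<eta>"
      if b: "norm p \<le> R" "norm p' \<le> R" "\<bar>l\<bar> \<le> R" "\<bar>l'\<bar> \<le> R" "norm (x - y) \<le> min \<kappa> 1"
        "norm (p - p') \<le> min \<kappa> 1" "\<bar>l - l'\<bar> \<le> min \<kappa> 1" for x y p p' l l'
    proof -
      obtain Q where Q: "\<And>\<kappa>. 0 < \<kappa> \<Longrightarrow> \<exists>\<zeta> z q. norm (\<zeta> - z) \<le> \<kappa> \<and> norm q \<le> Q \<and>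
        H x \<zeta> (p + q) - a x \<zeta> * l \<le> ?F x p l \<and> ?F y p' l' \<le> H y z (p' + q) - a y z * l'"
        using cell_problem_points[OF effective_hamiltonian_solvable effective_hamiltonian_solvable] by blast
      obtain \<zeta> z q where q: "norm (\<zeta> - z) \<le> \<kappa>"
        "H x \<zeta> (p + q) - a x \<zeta> * l \<le> ?F x p l" "?F y p' l' \<le> H y z (p' + q) - a y z * l'"
        using Q[OF \<kappa>(1)] by blast
      have "?F x p l < C" using effective_hamiltonian_points(2)[of x p l] C(2)[OF b(1)] b(3)
        by (meson abs_ge_self le_less_trans order_trans)
      moreover have "a x \<zeta> * l \<le> amax * \<bar>R\<bar>"
        using a_mult_abs_le[of x \<zeta> l] mult_left_mono[of "\<bar>l\<bar>" "\<bar>R\<bar>" amax] b(3) amax_pos by linarith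
      ultimately have Hb: "H x \<zeta> (p + q) < C + amax * \<bar>R\<bar>" using q(2) by linarith
      \<comment> \<open>The bound \<open>Q\<close> stems from the Lipschitz constants of the
        correctors and is not uniform in \<open>x\<close>, \<open>p\<close>, \<open>l\<close>. The
        momentum is bounded instead through the subsolution inequality: it bounds
        \<open>H x \<zeta> (p + q)\<close> from above, and superlinearity turns this into a bound
        that depends only on \<open>R\<close> and the data.\<close>
      have pq: "norm (p + q) \<le> max r (C + amax * \<bar>R\<bar>)"
        using r(2)[of "p + q" x \<zeta>] Hb by (cases "r \<le> norm (p + q)") auto
      have "norm (p' + q) \<le> norm (p + q) + norm (p - p')"
        using norm_triangle_ineq4[of "p + q" "p - p'"] by (simp add: algebra_simps)
      then have "norm (p' + q) \<le> R'" "norm (p + q) \<le> R'" using pq b(6) unfolding R'_def by auto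
      moreover have "\<bar>l\<bar> \<le> R'" "\<bar>l'\<bar> \<le> R'" using b(3,4) r(1) unfolding R'_def by auto
      ultimately have "H y z (p' + q) - a y z * l' \<le> H x \<zeta> (p + q) - a x \<zeta> * l + \<eta>"
        using b q(1) by (intro \<kappa>(2)) auto
      then show ?thesis using q by linarith
    qed
    then show ?thesis using \<kappa>(1) by (intro exI[of _ "min \<kappa> 1"]) auto
  qed
qed

lemma admissible_oscillating:
  assumes "0 < \<epsilon>"
  shows "admissible (\<lambda>x p l. - a x (inverse \<epsilon> *\<^sub>R x) * l + H x (inverse \<epsilon> *\<^sub>R x) p)"
  unfolding admissible_def
proof (intro conjI allI impI)
  let ?F = "\<lambda>x p l. - a x (inverse \<epsilon> *\<^sub>R x) * l + H x (inverse \<epsilon> *\<^sub>R x) p"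
  show "?F x p l' \<le> ?F x p l" if "l \<le> l'" for x p l l'
    using that a_pos[of x] by (simp add: mult_left_mono less_imp_le)
  show "\<exists>L0. \<forall>L\<ge>L0. \<forall>x p l. L / 2 \<le> norm p \<longrightarrow> l \<le> C * (1 + L) \<longrightarrow> C < ?F x p l" if C: "0 < C" for C
  proof -
    obtain L0 where L0: "\<And>L x y p l. L0 \<le> L \<Longrightarrow> L / 2 \<le> norm p \<Longrightarrow> l \<le> C * (1 + L) \<Longrightarrow> C < H x y p - a x y * l"
      using cell_hamiltonian_coercive[OF C] by blast
    have "C < ?F x p l" if "L0 \<le> L" "L / 2 \<le> norm p" "l \<le> C * (1 + L)" for L x p l
      using L0[OF that, of x "inverse \<epsilon> *\<^sub>R x"] by simp
    then show ?thesis by blast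
  qed
  show "\<exists>\<kappa>>0. \<forall>x y p p' l l'. norm p \<le> R \<longrightarrow> norm p' \<le> R \<longrightarrow> \<bar>l\<bar> \<le> R \<longrightarrow> \<bar>l'\<bar> \<le> R \<longrightarrow>
        norm (x - y) \<le> \<kappa> \<longrightarrow> norm (p - p') \<le> \<kappa> \<longrightarrow> \<bar>l - l'\<bar> \<le> \<kappa> \<longrightarrow> ?F y p' l' \<le> ?F x p l + \<eta>" if \<eta>: "0 < \<eta>" for R \<eta>
  proof -
    obtain \<kappa> where \<kappa>: "0 < \<kappa>" "\<And>x x' y y' p p' l l'. norm p \<le> R \<Longrightarrow> norm p' \<le> R \<Longrightarrow> \<bar>l\<bar> \<le> R \<Longrightarrow> \<bar>l'\<bar> \<le> R \<Longrightarrow>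
      norm (x - x') \<le> \<kappa> \<Longrightarrow> norm (y - y') \<le> \<kappa> \<Longrightarrow> norm (p - p') \<le> \<kappa> \<Longrightarrow> \<bar>l - l'\<bar> \<le> \<kappa> \<Longrightarrow>
      H x' y' p' - a x' y' * l' \<le> H x y p - a x y * l + \<eta>"
      using cell_hamiltonian_uc[OF \<eta>, of R] by blast
    \<comment> \<open>The modulus shrinks with \<epsilon>, because the fast variable moves by
      \<open>1 / \<epsilon>\<close> times as much as \<open>x\<close>. It enters only at fixed
      \<epsilon>.\<close>
    show ?thesis
    proof (intro exI[of _ "min \<kappa> (\<epsilon> * \<kappa>)"] conjI allI impI)
      fix x y p p' :: "real^'n" and l l' :: real
      assume b: "norm p \<le> R" "norm p' \<le> R" "\<bar>l\<bar> \<le> R" "\<bar>l'\<bar> \<le> R" "norm (x - y) \<le> min \<kappa> (\<epsilon> * \<kappa>)"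
        "norm (p - p') \<le> min \<kappa> (\<epsilon> * \<kappa>)" "\<bar>l - l'\<bar> \<le> min \<kappa> (\<epsilon> * \<kappa>)"
      have "norm (inverse \<epsilon> *\<^sub>R x - inverse \<epsilon> *\<^sub>R y) = inverse \<epsilon> * norm (x - y)"
        using assms by (simp add: scaleR_right_diff_distrib[symmetric])
      also have "\<dots> \<le> inverse \<epsilon> * (\<epsilon> * \<kappa>)" using b(5) assms by (intro mult_left_mono) auto
      also have "\<dots> = \<kappa>" using assms by simp
      finally have "norm (inverse \<epsilon> *\<^sub>R x - inverse \<epsilon> *\<^sub>R y) \<le> \<kappa>" .
      then show "?F y p' l' \<le> ?F x p l + \<eta>"
        using b \<kappa>(2)[of p p' l l' x y "inverse \<epsilon> *\<^sub>R x" "inverse \<epsilon> *\<^sub>R y"] by simp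
    qed (use \<kappa>(1) assms in simp)
  qed
qed

end

section \<open>Testing nonlocal subsolutions\<close>

lemma C1_on_linear_compose:
  assumes "C1_on UNIV f" "bounded_linear A" shows "C1_on S (\<lambda>w. f (A w))"
proof -
  obtain f' where f': "\<And>x. (f has_derivative blinfun_apply (f' x)) (at x)" "continuous_on UNIV f'"
    using assms(1) unfolding C1_on_def by auto
  show ?thesis
  proof (rule C1_onI)
    show "((\<lambda>w. f (A w)) has_derivative blinfun_apply (f' (A w) o\<^sub>L Blinfun A)) (at w within S)" for w
      using has_derivative_compose[OF bounded_linear_imp_has_derivative[OF assms(2)] f'(1)]
      by (simp add: bounded_linear_Blinfun_apply[OF assms(2)] blinfun_compose.rep_eq o_def)
    show "continuous_on S (\<lambda>w. f' (A w) o\<^sub>L Blinfun A)"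
      by (intro continuous_intros continuous_on_compose2[OF f'(2)] linear_continuous_on assms(2)) auto
  qed
qed

lemma C1_on_bounded_linear_image:
  assumes "bounded_linear A" "C1_on S g" shows "C1_on S (\<lambda>w. A (g w))"
proof -
  obtain g' where g': "\<And>x. x \<in> S \<Longrightarrow> (g has_derivative blinfun_apply (g' x)) (at x within S)" "continuous_on S g'"
    using assms(2) unfolding C1_on_def by auto
  show ?thesis
  proof (rule C1_onI)
    show "((\<lambda>w. A (g w)) has_derivative blinfun_apply (Blinfun A o\<^sub>L g' w)) (at w within S)" if "w \<in> S" for w
      using bounded_linear.has_derivative[OF assms(1) g'(1)[OF that]]
      by (simp add: bounded_linear_Blinfun_apply[OF assms(1)] blinfun_compose.rep_eq o_def)
    show "continuous_on S (\<lambda>w. Blinfun A o\<^sub>L g' w)" by (intro continuous_intros g')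
  qed
qed

lemma C2_on_linear_compose:
  assumes "C2_on UNIV f" "bounded_linear A" shows "C2_on S (\<lambda>w. f (A w))"
proof -
  obtain f' where f': "\<And>x. (f has_derivative blinfun_apply (f' x)) (at x)" "C1_on UNIV f'"
    using assms(1) unfolding C2_on_def by auto
  show ?thesis
  proof (rule C2_onI)
    show "((\<lambda>w. f (A w)) has_derivative blinfun_apply (f' (A w) o\<^sub>L Blinfun A)) (at w within S)" for w
      using has_derivative_compose[OF bounded_linear_imp_has_derivative[OF assms(2)] f'(1)]
      by (simp add: bounded_linear_Blinfun_apply[OF assms(2)] blinfun_compose.rep_eq o_def)
    show "C1_on S (\<lambda>w. f' (A w) o\<^sub>L Blinfun A)"
      by (rule C1_on_bounded_linear_image[OF bounded_bilinear.bounded_linear_left[OF bounded_bilinear_blinfun_compose]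
            C1_on_linear_compose[OF f'(2) assms(2)]])
  qed
qed

section \<open>Duality between sub- and supersolutions\<close>

definition ham_dual :: "(real^'n \<Rightarrow> real^'n \<Rightarrow> real \<Rightarrow> real) \<Rightarrow> real^'n \<Rightarrow> real^'n \<Rightarrow> real \<Rightarrow> real" where
  "ham_dual F = (\<lambda>x p l. - F x (- p) (- l))"

lemma ham_dual_ham_dual [simp]: "ham_dual (ham_dual F) = F"
  by (simp add: ham_dual_def)

lemma nonlocal_on_uminus: "nonlocal_on S K (\<lambda>w. - v w) x t = - nonlocal_on S K v x t"
proof -
  have "(- v (x + z, t) - - v (x, t)) * K z = - ((v (x + z, t) - v (x, t)) * K z)" for z
    by (simp add: algebra_simps)
  then show ?thesis unfolding nonlocal_on_def set_lebesgue_integral_def by simp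
qed

lemma C2_on_uminus:
  fixes f :: "'a::real_normed_vector \<Rightarrow> real"
  shows "C2_on S f \<Longrightarrow> C2_on S (\<lambda>x. - f x)"
  using C2_on_cmult[of S f "-1"] by simp

lemma supersolution_imp_subsolution_dual:
  assumes v: "viscosity_supersolution T K F v"
  shows "viscosity_subsolution T K (ham_dual F) (\<lambda>w. - v w)"
  unfolding viscosity_subsolution_def
proof (intro conjI allI impI)
  show "bounded ((\<lambda>w. - v w) ` QT T)"
    using v unfolding viscosity_supersolution_def bounded_iff by simp
  show "upper_semicontinuous_on (QT T) (\<lambda>w. - v w)"
    unfolding upper_semicontinuous_on_def
  proof (intro ballI allI impI)
    fix w c assume "w \<in> QT T" "- v w < c"
    then have "\<forall>\<^sub>F y in at w within QT T. - c < v y"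
      using v unfolding viscosity_supersolution_def lower_semicontinuous_on_def
      by (metis minus_less_iff)
    then show "\<forall>\<^sub>F y in at w within QT T. - v y < c" by eventually_elim simp
  qed
  fix x t \<phi> \<delta> p q
  assume a: "(x, t) \<in> QT T" "C2_on (QT T) \<phi>" "0 < \<delta>" "\<delta> < 1"
    "(\<phi> has_derivative (\<lambda>(h, s). p \<bullet> h + q * s)) (at (x, t) within QT T)"
    "\<forall>w\<in>ball x \<delta> \<times> {t - \<delta><..<t + \<delta>} \<inter> QT T. - v w - \<phi> w \<le> - v (x, t) - \<phi> (x, t)"
  have d: "((\<lambda>w. - \<phi> w) has_derivative (\<lambda>(h, s). (- p) \<bullet> h + (- q) * s)) (at (x, t) within QT T)"
    by (rule has_derivative_eq_rhs[OF has_derivative_minus[OF a(5)]]) (auto simp: fun_eq_iff)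
  have m: "\<forall>w\<in>ball x \<delta> \<times> {t - \<delta><..<t + \<delta>} \<inter> QT T. v w - (- \<phi> w) \<ge> v (x, t) - (- \<phi> (x, t))"
    using a(6) by force
  have "- q + F x (- p) (nonlocal_on (ball 0 \<delta>) K (\<lambda>w. - \<phi> w) x t + nonlocal_on (- ball 0 \<delta>) K v x t) \<ge> 0"
    using v a(1) C2_on_uminus[OF a(2)] a(3,4) d m unfolding viscosity_supersolution_def by blast
  then show "q + ham_dual F x p (nonlocal_on (ball 0 \<delta>) K \<phi> x t + nonlocal_on (- ball 0 \<delta>) K (\<lambda>w. - v w) x t) \<le> 0"
    by (simp add: ham_dual_def nonlocal_on_uminus add.commute)
qed

lemma subsolution_dual_imp_supersolution:
  assumes v: "viscosity_subsolution T K (ham_dual F) (\<lambda>w. - v w)"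
  shows "viscosity_supersolution T K F v"
  unfolding viscosity_supersolution_def
proof (intro conjI allI impI)
  show "bounded (v ` QT T)"
    using v unfolding viscosity_subsolution_def bounded_iff by simp
  show "lower_semicontinuous_on (QT T) v"
    unfolding lower_semicontinuous_on_def
  proof (intro ballI allI impI)
    fix w c assume "w \<in> QT T" "c < v w"
    then have "\<forall>\<^sub>F y in at w within QT T. - v y < - c"
      using v unfolding viscosity_subsolution_def upper_semicontinuous_on_def
      by (metis neg_less_iff_less)
    then show "\<forall>\<^sub>F y in at w within QT T. c < v y" by eventually_elim simp
  qed
  fix x t \<phi> \<delta> p q
  assume a: "(x, t) \<in> QT T" "C2_on (QT T) \<phi>" "0 < \<delta>" "\<delta> < 1"
    "(\<phi> has_derivative (\<lambda>(h, s). p \<bullet> h + q * s)) (at (x, t) within QT T)"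
    "\<forall>w\<in>ball x \<delta> \<times> {t - \<delta><..<t + \<delta>} \<inter> QT T. v w - \<phi> w \<ge> v (x, t) - \<phi> (x, t)"
  have d: "((\<lambda>w. - \<phi> w) has_derivative (\<lambda>(h, s). (- p) \<bullet> h + (- q) * s)) (at (x, t) within QT T)"
    by (rule has_derivative_eq_rhs[OF has_derivative_minus[OF a(5)]]) (auto simp: fun_eq_iff)
  have m: "\<forall>w\<in>ball x \<delta> \<times> {t - \<delta><..<t + \<delta>} \<inter> QT T. - v w - (- \<phi> w) \<le> - v (x, t) - (- \<phi> (x, t))"
    using a(6) by force
  have "- q + ham_dual F x (- p) (nonlocal_on (ball 0 \<delta>) K (\<lambda>w. - \<phi> w) x t + nonlocal_on (- ball 0 \<delta>) K (\<lambda>w. - v w) x t) \<le> 0"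
    using v a(1) C2_on_uminus[OF a(2)] a(3,4) d m unfolding viscosity_subsolution_def by blast
  then show "q + F x p (nonlocal_on (ball 0 \<delta>) K \<phi> x t + nonlocal_on (- ball 0 \<delta>) K v x t) \<ge> 0"
    by (simp add: ham_dual_def nonlocal_on_uminus add.commute)
qed

context levy_kernel
begin

lemma set_integral_le_dominated:
  assumes S: "S \<in> sets lebesgue" and D: "integrable lebesgue (\<lambda>z. D z * K z)" "\<And>z. 0 \<le> D z"
    and le: "\<And>z. z \<in> S \<Longrightarrow> f z \<le> D z"
  shows "(LINT z:S|lebesgue. f z * K z) \<le> (LINT z:S|lebesgue. D z * K z)"
proof (cases "set_integrable lebesgue S (\<lambda>z. f z * K z)")
  case True
  moreover have "set_integrable lebesgue S (\<lambda>z. D z * K z)"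
    unfolding set_integrable_def using S D(1) by (intro integrable_mult_indicator)
  ultimately show ?thesis
    by (rule set_integral_mono) (use le K_nonneg in \<open>auto intro!: mult_right_mono\<close>)
next
  case False
  then have "(LINT z:S|lebesgue. f z * K z) = 0"
    unfolding set_integrable_def set_lebesgue_integral_def by (rule not_integrable_integral_eq)
  also have "\<dots> \<le> (LINT z:S|lebesgue. D z * K z)"
    unfolding set_lebesgue_integral_def using D(2) K_nonneg
    by (intro integral_nonneg_AE) (auto simp: indicator_def)
  finally show ?thesis .
qed

text \<open>Inside the ball the test function contributes, outside it the solution. As both
  increments lie below one nonnegative \<open>D\<close>, a single integral over the space bounds the
  sum; a divergent integral has the value 0 and respects the bound.\<close>

lemma nonlocal_sum_le_dominated:
  assumes S: "S \<in> sets lebesgue" and D: "integrable lebesgue (\<lambda>z. D z * K z)" "\<And>z. 0 \<le> D z"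
    and "\<And>z. z \<in> S \<Longrightarrow> f z \<le> D z" "\<And>z. z \<notin> S \<Longrightarrow> g z \<le> D z"
  shows "(LINT z:S|lebesgue. f z * K z) + (LINT z:-S|lebesgue. g z * K z) \<le> (LINT z|lebesgue. D z * K z)"
proof -
  have S': "- S \<in> sets lebesgue" using S Compl_in_sets_lebesgue by blast
  have int: "set_integrable lebesgue A (\<lambda>z. D z * K z)" if "A \<in> sets lebesgue" for A
    unfolding set_integrable_def using that D(1) by (intro integrable_mult_indicator)
  have "(LINT z:S|lebesgue. D z * K z) + (LINT z:-S|lebesgue. D z * K z)
    = (LINT z:(S \<union> - S)|lebesgue. D z * K z)"
    by (intro set_integral_Un[symmetric] int S S') auto
  also have "\<dots> = (LINT z|lebesgue. D z * K z)" by (simp add: set_lebesgue_integral_def)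
  finally show ?thesis
    using set_integral_le_dominated[OF S D, of f] set_integral_le_dominated[OF S' D, of g] assms(4,5)
    by fastforce
qed

text \<open>The test functions of the barrier, the comparison principle and the spatial estimate all
  split into a function of \<open>x\<close> and a quadratic plus linear function of
  \<open>t\<close>. The maxima there are global, so every radius \<delta> below 1 is
  allowed.\<close>

lemma subsolution_test:
  assumes sub: "viscosity_subsolution T K F u" and t: "0 < t" "t \<le> T" and \<delta>: "0 < \<delta>" "\<delta> < 1"
    and f: "C2_on UNIV f" "(f has_derivative (\<lambda>h. p \<bullet> h)) (at x)"
    and max: "\<And>x' t'. 0 < t' \<Longrightarrow> t' \<le> T \<Longrightarrow>
      u (x', t') - (f x' + (b * (t' - s0)\<^sup>2 + \<theta> * t')) \<le> u (x, t) - (f x + (b * (t - s0)\<^sup>2 + \<theta> * t))"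
  shows "(2 * b * (t - s0) + \<theta>) + F x p ((LINT z:ball 0 \<delta>|lebesgue. (f (x + z) - f x) * K z)
     + (LINT z:- ball 0 \<delta>|lebesgue. (u (x + z, t) - u (x, t)) * K z)) \<le> 0"
proof -
  let ?\<phi> = "\<lambda>w :: (real^'n) \<times> real. f (fst w) + (b * (norm (snd w - s0))\<^sup>2 + \<theta> * snd w)"
  have "C2_on (QT T) ?\<phi>"
    by (intro C2_on_add C2_on_linear_compose[OF f(1)] C2_on_cmult C2_on_norm_square
        C2_on_bounded_linear bounded_linear_fst bounded_linear_snd)
  moreover have "(?\<phi> has_derivative (\<lambda>(h, s). p \<bullet> h + (2 * b * (t - s0) + \<theta>) * s)) (at (x, t) within QT T)"
  proof -
    have 1: "((\<lambda>w. f (fst w)) has_derivative (\<lambda>h. p \<bullet> fst h)) (at (x, t) within QT T)"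
      using has_derivative_compose[OF bounded_linear_imp_has_derivative[OF bounded_linear_fst], of f "\<lambda>h. p \<bullet> h" "(x, t)"] f(2)
      by simp
    have 2: "((\<lambda>w. b * (norm (snd w - s0))\<^sup>2 + \<theta> * snd w) has_derivative
        (\<lambda>h. b * (2 * ((snd (x, t) - s0) \<bullet> snd h)) + \<theta> * snd h)) (at (x, t) within QT T)"
      by (intro has_derivative_add has_derivative_mult_right has_derivative_norm_square
          bounded_linear_snd bounded_linear_imp_has_derivative)
    show ?thesis
      by (rule has_derivative_eq_rhs[OF has_derivative_add[OF 1 2]])
        (auto simp: fun_eq_iff algebra_simps)
  qed
  moreover have "\<forall>w\<in>ball x \<delta> \<times> {t - \<delta><..<t + \<delta>} \<inter> QT T. u w - ?\<phi> w \<le> u (x, t) - ?\<phi> (x, t)"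
    using max by (auto simp: QT_def)
  moreover have "(x, t) \<in> QT T" using t by (simp add: QT_def)
  ultimately have "(2 * b * (t - s0) + \<theta>) + F x p (nonlocal_on (ball 0 \<delta>) K ?\<phi> x t + nonlocal_on (- ball 0 \<delta>) K u x t) \<le> 0"
    using sub \<delta> unfolding viscosity_subsolution_def by blast
  then show ?thesis by (simp add: nonlocal_on_def)
qed

definition kmass :: real where "kmass = levy_mass 1 1"

lemma kmass_nonneg: "0 \<le> kmass" unfolding kmass_def by (intro levy_mass_nonneg) auto

text \<open>Rests on \<open>min (A * norm z) B \<le> (A + B) * min (norm z) 1\<close>. The bound is
  coarse but linear in the slope, which is the form that coercivity absorbs.\<close>

lemma nonlocal_sum_le_kmass:
  assumes "0 < \<delta>" "\<delta> \<le> 1" "0 \<le> A" "0 \<le> B"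
    and "\<And>z. f z \<le> A * norm z" "\<And>z. g z \<le> A * norm z" "\<And>z. g z \<le> B"
  shows "(LINT z:ball 0 \<delta>|lebesgue. f z * K z) + (LINT z:- ball 0 \<delta>|lebesgue. g z * K z) \<le> (A + B) * kmass"
proof -
  let ?D = "\<lambda>z :: real^'n. (A + B) * min (1 * norm z) 1"
  have I: "integrable lebesgue (\<lambda>z. (A + B) * (min (1 * norm z) 1 * K z))"
    using levy_mass_integrable[of 1 1] by simp
  have "(LINT z:ball 0 \<delta>|lebesgue. f z * K z) + (LINT z:- ball 0 \<delta>|lebesgue. g z * K z) \<le> (LINT z|lebesgue. ?D z * K z)"
  proof (rule nonlocal_sum_le_dominated)
    show "integrable lebesgue (\<lambda>z. ?D z * K z)" using I by (simp add: mult.assoc)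
    show "f z \<le> ?D z" if "z \<in> ball 0 \<delta>" for z
    proof -
      have "A * norm z \<le> (A + B) * norm z" using assms(4) by (intro mult_right_mono) auto
      then show ?thesis using that assms(2) assms(5)[of z] by (simp add: min_def)
    qed
    show "g z \<le> ?D z" if "z \<notin> ball 0 \<delta>" for z
    proof (cases "norm z \<le> 1")
      case True
      have "A * norm z \<le> (A + B) * norm z" using assms(4) by (intro mult_right_mono) auto
      then show ?thesis using True assms(6)[of z] by (simp add: min_def)
    next
      case False
      then show ?thesis using assms(3) assms(7)[of z] by (simp add: min_def)
    qed
    show "0 \<le> ?D z" for z using assms(3,4) by simp
  qed simp
  also have "\<dots> = (A + B) * kmass" unfolding kmass_def levy_mass_def by (simp add: mult.assoc)
  finally show ?thesis .
qed

lemma bowl_scaled_lipschitz: "0 \<le> r \<Longrightarrow> \<bar>bowl (r *\<^sub>R x) - bowl (r *\<^sub>R y)\<bar> \<le> r * norm (x - y)"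
  using bowl_lipschitz[of "r *\<^sub>R x" "r *\<^sub>R y"] by (simp add: scaleR_right_diff_distrib[symmetric])

text \<open>Stretching by \<open>1 / r\<close> lowers the slope to \<open>B * r\<close> and keeps
  the height \<open>B\<close>, so the nonlocal term vanishes with \<open>r\<close>.\<close>

lemma bowl_scaled_increment:
  assumes "0 \<le> B" "0 \<le> r"
  shows "B * bowl (r *\<^sub>R (x + z - x1)) - B * bowl (r *\<^sub>R (x - x1)) \<le> min (B * r * norm z) B"
proof -
  have "\<bar>bowl (r *\<^sub>R (x + z - x1)) - bowl (r *\<^sub>R (x - x1))\<bar> \<le> r * norm z"
    using bowl_scaled_lipschitz[OF assms(2), of "x + z - x1" "x - x1"] by simp
  moreover have "bowl (r *\<^sub>R (x + z - x1)) - bowl (r *\<^sub>R (x - x1)) \<le> 1"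
    using bowl_le_1[of "r *\<^sub>R (x + z - x1)"] bowl_nonneg[of "r *\<^sub>R (x - x1)"] by linarith
  ultimately have "bowl (r *\<^sub>R (x + z - x1)) - bowl (r *\<^sub>R (x - x1)) \<le> min (r * norm z) 1" by simp
  from mult_left_mono[OF this assms(1)] show ?thesis
    using assms(1) by (simp add: right_diff_distrib min_mult_distrib_left mult.assoc)
qed

lemma bowl_far: "1 \<le> norm x \<Longrightarrow> 1 / 2 \<le> bowl x"
  unfolding bowl_def using power_mono[of 1 "norm x" 2] by (simp add: pos_le_divide_eq add_pos_nonneg)

lemma C2_on_bowl_scaled: "C2_on UNIV (\<lambda>x :: 'a::euclidean_space. B * bowl (r *\<^sub>R (x - x1)))"
  using C2_on_cmult[OF C2_on_bowl[OF bounded_linear_scaleR_right, of UNIV r "r *\<^sub>R x1"], of B]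
  by (simp add: scaleR_right_diff_distrib)

lemma has_derivative_bowl_scaled:
  fixes x :: "'a::euclidean_space"
  assumes "0 \<le> B" "0 \<le> r"
  obtains p where "norm p \<le> B * r"
    "((\<lambda>x. B * bowl (r *\<^sub>R (x - x1))) has_derivative (\<lambda>h. p \<bullet> h)) (at x)"
proof -
  obtain p where p: "norm p \<le> 1" "((\<lambda>w. bowl (r *\<^sub>R w - r *\<^sub>R x1)) has_derivative (\<lambda>h. p \<bullet> (r *\<^sub>R h))) (at x)"
    using has_derivative_bowl[OF bounded_linear_scaleR_right, of r "r *\<^sub>R x1" x UNIV] by blast
  show ?thesis
  proof (rule that[of "(B * r) *\<^sub>R p"])
    show "norm ((B * r) *\<^sub>R p) \<le> B * r" using p(1) assms by (simp add: mult_left_le)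
    show "((\<lambda>x. B * bowl (r *\<^sub>R (x - x1))) has_derivative (\<lambda>h. ((B * r) *\<^sub>R p) \<bullet> h)) (at x)"
      using has_derivative_mult_right[OF p(2), of B] by (simp add: scaleR_right_diff_distrib mult.assoc)
  qed
qed

text \<open>The function \<open>c + A * bowl (x - x0) + C * t\<close> is a strict supersolution,
  because its gradient and nonlocal term lie where \<open>- C < F\<close>. Only a lower bound on
  \<open>F\<close> for bounded momenta is involved, so dual Hamiltonians are covered too.\<close>

lemma barrier:
  assumes "0 < T" and sub: "viscosity_subsolution T K F u" and cont: "continuous_on (QT_bar T) u"
    and M: "\<And>w. w \<in> QT_bar T \<Longrightarrow> \<bar>u w\<bar> \<le> M" and "0 \<le> A" "0 \<le> C"
    and init: "\<And>x. u (x, 0) \<le> c + A * bowl (x - x0)"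
    and low: "\<And>x p l. norm p \<le> A + 1 \<Longrightarrow> l \<le> levy_mass A A + 1 \<Longrightarrow> - C < F x p l"
    and t1: "0 \<le> t1" "t1 \<le> T"
  shows "u (x1, t1) \<le> c + A * bowl (x1 - x0) + C * t1"
proof (rule ccontr)
  assume neg: "\<not> u (x1, t1) \<le> c + A * bowl (x1 - x0) + C * t1"
  \<comment> \<open>Half of \<open>B\<close> exceeds \<open>M - c\<close>, so far from
    \<open>x1\<close> the penalized difference falls below \<open>c\<close>. At \<open>x1\<close>,
    where the violation is assumed, the penalty vanishes and does not weaken it.\<close>
  define B where "B = 2 * (\<bar>M\<bar> + \<bar>c\<bar> + 1)"
  have B: "0 < B" unfolding B_def by simp
  obtain A' where A': "0 < A'" "levy_mass A' B < 1" using levy_mass_small_left[of B 1] B by auto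
  \<comment> \<open>The stretched penalty adds at most 1 to the gradient and less than 1 to the
    nonlocal term: the margins allowed in \<open>low\<close>.\<close>
  define r where "r = min A' 1 / B"
  have r: "0 < r" "B * r \<le> 1" "B * r \<le> A'" using B A'(1) unfolding r_def by auto
  let ?f = "\<lambda>x. A * bowl (1 *\<^sub>R (x - x0)) + B * bowl (r *\<^sub>R (x - x1))"
  define \<Phi> where "\<Phi> = (\<lambda>w. u w - (?f (fst w) + C * snd w))"
  have cont\<Phi>: "continuous_on (QT_bar T) \<Phi>"
    unfolding \<Phi>_def by (intro continuous_intros cont)
  have "\<exists>m\<in>QT_bar T. \<forall>w\<in>QT_bar T. \<Phi> w \<le> \<Phi> m"
  proof (rule continuous_attains_sup_coercive[where y = "(x1, t1)" and R = "1 / r + T"])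
    show "closed (QT_bar T :: ((real^'n) \<times> real) set)" unfolding QT_bar_def by (intro closed_Times) auto
    fix w :: "(real^'n) \<times> real" assume w: "w \<in> QT_bar T" "1 / r + T < dist (x1, t1) w"
    obtain x t where xt: "w = (x, t)" by (cases w)
    have "dist (x1, t1) w \<le> dist x1 x + dist t1 t"
      using sqrt_sum_squares_le_sum_abs[of "dist x1 x" "dist t1 t"] by (simp add: xt dist_Pair_Pair)
    moreover have "dist t1 t \<le> T" using w(1) t1 by (auto simp: xt QT_bar_def dist_real_def)
    ultimately have "1 / r < norm (x - x1)" using w(2) by (simp add: dist_norm norm_minus_commute)
    then have "1 \<le> r * norm (x - x1)" using r(1) by (simp add: field_simps)
    then have "1 \<le> norm (r *\<^sub>R (x - x1))" by (simp only: norm_scaleR abs_of_pos[OF r(1)])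
    then have "B * (1 / 2) \<le> B * bowl (r *\<^sub>R (x - x1))" using B by (intro mult_left_mono bowl_far) auto
    moreover have "0 \<le> A * bowl (1 *\<^sub>R (x - x0))" "0 \<le> C * t" "u (x, t) \<le> M"
      using \<open>0 \<le> A\<close> \<open>0 \<le> C\<close> bowl_nonneg[of "x - x0"] w(1) M[OF w(1)] by (auto simp: xt QT_bar_def)
    ultimately have "\<Phi> w \<le> c" unfolding \<Phi>_def xt B_def by simp
    then show "\<Phi> w \<le> \<Phi> (x1, t1)" using neg unfolding \<Phi>_def by (simp add: bowl_0)
  qed (use t1 cont\<Phi> in \<open>auto simp: QT_bar_def\<close>)
  then obtain x t where m: "0 \<le> t" "t \<le> T" "\<And>x' t'. 0 \<le> t' \<Longrightarrow> t' \<le> T \<Longrightarrow> \<Phi> (x', t') \<le> \<Phi> (x, t)"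
    by (force simp: QT_bar_def)
  have pos: "c < \<Phi> (x, t)" using m(3)[OF t1, of x1] neg unfolding \<Phi>_def by (simp add: bowl_0)
  have "t \<noteq> 0"
  proof
    assume "t = 0"
    then have "\<Phi> (x, t) \<le> c - B * bowl (r *\<^sub>R (x - x1))" using init[of x] unfolding \<Phi>_def by simp
    then show False using pos B bowl_nonneg[of "r *\<^sub>R (x - x1)"] by (smt (verit) mult_nonneg_nonneg)
  qed
  then have t: "0 < t" using m(1) by simp
  obtain p1 where p1: "norm p1 \<le> A * 1" "((\<lambda>x. A * bowl (1 *\<^sub>R (x - x0))) has_derivative (\<lambda>h. p1 \<bullet> h)) (at x)"
    using has_derivative_bowl_scaled[OF \<open>0 \<le> A\<close>, of 1] by auto
  obtain p2 where p2: "norm p2 \<le> B * r" "((\<lambda>x. B * bowl (r *\<^sub>R (x - x1))) has_derivative (\<lambda>h. p2 \<bullet> h)) (at x)"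
    using has_derivative_bowl_scaled[of B r] B r(1) by (metis less_imp_le)
  have d: "(?f has_derivative (\<lambda>h. (p1 + p2) \<bullet> h)) (at x)"
    using has_derivative_add[OF p1(2) p2(2)] by (simp add: inner_add_left)
  have C2: "C2_on UNIV ?f" by (intro C2_on_add C2_on_bowl_scaled)
  let ?l = "(LINT z:ball 0 (1/2)|lebesgue. (?f (x + z) - ?f x) * K z)
     + (LINT z:- ball 0 (1/2)|lebesgue. (u (x + z, t) - u (x, t)) * K z)"
  have "(2 * 0 * (t - 0) + C) + F x (p1 + p2) ?l \<le> 0"
  proof (rule subsolution_test[OF sub t m(2) _ _ C2 d])
    show "u (x', t') - (?f x' + (0 * (t' - 0)\<^sup>2 + C * t')) \<le> u (x, t) - (?f x + (0 * (t - 0)\<^sup>2 + C * t))"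
      if "0 < t'" "t' \<le> T" for x' t'
      using m(3)[of t' x'] that unfolding \<Phi>_def by simp
  qed auto
  moreover have "?l \<le> levy_mass A A + 1"
  proof -
    let ?D = "\<lambda>z :: real^'n. min (A * norm z) A + min (B * r * norm z) B"
    have I: "integrable lebesgue (\<lambda>z. min (A * norm z) A * K z)" "integrable lebesgue (\<lambda>z. min (B * r * norm z) B * K z)"
      using \<open>0 \<le> A\<close> B r(1) by (auto intro!: levy_mass_integrable)
    have fD: "?f (x + z) - ?f x \<le> ?D z" for z
    proof -
      have "A * bowl (1 *\<^sub>R (x + z - x0)) - A * bowl (1 *\<^sub>R (x - x0)) \<le> min (A * norm z) A"
        using bowl_scaled_increment[OF \<open>0 \<le> A\<close> zero_le_one, of x z x0] by (simp only: mult_1_right)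
      moreover have "B * bowl (r *\<^sub>R (x + z - x1)) - B * bowl (r *\<^sub>R (x - x1)) \<le> min (B * r * norm z) B"
        by (rule bowl_scaled_increment) (use B r(1) in auto)
      ultimately show ?thesis by linarith
    qed
    have "?l \<le> (LINT z|lebesgue. ?D z * K z)"
    proof (rule nonlocal_sum_le_dominated)
      show "integrable lebesgue (\<lambda>z. ?D z * K z)"
        using Bochner_Integration.integrable_add[OF I] by (simp add: distrib_right)
      show "0 \<le> ?D z" for z using \<open>0 \<le> A\<close> B r(1) by simp
      show "u (x + z, t) - u (x, t) \<le> ?D z" for z
        using m(3)[OF m(1,2), of "x + z"] fD[of z] unfolding \<Phi>_def by simp
    qed (use fD in auto)
    also have "\<dots> = levy_mass A A + levy_mass (B * r) B"
      unfolding levy_mass_def using Bochner_Integration.integral_add[OF I] by (simp add: distrib_right)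
    also have "levy_mass (B * r) B \<le> levy_mass A' B" using B r by (intro levy_mass_mono) auto
    finally show ?thesis using A'(2) by simp
  qed
  moreover have "norm (p1 + p2) \<le> A + 1" using norm_triangle_ineq[of p1 p2] p1(1) p2(1) r(2) by simp
  ultimately show False using low[of "p1 + p2" ?l x] by simp
qed

end

section \<open>The comparison principle\<close>

lemma dist_Pair_le: "dist (a, b) (c, d) \<le> dist a c + dist b d"
  using sqrt_sum_squares_le_sum_abs[of "dist a c" "dist b d"] by (simp add: dist_Pair_Pair)

lemma admissible_antimono: "admissible F \<Longrightarrow> l \<le> l' \<Longrightarrow> F x p l' \<le> F x p l"
  unfolding admissible_def by (elim conjE) simp

lemma admissible_uc:
  assumes "admissible F" "0 < \<eta>"
  obtains \<kappa> where "0 < \<kappa>" "\<And>x y p p' l l'. norm p \<le> R \<Longrightarrow> norm p' \<le> R \<Longrightarrow> \<bar>l\<bar> \<le> R \<Longrightarrow> \<bar>l'\<bar> \<le> R \<Longrightarrow>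
    norm (x - y) \<le> \<kappa> \<Longrightarrow> norm (p - p') \<le> \<kappa> \<Longrightarrow> \<bar>l - l'\<bar> \<le> \<kappa> \<Longrightarrow> F y p' l' \<le> F x p l + \<eta>"
proof -
  have "\<exists>\<kappa>>0. \<forall>x y p p' l l'. norm p \<le> R \<longrightarrow> norm p' \<le> R \<longrightarrow> \<bar>l\<bar> \<le> R \<longrightarrow> \<bar>l'\<bar> \<le> R \<longrightarrow>
      norm (x - y) \<le> \<kappa> \<longrightarrow> norm (p - p') \<le> \<kappa> \<longrightarrow> \<bar>l - l'\<bar> \<le> \<kappa> \<longrightarrow> F y p' l' \<le> F x p l + \<eta>"
    using assms(1)[unfolded admissible_def, THEN conjunct2, THEN conjunct1] assms(2) by simp
  then show ?thesis using that by blast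
qed

lemma admissible_coercive:
  assumes "admissible F" "0 < C"
  obtains L0 where "\<And>L x p l. L0 \<le> L \<Longrightarrow> L / 2 \<le> norm p \<Longrightarrow> l \<le> C * (1 + L) \<Longrightarrow> C < F x p l"
proof -
  have "\<exists>L0. \<forall>L\<ge>L0. \<forall>x p l. L / 2 \<le> norm p \<longrightarrow> l \<le> C * (1 + L) \<longrightarrow> C < F x p l"
    using assms(1)[unfolded admissible_def, THEN conjunct2, THEN conjunct2] assms(2) by simp
  then show ?thesis using that by blast
qed

context levy_kernel
begin

lemma incr_borel_measurable:
  fixes u :: "(real^'n) \<times> real \<Rightarrow> real"
  assumes "continuous_on (QT_bar T) u" "0 \<le> t" "t \<le> T"
  shows "(\<lambda>z. u (x + z, t) - u (x, t)) \<in> borel_measurable lebesgue"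
proof -
  have "continuous_on UNIV (\<lambda>z. u (x + z, t) - u (x, t))"
    by (intro continuous_intros continuous_on_compose2[OF assms(1)]) (use assms(2,3) in \<open>auto simp: QT_bar_def\<close>)
  then show ?thesis
    by (intro measurable_completion) (simp add: borel_measurable_continuous_onI)
qed

lemma has_derivative_smooth_norm_scaled:
  fixes x :: "'a::euclidean_space"
  assumes "0 < e"
  shows "((\<lambda>x. L * smooth_norm e (x - y)) has_derivative
    (\<lambda>h. (L *\<^sub>R ((1 / smooth_norm e (x - y)) *\<^sub>R (x - y))) \<bullet> h)) (at x)"
  using has_derivative_mult_right[OF has_derivative_smooth_norm[OF bounded_linear_ident assms, of y x UNIV], of L]
  by simp

lemma C2_on_smooth_norm_scaled:
  "0 < e \<Longrightarrow> C2_on UNIV (\<lambda>x :: 'a::euclidean_space. L * smooth_norm e (x - y))"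
  by (rule C2_on_cmult[OF C2_on_smooth_norm[OF bounded_linear_ident]])

lemma smooth_norm_increment:
  "0 \<le> L \<Longrightarrow> L * smooth_norm e (x + z - y) - L * smooth_norm e (x - y) \<le> L * norm z"
  using smooth_norm_lipschitz[of e "x + z - y" "x - y"]
  by (simp add: right_diff_distrib[symmetric] mult_left_mono)

text \<open>Doubling of variables. The penalty \<^term>\<open>L * smooth_norm e (x - y)\<close> has a gradient of size about
  \<^term>\<open>L\<close> unless \<^term>\<open>norm (x - y) < e\<close>; for large \<^term>\<open>L\<close> coercivity excludes the former. Hence the
  momenta and the nonlocal terms stay bounded as \<^term>\<open>e\<close> tends to \<^term>\<open>0::real\<close>, so that the
  continuity of \<^term>\<open>F\<close> suffices. Comparing at the time lag \<^term>\<open>h\<close> yields continuity in time.\<close>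
lemma comparison:
  assumes "0 < T" and adm: "admissible F"
    and sub: "viscosity_subsolution T K F u" and super: "viscosity_supersolution T K F v"
    and cont: "continuous_on (QT_bar T) u" "continuous_on (QT_bar T) v"
    and Mu: "\<And>w. w \<in> QT_bar T \<Longrightarrow> \<bar>u w\<bar> \<le> M" and Mv: "\<And>w. w \<in> QT_bar T \<Longrightarrow> \<bar>v w\<bar> \<le> M"
    and h: "\<bar>h\<bar> \<le> T" and "0 < \<kappa>0"
    and bdry: "\<And>x y t s. 0 \<le> t \<Longrightarrow> t \<le> T \<Longrightarrow> 0 \<le> s \<Longrightarrow> s \<le> T \<Longrightarrow> t = 0 \<or> s = 0 \<Longrightarrow>
      norm (x - y) \<le> \<kappa>0 \<Longrightarrow> \<bar>t - s - h\<bar> \<le> \<kappa>0 \<Longrightarrow> u (x, t) - v (y, s) \<le> Bd"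
    and t1: "0 \<le> t1" "t1 \<le> T" "0 \<le> s1" "s1 \<le> T" "t1 - s1 = h"
  shows "u (x1, t1) - v (x1, s1) \<le> Bd"
proof (rule ccontr)
  assume neg: "\<not> u (x1, t1) - v (x1, s1) \<le> Bd"
  have M0: "0 \<le> M" using Mu[of "(x1, t1)"] t1 by (force simp: QT_bar_def)
  \<comment> \<open>A fifth of the violation: \<open>L * e\<close> and \<open>\<theta> * t1\<close>
    each cost at most \<eta> at the reference point, so a surplus over \<open>Bd\<close>
    survives.\<close>
  define \<eta> where "\<eta> = min ((u (x1, t1) - v (x1, s1) - Bd) / 5) 1"
  have \<eta>: "0 < \<eta>" "\<eta> \<le> 1" "Bd + 5 * \<eta> \<le> u (x1, t1) - v (x1, s1)"
  proof -
    show "0 < \<eta>" "\<eta> \<le> 1" using neg unfolding \<eta>_def by auto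
    have "\<eta> \<le> (u (x1, t1) - v (x1, s1) - Bd) / 5" unfolding \<eta>_def by (rule min.cobounded1)
    then show "Bd + 5 * \<eta> \<le> u (x1, t1) - v (x1, s1)" by simp
  qed
  \<comment> \<open>A bound for the penalties at the maximum: \<open>u - v\<close> is at most
    \<open>2 * M\<close> there, and the reference value is at least
    \<open>- 2 * M - 2\<close>.\<close>
  define P where "P = 4 * M + 2"
  have P: "0 < P" using M0 unfolding P_def by simp
  define \<theta> where "\<theta> = \<eta> / T"
  have \<theta>: "0 < \<theta>" "\<theta> * t1 \<le> \<eta>"
  proof -
    show "0 < \<theta>" using \<eta> \<open>0 < T\<close> by (simp add: \<theta>_def)
    then have "\<theta> * t1 \<le> \<theta> * T" using t1(2) by (intro mult_left_mono) auto
    then show "\<theta> * t1 \<le> \<eta>" using \<open>0 < T\<close> by (simp add: \<theta>_def)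
  qed
  \<comment> \<open>A time penalty of at most \<open>P\<close> then forces
    \<open>\<bar>t - s - h\<bar> \<le> \<kappa>0\<close>, as in \<open>bdry\<close>. Since
    \<open>b\<close> is fixed before \<open>L\<close>, the time derivative of the penalty is bounded
    independently of the spatial slope.\<close>
  define b where "b = P / \<kappa>0\<^sup>2"
  have b: "0 < b" "b * \<kappa>0\<^sup>2 = P" using P \<open>0 < \<kappa>0\<close> unfolding b_def by auto
  \<comment> \<open>The first entry dominates the time derivative of the penalty, the second, times
    \<open>1 + L\<close>, the nonlocal terms.\<close>
  define C where "C = max (6 * b * T) ((1 + 2 * M) * kmass) + 1"
  have C: "0 < C" "6 * b * T < C" "(1 + 2 * M) * kmass \<le> C"
  proof -
    have "0 < 6 * b * T" using b(1) \<open>0 < T\<close> by simp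
    moreover show "6 * b * T < C" "(1 + 2 * M) * kmass \<le> C" unfolding C_def by simp_all
    ultimately show "0 < C" by linarith
  qed
  have mono: "F x p l' \<le> F x p l" if "l \<le> l'" for x p l l'
    by (rule admissible_antimono[OF adm that])
  obtain L0 where L0: "\<And>L x p l. L0 \<le> L \<Longrightarrow> L / 2 \<le> norm p \<Longrightarrow> l \<le> C * (1 + L) \<Longrightarrow> C < F x p l"
    using admissible_coercive[OF adm C(1)] by blast
  \<comment> \<open>Large enough for coercivity, for \<open>norm (x - y) \<le> \<kappa>0\<close>,
    and, through \<open>6 \<le> L\<close>, for \<open>2 / 3 * L - 1 \<ge> L / 2\<close>, where 1
    bounds the gradient of the localizing penalty.\<close>
  define L where "L = max (max L0 (P / \<kappa>0)) 6"
  have L: "L0 \<le> L" "P / \<kappa>0 \<le> L" "6 \<le> L" unfolding L_def by auto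
  have Lpos: "0 < L" using L(3) by simp
  have L\<kappa>: "P \<le> L * \<kappa>0" using L(2) \<open>0 < \<kappa>0\<close> by (simp add: pos_divide_le_eq)
  define J where "J = (L + 1 + 2 * M) * kmass"
  have J: "0 \<le> J" unfolding J_def using L M0 kmass_nonneg by (intro mult_nonneg_nonneg) auto
  have JC: "J \<le> C * (1 + L)"
  proof -
    have "J \<le> ((1 + 2 * M) * (1 + L)) * kmass"
      unfolding J_def using L M0 kmass_nonneg by (intro mult_right_mono) (auto simp: algebra_simps)
    also have "\<dots> = ((1 + 2 * M) * kmass) * (1 + L)" by (simp add: mult_ac)
    also have "\<dots> \<le> C * (1 + L)" using C(3) L by (intro mult_right_mono) auto
    finally show ?thesis .
  qed
  define R where "R = max (L + 1) (J + 2)"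
  obtain \<kappa>' where \<kappa>': "0 < \<kappa>'" "\<And>x y p p' l l'. norm p \<le> R \<Longrightarrow> norm p' \<le> R \<Longrightarrow> \<bar>l\<bar> \<le> R \<Longrightarrow> \<bar>l'\<bar> \<le> R \<Longrightarrow>
        norm (x - y) \<le> \<kappa>' \<Longrightarrow> norm (p - p') \<le> \<kappa>' \<Longrightarrow> \<bar>l - l'\<bar> \<le> \<kappa>' \<Longrightarrow> F y p' l' \<le> F x p l + \<theta> / 2"
    using admissible_uc[OF adm half_gt_zero[OF \<theta>(1)], of R] by blast
  define \<kappa> where "\<kappa> = min \<kappa>' 1"
  have \<kappa>: "0 < \<kappa>" "\<kappa> \<le> \<kappa>'" "\<kappa> \<le> 1" using \<kappa>'(1) unfolding \<kappa>_def by auto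
  \<comment> \<open>The size of the tip comes after \<open>L\<close>, \<open>R\<close> and \<kappa>:
    the bounds on momenta and nonlocal terms do not depend on it.\<close>
  define e where "e = min \<kappa> (\<eta> / L)"
  have e: "0 < e" "e \<le> \<kappa>" "L * e \<le> \<eta>"
  proof -
    show "0 < e" "e \<le> \<kappa>" using \<kappa> L \<eta> unfolding e_def by auto
    have "L * e \<le> L * (\<eta> / L)" unfolding e_def using L by (intro mult_left_mono) auto
    then show "L * e \<le> \<eta>" using L by simp
  qed
  \<comment> \<open>Half of \<open>B\<close> is \<open>P + 2 * M\<close>: beyond distance
    \<open>1 / r\<close> from \<open>x1\<close> the penalty pushes the function below the reference
    value, whatever \<open>u - v\<close> is.\<close>
  define B where "B = 2 * (P + 2 * M)"
  have B: "0 < B" using P M0 unfolding B_def by simp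
  have B2: "B * (1 / 2) = P + 2 * M" by (simp add: B_def)
  obtain A' where A': "0 < A'" "levy_mass A' B < \<kappa> / 3" using levy_mass_small_left[of B "\<kappa> / 3"] B \<kappa> by auto
  define r where "r = min A' \<kappa> / B"
  have r: "0 < r" "B * r \<le> \<kappa>" "B * r \<le> A'" using B A'(1) \<kappa> unfolding r_def by auto
  obtain D' where D': "0 < D'" "levy_mass (L + 1) D' < \<kappa> / 3"
    using levy_mass_small_right[of "L + 1" "\<kappa> / 3"] \<kappa> L by auto
  \<comment> \<open>On the ball of radius \<delta> increments of slope \<open>L + 1\<close> stay
    below \<open>D'\<close>, so each inner integral is below \<open>\<kappa> / 3\<close>.\<close>
  define \<delta> where "\<delta> = min (1 / 2) (D' / (L + 1))"
  have \<delta>: "0 < \<delta>" "\<delta> < 1" "(L + 1) * \<delta> \<le> D'"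
  proof -
    show "0 < \<delta>" "\<delta> < 1" using D' L unfolding \<delta>_def by auto
    have "(L + 1) * \<delta> \<le> (L + 1) * (D' / (L + 1))" unfolding \<delta>_def using L by (intro mult_left_mono) auto
    then show "(L + 1) * \<delta> \<le> D'" using L by simp
  qed
  let ?N = "\<lambda>x y :: real^'n. L * smooth_norm e (x - y)"
  let ?B = "\<lambda>x :: real^'n. B * bowl (r *\<^sub>R (x - x1))"
  define \<Phi> where "\<Phi> = (\<lambda>(x, t, y, s). u (x, t) - v (y, s) - ?N x y - b * (t - s - h)\<^sup>2 - \<theta> * t - ?B x)"
  define S where "S = (UNIV :: (real^'n) set) \<times> {0..T} \<times> (UNIV :: (real^'n) set) \<times> {0..T}"
  have closedS: "closed S" unfolding S_def by (intro closed_Times) auto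
  have cont\<Phi>: "continuous_on S \<Phi>"
    unfolding \<Phi>_def case_prod_beta S_def
    by (intro continuous_intros continuous_on_compose2[OF cont(1)] continuous_on_compose2[OF cont(2)])
      (auto simp: QT_bar_def)
  have start: "Bd + 3 * \<eta> \<le> \<Phi> (x1, t1, x1, s1)" "- 2 * M - 2 * \<eta> \<le> \<Phi> (x1, t1, x1, s1)"
  proof -
    have "\<Phi> (x1, t1, x1, s1) = u (x1, t1) - v (x1, s1) - L * e - \<theta> * t1"
      using t1(5) e(1) unfolding \<Phi>_def by (simp add: smooth_norm_0 bowl_0)
    moreover have "\<bar>u (x1, t1)\<bar> \<le> M" "\<bar>v (x1, s1)\<bar> \<le> M" using t1 by (auto intro!: Mu Mv simp: QT_bar_def)
    ultimately show "Bd + 3 * \<eta> \<le> \<Phi> (x1, t1, x1, s1)" "- 2 * M - 2 * \<eta> \<le> \<Phi> (x1, t1, x1, s1)"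
      using \<eta>(3) e(3) \<theta>(2) by linarith+
  qed
  have pen: "0 \<le> ?N x y" "L * norm (x - y) \<le> ?N x y" "0 \<le> ?B x" "0 \<le> b * d\<^sup>2" for x y d
    using L B b(1) norm_le_smooth_norm[of "x - y" e] by (auto simp: smooth_norm_nonneg bowl_nonneg)
  have uv: "u (x, t) - v (y, s) \<le> 2 * M" if "0 \<le> t" "t \<le> T" "0 \<le> s" "s \<le> T" for x t y s
  proof -
    have "\<bar>u (x, t)\<bar> \<le> M" "\<bar>v (y, s)\<bar> \<le> M" using that by (auto intro!: Mu Mv simp: QT_bar_def)
    then show ?thesis by linarith
  qed
  have "\<exists>m\<in>S. \<forall>w\<in>S. \<Phi> w \<le> \<Phi> m"
  proof (rule continuous_attains_sup_coercive[OF closedS _ cont\<Phi>,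
        where y = "(x1, t1, x1, s1)" and R = "2 / r + P / L + 2 * T"])
    show "(x1, t1, x1, s1) \<in> S" using t1 by (simp add: S_def)
    fix w assume w: "w \<in> S" "2 / r + P / L + 2 * T < dist (x1, t1, x1, s1) w"
    obtain x t y s where xt: "w = (x, t, y, s)" by (cases w)
    have ts: "0 \<le> t" "t \<le> T" "0 \<le> s" "s \<le> T" using w(1) by (auto simp: xt S_def)
    have "dist (x1, t1, x1, s1) w \<le> dist x1 x + (dist t1 t + (dist x1 y + dist s1 s))"
      unfolding xt by (intro order_trans[OF dist_Pair_le] add_left_mono dist_Pair_le)
    moreover have "dist t1 t \<le> T" "dist s1 s \<le> T" using ts t1 by (auto simp: dist_real_def)
    moreover have "dist x1 y \<le> dist x1 x + dist x y" by (rule dist_triangle)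
    ultimately have less: "2 / r + P / L < 2 * dist x1 x + dist x y" using w(2) by linarith
    have val: "\<Phi> w = u (x, t) - v (y, s) - ?N x y - b * (t - s - h)\<^sup>2 - \<theta> * t - ?B x"
      by (simp add: \<Phi>_def xt)
    have \<theta>t: "0 \<le> \<theta> * t" using \<theta>(1) ts(1) by simp
    from less have "1 / r < norm (x - x1) \<or> P / L < norm (x - y)"
      by (auto simp: dist_norm norm_minus_commute)
    then show "\<Phi> w \<le> \<Phi> (x1, t1, x1, s1)"
    proof
      assume "1 / r < norm (x - x1)"
      then have "1 \<le> r * norm (x - x1)" using r(1) by (simp add: field_simps)
      then have "1 \<le> norm (r *\<^sub>R (x - x1))" by (simp only: norm_scaleR abs_of_pos[OF r(1)])
      then have "B * (1 / 2) \<le> ?B x" using B by (intro mult_left_mono bowl_far) auto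
      then have "\<Phi> w \<le> - P" using uv[OF ts, of x y] pen(1)[of x y] pen(4)[of "t - s - h"] \<theta>t
        unfolding val B2 by linarith
      then show ?thesis using start(2) \<eta>(2) M0 unfolding P_def by linarith
    next
      assume "P / L < norm (x - y)"
      then have "P \<le> L * norm (x - y)" using L by (simp add: field_simps)
      then have "\<Phi> w \<le> 2 * M - P" using uv[OF ts, of x y] pen(2)[of x y] pen(3)[of x] pen(4)[of "t - s - h"] \<theta>t
        unfolding val by linarith
      then show ?thesis using start(2) \<eta>(2) unfolding P_def by linarith
    qed
  qed
  then obtain m where m: "m \<in> S" "\<And>w. w \<in> S \<Longrightarrow> \<Phi> w \<le> \<Phi> m" by blast
  obtain x t y s where mx: "m = (x, t, y, s)" by (cases m)
  have ts: "0 \<le> t" "t \<le> T" "0 \<le> s" "s \<le> T" using m(1) by (auto simp: mx S_def)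
  have max: "\<Phi> (x', t', y', s') \<le> \<Phi> (x, t, y, s)" if "0 \<le> t'" "t' \<le> T" "0 \<le> s'" "s' \<le> T" for x' t' y' s'
    using m(2)[of "(x', t', y', s')"] that by (simp add: mx S_def)
  have ge: "\<Phi> (x1, t1, x1, s1) \<le> \<Phi> (x, t, y, s)" by (rule max) (use t1 in auto)
  have val: "\<Phi> (x, t, y, s) = u (x, t) - v (y, s) - ?N x y - b * (t - s - h)\<^sup>2 - \<theta> * t - ?B x"
    by (simp add: \<Phi>_def)
  have \<theta>t: "0 \<le> \<theta> * t" using \<theta>(1) ts(1) by simp
  have pens: "?N x y + b * (t - s - h)\<^sup>2 \<le> P"
    using ge start(2) val uv[OF ts, of x y] pen(3)[of x] \<theta>t \<eta>(2) unfolding P_def by linarith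
  have "b * (t - s - h)\<^sup>2 \<le> b * \<kappa>0\<^sup>2" using pens pen(1)[of x y] b(2) by linarith
  then have tsh: "\<bar>t - s - h\<bar> \<le> \<kappa>0" using b(1) \<open>0 < \<kappa>0\<close> abs_le_square_iff[of "t - s - h" \<kappa>0] by simp
  have "L * norm (x - y) \<le> L * \<kappa>0" using pens pen(2)[of x y] pen(4)[of "t - s - h"] L\<kappa> by linarith
  then have xy0: "norm (x - y) \<le> \<kappa>0" using L by simp
  have "t \<noteq> 0 \<and> s \<noteq> 0"
  proof (rule ccontr)
    assume "\<not> (t \<noteq> 0 \<and> s \<noteq> 0)"
    then have "u (x, t) - v (y, s) \<le> Bd" using bdry[OF ts _ xy0 tsh] by blast
    then show False using ge start(1) val pen(1)[of x y] pen(3)[of x] pen(4)[of "t - s - h"] \<theta>t \<eta>(1) by linarith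
  qed
  then have tpos: "0 < t" and spos: "0 < s" using ts by auto

  define p where "p = L *\<^sub>R ((1 / smooth_norm e (x - y)) *\<^sub>R (x - y))"
  obtain p2 where p2: "norm p2 \<le> B * r" "(?B has_derivative (\<lambda>h. p2 \<bullet> h)) (at x)"
    using has_derivative_bowl_scaled[of B r] B r(1) by (metis less_imp_le)
  have pL: "norm p \<le> L" "norm p2 \<le> 1" "norm p2 \<le> \<kappa>"
  proof -
    have "norm p = L * norm ((1 / smooth_norm e (x - y)) *\<^sub>R (x - y))"
      unfolding p_def by (simp only: norm_scaleR abs_of_pos[OF Lpos])
    also have "\<dots> \<le> L * 1" using L e(1) by (intro mult_left_mono norm_smooth_norm_gradient_le) auto
    finally show "norm p \<le> L" by simp
    show "norm p2 \<le> 1" "norm p2 \<le> \<kappa>" using p2(1) r(2) \<kappa> by auto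
  qed
  define fu where "fu = (\<lambda>x'. ?N x' y + ?B x')"
  define fv where "fv = (\<lambda>y'. ?N y' x)"
  have C2: "C2_on UNIV fu" "C2_on UNIV fv"
    unfolding fu_def fv_def by (intro C2_on_add C2_on_smooth_norm_scaled C2_on_bowl_scaled e(1))+
  have du: "(fu has_derivative (\<lambda>h. (p + p2) \<bullet> h)) (at x)"
    unfolding fu_def p_def
    using has_derivative_add[OF has_derivative_smooth_norm_scaled[OF e(1), of L y x] p2(2)]
    by (simp only: inner_add_left)
  have dv: "(fv has_derivative (\<lambda>h. (- p) \<bullet> h)) (at y)"
  proof -
    have "smooth_norm e (y - x) = smooth_norm e (x - y)"
      using smooth_norm_minus[of e "x - y"] by simp
    then have "L *\<^sub>R ((1 / smooth_norm e (y - x)) *\<^sub>R (y - x)) = - p"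
      unfolding p_def by (simp add: algebra_simps)
    then show ?thesis unfolding fv_def using has_derivative_smooth_norm_scaled[OF e(1), of L x y] by simp
  qed
  define Iu where "Iu = (LINT z:ball 0 \<delta>|lebesgue. (fu (x + z) - fu x) * K z)"
  define Eu where "Eu = (LINT z:- ball 0 \<delta>|lebesgue. (u (x + z, t) - u (x, t)) * K z)"
  define Iv where "Iv = (LINT z:ball 0 \<delta>|lebesgue. (fv (y + z) - fv y) * K z)"
  define Ev where "Ev = (LINT z:- ball 0 \<delta>|lebesgue. (- v (y + z, s) - - v (y, s)) * K z)"
  have tu: "(2 * b * (t - (s + h)) + \<theta>) + F x (p + p2) (Iu + Eu) \<le> 0"
    unfolding Iu_def Eu_def
  proof (rule subsolution_test[OF sub tpos ts(2) \<delta>(1,2) C2(1) du])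
    show "u (x', t') - (fu x' + (b * (t' - (s + h))\<^sup>2 + \<theta> * t')) \<le> u (x, t) - (fu x + (b * (t - (s + h))\<^sup>2 + \<theta> * t))"
      if "0 < t'" "t' \<le> T" for x' t'
      using max[of t' s x' y] that ts unfolding \<Phi>_def fu_def by (simp add: diff_diff_eq)
  qed
  have tv: "(2 * b * (s - (t - h)) + 0) + ham_dual F y (- p) (Iv + Ev) \<le> 0"
    unfolding Iv_def Ev_def
  proof (rule subsolution_test[OF supersolution_imp_subsolution_dual[OF super] spos ts(4) \<delta>(1,2) C2(2) dv])
    show "- v (y', s') - (fv y' + (b * (s' - (t - h))\<^sup>2 + 0 * s')) \<le> - v (y, s) - (fv y + (b * (s - (t - h))\<^sup>2 + 0 * s))"
      if "0 < s'" "s' \<le> T" for y' s'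
    proof -
      have "(s' - (t - h))\<^sup>2 = (t - s' - h)\<^sup>2" for s' by (simp add: power2_eq_square algebra_simps)
      moreover have "smooth_norm e (y' - x) = smooth_norm e (x - y')" for y'
        using smooth_norm_minus[of e "x - y'"] by simp
      ultimately show ?thesis
        using max[of t s' x y'] that ts unfolding \<Phi>_def fv_def by simp
    qed
  qed
  define lu where "lu = Iu + Eu"
  define lv where "lv = - (Iv + Ev)"
  have fu_incr: "fu (x + z) - fu x \<le> (L + 1) * norm z" for z
  proof -
    have "?B (x + z) - ?B x \<le> 1 * norm z"
      using bowl_scaled_increment[of B r x z x1] B r(1,2) \<kappa>(3) mult_right_mono[of "B * r" 1 "norm z"] by simp
    then show ?thesis
      using smooth_norm_increment[of L e x z y] L unfolding fu_def by (simp add: distrib_right)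
  qed
  have fv_incr: "fv (y + z) - fv y \<le> L * norm z" for z
    using smooth_norm_increment[of L e y z x] L unfolding fv_def by simp
  have u_incr: "u (x + z, t) - u (x, t) \<le> fu (x + z) - fu x" for z
    using max[OF ts, of "x + z" y] unfolding \<Phi>_def fu_def by simp
  have v_incr: "- v (y + z, s) - - v (y, s) \<le> fv (y + z) - fv y" for z
  proof -
    have "smooth_norm e (y' - x) = smooth_norm e (x - y')" for y'
      using smooth_norm_minus[of e "x - y'"] by simp
    then show ?thesis using max[OF ts, of x "y + z"] unfolding \<Phi>_def fv_def by simp
  qed
  have bd: "\<bar>u (x', t)\<bar> \<le> M" "\<bar>v (y', s)\<bar> \<le> M" for x' y'
    using ts by (auto intro!: Mu Mv simp: QT_bar_def)
  have lu: "lu \<le> J"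
    unfolding lu_def Iu_def Eu_def J_def
  proof (rule nonlocal_sum_le_kmass)
    show "u (x + z, t) - u (x, t) \<le> 2 * M" for z using bd(1)[of "x + z"] bd(1)[of x] by linarith
    show "u (x + z, t) - u (x, t) \<le> (L + 1) * norm z" for z
      using u_incr[of z] fu_incr[of z] by linarith
  qed (use \<delta> L M0 fu_incr in auto)
  have lv: "- J \<le> lv"
  proof -
    have "Iv + Ev \<le> (L + 2 * M) * kmass"
      unfolding Iv_def Ev_def
    proof (rule nonlocal_sum_le_kmass)
      show "- v (y + z, s) - - v (y, s) \<le> 2 * M" for z using bd(2)[of "y + z"] bd(2)[of y] by linarith
      show "- v (y + z, s) - - v (y, s) \<le> L * norm z" for z
        using v_incr[of z] fv_incr[of z] by linarith
    qed (use \<delta> L M0 fv_incr in auto)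
    also have "\<dots> \<le> J" unfolding J_def using kmass_nonneg by (intro mult_right_mono) auto
    finally show ?thesis unfolding lv_def by simp
  qed
  \<comment> \<open>Outside the tip the momentum has size at least \<open>L / 2\<close>, while the
    nonlocal term is at most \<open>C * (1 + L)\<close>. Coercivity then makes the Hamiltonian
    exceed \<open>C\<close>, more than the time derivative of the penalty can offset.\<close>
  have xye: "norm (x - y) < e"
  proof (rule ccontr)
    assume "\<not> norm (x - y) < e"
    then have "L * (2 / 3) \<le> L * norm ((1 / smooth_norm e (x - y)) *\<^sub>R (x - y))"
      using L e(1) by (intro mult_left_mono norm_smooth_norm_gradient_ge) auto
    also have "\<dots> = norm p" unfolding p_def by (simp only: norm_scaleR abs_of_pos[OF Lpos])
    finally have "L / 2 \<le> norm (p + p2)"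
      using norm_diff_ineq[of p p2] pL(2) L(3) by linarith
    then have "C < F x (p + p2) lu" using lu JC by (intro L0[OF L(1)]) auto
    moreover have "- (6 * b * T) \<le> 2 * b * (t - (s + h))"
    proof -
      have "- (3 * T) \<le> t - (s + h)" using ts h by linarith
      from mult_left_mono[OF this, of "2 * b"] show ?thesis using b(1) by simp
    qed
    ultimately show False using tu \<theta>(1) C(2) unfolding lu_def by linarith
  qed
  have diff: "lu - lv \<le> \<kappa>"
  proof -
    have ball: "ball (0::real^'n) \<delta> \<in> sets lebesgue" by simp
    then have far: "- ball (0::real^'n) \<delta> \<in> sets lebesgue" using Compl_in_sets_lebesgue by blast
    have "Iu \<le> levy_mass (L + 1) D'"
      unfolding Iu_def
    proof (rule set_integral_le_levy_mass'[OF ball])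
      show "fu (x + z) - fu x \<le> min ((L + 1) * norm z) D'" if "z \<in> ball 0 \<delta>" for z
      proof -
        have "(L + 1) * norm z \<le> (L + 1) * \<delta>" using that L by (intro mult_left_mono) auto
        then show ?thesis using fu_incr[of z] \<delta>(3) by simp
      qed
    qed (use L D' in auto)
    moreover have "Iv \<le> levy_mass (L + 1) D'"
      unfolding Iv_def
    proof (rule set_integral_le_levy_mass'[OF ball])
      show "fv (y + z) - fv y \<le> min ((L + 1) * norm z) D'" if "z \<in> ball 0 \<delta>" for z
      proof -
        have "(L + 1) * norm z \<le> (L + 1) * \<delta>" using that L by (intro mult_left_mono) auto
        moreover have "L * norm z \<le> (L + 1) * norm z" by (intro mult_right_mono) auto
        ultimately show ?thesis using fv_incr[of z] \<delta>(3) by simp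
      qed
    qed (use L D' in auto)
    \<comment> \<open>Moving \<open>x\<close> and \<open>y\<close> by the same \<open>z\<close>
      leaves \<open>smooth_norm e (x - y)\<close> unchanged, so maximality bounds the sum of the two
      outer increments by that of the localizing penalty alone.\<close>
    moreover have "Eu + Ev \<le> levy_mass A' B"
    proof -
      have "set_integrable lebesgue (- ball 0 \<delta>) (\<lambda>z. (u (x + z, t) - u (x, t)) * K z)"
      proof (rule set_integrable_bounded_far[where B = "2 * M" and \<delta> = \<delta>])
        show "\<bar>u (x + z, t) - u (x, t)\<bar> \<le> 2 * M" for z using bd(1)[of "x + z"] bd(1)[of x] by linarith
      qed (use \<delta> far incr_borel_measurable[OF cont(1) ts(1,2)] in auto)
      moreover have "set_integrable lebesgue (- ball 0 \<delta>) (\<lambda>z. (- v (y + z, s) - - v (y, s)) * K z)"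
      proof (rule set_integrable_bounded_far[where B = "2 * M" and \<delta> = \<delta>])
        show "\<bar>- v (y + z, s) - - v (y, s)\<bar> \<le> 2 * M" for z using bd(2)[of "y + z"] bd(2)[of y] by linarith
        show "(\<lambda>z. - v (y + z, s) - - v (y, s)) \<in> borel_measurable lebesgue"
          using borel_measurable_uminus[OF incr_borel_measurable[OF cont(2) ts(3,4), of y]] by simp
      qed (use \<delta> far in auto)
      ultimately have "Eu + Ev = (LINT z:- ball 0 \<delta>|lebesgue.
          (u (x + z, t) - u (x, t)) * K z + (- v (y + z, s) - - v (y, s)) * K z)"
        unfolding Eu_def Ev_def by (rule set_integral_add(2)[symmetric])
      also have "\<dots> = (LINT z:- ball 0 \<delta>|lebesgue.
          ((u (x + z, t) - u (x, t)) + (- v (y + z, s) - - v (y, s))) * K z)"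
        by (simp add: distrib_right)
      also have "\<dots> \<le> levy_mass (B * r) B"
      proof (rule set_integral_le_levy_mass'[OF far])
        show "(u (x + z, t) - u (x, t)) + (- v (y + z, s) - - v (y, s)) \<le> min (B * r * norm z) B" for z
        proof -
          have "(u (x + z, t) - u (x, t)) + (- v (y + z, s) - - v (y, s)) \<le> ?B (x + z) - ?B x"
            using max[OF ts, of "x + z" "y + z"] unfolding \<Phi>_def by simp
          also have "\<dots> \<le> min (B * r * norm z) B"
            by (rule bowl_scaled_increment) (use B r in auto)
          finally show ?thesis .
        qed
      qed (use B r in auto)
      also have "\<dots> \<le> levy_mass A' B" using B r by (intro levy_mass_mono) auto
      finally show ?thesis .
    qed
    ultimately show ?thesis unfolding lu_def lv_def using A'(2) D'(2) by linarith
  qed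
  \<comment> \<open>\<open>lu\<close> comes without a lower bound. Truncation at
    \<open>- J - \<kappa>\<close> gives a bounded value above \<open>lu\<close> that, lowered by
    \<kappa>, is still below \<open>lv\<close>; monotonicity of \<open>F\<close> justifies both
    replacements.\<close>
  define l where "l = max lu (- J - \<kappa>)"
  have l: "lu \<le> l" "l - \<kappa> \<le> lv" "\<bar>l\<bar> \<le> R" "\<bar>l - \<kappa>\<bar> \<le> R"
    using lu lv diff \<kappa> J unfolding l_def R_def by auto
  have "F y p (l - \<kappa>) \<le> F x (p + p2) l + \<theta> / 2"
  proof (rule \<kappa>'(2))
    have "norm (p + p2) \<le> norm p + norm p2" by (rule norm_triangle_ineq)
    then show "norm (p + p2) \<le> R" using pL unfolding R_def by simp
    show "norm p \<le> R" using pL(1) unfolding R_def by simp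
    show "norm (x - y) \<le> \<kappa>'" using xye e \<kappa> by simp
    show "norm (p + p2 - p) \<le> \<kappa>'" using pL(3) \<kappa> by simp
    show "\<bar>l - (l - \<kappa>)\<bar> \<le> \<kappa>'" using \<kappa> by simp
  qed (use l in auto)
  moreover have "F x (p + p2) l \<le> F x (p + p2) lu" by (rule mono[OF l(1)])
  moreover have "F y p lv \<le> F y p (l - \<kappa>)" by (rule mono[OF l(2)])
  moreover have "2 * b * (s - (t - h)) = - (2 * b * (t - (s + h)))" by (simp add: algebra_simps)
  moreover have "ham_dual F y (- p) (Iv + Ev) = - F y p lv" by (simp add: ham_dual_def lv_def)
  ultimately show False using tu tv \<theta>(1) unfolding lu_def by linarith
qed

text \<open>The doubling argument with one point frozen at \<open>(y0, s0)\<close>. The Hamiltonian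
  enters through coercivity alone, which for the oscillating problems is uniform in \<epsilon>. The
  maximum sits in the tip around \<open>y0\<close> or at the initial time, and the time penalty
  keeps it near \<open>s0\<close>, so a time modulus and the initial data suffice to estimate its
  value.\<close>

lemma spatial_oscillation_bound:
  assumes "0 < T" and sub: "viscosity_subsolution T K F u" and cont: "continuous_on (QT_bar T) u"
    and Mu: "\<And>w. w \<in> QT_bar T \<Longrightarrow> \<bar>u w\<bar> \<le> M" and "0 < b" "0 < L"
    and C: "2 * b * T \<le> C" "(1 + 2 * M) * kmass \<le> C"
    and coercive: "\<And>x p l. L / 2 \<le> norm p \<Longrightarrow> l \<le> C * (1 + L) \<Longrightarrow> C < F x p l"
    and s0: "0 \<le> s0" "s0 \<le> T" and "0 < e"
  shows "\<exists>x2 t2. 0 \<le> t2 \<and> t2 \<le> T \<and> L * norm (x2 - y0) \<le> 2 * M + L * e \<and> b * (t2 - s0)\<^sup>2 \<le> 2 * M + L * e \<and>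
    (t2 = 0 \<or> norm (x2 - y0) < e) \<and> (\<forall>x. u (x, s0) - L * (e + norm (x - y0)) \<le> u (x2, t2))"
proof -
  have M0: "0 \<le> M" using Mu[of "(0, 0)"] \<open>0 < T\<close> by (force simp: QT_bar_def)
  define f where "f = (\<lambda>x. L * smooth_norm e (x - y0))"
  define \<Phi> where "\<Phi> = (\<lambda>w. u w - (f (fst w) + b * (snd w - s0)\<^sup>2))"
  have cont\<Phi>: "continuous_on (QT_bar T) \<Phi>"
    unfolding \<Phi>_def f_def by (intro continuous_intros cont)
  have pen: "L * norm (x - y0) \<le> f x" "0 \<le> f x" "0 \<le> b * d\<^sup>2" for x d
    using \<open>0 < L\<close> \<open>0 < b\<close> norm_le_smooth_norm[of "x - y0" e] by (auto simp: f_def smooth_norm_nonneg)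
  have f0: "f y0 = L * e" using \<open>0 < e\<close> by (simp add: f_def smooth_norm_0)
  have start: "- M - L * e \<le> \<Phi> (y0, s0)"
    using Mu[of "(y0, s0)"] s0 f0 unfolding \<Phi>_def by (simp add: QT_bar_def abs_le_iff)
  have "\<exists>m\<in>QT_bar T. \<forall>w\<in>QT_bar T. \<Phi> w \<le> \<Phi> m"
  proof (rule continuous_attains_sup_coercive[where y = "(y0, s0)" and R = "(2 * M + L * e) / L + T"])
    show "closed (QT_bar T :: ((real^'n) \<times> real) set)" unfolding QT_bar_def by (intro closed_Times) auto
    fix w :: "(real^'n) \<times> real" assume w: "w \<in> QT_bar T" "(2 * M + L * e) / L + T < dist (y0, s0) w"
    obtain x t where xt: "w = (x, t)" by (cases w)
    have "dist (y0, s0) w \<le> dist y0 x + dist s0 t" unfolding xt by (rule dist_Pair_le)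
    moreover have "dist s0 t \<le> T" using w(1) s0 by (auto simp: xt QT_bar_def dist_real_def)
    ultimately have "(2 * M + L * e) / L < norm (x - y0)" using w(2) by (simp add: dist_norm norm_minus_commute)
    then have "2 * M + L * e \<le> L * norm (x - y0)" using \<open>0 < L\<close> by (simp add: field_simps)
    then have "\<Phi> w \<le> M - (2 * M + L * e)"
      using Mu[OF w(1)] pen(1)[of x] pen(3)[of "t - s0"] unfolding \<Phi>_def xt by simp
    then show "\<Phi> w \<le> \<Phi> (y0, s0)" using start by simp
  qed (use s0 cont\<Phi> in \<open>auto simp: QT_bar_def\<close>)
  then obtain x t where m: "0 \<le> t" "t \<le> T" "\<And>x' t'. 0 \<le> t' \<Longrightarrow> t' \<le> T \<Longrightarrow> \<Phi> (x', t') \<le> \<Phi> (x, t)"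
    by (force simp: QT_bar_def)
  have Mx: "\<bar>u (x', t)\<bar> \<le> M" for x' using m(1,2) by (auto intro!: Mu simp: QT_bar_def)
  have pens: "f x + b * (t - s0)\<^sup>2 \<le> 2 * M + L * e"
    using m(3)[OF s0, of y0] start Mx[of x] unfolding \<Phi>_def by simp
  have near: "t = 0 \<or> norm (x - y0) < e"
  proof (rule ccontr)
    assume "\<not> (t = 0 \<or> norm (x - y0) < e)"
    then have t: "0 < t" and xe: "e \<le> norm (x - y0)" using m(1) by auto
    define p where "p = L *\<^sub>R ((1 / smooth_norm e (x - y0)) *\<^sub>R (x - y0))"
    let ?l = "(LINT z:ball 0 (1/2)|lebesgue. (f (x + z) - f x) * K z)
     + (LINT z:- ball 0 (1/2)|lebesgue. (u (x + z, t) - u (x, t)) * K z)"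
    have "(2 * b * (t - s0) + 0) + F x p ?l \<le> 0"
    proof (rule subsolution_test[OF sub t m(2)])
      show "C2_on UNIV f" unfolding f_def by (rule C2_on_smooth_norm_scaled[OF \<open>0 < e\<close>])
      show "(f has_derivative (\<lambda>h. p \<bullet> h)) (at x)"
        unfolding f_def p_def by (rule has_derivative_smooth_norm_scaled[OF \<open>0 < e\<close>])
      show "u (x', t') - (f x' + (b * (t' - s0)\<^sup>2 + 0 * t')) \<le> u (x, t) - (f x + (b * (t - s0)\<^sup>2 + 0 * t))"
        if "0 < t'" "t' \<le> T" for x' t'
        using m(3)[of t' x'] that unfolding \<Phi>_def by simp
    qed auto
    moreover have "C < F x p ?l"
    proof (rule coercive)
      have "L * (2 / 3) \<le> L * norm ((1 / smooth_norm e (x - y0)) *\<^sub>R (x - y0))"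
        using \<open>0 < L\<close> \<open>0 < e\<close> xe by (intro mult_left_mono norm_smooth_norm_gradient_ge) auto
      also have "\<dots> = norm p" unfolding p_def by (simp only: norm_scaleR abs_of_pos[OF \<open>0 < L\<close>])
      finally show "L / 2 \<le> norm p" using \<open>0 < L\<close> by linarith
      have finc: "f (x + z) - f x \<le> L * norm z" for z
        using smooth_norm_increment[of L e x z y0] \<open>0 < L\<close> unfolding f_def by simp
      have "?l \<le> (L + 2 * M) * kmass"
      proof (rule nonlocal_sum_le_kmass)
        show "u (x + z, t) - u (x, t) \<le> 2 * M" for z using Mx[of "x + z"] Mx[of x] by linarith
        show "u (x + z, t) - u (x, t) \<le> L * norm z" for z
          using m(3)[OF m(1,2), of "x + z"] finc[of z] unfolding \<Phi>_def by simp
      qed (use \<open>0 < L\<close> M0 finc in auto)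
      also have "\<dots> \<le> ((1 + 2 * M) * (1 + L)) * kmass"
        using \<open>0 < L\<close> M0 kmass_nonneg by (intro mult_right_mono) (auto simp: algebra_simps)
      also have "\<dots> = ((1 + 2 * M) * kmass) * (1 + L)" by (simp add: mult_ac)
      also have "\<dots> \<le> C * (1 + L)" using C(2) \<open>0 < L\<close> by (intro mult_right_mono) auto
      finally show "?l \<le> C * (1 + L)" .
    qed
    moreover have "- (2 * b * T) \<le> 2 * b * (t - s0)"
    proof -
      have "- T \<le> t - s0" using m(1) s0 by linarith
      from mult_left_mono[OF this, of "2 * b"] show ?thesis using \<open>0 < b\<close> by simp
    qed
    ultimately show False using C(1) by linarith
  qed
  have "u (x', s0) - L * (e + norm (x' - y0)) \<le> u (x, t)" for x'
  proof -
    have "f x' \<le> L * (e + norm (x' - y0))"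
      unfolding f_def using \<open>0 < L\<close> \<open>0 < e\<close> by (intro mult_left_mono smooth_norm_le) auto
    then show ?thesis
      using m(3)[OF s0, of x'] pen(2)[of x] pen(3)[of "t - s0"] unfolding \<Phi>_def by simp
  qed
  then show ?thesis
    using m(1,2) near pens pen(1,2)[of x] pen(3)[of "t - s0"]
    by (intro exI[of _ x] exI[of _ t]) auto
qed

end

section \<open>The perturbed test function method\<close>

lemma C2_on_QT_gradient:
  fixes \<phi> :: "(real^'n) \<times> real \<Rightarrow> real"
  assumes "C2_on (QT T) \<phi>"
  obtains P Q where "continuous_on (QT T) P" "continuous_on (QT T) Q"
    "\<And>w. w \<in> QT T \<Longrightarrow> (\<phi> has_derivative (\<lambda>(h, s). P w \<bullet> h + Q w * s)) (at w within QT T)"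
proof -
  obtain f' where f': "\<And>w. w \<in> QT T \<Longrightarrow> (\<phi> has_derivative blinfun_apply (f' w)) (at w within QT T)"
    "C1_on (QT T) f'"
    using assms unfolding C2_on_def by blast
  have cont: "continuous_on (QT T) f'" by (rule C1_on_imp_continuous_on[OF f'(2)])
  define P where "P = (\<lambda>w. \<Sum>b\<in>Basis. blinfun_apply (f' w) (b, 0) *\<^sub>R b)"
  define Q where "Q = (\<lambda>w. blinfun_apply (f' w) (0, 1))"
  have eq: "blinfun_apply (f' w) = (\<lambda>(h, s). P w \<bullet> h + Q w * s)" for w
  proof (rule ext)
    fix hs :: "(real^'n) \<times> real"
    obtain h s where hs: "hs = (h, s)" by (cases hs)
    have "(h, s) = (\<Sum>b\<in>Basis. (h \<bullet> b) *\<^sub>R (b, 0)) + s *\<^sub>R (0, 1)"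
      by (simp add: prod_eq_iff fst_sum snd_sum euclidean_representation)
    then have "blinfun_apply (f' w) (h, s) = (\<Sum>b\<in>Basis. (h \<bullet> b) * blinfun_apply (f' w) (b, 0)) + s * Q w"
      unfolding Q_def by (simp only: blinfun.add_right blinfun.sum_right blinfun.scaleR_right real_scaleR_def)
    also have "(\<Sum>b\<in>Basis. (h \<bullet> b) * blinfun_apply (f' w) (b, 0)) = P w \<bullet> h"
      by (simp add: P_def inner_sum_left inner_commute[of h] mult.commute)
    finally show "blinfun_apply (f' w) hs = (case hs of (h, s) \<Rightarrow> P w \<bullet> h + Q w * s)"
      by (simp add: hs mult.commute)
  qed
  show ?thesis
  proof (rule that)
    show "continuous_on (QT T) P" "continuous_on (QT T) Q"
      unfolding P_def Q_def by (intro continuous_intros cont)+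
    show "(\<phi> has_derivative (\<lambda>(h, s). P w \<bullet> h + Q w * s)) (at w within QT T)" if "w \<in> QT T" for w
      using f'(1)[OF that] unfolding eq .
  qed
qed

lemma has_derivative_QT_space:
  fixes \<phi> :: "(real^'n) \<times> real \<Rightarrow> real"
  assumes "(\<phi> has_derivative (\<lambda>(h, s). P \<bullet> h + Q * s)) (at (x, t) within QT T)" "0 < t" "t \<le> T"
  shows "((\<lambda>x. \<phi> (x, t)) has_derivative (\<lambda>h. P \<bullet> h)) (at x)"
proof -
  have 1: "((\<lambda>x. (x, t)) has_derivative (\<lambda>h. (h, 0))) (at x)"
    by (auto intro!: derivative_eq_intros)
  have "(\<phi> has_derivative (\<lambda>(h, s). P \<bullet> h + Q * s)) (at (x, t) within range (\<lambda>x. (x, t)))"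
    by (rule has_derivative_subset[OF assms(1)]) (use assms in \<open>auto simp: QT_def\<close>)
  from has_derivative_in_compose[OF 1 this] show ?thesis by simp
qed

text \<open>At the final time the time derivative is one-sided; it is unique nevertheless, because
  every \<open>t\<close> in \<open>{0<..T}\<close> is a limit point of this interval.\<close>

lemma has_derivative_QT_unique:
  fixes \<phi> :: "(real^'n) \<times> real \<Rightarrow> real"
  assumes "(\<phi> has_derivative (\<lambda>(h, s). P \<bullet> h + Q * s)) (at (x, t) within QT T)"
    and "(\<phi> has_derivative (\<lambda>(h, s). P' \<bullet> h + Q' * s)) (at (x, t) within QT T)" and t: "0 < t" "t \<le> T"
  shows "P = P'" "Q = Q'"
proof -
  show "P = P'"
    by (rule gradient_unique[OF has_derivative_QT_space[OF assms(1) t] has_derivative_QT_space[OF assms(2) t]])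
  have time: "((\<lambda>s. \<phi> (x, s)) has_vector_derivative R) (at t within {0<..T})"
    if d: "(\<phi> has_derivative (\<lambda>(h, s). S \<bullet> h + R * s)) (at (x, t) within QT T)" for S R
  proof -
    have 1: "((\<lambda>s. (x, s)) has_derivative (\<lambda>h. (0, h))) (at t within {0<..T})"
      by (auto intro!: derivative_eq_intros)
    have "(\<phi> has_derivative (\<lambda>(h, s). S \<bullet> h + R * s)) (at (x, t) within (\<lambda>s. (x, s)) ` {0<..T})"
      by (rule has_derivative_subset[OF d]) (auto simp: QT_def)
    from has_derivative_in_compose[OF 1 this] show ?thesis
      by (simp add: has_vector_derivative_def mult.commute)
  qed
  have "t islimpt {0<..T}"
  proof (rule connected_imp_perfect)
    show "{0<..T} \<noteq> {a}" for a
    proof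
      assume "{0<..T} = {a}"
      moreover have "t \<in> {0<..T}" "t / 2 \<in> {0<..T}" using t by auto
      ultimately have "t / 2 = t" by (metis singletonD)
      then show False using t by simp
    qed
  qed (use t in auto)
  then have "at t within {0<..T} \<noteq> bot" by (simp add: trivial_limit_within)
  from vector_derivative_unique_within[OF this time[OF assms(1)] time[OF assms(2)]] show "Q = Q'" .
qed

lemma lipschitz_of_gradient_bound:
  fixes f :: "'a::euclidean_space \<Rightarrow> real"
  assumes "\<And>x. x \<in> cball x0 r \<Longrightarrow> (f has_derivative (\<lambda>h. g x \<bullet> h)) (at x)"
    and "\<And>x. x \<in> cball x0 r \<Longrightarrow> norm (g x) \<le> A"
    and "x \<in> cball x0 r" "y \<in> cball x0 r"
  shows "\<bar>f x - f y\<bar> \<le> A * norm (x - y)"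
proof -
  have "norm (f x - f y) \<le> A * norm (x - y)"
  proof (rule differentiable_bound[OF convex_cball _ _ assms(3,4)])
    show "(f has_derivative (\<lambda>h. g z \<bullet> h)) (at z within cball x0 r)" if "z \<in> cball x0 r" for z
      using assms(1)[OF that] by (rule has_derivative_at_withinI)
    show "onorm (\<lambda>h. g z \<bullet> h) \<le> A" if "z \<in> cball x0 r" for z
    proof (rule onorm_le)
      fix h
      have "norm (g z \<bullet> h) \<le> norm (g z) * norm h" by (rule Cauchy_Schwarz_ineq2[unfolded real_norm_def[symmetric]])
      also have "\<dots> \<le> A * norm h" using assms(2)[OF that] by (intro mult_right_mono) auto
      finally show "norm (g z \<bullet> h) \<le> A * norm h" .
    qed
  qed
  then show ?thesis by simp
qed

text \<open>\<open>upper\<close> and \<open>freq\<close> together say that \<open>ub\<close> is the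
  pointwise limsup of the family as \<epsilon> tends to 0. Under equicontinuity it agrees with the
  half-relaxed upper limit, since nearby points contribute nothing new.\<close>

lemma upper_relaxed_equicontinuous:
  fixes u :: "real \<Rightarrow> 'a::metric_space \<Rightarrow> real"
  assumes equi: "\<And>\<eta>. 0 < \<eta> \<Longrightarrow> \<exists>\<tau>>0. \<forall>\<epsilon>>0. \<forall>w\<in>S. \<forall>w'\<in>S. dist w w' \<le> \<tau> \<longrightarrow> \<bar>u \<epsilon> w - u \<epsilon> w'\<bar> \<le> \<eta>"
    and upper: "\<And>w \<eta>. w \<in> S \<Longrightarrow> 0 < \<eta> \<Longrightarrow> \<exists>e>0. \<forall>\<epsilon>. 0 < \<epsilon> \<and> \<epsilon> < e \<longrightarrow> u \<epsilon> w \<le> ub w + \<eta>"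
    and freq: "\<And>w \<eta> e. w \<in> S \<Longrightarrow> 0 < \<eta> \<Longrightarrow> 0 < e \<Longrightarrow> \<exists>\<epsilon>. 0 < \<epsilon> \<and> \<epsilon> < e \<and> ub w - \<eta> \<le> u \<epsilon> w"
    and "0 < \<eta>"
  shows "\<exists>\<tau>>0. \<forall>w\<in>S. \<forall>w'\<in>S. dist w w' \<le> \<tau> \<longrightarrow> \<bar>ub w - ub w'\<bar> \<le> \<eta>"
proof -
  obtain \<tau> where \<tau>: "0 < \<tau>" "\<And>\<epsilon> w w'. 0 < \<epsilon> \<Longrightarrow> w \<in> S \<Longrightarrow> w' \<in> S \<Longrightarrow> dist w w' \<le> \<tau> \<Longrightarrow> \<bar>u \<epsilon> w - u \<epsilon> w'\<bar> \<le> \<eta> / 3"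
    using equi[of "\<eta> / 3"] \<open>0 < \<eta>\<close> by (metis zero_less_divide_iff zero_less_numeral)
  have le: "ub w \<le> ub w' + \<eta>" if w: "w \<in> S" "w' \<in> S" "dist w w' \<le> \<tau>" for w w'
  proof -
    obtain e where e: "0 < e" "\<And>\<epsilon>. 0 < \<epsilon> \<Longrightarrow> \<epsilon> < e \<Longrightarrow> u \<epsilon> w' \<le> ub w' + \<eta> / 3"
      using upper[OF w(2), of "\<eta> / 3"] \<open>0 < \<eta>\<close> by auto
    obtain \<epsilon> where \<epsilon>: "0 < \<epsilon>" "\<epsilon> < e" "ub w - \<eta> / 3 \<le> u \<epsilon> w"
      using freq[OF w(1) _ e(1), of "\<eta> / 3"] \<open>0 < \<eta>\<close> by auto
    show ?thesis using e(2)[OF \<epsilon>(1,2)] \<epsilon>(3) \<tau>(2)[OF \<epsilon>(1) w] by linarith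
  qed
  have "\<bar>ub w - ub w'\<bar> \<le> \<eta>" if "w \<in> S" "w' \<in> S" "dist w w' \<le> \<tau>" for w w'
    using le[of w w'] le[of w' w] that by (simp add: dist_commute abs_le_iff)
  then show ?thesis using \<tau>(1) by blast
qed

text \<open>A finite net and equicontinuity make the pointwise upper bound uniform on compact sets.
  Applied to the family and to its negative this yields locally uniform convergence.\<close>

lemma upper_relaxed_uniform:
  fixes u :: "real \<Rightarrow> 'a::metric_space \<Rightarrow> real"
  assumes equi: "\<And>\<eta>. 0 < \<eta> \<Longrightarrow> \<exists>\<tau>>0. \<forall>\<epsilon>>0. \<forall>w\<in>S. \<forall>w'\<in>S. dist w w' \<le> \<tau> \<longrightarrow> \<bar>u \<epsilon> w - u \<epsilon> w'\<bar> \<le> \<eta>"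
    and upper: "\<And>w \<eta>. w \<in> S \<Longrightarrow> 0 < \<eta> \<Longrightarrow> \<exists>e>0. \<forall>\<epsilon>. 0 < \<epsilon> \<and> \<epsilon> < e \<longrightarrow> u \<epsilon> w \<le> ub w + \<eta>"
    and freq: "\<And>w \<eta> e. w \<in> S \<Longrightarrow> 0 < \<eta> \<Longrightarrow> 0 < e \<Longrightarrow> \<exists>\<epsilon>. 0 < \<epsilon> \<and> \<epsilon> < e \<and> ub w - \<eta> \<le> u \<epsilon> w"
    and "0 < \<eta>" and C: "compact C" "C \<subseteq> S"
  shows "\<exists>e>0. \<forall>\<epsilon>. 0 < \<epsilon> \<and> \<epsilon> < e \<longrightarrow> (\<forall>w\<in>C. u \<epsilon> w \<le> ub w + \<eta>)"
proof -
  have \<eta>3: "0 < \<eta> / 3" using \<open>0 < \<eta>\<close> by simp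
  obtain \<tau>1 where \<tau>1: "0 < \<tau>1" "\<And>\<epsilon> w w'. 0 < \<epsilon> \<Longrightarrow> w \<in> S \<Longrightarrow> w' \<in> S \<Longrightarrow> dist w w' \<le> \<tau>1 \<Longrightarrow> \<bar>u \<epsilon> w - u \<epsilon> w'\<bar> \<le> \<eta> / 3"
    using equi[OF \<eta>3] by blast
  obtain \<tau>2 where \<tau>2: "0 < \<tau>2" "\<And>w w'. w \<in> S \<Longrightarrow> w' \<in> S \<Longrightarrow> dist w w' \<le> \<tau>2 \<Longrightarrow> \<bar>ub w - ub w'\<bar> \<le> \<eta> / 3"
    using upper_relaxed_equicontinuous[of S u ub, OF equi upper freq \<eta>3] by blast
  define \<tau> where "\<tau> = min \<tau>1 \<tau>2"
  have \<tau>: "0 < \<tau>" using \<tau>1 \<tau>2 unfolding \<tau>_def by simp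
  have "C \<subseteq> (\<Union>w\<in>C. ball w \<tau>)" using \<tau> by auto
  then obtain D where D: "D \<subseteq> C" "finite D" "C \<subseteq> (\<Union>w\<in>D. ball w \<tau>)"
    using compactE_image[OF C(1), of C "\<lambda>w. ball w \<tau>"] by auto
  have "\<exists>e>0. \<forall>\<epsilon>. 0 < \<epsilon> \<and> \<epsilon> < e \<longrightarrow> (\<forall>w\<in>D. u \<epsilon> w \<le> ub w + \<eta> / 3)"
    using D(2,1)
  proof (induction D rule: finite_induct)
    case empty
    show ?case by (auto intro: exI[of _ 1])
  next
    case (insert w D)
    then obtain e1 where e1: "0 < e1" "\<forall>\<epsilon>. 0 < \<epsilon> \<and> \<epsilon> < e1 \<longrightarrow> (\<forall>w\<in>D. u \<epsilon> w \<le> ub w + \<eta> / 3)" by auto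
    obtain e2 where e2: "0 < e2" "\<forall>\<epsilon>. 0 < \<epsilon> \<and> \<epsilon> < e2 \<longrightarrow> u \<epsilon> w \<le> ub w + \<eta> / 3"
      using upper[OF _ \<eta>3, of w] insert.prems C(2) by auto
    show ?case using e1 e2 by (intro exI[of _ "min e1 e2"]) auto
  qed
  then obtain e where e: "0 < e" "\<And>\<epsilon> w. 0 < \<epsilon> \<Longrightarrow> \<epsilon> < e \<Longrightarrow> w \<in> D \<Longrightarrow> u \<epsilon> w \<le> ub w + \<eta> / 3" by auto
  have "u \<epsilon> w \<le> ub w + \<eta>" if \<epsilon>: "0 < \<epsilon>" "\<epsilon> < e" and w: "w \<in> C" for \<epsilon> w
  proof -
    obtain w' where w': "w' \<in> D" "dist w w' < \<tau>" using D(3) w by (auto simp: dist_commute)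
    have "w \<in> S" "w' \<in> S" using w w' D C by auto
    then have "\<bar>u \<epsilon> w - u \<epsilon> w'\<bar> \<le> \<eta> / 3" "\<bar>ub w - ub w'\<bar> \<le> \<eta> / 3"
      using \<tau>1(2)[OF \<epsilon>(1), of w w'] \<tau>2(2)[of w w'] w'(2) unfolding \<tau>_def by auto
    then show ?thesis using e(2)[OF \<epsilon> w'(1)] by linarith
  qed
  then show ?thesis using e(1) by blast
qed

context levy_kernel
begin

lemma set_integrable_near:
  assumes [measurable]: "f \<in> borel_measurable lebesgue" and S[measurable]: "S \<in> sets lebesgue"
    and "S \<subseteq> ball 0 1" and bd: "\<And>z. z \<in> S \<Longrightarrow> \<bar>f z\<bar> \<le> A * norm z"
  shows "set_integrable lebesgue S (\<lambda>z. f z * K z)"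
proof (rule set_integrable_bound)
  show "set_integrable lebesgue S (\<lambda>z. min (\<bar>A\<bar> * norm z) \<bar>A\<bar> * K z)"
    by (intro levy_mass_set_integrable) auto
  show "set_borel_measurable lebesgue S (\<lambda>z. f z * K z)"
    unfolding set_borel_measurable_def by measurable
  show "AE z in lebesgue. z \<in> S \<longrightarrow> norm (f z * K z) \<le> norm (min (\<bar>A\<bar> * norm z) \<bar>A\<bar> * K z)"
  proof (intro AE_I2 impI)
    fix z assume z: "z \<in> S"
    have n: "norm z \<le> 1" using z assms(3) by auto
    have "\<bar>f z\<bar> \<le> A * norm z" by (rule bd[OF z])
    also have "\<dots> \<le> \<bar>A\<bar> * norm z" by (intro mult_right_mono) auto
    finally have "\<bar>f z\<bar> \<le> min (\<bar>A\<bar> * norm z) \<bar>A\<bar>" using mult_left_mono[OF n, of "\<bar>A\<bar>"] by simp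
    then have "\<bar>f z\<bar> * K z \<le> min (\<bar>A\<bar> * norm z) \<bar>A\<bar> * K z"
      using K_nonneg by (intro mult_right_mono) auto
    also have "\<dots> \<le> norm (min (\<bar>A\<bar> * norm z) \<bar>A\<bar> * K z)" by simp
    finally show "norm (f z * K z) \<le> norm (min (\<bar>A\<bar> * norm z) \<bar>A\<bar> * K z)"
      using K_nonneg[of z] by (simp add: abs_mult)
  qed
qed

text \<open>In the application \<open>\<delta>'\<close> shrinks with \<epsilon>, \<delta> belongs to
  the limiting test function, and the intermediate radius \<open>s\<close> is independent of
  \<epsilon>. Within \<open>s\<close> one-sided linear bounds cost three small terms: one each for
  \<open>f\<close>, \<open>u\<close> and \<open>- g\<close>. Between \<open>s\<close> and \<delta>
  the touching condition replaces \<open>v\<close> by \<open>g\<close>, and beyond \<open>s\<close>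
  the increments \<open>u\<close> and \<open>v\<close> are compared directly.\<close>

lemma nonlocal_terms_le:
  fixes f g u v :: "real^'n \<Rightarrow> real"
  assumes s: "0 < s" "s \<le> \<delta>" "\<delta> \<le> 1" and \<delta>': "0 < \<delta>'" "\<delta>' \<le> s"
    and meas: "g \<in> borel_measurable lebesgue" "u \<in> borel_measurable lebesgue" "v \<in> borel_measurable lebesgue"
    and bd: "\<And>z. \<bar>u z\<bar> \<le> M" "\<And>z. \<bar>v z\<bar> \<le> M"
    and "0 \<le> P" "0 \<le> A" "0 \<le> B"
    and f: "\<And>z. norm z < \<delta>' \<Longrightarrow> f z \<le> P * norm z"
    and uP: "\<And>z. norm z < s \<Longrightarrow> u z \<le> P * norm z"
    and g: "\<And>z. norm z < s \<Longrightarrow> - (P * norm z) \<le> g z" "\<And>z. norm z < \<delta> \<Longrightarrow> \<bar>g z\<bar> \<le> G * norm z"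
    and vg: "\<And>z. norm z < \<delta> \<Longrightarrow> v z \<le> g z"
    and uv: "\<And>z. s \<le> norm z \<Longrightarrow> u z - v z \<le> min (A * norm z) B"
  shows "(LINT z:ball 0 \<delta>'|lebesgue. f z * K z) + (LINT z:- ball 0 \<delta>'|lebesgue. u z * K z)
    \<le> (LINT z:ball 0 \<delta>|lebesgue. g z * K z) + (LINT z:- ball 0 \<delta>|lebesgue. v z * K z)
      + (3 * levy_mass P (P * s) + levy_mass A B)"
proof -
  define S where "S = ball (0::real^'n) s"
  define D where "D = ball (0::real^'n) \<delta>"
  define D' where "D' = ball (0::real^'n) \<delta>'"
  have meas_sets: "S \<in> sets lebesgue" "D \<in> sets lebesgue" "D' \<in> sets lebesgue"
    "- S \<in> sets lebesgue" "- D \<in> sets lebesgue" "- D' \<in> sets lebesgue"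
    using Compl_in_sets_lebesgue by (auto simp: S_def D_def D'_def)
  have diff_sets: "S - D' \<in> sets lebesgue" "D - S \<in> sets lebesgue" using meas_sets by auto
  have sub: "D' \<subseteq> S" "S \<subseteq> D" using s \<delta>' by (auto simp: S_def D_def D'_def)
  have far: "set_integrable lebesgue E (\<lambda>z. w z * K z)"
    if "E \<in> sets lebesgue" "w = u \<or> w = v" "\<And>z. z \<in> E \<Longrightarrow> \<delta>' \<le> norm z" for E w
    by (rule set_integrable_bounded_far[where B = M and \<delta> = \<delta>']) (use that meas bd \<delta>' in auto)
  have near: "set_integrable lebesgue E (\<lambda>z. g z * K z)" if "E \<in> sets lebesgue" "E \<subseteq> D" for E
    by (rule set_integrable_near[where A = G]) (use that meas g(2) s in \<open>auto simp: D_def\<close>)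
  have Ps: "P * norm z \<le> min (P * norm z) (P * s)" if "norm z < s" for z :: "real^'n"
    using mult_left_mono[of "norm z" s P] that \<open>0 \<le> P\<close> by simp
  have nn: "0 \<le> P * s" using \<open>0 \<le> P\<close> s by simp
  have 1: "(LINT z:D'|lebesgue. f z * K z) \<le> levy_mass P (P * s)"
    by (rule set_integral_le_levy_mass'[OF meas_sets(3) \<open>0 \<le> P\<close> nn])
      (use f Ps \<delta>' in \<open>force simp: D'_def intro: order_trans\<close>)
  have 2: "(LINT z:S - D'|lebesgue. u z * K z) \<le> levy_mass P (P * s)"
    by (rule set_integral_le_levy_mass'[OF diff_sets(1) \<open>0 \<le> P\<close> nn])
      (use uP Ps in \<open>force simp: S_def intro: order_trans\<close>)
  have 3: "(LINT z:S|lebesgue. - g z * K z) \<le> levy_mass P (P * s)"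
  proof (rule set_integral_le_levy_mass'[OF meas_sets(1) \<open>0 \<le> P\<close> nn])
    fix z assume "z \<in> S"
    then have "norm z < s" by (simp add: S_def)
    then show "- g z \<le> min (P * norm z) (P * s)" using g(1)[of z] Ps[of z] by linarith
  qed
  have neg: "(LINT z:S|lebesgue. - g z * K z) = - (LINT z:S|lebesgue. g z * K z)"
    unfolding set_lebesgue_integral_def by simp
  have split_u: "(LINT z:- D'|lebesgue. u z * K z) = (LINT z:S - D'|lebesgue. u z * K z) + (LINT z:- S|lebesgue. u z * K z)"
  proof -
    have "- D' = (S - D') \<union> - S" using sub by auto
    then show ?thesis
      using set_integral_Un[of "S - D'" "- S" lebesgue "\<lambda>z. u z * K z"]
        far[OF diff_sets(1), of u] far[OF meas_sets(4), of u] \<delta>'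
      by (auto simp: S_def D'_def)
  qed
  have split_v: "(LINT z:- S|lebesgue. v z * K z) = (LINT z:D - S|lebesgue. v z * K z) + (LINT z:- D|lebesgue. v z * K z)"
  proof -
    have "- S = (D - S) \<union> - D" using sub by auto
    then show ?thesis
      using set_integral_Un[of "D - S" "- D" lebesgue "\<lambda>z. v z * K z"]
        far[OF diff_sets(2), of v] far[OF meas_sets(5), of v] \<delta>' s
      by (auto simp: S_def D_def)
  qed
  have split_g: "(LINT z:D|lebesgue. g z * K z) = (LINT z:S|lebesgue. g z * K z) + (LINT z:D - S|lebesgue. g z * K z)"
  proof -
    have "D = S \<union> (D - S)" using sub by auto
    then show ?thesis
      using set_integral_Un[of S "D - S" lebesgue "\<lambda>z. g z * K z"] near[OF meas_sets(1) sub(2)] near[OF diff_sets(2)]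
      by auto
  qed
  have 4: "(LINT z:D - S|lebesgue. v z * K z) \<le> (LINT z:D - S|lebesgue. g z * K z)"
  proof (rule set_integral_mono)
    show "set_integrable lebesgue (D - S) (\<lambda>z. v z * K z)"
      by (rule far[OF diff_sets(2)]) (use \<delta>' in \<open>auto simp: S_def\<close>)
    show "set_integrable lebesgue (D - S) (\<lambda>z. g z * K z)" by (rule near[OF diff_sets(2)]) auto
    show "v z * K z \<le> g z * K z" if "z \<in> D - S" for z
      using vg[of z] that K_nonneg by (intro mult_right_mono) (auto simp: D_def)
  qed
  have 5: "(LINT z:- S|lebesgue. u z * K z) - (LINT z:- S|lebesgue. v z * K z) \<le> levy_mass A B"
  proof -
    have "(LINT z:- S|lebesgue. u z * K z) - (LINT z:- S|lebesgue. v z * K z)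
      = (LINT z:- S|lebesgue. u z * K z - v z * K z)"
      using far[OF meas_sets(4), of u] far[OF meas_sets(4), of v] \<delta>'
      by (intro set_integral_diff(2)[symmetric]) (auto simp: S_def)
    also have "\<dots> = (LINT z:- S|lebesgue. (u z - v z) * K z)" by (simp add: left_diff_distrib)
    also have "\<dots> \<le> levy_mass A B"
      by (rule set_integral_le_levy_mass'[OF meas_sets(4) \<open>0 \<le> A\<close> \<open>0 \<le> B\<close>]) (use uv in \<open>auto simp: S_def\<close>)
    finally show ?thesis .
  qed
  show ?thesis
    using 1 2 3 neg 4 5 split_u split_v split_g unfolding S_def D_def D'_def by linarith
qed

end

context levy_kernel
begin

lemma borel_measurable_lebesgue_continuous:
  fixes f :: "real^'n \<Rightarrow> real"
  shows "continuous_on UNIV f \<Longrightarrow> f \<in> borel_measurable lebesgue"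
  by (intro measurable_completion) (simp add: borel_measurable_continuous_onI)

text \<open>The corrector is only Lipschitz, so it cannot be part of a test function; the variable \<^term>\<open>y = x + d\<close>
  of the corrector is doubled instead.\<close>
lemma perturbed_test_function:
  fixes a :: "real^'n \<Rightarrow> real^'n \<Rightarrow> real" and H :: "real^'n \<Rightarrow> real^'n \<Rightarrow> real^'n \<Rightarrow> real"
  assumes "0 < T" and a_bounds: "\<And>x y. 0 \<le> a x y" "\<And>x y. a x y \<le> amax"
    and a_uc: "\<And>\<eta>. 0 < \<eta> \<Longrightarrow> \<exists>\<kappa>>0. \<forall>x x' y y'. norm (x - x') \<le> \<kappa> \<longrightarrow> norm (y - y') \<le> \<kappa> \<longrightarrow>
          \<bar>a x y - a x' y'\<bar> \<le> \<eta>"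
    and H_uc: "\<And>R \<eta>. 0 < \<eta> \<Longrightarrow> \<exists>\<kappa>>0. \<forall>x x' y y' p p'. norm p \<le> R \<longrightarrow> norm p' \<le> R \<longrightarrow>
          norm (x - x') \<le> \<kappa> \<longrightarrow> norm (y - y') \<le> \<kappa> \<longrightarrow> norm (p - p') \<le> \<kappa> \<longrightarrow> \<bar>H x y p - H x' y' p'\<bar> \<le> \<eta>"
    and sub: "\<And>\<epsilon>. 0 < \<epsilon> \<Longrightarrow> viscosity_subsolution T K
          (\<lambda>x p l. - a x (inverse \<epsilon> *\<^sub>R x) * l + H x (inverse \<epsilon> *\<^sub>R x) p) (u \<epsilon>)"
    and cont: "\<And>\<epsilon>. 0 < \<epsilon> \<Longrightarrow> continuous_on (QT_bar T) (u \<epsilon>)"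
    and M: "\<And>\<epsilon> w. 0 < \<epsilon> \<Longrightarrow> w \<in> QT_bar T \<Longrightarrow> \<bar>u \<epsilon> w\<bar> \<le> M"
    and equi: "\<And>\<eta>. 0 < \<eta> \<Longrightarrow> \<exists>\<tau>>0. \<forall>\<epsilon>>0. \<forall>w\<in>QT_bar T. \<forall>w'\<in>QT_bar T. dist w w' \<le> \<tau> \<longrightarrow> \<bar>u \<epsilon> w - u \<epsilon> w'\<bar> \<le> \<eta>"
    and upper: "\<And>w \<eta>. w \<in> QT_bar T \<Longrightarrow> 0 < \<eta> \<Longrightarrow> \<exists>e>0. \<forall>\<epsilon>. 0 < \<epsilon> \<and> \<epsilon> < e \<longrightarrow> u \<epsilon> w \<le> ub w + \<eta>"
    and freq: "\<And>w \<eta> e. w \<in> QT_bar T \<Longrightarrow> 0 < \<eta> \<Longrightarrow> 0 < e \<Longrightarrow> \<exists>\<epsilon>. 0 < \<epsilon> \<and> \<epsilon> < e \<and> ub w - \<eta> \<le> u \<epsilon> w"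
    and cell: "\<And>x p l. cell_problem_solvable a H x p l (Hb x p l)"
  shows "viscosity_subsolution T K Hb ub"
proof -
  have ub_equi: "\<exists>\<tau>>0. \<forall>w\<in>QT_bar T. \<forall>w'\<in>QT_bar T. dist w w' \<le> \<tau> \<longrightarrow> \<bar>ub w - ub w'\<bar> \<le> \<eta>" if "0 < \<eta>" for \<eta>
    by (rule upper_relaxed_equicontinuous[of "QT_bar T" u ub, OF equi upper freq that])
  have ub_unif: "\<exists>e>0. \<forall>\<epsilon>. 0 < \<epsilon> \<and> \<epsilon> < e \<longrightarrow> (\<forall>w\<in>C. u \<epsilon> w \<le> ub w + \<eta>)"
    if "0 < \<eta>" "compact C" "C \<subseteq> QT_bar T" for \<eta> C
    by (rule upper_relaxed_uniform[of "QT_bar T" u ub, OF equi upper freq that])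
  have ub_cont: "continuous_on (QT_bar T) ub"
    unfolding continuous_on_iff
  proof (intro ballI allI impI)
    fix w :: "(real^'n) \<times> real" and e :: real assume w: "w \<in> QT_bar T" and "0 < e"
    then obtain \<tau> where "0 < \<tau>" "\<forall>w\<in>QT_bar T. \<forall>w'\<in>QT_bar T. dist w w' \<le> \<tau> \<longrightarrow> \<bar>ub w - ub w'\<bar> \<le> e / 2"
      using ub_equi[of "e / 2"] by auto
    then show "\<exists>d>0. \<forall>w'\<in>QT_bar T. dist w' w < d \<longrightarrow> dist (ub w') (ub w) < e"
      using w \<open>0 < e\<close> by (intro exI[of _ \<tau>]) (force simp: dist_real_def)
  qed
  have ubM: "\<bar>ub w\<bar> \<le> M" if w: "w \<in> QT_bar T" for w
  proof -
    have "ub w \<le> M + e" if "0 < e" for e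
      using freq[OF w that zero_less_one] M[OF _ w] by (smt (verit))
    moreover have "- M \<le> ub w + e" if e: "0 < e" for e
    proof -
      obtain e' where "0 < e'" "\<forall>\<epsilon>. 0 < \<epsilon> \<and> \<epsilon> < e' \<longrightarrow> u \<epsilon> w \<le> ub w + e" using upper[OF w e] by blast
      then have "u (e' / 2) w \<le> ub w + e" "0 < e' / 2" by auto
      then show ?thesis using M[OF \<open>0 < e' / 2\<close> w] by linarith
    qed
    ultimately have "ub w \<le> M" "- M \<le> ub w" by (auto intro: field_le_epsilon)
    then show ?thesis by simp
  qed
  have M0: "0 \<le> M" using ubM[of "(0, 0)"] \<open>0 < T\<close> by (force simp: QT_bar_def)
  have QT_sub: "(QT T :: ((real^'n) \<times> real) set) \<subseteq> QT_bar T" by (auto simp: QT_def QT_bar_def)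
  show ?thesis
    unfolding viscosity_subsolution_def
  proof (intro conjI allI impI)
    show "bounded (ub ` QT T)"
      using ubM QT_sub unfolding bounded_iff by (intro exI[of _ M]) auto
    show "upper_semicontinuous_on (QT T) ub"
      unfolding upper_semicontinuous_on_def
    proof (intro ballI allI impI)
      fix w c assume "w \<in> QT T" "ub w < c"
      moreover have "(ub \<longlongrightarrow> ub w) (at w within QT T)"
        using continuous_on_subset[OF ub_cont QT_sub] \<open>w \<in> QT T\<close> unfolding continuous_on_def by blast
      ultimately show "\<forall>\<^sub>F y in at w within QT T. ub y < c" by (intro order_tendstoD)
    qed
    fix x0 t0 \<phi> \<delta> p q
    assume w0: "(x0, t0) \<in> QT T" and \<phi>: "C2_on (QT T) \<phi>" and \<delta>: "0 < \<delta>" "\<delta> < 1"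
      and pq: "(\<phi> has_derivative (\<lambda>(h, s). p \<bullet> h + q * s)) (at (x0, t0) within QT T)"
      and touch: "\<forall>w\<in>ball x0 \<delta> \<times> {t0 - \<delta><..<t0 + \<delta>} \<inter> QT T. ub w - \<phi> w \<le> ub (x0, t0) - \<phi> (x0, t0)"
    define l0 where "l0 = nonlocal_on (ball 0 \<delta>) K \<phi> x0 t0 + nonlocal_on (- ball 0 \<delta>) K ub x0 t0"
    have t0: "0 < t0" "t0 \<le> T" using w0 by (auto simp: QT_def)
    have w0': "(x0, t0) \<in> QT_bar T" using w0 QT_sub by auto
    show "q + Hb x0 p l0 \<le> 0"
    proof (rule ccontr)
      assume "\<not> q + Hb x0 p l0 \<le> 0"
      define c where "c = Hb x0 p l0"
      \<comment> \<open>The gap is shared out: the time derivative, \<open>H\<close>, the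
        coefficient \<open>a\<close> and the nonlocal term lose at most \<theta> each, four sixths
        in all.\<close>
      define \<theta> where "\<theta> = (q + c) / 6"
      have \<theta>: "0 < \<theta>" "q + c = 6 * \<theta>" using \<open>\<not> q + Hb x0 p l0 \<le> 0\<close> unfolding \<theta>_def c_def by auto
      obtain \<psi> L' where \<psi>: "Z_periodic \<psi>" "L'-lipschitz_on UNIV \<psi>"
        "viscosity_solution_first_order (\<lambda>y r. - a x0 y * l0 + H x0 y (p + r) - c) \<psi>"
        using cell[of x0 p l0] unfolding cell_problem_solvable_def c_def by blast
      define L where "L = L' + 1"
      have L: "0 < L" using lipschitz_on_nonneg[OF \<psi>(2)] unfolding L_def by simp
      have \<psi>lip: "\<psi> x - \<psi> y \<le> L * norm (x - y)" for x y
      proof -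
        have "\<psi> x - \<psi> y \<le> L' * norm (x - y)"
          using lipschitz_onD[OF \<psi>(2), of x y] by (simp add: dist_norm)
        also have "\<dots> \<le> L * norm (x - y)" unfolding L_def by (intro mult_right_mono) auto
        finally show ?thesis .
      qed
      have \<psi>cont: "continuous_on UNIV \<psi>" by (rule lipschitz_on_continuous_on[OF \<psi>(2)])
      have super: "fo_sub (fo_dual (\<lambda>y r. - a x0 y * l0 + H x0 y (p + r) - c)) (\<lambda>y. - \<psi> y)"
        using \<psi>(3) unfolding viscosity_solution_first_order_iff by blast
      obtain B where B: "0 < B" "\<And>y. \<bar>\<psi> y\<bar> \<le> B"
      proof -
        have "Z_periodic (\<lambda>y. \<bar>\<psi> y\<bar>)" using \<psi>(1) by (simp add: Z_periodic_def)
        then obtain y where y: "\<And>z. \<bar>\<psi> z\<bar> \<le> \<bar>\<psi> y\<bar>"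
          using Z_periodic_attains_sup[of "\<lambda>y. \<bar>\<psi> y\<bar>"] \<psi>cont by (auto intro: continuous_intros)
        have "\<bar>\<psi> z\<bar> \<le> \<bar>\<psi> y\<bar> + 1" for z using y[of z] by simp
        then show ?thesis using that[of "\<bar>\<psi> y\<bar> + 1"] by simp
      qed
      have amax0: "0 \<le> amax" using a_bounds(1)[of 0 0] a_bounds(2)[of 0 0] by linarith
      \<comment> \<open>An error of this size in the nonlocal term costs at most \<theta> after
        multiplication by \<open>a\<close>; \<open>\<theta>a\<close> plays the same role for the
        variation of \<open>a\<close>, which is multiplied by \<open>l0\<close>.\<close>
      define \<theta>' where "\<theta>' = \<theta> / (amax + 1)"
      have \<theta>': "0 < \<theta>'" "amax * \<theta>' \<le> \<theta>"
      proof -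
        show "0 < \<theta>'" using \<theta>(1) amax0 by (simp add: \<theta>'_def)
        have "amax * \<theta>' = (amax / (amax + 1)) * \<theta>" by (simp add: \<theta>'_def)
        also have "\<dots> \<le> 1 * \<theta>" using amax0 \<theta>(1) by (intro mult_right_mono) auto
        finally show "amax * \<theta>' \<le> \<theta>" by simp
      qed
      define \<theta>a where "\<theta>a = \<theta> / (\<bar>l0\<bar> + 1)"
      have \<theta>a: "0 < \<theta>a" "\<theta>a * \<bar>l0\<bar> \<le> \<theta>"
      proof -
        show "0 < \<theta>a" using \<theta>(1) by (simp add: \<theta>a_def add_nonneg_pos)
        have "\<theta>a * \<bar>l0\<bar> = (\<bar>l0\<bar> / (\<bar>l0\<bar> + 1)) * \<theta>" by (simp add: \<theta>a_def)
        also have "\<dots> \<le> 1 * \<theta>" using \<theta>(1) by (intro mult_right_mono) auto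
        finally show "\<theta>a * \<bar>l0\<bar> \<le> \<theta>" by simp
      qed
      define Rp where "Rp = norm p + 2 * L + 1"
      obtain \<kappa>a where \<kappa>a: "0 < \<kappa>a" "\<And>x x' y y'. norm (x - x') \<le> \<kappa>a \<Longrightarrow> norm (y - y') \<le> \<kappa>a \<Longrightarrow> \<bar>a x y - a x' y'\<bar> \<le> \<theta>a"
        using a_uc[OF \<theta>a(1)] by blast
      obtain \<kappa>h where \<kappa>h: "0 < \<kappa>h" "\<And>x x' y y' p p'. norm p \<le> Rp \<Longrightarrow> norm p' \<le> Rp \<Longrightarrow>
          norm (x - x') \<le> \<kappa>h \<Longrightarrow> norm (y - y') \<le> \<kappa>h \<Longrightarrow> norm (p - p') \<le> \<kappa>h \<Longrightarrow> \<bar>H x y p - H x' y' p'\<bar> \<le> \<theta>"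
        using H_uc[OF \<theta>(1), of Rp] by blast
      define \<kappa> where "\<kappa> = min (min \<kappa>a \<kappa>h) (min 1 \<theta>)"
      have \<kappa>: "0 < \<kappa>" "\<kappa> \<le> \<kappa>a" "\<kappa> \<le> \<kappa>h" "\<kappa> \<le> 1" "\<kappa> \<le> \<theta>"
        using \<kappa>a(1) \<kappa>h(1) \<theta>(1) unfolding \<kappa>_def by auto
      obtain Pg Qg where g: "continuous_on (QT T) Pg" "continuous_on (QT T) Qg"
        "\<And>w. w \<in> QT T \<Longrightarrow> (\<phi> has_derivative (\<lambda>(h, s). Pg w \<bullet> h + Qg w * s)) (at w within QT T)"
        by (rule C2_on_QT_gradient[OF \<phi>]) (rule that)
      have g0: "Pg (x0, t0) = p" "Qg (x0, t0) = q"
        using has_derivative_QT_unique[OF g(3)[OF w0] pq t0] by auto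
      obtain \<rho>g where \<rho>g: "0 < \<rho>g" "\<And>w. w \<in> QT T \<Longrightarrow> dist w (x0, t0) < \<rho>g \<Longrightarrow> norm (Pg w - p) \<le> \<kappa> / 2 \<and> \<bar>Qg w - q\<bar> \<le> \<kappa> / 2"
      proof -
        obtain d1 where d1: "0 < d1" "\<forall>w\<in>QT T. dist w (x0, t0) < d1 \<longrightarrow> dist (Pg w) (Pg (x0, t0)) < \<kappa> / 2"
          using g(1) w0 \<kappa>(1) unfolding continuous_on_iff by (meson half_gt_zero)
        obtain d2 where d2: "0 < d2" "\<forall>w\<in>QT T. dist w (x0, t0) < d2 \<longrightarrow> dist (Qg w) (Qg (x0, t0)) < \<kappa> / 2"
          using g(2) w0 \<kappa>(1) unfolding continuous_on_iff by (meson half_gt_zero)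
        show ?thesis
          using d1 d2 g0 by (intro that[of "min d1 d2"]) (auto simp: dist_norm less_imp_le)
      qed
      define \<rho> where "\<rho> = min (min (\<delta> / 2) (t0 / 2)) (min (\<rho>g / 4) (\<kappa> / 8))"
      have \<rho>: "0 < \<rho>" "\<rho> < \<delta>" "\<rho> < t0" "2 * \<rho> < \<rho>g" "4 * \<rho> \<le> \<kappa> / 2"
        using \<delta> t0 \<rho>g(1) \<kappa>(1) unfolding \<rho>_def by auto
      \<comment> \<open>A slope that bounds the increments of the test function, including the
        quadratic from the doubling, and those of \<open>u \<epsilon>\<close> from above,
        independently of \<epsilon>.\<close>
      define P where "P = norm p + 2 * L + 4"
      have P: "0 < P" using L unfolding P_def by (simp add: add_nonneg_pos)
      \<comment> \<open>This radius is fixed before \<epsilon>. Inside it the relevant increments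
        have slope at most \<open>P\<close>, so their contribution is small uniformly in
        \<epsilon>.\<close>
      obtain s where s: "0 < s" "s \<le> \<rho> / 2" "levy_mass P (P * s) < \<theta>' / 4"
      proof -
        obtain b where b: "0 < b" "levy_mass P b < \<theta>' / 4"
          using levy_mass_small_right[of P "\<theta>' / 4"] P \<theta>'(1) by auto
        define s where "s = min (b / P) (\<rho> / 2)"
        have "P * s \<le> P * (b / P)" using P unfolding s_def by (intro mult_left_mono) auto
        then have "P * s \<le> b" using P by simp
        moreover have "0 < s" using b P \<rho> unfolding s_def by simp
        ultimately have "levy_mass P (P * s) \<le> levy_mass P b" using P by (intro levy_mass_mono) auto
        moreover have "s \<le> \<rho> / 2" unfolding s_def by (rule min.cobounded2)
        ultimately show ?thesis using that[of s] \<open>0 < s\<close> b(2) by linarith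
      qed
      define B4 where "B4 = 4 * M + 1"
      have B4: "0 < B4" using M0 unfolding B4_def by simp
      obtain A where A: "0 < A" "levy_mass A B4 < \<theta>' / 4"
        using levy_mass_small_left[of B4 "\<theta>' / 4"] B4 \<theta>'(1) by auto
      \<comment> \<open>Beyond \<open>s\<close> and within a large ball the increments will differ
        by at most \<open>4 * \<eta>\<close>, which has to lie below
        \<open>min (A * norm z) B4\<close>; there \<open>norm z \<ge> s\<close>.\<close>
      define \<eta> where "\<eta> = min (A * s / 4) (1 / 4)"
      have \<eta>: "0 < \<eta>" "4 * \<eta> \<le> A * s" "4 * \<eta> \<le> B4" using A(1) s(1) M0 unfolding \<eta>_def B4_def by auto
      obtain \<tau>1 where \<tau>1: "0 < \<tau>1" "\<And>\<epsilon> w w'. 0 < \<epsilon> \<Longrightarrow> w \<in> QT_bar T \<Longrightarrow> w' \<in> QT_bar T \<Longrightarrow> dist w w' \<le> \<tau>1 \<Longrightarrow> \<bar>u \<epsilon> w - u \<epsilon> w'\<bar> \<le> \<eta>"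
        using equi[OF \<eta>(1)] by blast
      obtain \<tau>2 where \<tau>2: "0 < \<tau>2" "\<And>w w'. w \<in> QT_bar T \<Longrightarrow> w' \<in> QT_bar T \<Longrightarrow> dist w w' \<le> \<tau>2 \<Longrightarrow> \<bar>ub w - ub w'\<bar> \<le> \<eta>"
        using ub_equi[OF \<eta>(1)] by blast
      define \<rho>1 where "\<rho>1 = min (\<rho> / 2) (min \<tau>1 \<tau>2 / 2)"
      have \<rho>1: "0 < \<rho>1" "\<rho>1 \<le> \<rho> / 2" "2 * \<rho>1 \<le> \<tau>1" "2 * \<rho>1 \<le> \<tau>2"
        using \<rho> \<tau>1 \<tau>2 unfolding \<rho>1_def by auto
      define \<eta>2 where "\<eta>2 = min \<eta> (\<rho>1\<^sup>2 / 4)"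
      have \<eta>2: "0 < \<eta>2" "\<eta>2 \<le> \<eta>" "3 * \<eta>2 < \<rho>1\<^sup>2"
        using \<eta>(1) \<rho>1(1) unfolding \<eta>2_def by (auto simp: min_def)
      \<comment> \<open>The upper bound by \<open>ub\<close> is uniform on compact sets only. Beyond
        \<open>Rb\<close> the crude bound \<open>4 * M\<close> for the difference of increments
        already lies below \<open>A * norm z\<close>.\<close>
      define Rb where "Rb = 4 * M / A + 1"
      have Rb: "0 < Rb" "4 * M \<le> A * Rb" using M0 A(1) unfolding Rb_def by (auto simp: field_simps add_nonneg_pos)
      define Cp where "Cp = cball x0 (Rb + 1) \<times> {0..T}"
      have Cp: "compact Cp" "Cp \<subseteq> QT_bar T" unfolding Cp_def by (auto simp: compact_Times QT_bar_def)
      obtain e0 where e0: "0 < e0" "\<And>\<epsilon> w. 0 < \<epsilon> \<Longrightarrow> \<epsilon> < e0 \<Longrightarrow> w \<in> Cp \<Longrightarrow> u \<epsilon> w \<le> ub w + \<eta>2"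
        using ub_unif[OF \<eta>2(1) Cp] by blast
      \<comment> \<open>\<open>freq\<close> provides arbitrarily small \<epsilon> for which
        \<open>u \<epsilon>\<close> nearly attains the limsup at the contact point; at this stage no
        limit is available.\<close>
      obtain \<epsilon> where \<epsilon>: "0 < \<epsilon>" "\<epsilon> < min (min e0 1) (\<eta>2 / (2 * B))" "ub (x0, t0) - \<eta>2 \<le> u \<epsilon> (x0, t0)"
        using freq[OF w0' \<eta>2(1), of "min (min e0 1) (\<eta>2 / (2 * B))"] e0(1) \<eta>2(1) B(1) by auto
      have \<epsilon>B: "2 * (\<epsilon> * B) \<le> \<eta>2" using \<epsilon>(2) B(1) by (simp add: field_simps)
      have up: "u \<epsilon> w \<le> ub w + \<eta>2" if "w \<in> Cp" for w using e0(2)[OF \<epsilon>(1) _ that] \<epsilon>(2) by simp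
      \<comment> \<open>In the fast variable the shift \<open>d / \<epsilon>\<close> has size at
        most \<kappa>. Since \<open>\<beta> * R = L\<close>, the quadratic outweighs the Lipschitz
        constant of the rescaled corrector beyond \<open>R\<close>, while its gradient on the ball
        of radius \<open>R\<close> is at most \<open>2 * L\<close>.\<close>
      define R where "R = \<kappa> * \<epsilon>"
      define \<beta> where "\<beta> = L / R"
      have R: "0 < R" "\<beta> * R = L" "0 < \<beta>" "R \<le> \<kappa>"
        using \<kappa> \<epsilon> L unfolding \<beta>_def R_def by (auto simp: mult_left_le)
      define I where "I = {t0 - \<rho>..min (t0 + \<rho>) T}"
      define \<Phi> where "\<Phi> = (\<lambda>(x, t, d). u \<epsilon> (x, t) - \<phi> (x, t) - ((norm (x - x0))\<^sup>2 + (t - t0)\<^sup>2)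
         - \<epsilon> * \<psi> (inverse \<epsilon> *\<^sub>R (x + d)) - \<beta> * (norm d)\<^sup>2)"
      have I: "t \<in> I \<Longrightarrow> 0 < t \<and> t \<le> T" for t using \<rho> unfolding I_def by auto
      have \<phi>cont: "continuous_on (QT T) \<phi>"
        by (rule C1_on_imp_continuous_on[OF C2_on_imp_C1_on[OF \<phi>]])
      have cont\<Phi>: "continuous_on (cball x0 \<rho> \<times> I \<times> cball 0 R) \<Phi>"
        unfolding \<Phi>_def case_prod_beta
        by (intro continuous_intros continuous_on_compose2[OF cont[OF \<epsilon>(1)]] continuous_on_compose2[OF \<phi>cont]
            continuous_on_compose2[OF \<psi>cont])
          (use I in \<open>auto simp: QT_bar_def QT_def less_imp_le\<close>)
      have "compact (cball x0 \<rho> \<times> I \<times> cball (0::real^'n) R)"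
        unfolding I_def by (intro compact_Times compact_cball compact_Icc)
      moreover have start: "(x0, t0, 0) \<in> cball x0 \<rho> \<times> I \<times> cball (0::real^'n) R"
        using \<rho> R(1) t0 by (auto simp: I_def)
      ultimately obtain m where m: "m \<in> cball x0 \<rho> \<times> I \<times> cball 0 R"
          "\<And>w. w \<in> cball x0 \<rho> \<times> I \<times> cball 0 R \<Longrightarrow> \<Phi> w \<le> \<Phi> m"
        using continuous_attains_sup[OF _ _ cont\<Phi>] by blast
      obtain x t d where xtd: "m = (x, t, d)" by (cases m)
      have xt: "x \<in> cball x0 \<rho>" "t \<in> I" "norm d \<le> R" using m(1) xtd by auto
      have t: "0 < t" "t \<le> T" using I[OF xt(2)] by auto
      have glob: "\<Phi> (x', t', d') \<le> \<Phi> (x, t, d)" if "x' \<in> cball x0 \<rho>" "t' \<in> I" for x' t' d'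
      proof (cases "norm d' \<le> R")
        case True
        then show ?thesis using m(2)[of "(x', t', d')"] that xtd by simp
      next
        case False
        have "\<epsilon> * (\<psi> (inverse \<epsilon> *\<^sub>R x') - \<psi> (inverse \<epsilon> *\<^sub>R (x' + d')))
            \<le> \<epsilon> * (L * norm (inverse \<epsilon> *\<^sub>R x' - inverse \<epsilon> *\<^sub>R (x' + d')))"
          using \<psi>lip \<epsilon>(1) by (intro mult_left_mono) auto
        also have "\<dots> = L * norm d'"
          using \<epsilon>(1) by (simp add: scaleR_right_diff_distrib[symmetric])
        also have "\<dots> \<le> \<beta> * (norm d')\<^sup>2"
        proof -
          have "(\<beta> * R) * norm d' \<le> (\<beta> * norm d') * norm d'"
            using False R(3) by (intro mult_right_mono mult_left_mono) auto
          then show ?thesis using R(2) by (simp add: power2_eq_square mult.assoc)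
        qed
        finally have "\<Phi> (x', t', d') \<le> \<Phi> (x', t', 0)" unfolding \<Phi>_def by (simp add: right_diff_distrib)
        also have "\<dots> \<le> \<Phi> (x, t, d)" using m(2)[of "(x', t', 0)"] that xtd R(1) by simp
        finally show ?thesis .
      qed
      \<comment> \<open>The added squares make the contact point strict. All errors sum up to at
        most \<open>3 * \<eta>2\<close>, which is below \<open>\<rho>1\<^sup>2\<close>, so the
        maximum is trapped near \<open>(x0, t0)\<close>.\<close>
      have close: "(norm (x - x0))\<^sup>2 + (t - t0)\<^sup>2 < \<rho>1\<^sup>2"
      proof -
        have "(x, t) \<in> Cp" using xt(1) t Rb(1) \<rho> \<delta> unfolding Cp_def by simp
        then have "u \<epsilon> (x, t) \<le> ub (x, t) + \<eta>2" by (rule up)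
        moreover have "ub (x, t) - \<phi> (x, t) \<le> ub (x0, t0) - \<phi> (x0, t0)"
          using touch xt(1,2) t \<rho>(2) by (force simp: I_def QT_def)
        moreover have "\<Phi> (x0, t0, 0) \<le> \<Phi> (x, t, d)" by (rule glob) (use start in auto)
        moreover have "\<bar>\<epsilon> * \<psi> y\<bar> \<le> \<epsilon> * B" for y using B(2) \<epsilon>(1) by (simp add: abs_mult)
        note this[of "inverse \<epsilon> *\<^sub>R (x + d)"] this[of "inverse \<epsilon> *\<^sub>R x0"]
        moreover have "0 \<le> \<beta> * (norm d)\<^sup>2" using R(3) by simp
        ultimately have "(norm (x - x0))\<^sup>2 + (t - t0)\<^sup>2 \<le> 2 * \<eta>2 + 2 * (\<epsilon> * B)"
          using \<epsilon>(3) unfolding \<Phi>_def by (simp add: abs_le_iff)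
        then show ?thesis using \<epsilon>B \<eta>2(3) by linarith
      qed
      have x\<rho>1: "norm (x - x0) < \<rho>1" and t\<rho>1: "\<bar>t - t0\<bar> < \<rho>1"
      proof -
        have "(norm (x - x0))\<^sup>2 < \<rho>1\<^sup>2" "(t - t0)\<^sup>2 < \<rho>1\<^sup>2"
          using close zero_le_power2[of "t - t0"] zero_le_power2[of "norm (x - x0)"] by linarith+
        then show "norm (x - x0) < \<rho>1" "\<bar>t - t0\<bar> < \<rho>1"
          using \<rho>1(1) power2_less_imp_less[of "norm (x - x0)" \<rho>1] power2_less_imp_less[of "\<bar>t - t0\<bar>" \<rho>1] by auto
      qed
      have dist_near: "dist (x' + y', t) (x0 + y', t0) \<le> 2 * \<rho>1" if "norm (x' - x0) < \<rho>1" for x' y'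
        using dist_Pair_le[of "x' + y'" t "x0 + y'" t0] that t\<rho>1 by (simp add: dist_norm)
      define y where "y = x + d"
      define r where "r = (2 * \<beta>) *\<^sub>R (x - y)"
      have rL: "norm r \<le> 2 * L"
        using xt(3) R mult_left_mono[of "norm d" R "2 * \<beta>"] unfolding r_def y_def by simp
      \<comment> \<open>Maximality in \<open>d\<close> with \<open>(x, t)\<close> fixed tests the
        corrector from below at \<open>y / \<epsilon>\<close>; scaling turns the quadratic in
        \<open>d\<close> into one in the fast variable.\<close>
      have corr: "0 \<le> - a x0 (inverse \<epsilon> *\<^sub>R y) * l0 + H x0 (inverse \<epsilon> *\<^sub>R y) (p + r) - c"
      proof -
        let ?z = "inverse \<epsilon> *\<^sub>R y" and ?y = "inverse \<epsilon> *\<^sub>R x"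
        have "fo_dual (\<lambda>y r. - a x0 y * l0 + H x0 y (p + r) - c) ?z ((2 * (\<beta> * \<epsilon>)) *\<^sub>R (?z - ?y)) \<le> 0"
        proof (rule fo_subD[OF super C1_on_norm_square_scaled has_derivative_norm_square_scaled],
            rule always_eventually, rule allI)
          fix z
          have scale: "\<beta> * (norm (\<epsilon> *\<^sub>R z - x))\<^sup>2 = \<epsilon> * (\<beta> * \<epsilon> * (norm (z - ?y))\<^sup>2)" for z
          proof -
            have "\<epsilon> *\<^sub>R z - x = \<epsilon> *\<^sub>R (z - ?y)" using \<epsilon>(1) by (simp add: scaleR_right_diff_distrib)
            then have "norm (\<epsilon> *\<^sub>R z - x) = \<epsilon> * norm (z - ?y)" using \<epsilon>(1) by simp
            then show ?thesis by (simp add: power_mult_distrib power2_eq_square)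
          qed
          have val: "\<Phi> (x, t, \<epsilon> *\<^sub>R z - x) = u \<epsilon> (x, t) - \<phi> (x, t) - ((norm (x - x0))\<^sup>2 + (t - t0)\<^sup>2)
              + \<epsilon> * (- \<psi> z - \<beta> * \<epsilon> * (norm (z - ?y))\<^sup>2)" for z
          proof -
            have eqz: "inverse \<epsilon> *\<^sub>R (x + (\<epsilon> *\<^sub>R z - x)) = z" using \<epsilon>(1) by simp
            show ?thesis unfolding \<Phi>_def prod.case eqz scale by (simp add: right_diff_distrib)
          qed
          have "\<Phi> (x, t, \<epsilon> *\<^sub>R z - x) \<le> \<Phi> (x, t, \<epsilon> *\<^sub>R ?z - x)"
            using glob[OF xt(1,2), of "\<epsilon> *\<^sub>R z - x"] \<epsilon>(1) by (simp add: y_def)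
          then have "\<epsilon> * (- \<psi> z - \<beta> * \<epsilon> * (norm (z - ?y))\<^sup>2) \<le> \<epsilon> * (- \<psi> ?z - \<beta> * \<epsilon> * (norm (?z - ?y))\<^sup>2)"
            unfolding val by (simp only: add_le_cancel_left)
          then show "- \<psi> z - \<beta> * \<epsilon> * (norm (z - ?y))\<^sup>2 \<le> - \<psi> ?z - \<beta> * \<epsilon> * (norm (?z - ?y))\<^sup>2"
            using \<epsilon>(1) by (simp only: mult_le_cancel_left_pos)
        qed
        moreover have "(2 * (\<beta> * \<epsilon>)) *\<^sub>R (?z - ?y) = - r"
        proof -
          have "(2 * (\<beta> * \<epsilon>)) *\<^sub>R (?z - ?y) = (2 * \<beta>) *\<^sub>R (\<epsilon> *\<^sub>R (inverse \<epsilon> *\<^sub>R (y - x)))"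
            by (simp add: scaleR_right_diff_distrib mult.assoc)
          also have "\<dots> = (2 * \<beta>) *\<^sub>R (y - x)" using \<epsilon>(1) by simp
          finally show ?thesis unfolding r_def by (simp add: scaleR_right_diff_distrib)
        qed
        ultimately show ?thesis by (simp add: fo_dual_def)
      qed
      \<comment> \<open>Maximality in \<open>(x, t)\<close> is used with \<open>y = x + d\<close>
        fixed: the corrector term is then constant and drops out, which leaves a twice
        differentiable test function.\<close>
      define f where "f = (\<lambda>w. \<phi> w + (1 * (norm (fst w - x0))\<^sup>2 + 1 * (norm (snd w - t0))\<^sup>2) + \<beta> * (norm (fst w - y))\<^sup>2)"
      define ph where "ph = Pg (x, t) + 2 *\<^sub>R (x - x0) + r"
      define qh where "qh = Qg (x, t) + 2 * (t - t0)"
      have fC2: "C2_on (QT T) f"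
        unfolding f_def by (intro C2_on_add \<phi> C2_on_cmult C2_on_norm_square bounded_linear_fst bounded_linear_snd)
      have xtQ: "(x, t) \<in> QT T" using t by (simp add: QT_def)
      have fder: "(f has_derivative (\<lambda>(h, s). ph \<bullet> h + qh * s)) (at (x, t) within QT T)"
        unfolding f_def
        by (rule has_derivative_eq_rhs, (rule has_derivative_add has_derivative_mult_right g(3)[OF xtQ]
            has_derivative_norm_square bounded_linear_fst bounded_linear_snd)+)
          (auto simp: fun_eq_iff ph_def qh_def r_def inner_add_left algebra_simps)
      have fmax: "u \<epsilon> (x', t') - f (x', t') \<le> u \<epsilon> (x, t) - f (x, t)" if "x' \<in> cball x0 \<rho>" "t' \<in> I" for x' t'
      proof -
        have "norm (x' - y) = norm (y - x')" "norm (x - y) = norm d" by (simp_all add: norm_minus_commute y_def)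
        then show ?thesis
          using glob[OF that, of "y - x'"] unfolding \<Phi>_def f_def by (simp add: y_def)
      qed
      \<comment> \<open>The bound \<open>1 / \<beta>\<close> keeps the quadratic, whose coefficient
        \<beta> blows up as \<epsilon> tends to 0, at slope \<open>2 * L + 1\<close> on the test
        ball.\<close>
      define \<delta>' where "\<delta>' = min (min s (\<rho> - \<rho>1)) (1 / \<beta>)"
      have \<delta>': "0 < \<delta>'" "\<delta>' \<le> s" "\<delta>' \<le> \<rho> - \<rho>1" "\<beta> * \<delta>' \<le> 1" "\<delta>' < 1"
      proof -
        show "0 < \<delta>'" "\<delta>' \<le> s" "\<delta>' \<le> \<rho> - \<rho>1" using s(1) \<rho>(1) \<rho>1 R(3) unfolding \<delta>'_def by auto
        have "\<beta> * \<delta>' \<le> \<beta> * (1 / \<beta>)" unfolding \<delta>'_def using R(3) by (intro mult_left_mono) auto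
        then show "\<beta> * \<delta>' \<le> 1" using R(3) by simp
        show "\<delta>' < 1" using \<open>\<delta>' \<le> s\<close> s(2) \<rho>(1,2) \<delta>(2) by linarith
      qed
      define l where "l = nonlocal_on (ball 0 \<delta>') K f x t + nonlocal_on (- ball 0 \<delta>') K (u \<epsilon>) x t"
      have visc: "qh + (- a x (inverse \<epsilon> *\<^sub>R x) * l + H x (inverse \<epsilon> *\<^sub>R x) ph) \<le> 0"
      proof -
        have "\<forall>w\<in>ball x \<delta>' \<times> {t - \<delta>'<..<t + \<delta>'} \<inter> QT T. u \<epsilon> w - f w \<le> u \<epsilon> (x, t) - f (x, t)"
        proof
          fix w assume w: "w \<in> ball x \<delta>' \<times> {t - \<delta>'<..<t + \<delta>'} \<inter> QT T"
          obtain x' t' where w': "w = (x', t')" by (cases w)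
          have "dist x0 x' \<le> dist x0 x + dist x x'" by (rule dist_triangle)
          then have "x' \<in> cball x0 \<rho>" using w w' x\<rho>1 \<delta>'(3) by (simp add: dist_norm norm_minus_commute)
          moreover have "t' \<in> I" using w w' t\<rho>1 \<delta>'(3) by (auto simp: I_def QT_def)
          ultimately show "u \<epsilon> w - f w \<le> u \<epsilon> (x, t) - f (x, t)" unfolding w' by (rule fmax)
        qed
        then show ?thesis
          using sub[OF \<epsilon>(1)] xtQ fC2 \<delta>'(1,5) fder unfolding viscosity_subsolution_def l_def by blast
      qed
      have \<phi>space: "((\<lambda>x. \<phi> (x, t')) has_derivative (\<lambda>h. Pg (x', t') \<bullet> h)) (at x')" if "0 < t'" "t' \<le> T" for x' t'
        using has_derivative_QT_space[OF g(3) that] that by (simp add: QT_def)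
      have Pgn: "norm (Pg (x', t')) \<le> norm p + 1" if "x' \<in> cball x0 \<rho>" "t' \<in> I" for x' t'
      proof -
        have "dist (x', t') (x0, t0) < \<rho>g"
          using dist_Pair_le[of x' t' x0 t0] that \<rho>(4) by (auto simp: I_def dist_commute dist_real_def)
        then have "norm (Pg (x', t') - p) \<le> \<kappa> / 2" using \<rho>g(2) I[OF that(2)] by (simp add: QT_def)
        then show ?thesis using norm_triangle_ineq2[of "Pg (x', t')" p] \<kappa>(4) by linarith
      qed
      have \<phi>lip: "\<bar>\<phi> (x1, t') - \<phi> (x2, t')\<bar> \<le> (norm p + 1) * norm (x1 - x2)"
        if "x1 \<in> cball x0 \<rho>" "x2 \<in> cball x0 \<rho>" "t' \<in> I" for x1 x2 t'
        using lipschitz_of_gradient_bound[of x0 \<rho> "\<lambda>x. \<phi> (x, t')" "\<lambda>x. Pg (x, t')" "norm p + 1" x1 x2]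
          \<phi>space I[OF that(3)] Pgn that by auto
      have inball: "x + z \<in> cball x0 \<rho>" if "norm z < s" for z
      proof -
        have "norm (x + z - x0) \<le> norm (x - x0) + norm z"
          using norm_triangle_ineq[of "x - x0" z] by (simp add: algebra_simps)
        then have "norm (x + z - x0) \<le> \<rho>" using that s(2) x\<rho>1 \<rho>1(2) by linarith
        then show ?thesis by (simp add: dist_norm norm_minus_commute)
      qed
      have sq: "(norm (x + z - x'))\<^sup>2 - (norm (x - x'))\<^sup>2 \<le> 2 * norm (x - x') * norm z + (norm z)\<^sup>2" for z x'
      proof -
        have "(norm (x + z - x'))\<^sup>2 = (norm ((x - x') + z))\<^sup>2" by (simp add: algebra_simps)
        also have "\<dots> = (norm (x - x'))\<^sup>2 + 2 * ((x - x') \<bullet> z) + (norm z)\<^sup>2"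
          by (simp add: power2_norm_eq_inner inner_add_left inner_add_right inner_commute)
        finally show ?thesis using norm_cauchy_schwarz[of "x - x'" z] by simp
      qed
      have inc1: "\<phi> (x + z, t) - \<phi> (x, t) + ((norm (x + z - x0))\<^sup>2 - (norm (x - x0))\<^sup>2) \<le> (norm p + 2) * norm z"
        if z: "norm z < s" for z
      proof -
        have "\<bar>\<phi> (x + z, t) - \<phi> (x, t)\<bar> \<le> (norm p + 1) * norm z"
          using \<phi>lip[OF inball[OF z] xt(1,2)] by simp
        moreover have "2 * norm (x - x0) * norm z + (norm z)\<^sup>2 \<le> 1 * norm z"
        proof -
          have "2 * norm (x - x0) + norm z \<le> 1" using z s(2) x\<rho>1 \<rho>1(2) \<rho>(2) \<delta>(2) \<rho>(5) \<kappa>(4) by linarith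
          from mult_right_mono[OF this, of "norm z"] show ?thesis by (simp add: power2_eq_square distrib_right)
        qed
        ultimately show ?thesis using sq[of z x0] by (simp add: distrib_right)
      qed
      have near_f: "f (x + z, t) - f (x, t) \<le> P * norm z" if z: "norm z < \<delta>'" for z
      proof -
        have "\<beta> * ((norm (x + z - y))\<^sup>2 - (norm (x - y))\<^sup>2) \<le> \<beta> * (2 * norm (x - y) * norm z + (norm z)\<^sup>2)"
          using sq[of z y] R(3) by (intro mult_left_mono) auto
        also have "\<dots> = (2 * (\<beta> * norm (x - y)) + \<beta> * norm z) * norm z"
          by (simp add: power2_eq_square algebra_simps)
        also have "\<dots> \<le> (2 * L + 1) * norm z"
        proof (intro mult_right_mono add_mono)
          have "\<beta> * norm (x - y) \<le> \<beta> * R" using xt(3) R(3) unfolding y_def by (intro mult_left_mono) auto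
          then show "2 * (\<beta> * norm (x - y)) \<le> 2 * L" using R(2) by simp
          have "\<beta> * norm z \<le> \<beta> * \<delta>'" using z R(3) by (intro mult_left_mono) auto
          then show "\<beta> * norm z \<le> 1" using \<delta>'(4) by simp
        qed simp
        finally have "\<beta> * (norm (x + z - y))\<^sup>2 - \<beta> * (norm (x - y))\<^sup>2 \<le> (2 * L + 1) * norm z"
          by (simp add: right_diff_distrib)
        moreover have "\<phi> (x + z, t) - \<phi> (x, t) + ((norm (x + z - x0))\<^sup>2 - (norm (x - x0))\<^sup>2) \<le> (norm p + 2) * norm z"
          using z \<delta>'(2) by (intro inc1) simp
        moreover have "(2 * L + 1) * norm z + (norm p + 2) * norm z \<le> P * norm z"
          unfolding P_def by (simp add: distrib_right)
        ultimately show ?thesis unfolding f_def by simp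
      qed
      \<comment> \<open>Here \<open>d\<close> is kept fixed instead of \<open>y\<close>. The cost is
        the Lipschitz constant of the corrector rather than the steep quadratic, so the bound holds
        on the whole ball of radius \<open>s\<close>.\<close>
      have near_u: "u \<epsilon> (x + z, t) - u \<epsilon> (x, t) \<le> P * norm z" if z: "norm z < s" for z
      proof -
        have "\<epsilon> * (\<psi> (inverse \<epsilon> *\<^sub>R (x + z + d)) - \<psi> (inverse \<epsilon> *\<^sub>R (x + d)))
            \<le> \<epsilon> * (L * norm (inverse \<epsilon> *\<^sub>R (x + z + d) - inverse \<epsilon> *\<^sub>R (x + d)))"
          using \<psi>lip \<epsilon>(1) by (intro mult_left_mono) auto
        also have "\<dots> = L * norm z"
          using \<epsilon>(1) by (simp add: scaleR_right_diff_distrib[symmetric])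
        finally have "\<epsilon> * \<psi> (inverse \<epsilon> *\<^sub>R (x + z + d)) - \<epsilon> * \<psi> (inverse \<epsilon> *\<^sub>R (x + d)) \<le> L * norm z"
          by (simp add: right_diff_distrib)
        moreover have "\<Phi> (x + z, t, d) \<le> \<Phi> (x, t, d)" by (rule glob[OF inball[OF z] xt(2)])
        moreover have "L * norm z + (norm p + 2) * norm z \<le> P * norm z"
          using L unfolding P_def by (simp add: distrib_right)
        ultimately show ?thesis using inc1[OF z] unfolding \<Phi>_def by simp
      qed
      have t0I: "t0 \<in> I" using \<rho>(1) t0(2) by (simp add: I_def)
      \<comment> \<open>The constant may be large; it only serves the convergence of the integral of
        the increments of \<phi> over the ball of radius \<delta>.\<close>
      have lip0: "\<exists>G. \<forall>z. norm z < \<delta> \<longrightarrow> \<bar>\<phi> (x0 + z, t0) - \<phi> (x0, t0)\<bar> \<le> G * norm z"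
      proof -
        have "continuous_on (cball x0 1) (\<lambda>x. norm (Pg (x, t0)))"
          by (intro continuous_intros continuous_on_compose2[OF g(1)]) (use t0 in \<open>auto simp: QT_def\<close>)
        then have "\<exists>xm\<in>cball x0 1. \<forall>x\<in>cball x0 1. norm (Pg (x, t0)) \<le> norm (Pg (xm, t0))"
          by (intro continuous_attains_sup) auto
        then obtain xm where xm: "\<And>x. x \<in> cball x0 1 \<Longrightarrow> norm (Pg (x, t0)) \<le> norm (Pg (xm, t0))"
          by blast
        have "\<bar>\<phi> (x0 + z, t0) - \<phi> (x0, t0)\<bar> \<le> norm (Pg (xm, t0)) * norm z" if "norm z < \<delta>" for z
          using lipschitz_of_gradient_bound[of x0 1 "\<lambda>x. \<phi> (x, t0)" "\<lambda>x. Pg (x, t0)" "norm (Pg (xm, t0))" "x0 + z" x0]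
            \<phi>space[OF t0] xm that \<delta>(2) by (auto simp: dist_norm)
        then show ?thesis by blast
      qed
      then obtain G where G: "\<And>z. norm z < \<delta> \<Longrightarrow> \<bar>\<phi> (x0 + z, t0) - \<phi> (x0, t0)\<bar> \<le> G * norm z" by blast
      have bdu: "\<bar>u \<epsilon> (x', t)\<bar> \<le> M" "\<bar>ub (x', t0)\<bar> \<le> M" for x'
        using M[OF \<epsilon>(1)] ubM t t0 by (auto simp: QT_bar_def)
      have lle: "l \<le> l0 + (3 * levy_mass P (P * s) + levy_mass A B4)"
        unfolding l_def l0_def nonlocal_on_def
      proof (rule nonlocal_terms_le[where M = "2 * M" and G = G and s = s and P = P and A = A and B = B4])
        show "(\<lambda>z. \<phi> (x0 + z, t0) - \<phi> (x0, t0)) \<in> borel_measurable lebesgue"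
          by (intro borel_measurable_lebesgue_continuous continuous_intros continuous_on_compose2[OF \<phi>cont])
            (use t0 in \<open>auto simp: QT_def\<close>)
        show "(\<lambda>z. u \<epsilon> (x + z, t) - u \<epsilon> (x, t)) \<in> borel_measurable lebesgue"
          using incr_borel_measurable[OF cont[OF \<epsilon>(1)]] t by simp
        show "(\<lambda>z. ub (x0 + z, t0) - ub (x0, t0)) \<in> borel_measurable lebesgue"
          using incr_borel_measurable[OF ub_cont] t0 by simp
        show "\<bar>u \<epsilon> (x + z, t) - u \<epsilon> (x, t)\<bar> \<le> 2 * M" for z
          using bdu(1)[of "x + z"] bdu(1)[of x] by linarith
        show "\<bar>ub (x0 + z, t0) - ub (x0, t0)\<bar> \<le> 2 * M" for z
          using bdu(2)[of "x0 + z"] bdu(2)[of x0] by linarith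
        show "- (P * norm z) \<le> \<phi> (x0 + z, t0) - \<phi> (x0, t0)" if "norm z < s" for z
        proof -
          have "\<bar>\<phi> (x0 + z, t0) - \<phi> (x0, t0)\<bar> \<le> (norm p + 1) * norm z"
            using \<phi>lip[of "x0 + z" x0 t0] t0I that s(2) \<rho>(1) by (simp add: dist_norm)
          also have "\<dots> \<le> P * norm z" using L unfolding P_def by (intro mult_right_mono) auto
          finally show ?thesis by linarith
        qed
        show "ub (x0 + z, t0) - ub (x0, t0) \<le> \<phi> (x0 + z, t0) - \<phi> (x0, t0)" if "norm z < \<delta>" for z
        proof -
          have "(x0 + z, t0) \<in> ball x0 \<delta> \<times> {t0 - \<delta><..<t0 + \<delta>} \<inter> QT T"
            using that \<delta>(1) t0 by (simp add: dist_norm QT_def)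
          from bspec[OF touch this] show ?thesis by simp
        qed
        show "u \<epsilon> (x + z, t) - u \<epsilon> (x, t) - (ub (x0 + z, t0) - ub (x0, t0)) \<le> min (A * norm z) B4"
          if z: "s \<le> norm z" for z
        proof (cases "norm z \<le> Rb")
          case True
          have "norm (x + z - x0) \<le> norm (x - x0) + norm z"
            using norm_triangle_ineq[of "x - x0" z] by (simp add: algebra_simps)
          then have "(x + z, t) \<in> Cp"
            using True x\<rho>1 \<rho>1(2) \<rho>(2) \<delta>(2) t \<rho>(1) by (simp add: Cp_def dist_norm norm_minus_commute)
          then have 1: "u \<epsilon> (x + z, t) \<le> ub (x + z, t) + \<eta>" using up[of "(x + z, t)"] \<eta>2(2) by linarith
          have Q: "(x', t) \<in> QT_bar T" "(x', t0) \<in> QT_bar T" for x' using t t0 by (auto simp: QT_bar_def)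
          have 2: "\<bar>ub (x + z, t) - ub (x0 + z, t0)\<bar> \<le> \<eta>"
            using dist_near[OF x\<rho>1, of z] \<rho>1(4) by (intro \<tau>2(2) Q) simp
          have 3: "\<bar>u \<epsilon> (x, t) - u \<epsilon> (x0, t0)\<bar> \<le> \<eta>"
            using dist_near[OF x\<rho>1, of 0] \<rho>1(3) by (intro \<tau>1(2) Q \<epsilon>(1)) simp
          have "u \<epsilon> (x + z, t) - u \<epsilon> (x, t) - (ub (x0 + z, t0) - ub (x0, t0)) \<le> 4 * \<eta>"
            using 1 2 3 \<epsilon>(3) \<eta>2(2) by linarith
          moreover have "A * s \<le> A * norm z" using z A(1) by simp
          ultimately show ?thesis using \<eta>(2,3) by simp
        next
          case False
          have "A * Rb \<le> A * norm z" using False A(1) by simp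
          then have "4 * M \<le> min (A * norm z) B4" using Rb(2) unfolding B4_def by simp
          then show ?thesis
            using bdu(1)[of "x + z"] bdu(1)[of x] bdu(2)[of "x0 + z"] bdu(2)[of x0] by linarith
        qed
      qed (use s \<rho> \<delta> \<delta>' P A B4 near_f near_u G in auto)
      then have l_le: "l \<le> l0 + \<theta>'" using s(3) A(2) by linarith
      have yx: "norm (inverse \<epsilon> *\<^sub>R x - inverse \<epsilon> *\<^sub>R y) \<le> \<kappa>"
      proof -
        have "norm (inverse \<epsilon> *\<^sub>R x - inverse \<epsilon> *\<^sub>R y) = inverse \<epsilon> * norm d"
          using \<epsilon>(1) by (simp add: scaleR_right_diff_distrib[symmetric] y_def)
        also have "\<dots> \<le> inverse \<epsilon> * R" using xt(3) \<epsilon>(1) by (intro mult_left_mono) auto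
        also have "\<dots> = \<kappa>" using \<epsilon>(1) unfolding R_def by simp
        finally show ?thesis .
      qed
      have x\<kappa>: "norm (x - x0) \<le> \<kappa>" using x\<rho>1 \<rho>1(2) \<rho>(5) \<rho>(1) \<kappa>(1) by linarith
      have grad: "norm (Pg (x, t) - p) \<le> \<kappa> / 2" "\<bar>Qg (x, t) - q\<bar> \<le> \<kappa> / 2"
      proof -
        have "dist (x, t) (x0, t0) < \<rho>g"
          using dist_near[OF x\<rho>1, of 0] \<rho>1(2) \<rho>(1,4) by simp
        then show "norm (Pg (x, t) - p) \<le> \<kappa> / 2" "\<bar>Qg (x, t) - q\<bar> \<le> \<kappa> / 2" using \<rho>g(2)[OF xtQ] by auto
      qed
      have phr: "norm (ph - (p + r)) \<le> \<kappa>"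
      proof -
        have "ph - (p + r) = (Pg (x, t) - p) + 2 *\<^sub>R (x - x0)" by (simp add: ph_def)
        then have "norm (ph - (p + r)) \<le> norm (Pg (x, t) - p) + norm (2 *\<^sub>R (x - x0))"
          by (simp only: norm_triangle_ineq)
        then show ?thesis using grad(1) x\<rho>1 \<rho>1(2) \<rho>(1,5) by simp
      qed
      have pr: "norm (p + r) \<le> norm p + 2 * L" using norm_triangle_ineq[of p r] rL by linarith
      have "norm ph \<le> norm (p + r) + norm (ph - (p + r))" using norm_triangle_sub by blast
      then have phR: "norm ph \<le> Rp" "norm (p + r) \<le> Rp" using pr phr \<kappa>(4) unfolding Rp_def by linarith+
      have Hd: "\<bar>H x (inverse \<epsilon> *\<^sub>R x) ph - H x0 (inverse \<epsilon> *\<^sub>R y) (p + r)\<bar> \<le> \<theta>"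
        using phR x\<kappa> yx phr \<kappa> by (intro \<kappa>h(2)) auto
      have ad: "\<bar>a x (inverse \<epsilon> *\<^sub>R x) - a x0 (inverse \<epsilon> *\<^sub>R y)\<bar> \<le> \<theta>a"
        using x\<kappa> yx \<kappa> by (intro \<kappa>a(2)) auto
      have "\<bar>(a x (inverse \<epsilon> *\<^sub>R x) - a x0 (inverse \<epsilon> *\<^sub>R y)) * l0\<bar> \<le> \<theta>a * \<bar>l0\<bar>"
        using ad by (simp add: abs_mult mult_right_mono)
      then have al0: "a x (inverse \<epsilon> *\<^sub>R x) * l0 \<le> a x0 (inverse \<epsilon> *\<^sub>R y) * l0 + \<theta>"
        using \<theta>a(2) by (simp add: left_diff_distrib)
      have "a x (inverse \<epsilon> *\<^sub>R x) * l \<le> a x (inverse \<epsilon> *\<^sub>R x) * (l0 + \<theta>')"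
        using l_le a_bounds(1) by (rule mult_left_mono)
      also have "\<dots> = a x (inverse \<epsilon> *\<^sub>R x) * l0 + a x (inverse \<epsilon> *\<^sub>R x) * \<theta>'" by (rule distrib_left)
      also have "a x (inverse \<epsilon> *\<^sub>R x) * \<theta>' \<le> amax * \<theta>'"
        using a_bounds(2) \<theta>'(1) by (intro mult_right_mono) auto
      finally have al: "a x (inverse \<epsilon> *\<^sub>R x) * l \<le> a x (inverse \<epsilon> *\<^sub>R x) * l0 + \<theta>" using \<theta>'(2) by linarith
      have "q - \<theta> \<le> qh"
        using grad(2) t\<rho>1 \<rho>1(2) \<rho>(1,5) \<kappa>(1,5) unfolding qh_def abs_le_iff abs_less_iff by simp
      then show False using visc corr Hd al0 al \<theta> by linarith
    qed
  qed
qed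

end

section \<open>Convergence\<close>

text \<open>The limsup is obtained as the infimum of the eventual upper bounds. The value 0 outside
  \<open>S\<close> allows two such limits to be identified as functions rather than on
  \<open>S\<close> only.\<close>

lemma limsup_family:
  fixes u :: "real \<Rightarrow> 'a \<Rightarrow> real"
  assumes M: "\<And>\<epsilon> w. 0 < \<epsilon> \<Longrightarrow> w \<in> S \<Longrightarrow> \<bar>u \<epsilon> w\<bar> \<le> M"
  shows "\<exists>ub. (\<forall>w \<eta>. w \<in> S \<longrightarrow> 0 < \<eta> \<longrightarrow> (\<exists>e>0. \<forall>\<epsilon>. 0 < \<epsilon> \<and> \<epsilon> < e \<longrightarrow> u \<epsilon> w \<le> ub w + \<eta>)) \<and>
    (\<forall>w \<eta> e. w \<in> S \<longrightarrow> 0 < \<eta> \<longrightarrow> 0 < e \<longrightarrow> (\<exists>\<epsilon>. 0 < \<epsilon> \<and> \<epsilon> < e \<and> ub w - \<eta> \<le> u \<epsilon> w)) \<and> (\<forall>w. w \<notin> S \<longrightarrow> ub w = 0)"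
proof -
  define U where "U = (\<lambda>w. {c. \<exists>e>0. \<forall>\<epsilon>. 0 < \<epsilon> \<and> \<epsilon> < e \<longrightarrow> u \<epsilon> w \<le> c})"
  define ub where "ub = (\<lambda>w. if w \<in> S then Inf (U w) else 0)"
  have ne: "U w \<noteq> {}" and bdd: "bdd_below (U w)" if w: "w \<in> S" for w
  proof -
    have "M \<in> U w" unfolding U_def using M[OF _ w] by (auto simp: abs_le_iff intro!: exI[of _ 1])
    then show "U w \<noteq> {}" by blast
    show "bdd_below (U w)"
    proof (rule bdd_belowI[of _ "- M"])
      fix c assume "c \<in> U w"
      then obtain e where e: "0 < e" "\<forall>\<epsilon>. 0 < \<epsilon> \<and> \<epsilon> < e \<longrightarrow> u \<epsilon> w \<le> c" unfolding U_def by blast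
      then have "u (e / 2) w \<le> c" "0 < e / 2" by auto
      then show "- M \<le> c" using M[OF \<open>0 < e / 2\<close> w] by linarith
    qed
  qed
  have "\<exists>e>0. \<forall>\<epsilon>. 0 < \<epsilon> \<and> \<epsilon> < e \<longrightarrow> u \<epsilon> w \<le> ub w + \<eta>" if w: "w \<in> S" and "0 < \<eta>" for w \<eta>
  proof -
    have "Inf (U w) < ub w + \<eta>" using that by (simp add: ub_def)
    then obtain c where c: "c \<in> U w" "c < ub w + \<eta>"
      using cInf_less_iff[OF ne[OF w] bdd[OF w]] by blast
    then obtain e where "0 < e" "\<forall>\<epsilon>. 0 < \<epsilon> \<and> \<epsilon> < e \<longrightarrow> u \<epsilon> w \<le> c" unfolding U_def by blast
    then show ?thesis using c(2) by (intro exI[of _ e]) force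
  qed
  moreover have "\<exists>\<epsilon>. 0 < \<epsilon> \<and> \<epsilon> < e \<and> ub w - \<eta> \<le> u \<epsilon> w" if w: "w \<in> S" and "0 < \<eta>" "0 < e" for w \<eta> e
  proof (rule ccontr)
    assume "\<not> ?thesis"
    then have "ub w - \<eta> \<in> U w" unfolding U_def using \<open>0 < e\<close> by force
    then have "Inf (U w) \<le> ub w - \<eta>" by (rule cInf_lower[OF _ bdd[OF w]])
    then show False using w \<open>0 < \<eta>\<close> by (simp add: ub_def)
  qed
  moreover have "ub w = 0" if "w \<notin> S" for w using that by (simp add: ub_def)
  ultimately show ?thesis by blast
qed

lemma uniformly_continuous_on_UNIV_obtain:
  assumes "uniformly_continuous_on UNIV f" "0 < e"
  obtains d where "0 < d" "\<And>x x'. dist x' x < d \<Longrightarrow> dist (f x') (f x) < e"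
proof -
  obtain d where "0 < d" "\<forall>x\<in>UNIV. \<forall>x'\<in>UNIV. dist x' x < d \<longrightarrow> dist (f x') (f x) < e"
    using assms unfolding uniformly_continuous_on_def by meson
  then show ?thesis using that by simp
qed

section \<open>Attainment of the initial data\<close>

definition attains_initially :: "real \<Rightarrow> (real^'n \<Rightarrow> real) \<Rightarrow> ((real^'n) \<times> real \<Rightarrow> real) \<Rightarrow> bool" where
  "attains_initially T u0 u \<longleftrightarrow> (\<forall>\<eta>>0. \<exists>\<tau>>0. \<forall>x t. 0 \<le> t \<longrightarrow> t \<le> T \<longrightarrow> t \<le> \<tau> \<longrightarrow> \<bar>u (x, t) - u0 x\<bar> \<le> \<eta>)"

lemma attains_initially_at_0:
  assumes "attains_initially T u0 u" "0 \<le> T" shows "u (x, 0) = u0 x"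
proof -
  have h: "\<bar>u (x, 0) - u0 x\<bar> \<le> \<eta>" if \<eta>: "0 < \<eta>" for \<eta>
  proof -
    obtain \<tau> where "0 < \<tau>" "\<forall>x t. 0 \<le> t \<longrightarrow> t \<le> T \<longrightarrow> t \<le> \<tau> \<longrightarrow> \<bar>u (x, t) - u0 x\<bar> \<le> \<eta>"
      using assms(1) \<eta> unfolding attains_initially_def by blast
    then show ?thesis using assms(2) by simp
  qed
  have "\<bar>u (x, 0) - u0 x\<bar> \<le> 0"
  proof (rule field_le_epsilon)
    show "\<bar>u (x, 0) - u0 x\<bar> \<le> 0 + e" if "0 < e" for e using h[OF that] by simp
  qed
  then show ?thesis by simp
qed

lemma attains_initially_imp_uniformly:
  fixes u :: "(real^'n) \<times> real \<Rightarrow> real"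
  assumes "0 < T" and bd: "\<And>w. w \<in> QT_bar T \<Longrightarrow> \<bar>u w\<bar> \<le> M" and bd0: "\<And>x. \<bar>u0 x\<bar> \<le> M"
    and init: "attains_initially T u0 u"
  shows "attains_uniformly T u0 u"
proof -
  \<comment> \<open>The supremum over all times up to \<open>t\<close> makes \<omega> monotone; the
    cap \<open>min t T\<close> extends it beyond the final time.\<close>
  define E where "E = (\<lambda>t. (\<lambda>(x, s). \<bar>u (x, s) - u0 x\<bar>) ` (UNIV \<times> {0..min t T}))"
  define \<omega> where "\<omega> = (\<lambda>t. Sup (E t))"
  have le: "e \<le> 2 * M" if et: "e \<in> E t" for e t
  proof -
    obtain x s where "e = \<bar>u (x, s) - u0 x\<bar>" "0 \<le> s" "s \<le> T" using et unfolding E_def by auto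
    then show ?thesis using bd[of "(x, s)"] bd0[of x] by (simp add: QT_bar_def)
  qed
  have bdd: "bdd_above (E t)" for t by (rule bdd_aboveI[of _ "2 * M"]) (rule le)
  have E0: "0 \<in> E t" if "0 \<le> t" for t
    using attains_initially_at_0[OF init, of 0] \<open>0 < T\<close> that unfolding E_def
    by (intro image_eqI[of _ _ "(0, 0)"]) auto
  have mono: "\<omega> s \<le> \<omega> t" if "0 \<le> s" "s \<le> t" for s t
    unfolding \<omega>_def using E0[OF that(1)] bdd by (intro cSup_subset_mono) (use that in \<open>auto simp: E_def\<close>)
  have nonneg: "0 \<le> \<omega> t" if "0 \<le> t" for t
    unfolding \<omega>_def by (rule cSup_upper[OF E0[OF that] bdd])
  have small: "\<exists>\<tau>>0. \<forall>t. 0 \<le> t \<longrightarrow> t \<le> \<tau> \<longrightarrow> \<omega> t \<le> \<eta>" if \<eta>: "0 < \<eta>" for \<eta>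
  proof -
    obtain \<tau> where \<tau>: "0 < \<tau>" "\<And>x t. 0 \<le> t \<Longrightarrow> t \<le> T \<Longrightarrow> t \<le> \<tau> \<Longrightarrow> \<bar>u (x, t) - u0 x\<bar> \<le> \<eta>"
      using init \<eta> unfolding attains_initially_def by blast
    have "\<omega> t \<le> \<eta>" if "0 \<le> t" "t \<le> \<tau>" for t
      unfolding \<omega>_def using E0[OF that(1)] by (intro cSup_least) (use that \<tau>(2) in \<open>auto simp: E_def\<close>)
    then show ?thesis using \<tau>(1) by blast
  qed
  have "E 0 \<subseteq> {0}" using attains_initially_at_0[OF init] \<open>0 < T\<close> unfolding E_def by auto
  then have "E 0 = {0}" using E0[of 0] by auto
  then have "\<omega> 0 = 0" unfolding \<omega>_def by simp
  moreover have "(\<omega> \<longlongrightarrow> 0) (at_right 0)"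
  proof (rule tendstoI)
    fix e :: real assume "0 < e"
    then obtain \<tau> where \<tau>: "0 < \<tau>" "\<forall>t. 0 \<le> t \<longrightarrow> t \<le> \<tau> \<longrightarrow> \<omega> t \<le> e / 2" using small[of "e / 2"] by auto
    show "\<forall>\<^sub>F t in at_right 0. dist (\<omega> t) 0 < e"
      unfolding eventually_at_right_field
    proof (intro exI[of _ \<tau>] conjI allI impI \<tau>(1))
      fix t :: real assume "0 < t" "t < \<tau>"
      then have "\<omega> t \<le> e / 2" "0 \<le> \<omega> t" using \<tau>(2) nonneg[of t] by auto
      then show "dist (\<omega> t) 0 < e" using \<open>0 < e\<close> by (simp add: dist_real_def)
    qed
  qed
  moreover have "\<bar>u (x, t) - u0 x\<bar> \<le> \<omega> t" if "t \<in> {0..T}" for x t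
    unfolding \<omega>_def using that by (intro cSup_upper bdd) (auto simp: E_def intro!: image_eqI[of _ _ "(x, t)"])
  ultimately show ?thesis
    unfolding attains_uniformly_def modulus_of_continuity_def
    using mono nonneg by (intro exI[of _ \<omega>]) (auto intro: mono_onI)
qed

lemma attains_uniformly_imp_initially:
  assumes "attains_uniformly T u0 u" shows "attains_initially T u0 u"
  unfolding attains_initially_def
proof (intro allI impI)
  fix \<eta> :: real assume "0 < \<eta>"
  obtain \<omega> where \<omega>: "\<omega> 0 = 0" "(\<omega> \<longlongrightarrow> 0) (at_right 0)" "\<forall>t\<in>{0..T}. \<forall>x. \<bar>u (x, t) - u0 x\<bar> \<le> \<omega> t"
    using assms unfolding attains_uniformly_def modulus_of_continuity_def by blast
  from order_tendstoD(2)[OF \<omega>(2) \<open>0 < \<eta>\<close>]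
  obtain b where b: "0 < b" "\<And>t. 0 < t \<Longrightarrow> t < b \<Longrightarrow> \<omega> t < \<eta>"
    unfolding eventually_at_right_field by auto
  have "\<bar>u (x, t) - u0 x\<bar> \<le> \<eta>" if "0 \<le> t" "t \<le> T" "t \<le> b / 2" for x t
  proof -
    have "\<omega> t \<le> \<eta>"
      using that b(1) b(2)[of t] \<omega>(1) \<open>0 < \<eta>\<close> by (cases "t = 0") auto
    moreover have "\<bar>u (x, t) - u0 x\<bar> \<le> \<omega> t" using \<omega>(3) that by simp
    ultimately show ?thesis by linarith
  qed
  then show "\<exists>\<tau>>0. \<forall>x t. 0 \<le> t \<longrightarrow> t \<le> T \<longrightarrow> t \<le> \<tau> \<longrightarrow> \<bar>u (x, t) - u0 x\<bar> \<le> \<eta>"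
    using b(1) by (intro exI[of _ "b / 2"]) auto
qed

text \<open>Competitors in the uniqueness statement are continuous on \<open>QT T\<close>, whereas
  comparison needs continuity up to the initial time; uniform attainment of uniformly continuous
  data supplies it.\<close>

lemma continuous_on_QT_bar_if_attains:
  fixes v :: "(real^'n) \<times> real \<Rightarrow> real"
  assumes cont: "continuous_on (QT T) v" and init: "attains_initially T u0 v" and "0 < T"
    and uc: "uniformly_continuous_on UNIV u0"
  shows "continuous_on (QT_bar T) v"
  unfolding continuous_on_iff
proof (intro ballI allI impI)
  fix w :: "(real^'n) \<times> real" and e :: real assume w: "w \<in> QT_bar T" and "0 < e"
  obtain x t where xt: "w = (x, t)" by (cases w)
  have t: "0 \<le> t" "t \<le> T" using w by (auto simp: xt QT_bar_def)
  show "\<exists>d>0. \<forall>w'\<in>QT_bar T. dist w' w < d \<longrightarrow> dist (v w') (v w) < e"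
  proof (cases "t = 0")
    case False
    then have "w \<in> QT T" using t by (simp add: xt QT_def)
    then obtain d where d: "0 < d" "\<forall>w'\<in>QT T. dist w' w < d \<longrightarrow> dist (v w') (v w) < e"
      using cont \<open>0 < e\<close> unfolding continuous_on_iff by blast
    have "w' \<in> QT T" if "w' \<in> QT_bar T" "dist w' w < t" for w'
    proof -
      have "dist (snd w') (snd w) < t" using that(2) dist_snd_le[of w' w] by linarith
      then show ?thesis using that(1) by (auto simp: xt QT_bar_def QT_def dist_real_def)
    qed
    then show ?thesis using d False t by (intro exI[of _ "min d t"]) auto
  next
    case True
    have e3: "0 < e / 3" using \<open>0 < e\<close> by simp
    obtain \<tau> where \<tau>: "0 < \<tau>" "\<And>x t. 0 \<le> t \<Longrightarrow> t \<le> T \<Longrightarrow> t \<le> \<tau> \<Longrightarrow> \<bar>v (x, t) - u0 x\<bar> \<le> e / 3"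
      using init e3 unfolding attains_initially_def by blast
    obtain d where d: "0 < d" "\<And>x x'. dist x' x < d \<Longrightarrow> dist (u0 x') (u0 x) < e / 3"
      by (rule uniformly_continuous_on_UNIV_obtain[OF uc e3]) (rule that)
    have "dist (v w') (v w) < e" if w': "w' \<in> QT_bar T" "dist w' w < min \<tau> d" for w'
    proof -
      obtain x' t' where xt': "w' = (x', t')" by (cases w')
      have "dist x' x < d" "dist t' t < \<tau>"
        using w'(2) dist_fst_le[of w' w] dist_snd_le[of w' w] by (auto simp: xt xt')
      moreover have "0 \<le> t'" "t' \<le> T" using w'(1) by (auto simp: xt' QT_bar_def)
      moreover have "t' \<le> \<tau>" using \<open>dist t' t < \<tau>\<close> True \<open>0 \<le> t'\<close> by (simp add: dist_real_def)
      ultimately have "\<bar>v (x', t') - u0 x'\<bar> \<le> e / 3" "dist (u0 x') (u0 x) < e / 3"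
        using \<tau>(2) d(2) by blast+
      moreover have "v (x, 0) = u0 x" using attains_initially_at_0[OF init] \<open>0 < T\<close> by simp
      ultimately show ?thesis using \<open>0 < e\<close> unfolding xt xt' True dist_real_def by linarith
    qed
    then show ?thesis using \<tau>(1) d(1) by (intro exI[of _ "min \<tau> d"]) auto
  qed
qed

text \<open>Comparison with lag 0. If one of two times within \<kappa> of each other is 0, both are
  small, and both functions are close to \<open>u0\<close> at nearby points.\<close>

lemma (in levy_kernel) comparison_ivp:
  assumes "0 < T" and adm: "admissible F"
    and sub: "viscosity_subsolution T K F u" and super: "viscosity_supersolution T K F v"
    and cont: "continuous_on (QT_bar T) u" "continuous_on (QT_bar T) v"
    and M: "\<And>w. w \<in> QT_bar T \<Longrightarrow> \<bar>u w\<bar> \<le> M" "\<And>w. w \<in> QT_bar T \<Longrightarrow> \<bar>v w\<bar> \<le> M"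
    and init: "attains_initially T u0 u" "attains_initially T u0 v"
    and uc: "uniformly_continuous_on UNIV u0" and w: "w \<in> QT_bar T"
  shows "u w \<le> v w"
proof (rule field_le_epsilon)
  fix \<eta> :: real assume \<eta>: "0 < \<eta>"
  obtain x1 t1 where xt: "w = (x1, t1)" by (cases w)
  have \<eta>3: "0 < \<eta> / 3" using \<eta> by simp
  obtain \<tau>1 where \<tau>1: "0 < \<tau>1" "\<And>x t. 0 \<le> t \<Longrightarrow> t \<le> T \<Longrightarrow> t \<le> \<tau>1 \<Longrightarrow> \<bar>u (x, t) - u0 x\<bar> \<le> \<eta> / 3"
    using init(1) \<eta>3 unfolding attains_initially_def by blast
  obtain \<tau>2 where \<tau>2: "0 < \<tau>2" "\<And>x t. 0 \<le> t \<Longrightarrow> t \<le> T \<Longrightarrow> t \<le> \<tau>2 \<Longrightarrow> \<bar>v (x, t) - u0 x\<bar> \<le> \<eta> / 3"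
    using init(2) \<eta>3 unfolding attains_initially_def by blast
  obtain d where d: "0 < d" "\<And>x x'. dist x' x < d \<Longrightarrow> dist (u0 x') (u0 x) < \<eta> / 3"
    by (rule uniformly_continuous_on_UNIV_obtain[OF uc \<eta>3]) (rule that)
  define \<kappa> where "\<kappa> = min (min \<tau>1 \<tau>2) (d / 2)"
  have \<kappa>: "0 < \<kappa>" "\<kappa> \<le> \<tau>1" "\<kappa> \<le> \<tau>2" "\<kappa> < d" using \<tau>1 \<tau>2 d unfolding \<kappa>_def by auto
  have "u (x1, t1) - v (x1, t1) \<le> \<eta>"
  proof (rule comparison[OF \<open>0 < T\<close> adm sub super cont M _ \<kappa>(1), where h = 0])
    fix x y :: "real^'n" and t s assume a: "0 \<le> t" "t \<le> T" "0 \<le> s" "s \<le> T" "t = 0 \<or> s = 0" "norm (x - y) \<le> \<kappa>" "\<bar>t - s - 0\<bar> \<le> \<kappa>"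
    have "t \<le> \<kappa>" "s \<le> \<kappa>" using a \<kappa>(1) by auto
    then have "t \<le> \<tau>1" "s \<le> \<tau>2" using \<kappa> by auto
    then have "\<bar>u (x, t) - u0 x\<bar> \<le> \<eta> / 3" "\<bar>v (y, s) - u0 y\<bar> \<le> \<eta> / 3"
      using \<tau>1(2)[OF a(1,2)] \<tau>2(2)[OF a(3,4)] by blast+
    moreover have "dist (u0 x) (u0 y) < \<eta> / 3" using a(6) \<kappa> by (intro d(2)) (simp add: dist_norm)
    ultimately show "u (x, t) - v (y, s) \<le> \<eta>" unfolding dist_real_def by linarith
  qed (use w \<open>0 < T\<close> in \<open>auto simp: xt QT_bar_def\<close>)
  then show "u w \<le> v w + \<eta>" by (simp add: xt)
qed

text \<open>Cell problems are closed under negation of the corrector: \<open>a\<close> is kept and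
  \<open>H\<close> becomes \<open>- H x y (- p)\<close>. The result for upper limits can thus be
  applied to the negated family.\<close>

lemma cell_problem_solvable_dual:
  assumes "cell_problem_solvable a H x p l c"
  shows "cell_problem_solvable a (\<lambda>x y p. - H x y (- p)) x (- p) (- l) (- c)"
proof -
  obtain \<psi> L where \<psi>: "Z_periodic \<psi>" "L-lipschitz_on UNIV \<psi>"
    "viscosity_solution_first_order (\<lambda>y q. - a x y * l + H x y (p + q) - c) \<psi>"
    using assms unfolding cell_problem_solvable_def by blast
  let ?G = "\<lambda>y q. - a x y * l + H x y (p + q) - c"
  have eq: "(\<lambda>y q. - a x y * (- l) + - H x y (- (- p + q)) - - c) = fo_dual ?G"
    by (simp add: fo_dual_def fun_eq_iff)
  have "fo_dual (fo_dual ?G) = ?G" by (simp add: fo_dual_def)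
  then have "viscosity_solution_first_order (fo_dual ?G) (\<lambda>y. - \<psi> y)"
    using \<psi>(3) unfolding viscosity_solution_first_order_iff by (auto intro: continuous_intros)
  moreover have "Z_periodic (\<lambda>y. - \<psi> y)" using \<psi>(1) by (simp add: Z_periodic_def)
  moreover have "L-lipschitz_on UNIV (\<lambda>y. - \<psi> y)" using \<psi>(2) by (simp add: lipschitz_on_def dist_minus)
  ultimately show ?thesis
    unfolding cell_problem_solvable_def eq by blast
qed

section \<open>Bounds and equicontinuity of the family, and passage to the limit\<close>

locale homogenization_problem = levy_kernel K + homogenization_data a H amin amax
  for K :: "real^'n \<Rightarrow> real" and a H amin amax +
  fixes T :: real and u0 :: "real^'n \<Rightarrow> real" and B0 :: real and u :: "real \<Rightarrow> (real^'n) \<times> real \<Rightarrow> real"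
  assumes T: "0 < T" and B0: "\<And>x. \<bar>u0 x\<bar> \<le> B0" and u0_uc: "uniformly_continuous_on UNIV u0"
    and u_sol: "\<And>\<epsilon>. 0 < \<epsilon> \<Longrightarrow> viscosity_solution_ivp T K
       (\<lambda>x p l. - a x (inverse \<epsilon> *\<^sub>R x) * l + H x (inverse \<epsilon> *\<^sub>R x) p) u0 (u \<epsilon>)"
begin

definition F :: "real \<Rightarrow> real^'n \<Rightarrow> real^'n \<Rightarrow> real \<Rightarrow> real" where
  "F \<epsilon> = (\<lambda>x p l. - a x (inverse \<epsilon> *\<^sub>R x) * l + H x (inverse \<epsilon> *\<^sub>R x) p)"

lemma F_admissible: "0 < \<epsilon> \<Longrightarrow> admissible (F \<epsilon>)"
  unfolding F_def by (rule admissible_oscillating)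

lemma u_facts:
  assumes "0 < \<epsilon>"
  shows "viscosity_subsolution T K (F \<epsilon>) (u \<epsilon>)" "viscosity_supersolution T K (F \<epsilon>) (u \<epsilon>)"
    "continuous_on (QT_bar T) (u \<epsilon>)" "u \<epsilon> (x, 0) = u0 x" "bounded (u \<epsilon> ` QT_bar T)"
  using u_sol[OF assms] unfolding viscosity_solution_ivp_def viscosity_solution_def F_def by auto

lemma u_dual: "0 < \<epsilon> \<Longrightarrow> viscosity_subsolution T K (ham_dual (F \<epsilon>)) (\<lambda>w. - u \<epsilon> w)"
  by (rule supersolution_imp_subsolution_dual[OF u_facts(2)])

text \<open>\<open>C\<close> depends on \<open>A\<close> and on bounds of the cell Hamiltonian that
  are uniform in the fast variable, hence not on \<epsilon>, \<open>c\<close> or \<open>x0\<close>.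
  The estimate is read off at \<open>x0\<close>, where the bowl vanishes.\<close>

lemma u_barrier:
  assumes "0 \<le> A"
  obtains C where "0 < C"
    "\<And>\<epsilon> c x0 t. 0 < \<epsilon> \<Longrightarrow> 0 \<le> t \<Longrightarrow> t \<le> T \<Longrightarrow> \<forall>x. u0 x \<le> c + A * bowl (x - x0) \<Longrightarrow> u \<epsilon> (x0, t) \<le> c + C * t"
    "\<And>\<epsilon> c x0 t. 0 < \<epsilon> \<Longrightarrow> 0 \<le> t \<Longrightarrow> t \<le> T \<Longrightarrow> \<forall>x. - u0 x \<le> c + A * bowl (x - x0) \<Longrightarrow> - u \<epsilon> (x0, t) \<le> c + C * t"
proof -
  define \<Lambda> where "\<Lambda> = levy_mass A A + 1"
  have \<Lambda>: "0 \<le> \<Lambda>" unfolding \<Lambda>_def using levy_mass_nonneg[OF assms assms] by simp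
  obtain C where C: "0 < C" "\<And>x y p l. norm p \<le> A + 1 \<Longrightarrow> l \<le> \<Lambda> \<Longrightarrow> - C < H x y p - a x y * l"
    "\<And>x y p l. norm p \<le> A + 1 \<Longrightarrow> - \<Lambda> \<le> l \<Longrightarrow> H x y p - a x y * l < C"
    using cell_hamiltonian_bounds[OF \<Lambda>, of "A + 1"] by blast
  have *: "(\<forall>x. u0 x \<le> c + A * bowl (x - x0)) \<longrightarrow> u \<epsilon> (x0, t) \<le> c + C * t"
    "(\<forall>x. - u0 x \<le> c + A * bowl (x - x0)) \<longrightarrow> - u \<epsilon> (x0, t) \<le> c + C * t"
    if "0 < \<epsilon>" and t: "0 \<le> t" "t \<le> T" for \<epsilon> c :: real and x0 :: "real^'n" and t
  proof -
    obtain M where M: "\<And>w. w \<in> QT_bar T \<Longrightarrow> \<bar>u \<epsilon> w\<bar> \<le> M"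
      using u_facts(5)[OF \<open>0 < \<epsilon>\<close>] unfolding bounded_iff by auto
    have low1: "- C < F \<epsilon> x p l" if "norm p \<le> A + 1" "l \<le> levy_mass A A + 1" for x p l
      using C(2)[OF that(1), of l x "inverse \<epsilon> *\<^sub>R x"] that(2) by (simp add: F_def \<Lambda>_def)
    have low2: "- C < ham_dual (F \<epsilon>) x p l" if "norm p \<le> A + 1" "l \<le> levy_mass A A + 1" for x p l
      using C(3)[of "- p" "- l" x "inverse \<epsilon> *\<^sub>R x"] that by (simp add: F_def ham_dual_def \<Lambda>_def)
    have "u \<epsilon> (x0, t) \<le> c + C * t" if "\<forall>x. u0 x \<le> c + A * bowl (x - x0)"
      using barrier[OF T u_facts(1,3)[OF \<open>0 < \<epsilon>\<close>] M assms less_imp_le[OF C(1)] _ low1 t, of c x0 x0]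
        that u_facts(4)[OF \<open>0 < \<epsilon>\<close>] by (simp add: bowl_0)
    then show "(\<forall>x. u0 x \<le> c + A * bowl (x - x0)) \<longrightarrow> u \<epsilon> (x0, t) \<le> c + C * t" by blast
    have contm: "continuous_on (QT_bar T) (\<lambda>w. - u \<epsilon> w)"
      by (intro continuous_intros u_facts(3)[OF \<open>0 < \<epsilon>\<close>])
    have "- u \<epsilon> (x0, t) \<le> c + C * t" if "\<forall>x. - u0 x \<le> c + A * bowl (x - x0)"
      using barrier[OF T u_dual[OF \<open>0 < \<epsilon>\<close>] contm _ assms less_imp_le[OF C(1)] _ low2 t, of M c x0 x0]
        that u_facts(4)[OF \<open>0 < \<epsilon>\<close>] M by (simp add: bowl_0)
    then show "(\<forall>x. - u0 x \<le> c + A * bowl (x - x0)) \<longrightarrow> - u \<epsilon> (x0, t) \<le> c + C * t" by blast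
  qed
  show ?thesis by (rule that[OF C(1)]) (use * in blast)+
qed

lemma uniform_bound: "\<exists>M. \<forall>\<epsilon>>0. \<forall>w\<in>QT_bar T. \<bar>u \<epsilon> w\<bar> \<le> M"
proof -
  obtain C where C: "0 < C"
    "\<And>\<epsilon> c x0 t. 0 < \<epsilon> \<Longrightarrow> 0 \<le> t \<Longrightarrow> t \<le> T \<Longrightarrow> \<forall>x. u0 x \<le> c + 0 * bowl (x - x0) \<Longrightarrow> u \<epsilon> (x0, t) \<le> c + C * t"
    "\<And>\<epsilon> c x0 t. 0 < \<epsilon> \<Longrightarrow> 0 \<le> t \<Longrightarrow> t \<le> T \<Longrightarrow> \<forall>x. - u0 x \<le> c + 0 * bowl (x - x0) \<Longrightarrow> - u \<epsilon> (x0, t) \<le> c + C * t"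
    by (rule u_barrier[OF order_refl]) (rule that)
  have "\<bar>u \<epsilon> w\<bar> \<le> B0 + C * T" if "0 < \<epsilon>" "w \<in> QT_bar T" for \<epsilon> w
  proof -
    obtain x t where w: "w = (x, t)" by (cases w)
    have t: "0 \<le> t" "t \<le> T" using that by (auto simp: w QT_bar_def)
    have "\<forall>x. u0 x \<le> B0" "\<forall>x. - u0 x \<le> B0" using B0 by (auto simp: abs_le_iff)
    then have "u \<epsilon> (x, t) \<le> B0 + C * t" "- u \<epsilon> (x, t) \<le> B0 + C * t"
      using C(2)[OF that(1) t, of B0 x] C(3)[OF that(1) t, of B0 x] by auto
    moreover have "C * t \<le> C * T" using C(1) t by simp
    ultimately show ?thesis unfolding w by linarith
  qed
  then show ?thesis by blast
qed

lemma initial_modulus: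
  assumes "0 < \<eta>"
  shows "\<exists>\<tau>>0. \<forall>\<epsilon>>0. \<forall>x t. 0 \<le> t \<longrightarrow> t \<le> T \<longrightarrow> t \<le> \<tau> \<longrightarrow> \<bar>u \<epsilon> (x, t) - u0 x\<bar> \<le> \<eta>"
proof -
  obtain d where d: "0 < d" "\<And>x x'. dist x' x < d \<Longrightarrow> dist (u0 x') (u0 x) < \<eta> / 2"
    by (rule uniformly_continuous_on_UNIV_obtain[OF u0_uc half_gt_zero[OF assms]]) (rule that)
  \<comment> \<open>The value of \<open>bowl\<close> at distance \<open>d\<close>. With
    \<open>A * c = 2 * B0\<close> the term \<open>A * bowl\<close> exceeds the total oscillation of
    \<open>u0\<close> beyond that distance, while closer points are covered by
    \<open>\<eta> / 2\<close>.\<close>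
  define c where "c = d\<^sup>2 / (1 + d\<^sup>2)"
  have c: "0 < c" using d(1) unfolding c_def by (simp add: add_pos_nonneg)
  define A where "A = 2 * B0 / c"
  have B00: "0 \<le> B0" using B0[of 0] by linarith
  have A: "0 \<le> A" "A * c = 2 * B0" using B00 c unfolding A_def by auto
  have key: "\<bar>u0 x - u0 x0\<bar> \<le> \<eta> / 2 + A * bowl (x - x0)" for x x0
  proof (cases "dist x x0 < d")
    case True
    then have "\<bar>u0 x - u0 x0\<bar> \<le> \<eta> / 2" using d(2)[OF True] by (simp add: dist_real_def)
    moreover have "0 \<le> A * bowl (x - x0)" by (intro mult_nonneg_nonneg A(1) bowl_nonneg)
    ultimately show ?thesis by linarith
  next
    case False
    then have "d\<^sup>2 \<le> (norm (x - x0))\<^sup>2" using d(1) by (intro power_mono) (auto simp: dist_norm)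
    moreover have "0 < 1 + d\<^sup>2" "0 < 1 + (norm (x - x0))\<^sup>2" by (simp_all add: add_pos_nonneg)
    ultimately have "c \<le> bowl (x - x0)" unfolding c_def bowl_def by (simp add: divide_simps algebra_simps)
    then have "A * c \<le> A * bowl (x - x0)" using A(1) by (rule mult_left_mono)
    then show ?thesis using A(2) B0[of x] B0[of x0] assms by linarith
  qed
  obtain C where C: "0 < C"
    "\<And>\<epsilon> c x0 t. 0 < \<epsilon> \<Longrightarrow> 0 \<le> t \<Longrightarrow> t \<le> T \<Longrightarrow> \<forall>x. u0 x \<le> c + A * bowl (x - x0) \<Longrightarrow> u \<epsilon> (x0, t) \<le> c + C * t"
    "\<And>\<epsilon> c x0 t. 0 < \<epsilon> \<Longrightarrow> 0 \<le> t \<Longrightarrow> t \<le> T \<Longrightarrow> \<forall>x. - u0 x \<le> c + A * bowl (x - x0) \<Longrightarrow> - u \<epsilon> (x0, t) \<le> c + C * t"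
    by (rule u_barrier[OF A(1)]) (rule that)
  show ?thesis
  proof (intro exI[of _ "\<eta> / (2 * C)"] conjI allI impI)
    show "0 < \<eta> / (2 * C)" using assms C(1) by simp
    fix \<epsilon> t :: real and x :: "real^'n" assume "0 < \<epsilon>" and t: "0 \<le> t" "t \<le> T" "t \<le> \<eta> / (2 * C)"
    have "C * t \<le> \<eta> / 2" using t(3) C(1) by (simp add: field_simps)
    moreover have "u0 x' \<le> (u0 x + \<eta> / 2) + A * bowl (x' - x)"
      "- u0 x' \<le> (- u0 x + \<eta> / 2) + A * bowl (x' - x)" for x'
      using key[of x' x] by linarith+
    then have "u \<epsilon> (x, t) \<le> (u0 x + \<eta> / 2) + C * t" "- u \<epsilon> (x, t) \<le> (- u0 x + \<eta> / 2) + C * t"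
      using C(2,3)[OF \<open>0 < \<epsilon>\<close> t(1,2)] by blast+
    ultimately show "\<bar>u \<epsilon> (x, t) - u0 x\<bar> \<le> \<eta>" by linarith
  qed
qed

text \<open>A solution is compared with itself at the lag \<open>t - s\<close>. When one of the two
  times is 0 the other is at most \<open>2 * \<kappa>\<close>, where the initial modulus applies.
  The width \<kappa> is independent of \<epsilon>, although comparison uses the \<epsilon>-dependent
  continuity of the Hamiltonian.\<close>

lemma time_modulus:
  assumes "0 < \<eta>"
  shows "\<exists>\<tau>>0. \<forall>\<epsilon>>0. \<forall>x t s. 0 \<le> t \<longrightarrow> t \<le> T \<longrightarrow> 0 \<le> s \<longrightarrow> s \<le> T \<longrightarrow> \<bar>t - s\<bar> \<le> \<tau> \<longrightarrow> \<bar>u \<epsilon> (x, t) - u \<epsilon> (x, s)\<bar> \<le> \<eta>"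
proof -
  have \<eta>2: "0 < \<eta> / 2" using assms by simp
  obtain M where M: "\<And>\<epsilon> w. 0 < \<epsilon> \<Longrightarrow> w \<in> QT_bar T \<Longrightarrow> \<bar>u \<epsilon> w\<bar> \<le> M" using uniform_bound by blast
  obtain \<tau> where \<tau>: "0 < \<tau>" "\<And>\<epsilon> x t. 0 < \<epsilon> \<Longrightarrow> 0 \<le> t \<Longrightarrow> t \<le> T \<Longrightarrow> t \<le> \<tau> \<Longrightarrow> \<bar>u \<epsilon> (x, t) - u0 x\<bar> \<le> \<eta> / 2"
    using initial_modulus[OF \<eta>2] by blast
  obtain d where d: "0 < d" "\<And>x x'. dist x' x < d \<Longrightarrow> dist (u0 x') (u0 x) < \<eta> / 2"
    by (rule uniformly_continuous_on_UNIV_obtain[OF u0_uc \<eta>2]) (rule that)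
  define \<kappa> where "\<kappa> = min (\<tau> / 2) (d / 2)"
  have \<kappa>: "0 < \<kappa>" "2 * \<kappa> \<le> \<tau>" "\<kappa> < d" using \<tau> d unfolding \<kappa>_def by auto
  have key: "u \<epsilon> (x, t) - u \<epsilon> (x, s) \<le> \<eta>"
    if "0 < \<epsilon>" and ts: "0 \<le> t" "t \<le> T" "0 \<le> s" "s \<le> T" "\<bar>t - s\<bar> \<le> \<kappa>" for \<epsilon> x t s
  proof (rule comparison[OF T F_admissible u_facts(1,2,3,3) M M _ \<kappa>(1), where h = "t - s"])
    fix x y :: "real^'n" and t' s' assume a: "0 \<le> t'" "t' \<le> T" "0 \<le> s'" "s' \<le> T" "t' = 0 \<or> s' = 0" "norm (x - y) \<le> \<kappa>" "\<bar>t' - s' - (t - s)\<bar> \<le> \<kappa>"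
    have u00: "dist (u0 x) (u0 y) < \<eta> / 2" using a(6) \<kappa> by (intro d(2)) (simp add: dist_norm)
    from a(5) show "u \<epsilon> (x, t') - u \<epsilon> (y, s') \<le> \<eta>"
    proof
      assume "t' = 0"
      then have "s' \<le> \<tau>" using a(7) ts(5) \<kappa>(2) by linarith
      then have "\<bar>u \<epsilon> (y, s') - u0 y\<bar> \<le> \<eta> / 2" using \<tau>(2) \<open>0 < \<epsilon>\<close> a by blast
      then show ?thesis
        using u_facts(4)[OF \<open>0 < \<epsilon>\<close>, of x] u00 unfolding dist_real_def \<open>t' = 0\<close> by linarith
    next
      assume "s' = 0"
      then have "t' \<le> \<tau>" using a(7) ts(5) \<kappa>(2) by linarith
      then have "\<bar>u \<epsilon> (x, t') - u0 x\<bar> \<le> \<eta> / 2" using \<tau>(2) \<open>0 < \<epsilon>\<close> a by blast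
      then show ?thesis
        using u_facts(4)[OF \<open>0 < \<epsilon>\<close>, of y] u00 unfolding dist_real_def \<open>s' = 0\<close> by linarith
    qed
  qed (use that in auto)
  have "\<bar>u \<epsilon> (x, t) - u \<epsilon> (x, s)\<bar> \<le> \<eta>"
    if "0 < \<epsilon>" "0 \<le> t" "t \<le> T" "0 \<le> s" "s \<le> T" "\<bar>t - s\<bar> \<le> \<kappa>" for \<epsilon> x t s
    using key[OF that, of x] key[of \<epsilon> s t x] that by (simp add: abs_minus_commute abs_le_iff)
  then show ?thesis using \<kappa>(1) by blast
qed

text \<open>The slope \<open>L\<close> is uniform in \<epsilon>, while the tip size \<open>e\<close>
  may depend on \<epsilon> and on the point: it has to match the continuity of a single function,
  and it enters the final estimate only through \<open>L * e\<close>, which is at most a quarter of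
  \<eta>.\<close>

lemma space_modulus:
  assumes "0 < \<eta>"
  shows "\<exists>\<tau>>0. \<forall>\<epsilon>>0. \<forall>x y t. 0 \<le> t \<longrightarrow> t \<le> T \<longrightarrow> norm (x - y) \<le> \<tau> \<longrightarrow> \<bar>u \<epsilon> (x, t) - u \<epsilon> (y, t)\<bar> \<le> \<eta>"
proof -
  define \<eta>' where "\<eta>' = \<eta> / 4"
  have \<eta>': "0 < \<eta>'" using assms by (simp add: \<eta>'_def)
  obtain M where M: "\<And>\<epsilon> w. 0 < \<epsilon> \<Longrightarrow> w \<in> QT_bar T \<Longrightarrow> \<bar>u \<epsilon> w\<bar> \<le> M" using uniform_bound by blast
  have M0: "0 \<le> M" using M[OF zero_less_one, of "(0, 0)"] T by (force simp: QT_bar_def)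
  obtain \<tau>1 where \<tau>1: "0 < \<tau>1" "\<And>\<epsilon> x t. 0 < \<epsilon> \<Longrightarrow> 0 \<le> t \<Longrightarrow> t \<le> T \<Longrightarrow> t \<le> \<tau>1 \<Longrightarrow> \<bar>u \<epsilon> (x, t) - u0 x\<bar> \<le> \<eta>'"
    using initial_modulus[OF \<eta>'] by blast
  obtain \<tau>2 where \<tau>2': "0 < \<tau>2" "\<forall>\<epsilon>>0. \<forall>x t s. 0 \<le> t \<longrightarrow> t \<le> T \<longrightarrow> 0 \<le> s \<longrightarrow> s \<le> T \<longrightarrow> \<bar>t - s\<bar> \<le> \<tau>2 \<longrightarrow> \<bar>u \<epsilon> (x, t) - u \<epsilon> (x, s)\<bar> \<le> \<eta>'"
    using time_modulus[OF \<eta>'] by (elim exE conjE)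
  note \<tau>2 = \<tau>2'(1) \<tau>2'(2)[rule_format]
  obtain d where d: "0 < d" "\<And>x x'. dist x' x < d \<Longrightarrow> dist (u0 x') (u0 x) < \<eta>'"
    by (rule uniformly_continuous_on_UNIV_obtain[OF u0_uc \<eta>']) (rule that)
  define \<kappa> where "\<kappa> = min (min \<tau>1 \<tau>2) (d / 2)"
  have \<kappa>: "0 < \<kappa>" "\<kappa> \<le> \<tau>1" "\<kappa> \<le> \<tau>2" "\<kappa> < d" using \<tau>1 \<tau>2 d unfolding \<kappa>_def by auto
  \<comment> \<open>The penalties at the maximum are at most \<open>2 * M + L * e\<close>, hence at
    most \<open>2 * M + 1\<close>. This \<open>b\<close>, together with
    \<open>(2 * M + 1) / \<kappa> \<le> L\<close> below, confines the maximum to distance \<kappa>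
    in time and in space.\<close>
  define b where "b = (2 * M + 1) / \<kappa>\<^sup>2"
  have b: "0 < b" "b * \<kappa>\<^sup>2 = 2 * M + 1" using M0 \<kappa> unfolding b_def by auto
  define C where "C = max (2 * b * T) ((1 + 2 * M) * kmass) + 1"
  have C: "2 * b * T \<le> C" "(1 + 2 * M) * kmass \<le> C" "0 < C"
  proof -
    show "2 * b * T \<le> C" "(1 + 2 * M) * kmass \<le> C" unfolding C_def by simp_all
    have "0 < 2 * b * T" using b T by simp
    then show "0 < C" unfolding C_def by linarith
  qed
  obtain L0 where L0: "\<And>L x y p l. L0 \<le> L \<Longrightarrow> L / 2 \<le> norm p \<Longrightarrow> l \<le> C * (1 + L) \<Longrightarrow> C < H x y p - a x y * l"
    using cell_hamiltonian_coercive[OF C(3)] by blast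
  define L where "L = max (max L0 ((2 * M + 1) / \<kappa>)) 1"
  have L: "L0 \<le> L" "(2 * M + 1) / \<kappa> \<le> L" "1 \<le> L" unfolding L_def by auto
  have L\<kappa>: "2 * M + 1 \<le> L * \<kappa>" using L(2) \<kappa>(1) by (simp add: pos_divide_le_eq)
  have key: "u \<epsilon> (x, s) - u \<epsilon> (y, s) \<le> \<eta>"
    if "0 < \<epsilon>" and s: "0 \<le> s" "s \<le> T" and xy: "norm (x - y) \<le> \<eta>' / L" for \<epsilon> x y s
  proof -
    have "(y, s) \<in> QT_bar T" using s by (simp add: QT_bar_def)
    then obtain e0 where e0: "0 < e0" "\<forall>w\<in>QT_bar T. dist w (y, s) < e0 \<longrightarrow> dist (u \<epsilon> w) (u \<epsilon> (y, s)) < \<eta>'"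
      using u_facts(3)[OF \<open>0 < \<epsilon>\<close>] \<eta>' unfolding continuous_on_iff by blast
    define e where "e = min e0 (min 1 \<eta>' / L)"
    have e: "0 < e" "e \<le> e0" "L * e \<le> min 1 \<eta>'"
    proof -
      show "0 < e" "e \<le> e0" using e0 \<eta>' L(3) unfolding e_def by auto
      have "L * e \<le> L * (min 1 \<eta>' / L)" unfolding e_def using L(3) by (intro mult_left_mono) auto
      then show "L * e \<le> min 1 \<eta>'" using L(3) by simp
    qed
    have Lpos: "0 < L" using L(3) by simp
    have coer: "C < F \<epsilon> x p l" if "L / 2 \<le> norm p" "l \<le> C * (1 + L)" for x p l
      using L0[OF L(1) that, of x "inverse \<epsilon> *\<^sub>R x"] by (simp add: F_def)
    have "\<exists>x2 t2. 0 \<le> t2 \<and> t2 \<le> T \<and> L * norm (x2 - y) \<le> 2 * M + L * e \<and> b * (t2 - s)\<^sup>2 \<le> 2 * M + L * e \<and>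
        (t2 = 0 \<or> norm (x2 - y) < e) \<and> (\<forall>x. u \<epsilon> (x, s) - L * (e + norm (x - y)) \<le> u \<epsilon> (x2, t2))"
      by (rule spatial_oscillation_bound[OF T u_facts(1,3)[OF \<open>0 < \<epsilon>\<close>] _ b(1) Lpos C(1,2) _ s e(1)])
        (fact M[OF \<open>0 < \<epsilon>\<close>], fact coer)
    then obtain x2 t2 where 2: "0 \<le> t2" "t2 \<le> T" "L * norm (x2 - y) \<le> 2 * M + L * e" "b * (t2 - s)\<^sup>2 \<le> 2 * M + L * e"
      "t2 = 0 \<or> norm (x2 - y) < e" "\<forall>x. u \<epsilon> (x, s) - L * (e + norm (x - y)) \<le> u \<epsilon> (x2, t2)"
      by (elim exE conjE)
    have "b * (t2 - s)\<^sup>2 \<le> b * \<kappa>\<^sup>2" using 2(4) b(2) e(3) by simp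
    then have ts: "\<bar>t2 - s\<bar> \<le> \<kappa>" using b(1) \<kappa>(1) abs_le_square_iff[of "t2 - s" \<kappa>] by simp
    have "L * norm (x2 - y) \<le> L * \<kappa>" using 2(3) L\<kappa> e(3) by simp
    then have x2: "norm (x2 - y) \<le> \<kappa>" using Lpos by simp
    \<comment> \<open>At the initial time the modulus of \<open>u0\<close> is used. Otherwise the
      maximum is in the tip, where continuity at \<open>(y, s)\<close> and the uniform time modulus
      relate its value to \<open>u \<epsilon> (y, s)\<close>.\<close>
    from 2(5) have "u \<epsilon> (x2, t2) \<le> u \<epsilon> (y, s) + 2 * \<eta>'"
    proof
      assume t2: "t2 = 0"
      then have "s \<le> \<tau>1" using ts \<kappa>(2) s(1) by linarith
      then have "\<bar>u \<epsilon> (y, s) - u0 y\<bar> \<le> \<eta>'" using \<tau>1(2) \<open>0 < \<epsilon>\<close> s by blast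
      moreover have "dist (u0 x2) (u0 y) < \<eta>'" using x2 \<kappa>(4) by (intro d(2)) (simp add: dist_norm)
      ultimately show ?thesis using u_facts(4)[OF \<open>0 < \<epsilon>\<close>, of x2] unfolding dist_real_def t2 by linarith
    next
      assume x2e: "norm (x2 - y) < e"
      have "dist (x2, s) (y, s) < e0" using x2e e(2) by (simp add: dist_Pair_Pair dist_norm)
      then have "dist (u \<epsilon> (x2, s)) (u \<epsilon> (y, s)) < \<eta>'" using e0(2) s by (simp add: QT_bar_def)
      moreover have "\<bar>u \<epsilon> (x2, t2) - u \<epsilon> (x2, s)\<bar> \<le> \<eta>'" using \<tau>2(2)[OF \<open>0 < \<epsilon>\<close> 2(1,2) s] ts \<kappa>(3) by simp
      ultimately show ?thesis unfolding dist_real_def by linarith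
    qed
    moreover have "L * norm (x - y) \<le> \<eta>'" using xy Lpos by (simp add: field_simps)
    ultimately show ?thesis using 2(6)[rule_format, of x] e(3) unfolding \<eta>'_def by (simp add: distrib_left)
  qed
  have "\<bar>u \<epsilon> (x, s) - u \<epsilon> (y, s)\<bar> \<le> \<eta>" if "0 < \<epsilon>" "0 \<le> s" "s \<le> T" "norm (x - y) \<le> \<eta>' / L" for \<epsilon> x y s
    using key[OF that] key[of \<epsilon> s y x] that by (simp add: norm_minus_commute abs_le_iff)
  then show ?thesis using \<eta>' L(3) by (intro exI[of _ "\<eta>' / L"]) auto
qed

lemma equicontinuity:
  assumes "0 < \<eta>"
  shows "\<exists>\<tau>>0. \<forall>\<epsilon>>0. \<forall>w\<in>QT_bar T. \<forall>w'\<in>QT_bar T. dist w w' \<le> \<tau> \<longrightarrow> \<bar>u \<epsilon> w - u \<epsilon> w'\<bar> \<le> \<eta>"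
proof -
  have \<eta>2: "0 < \<eta> / 2" using assms by simp
  obtain \<tau>1 where \<tau>1': "0 < \<tau>1" "\<forall>\<epsilon>>0. \<forall>x t s. 0 \<le> t \<longrightarrow> t \<le> T \<longrightarrow> 0 \<le> s \<longrightarrow> s \<le> T \<longrightarrow> \<bar>t - s\<bar> \<le> \<tau>1 \<longrightarrow> \<bar>u \<epsilon> (x, t) - u \<epsilon> (x, s)\<bar> \<le> \<eta> / 2"
    using time_modulus[OF \<eta>2] by (elim exE conjE)
  note \<tau>1 = \<tau>1'(1) \<tau>1'(2)[rule_format]
  obtain \<tau>2 where \<tau>2': "0 < \<tau>2" "\<forall>\<epsilon>>0. \<forall>x y t. 0 \<le> t \<longrightarrow> t \<le> T \<longrightarrow> norm (x - y) \<le> \<tau>2 \<longrightarrow> \<bar>u \<epsilon> (x, t) - u \<epsilon> (y, t)\<bar> \<le> \<eta> / 2"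
    using space_modulus[OF \<eta>2] by (elim exE conjE)
  note \<tau>2 = \<tau>2'(1) \<tau>2'(2)[rule_format]
  have "\<bar>u \<epsilon> w - u \<epsilon> w'\<bar> \<le> \<eta>" if "0 < \<epsilon>" "w \<in> QT_bar T" "w' \<in> QT_bar T" "dist w w' \<le> min \<tau>1 \<tau>2" for \<epsilon> w w'
  proof -
    obtain x t y s where w: "w = (x, t)" "w' = (y, s)" by (cases w, cases w')
    have ts: "0 \<le> t" "t \<le> T" "0 \<le> s" "s \<le> T" using that by (auto simp: w QT_bar_def)
    have "dist x y \<le> \<tau>2" "dist t s \<le> \<tau>1"
      using that(4) dist_fst_le[of w w'] dist_snd_le[of w w'] by (auto simp: w)
    then have "\<bar>u \<epsilon> (x, t) - u \<epsilon> (x, s)\<bar> \<le> \<eta> / 2" "\<bar>u \<epsilon> (x, s) - u \<epsilon> (y, s)\<bar> \<le> \<eta> / 2"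
      using \<tau>1(2)[OF \<open>0 < \<epsilon>\<close> ts] \<tau>2(2)[OF \<open>0 < \<epsilon>\<close> ts(3,4)] by (auto simp: dist_real_def dist_norm)
    then show ?thesis unfolding w by linarith
  qed
  then show ?thesis using \<tau>1(1) \<tau>2(1) by (intro exI[of _ "min \<tau>1 \<tau>2"]) auto
qed

theorem homogenization:
  "\<exists>v. (\<forall>S. compact S \<longrightarrow> S \<subseteq> QT_bar T \<longrightarrow> uniform_limit S u v (at_right 0)) \<and>
       viscosity_solution_ivp T K (effective_hamiltonian a H) u0 v \<and>
       attains_uniformly T u0 v \<and>
       (\<forall>v'. viscosity_solution T K (effective_hamiltonian a H) v' \<longrightarrow>
             attains_uniformly T u0 v' \<longrightarrow> (\<forall>w\<in>QT_bar T. v' w = v w))"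
proof -
  let ?S = "QT_bar T :: ((real^'n) \<times> real) set"
  let ?Hb = "effective_hamiltonian a H"
  obtain M where M: "\<And>\<epsilon> w. 0 < \<epsilon> \<Longrightarrow> w \<in> ?S \<Longrightarrow> \<bar>u \<epsilon> w\<bar> \<le> M" using uniform_bound by blast
  have M': "\<And>\<epsilon> w. 0 < \<epsilon> \<Longrightarrow> w \<in> ?S \<Longrightarrow> \<bar>- u \<epsilon> w\<bar> \<le> M" using M by simp
  obtain ub where ub: "\<And>w \<eta>. w \<in> ?S \<Longrightarrow> 0 < \<eta> \<Longrightarrow> \<exists>e>0. \<forall>\<epsilon>. 0 < \<epsilon> \<and> \<epsilon> < e \<longrightarrow> u \<epsilon> w \<le> ub w + \<eta>"
    "\<And>w \<eta> e. w \<in> ?S \<Longrightarrow> 0 < \<eta> \<Longrightarrow> 0 < e \<Longrightarrow> \<exists>\<epsilon>. 0 < \<epsilon> \<and> \<epsilon> < e \<and> ub w - \<eta> \<le> u \<epsilon> w" "\<And>w. w \<notin> ?S \<Longrightarrow> ub w = 0"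
    using limsup_family[of ?S u M] M by blast
  \<comment> \<open>\<open>nb\<close> is the limsup of the negated family, so \<open>- nb\<close> is
    the liminf of the family.\<close>
  obtain nb where nb: "\<And>w \<eta>. w \<in> ?S \<Longrightarrow> 0 < \<eta> \<Longrightarrow> \<exists>e>0. \<forall>\<epsilon>. 0 < \<epsilon> \<and> \<epsilon> < e \<longrightarrow> - u \<epsilon> w \<le> nb w + \<eta>"
    "\<And>w \<eta> e. w \<in> ?S \<Longrightarrow> 0 < \<eta> \<Longrightarrow> 0 < e \<Longrightarrow> \<exists>\<epsilon>. 0 < \<epsilon> \<and> \<epsilon> < e \<and> nb w - \<eta> \<le> - u \<epsilon> w" "\<And>w. w \<notin> ?S \<Longrightarrow> nb w = 0"
    using limsup_family[of ?S "\<lambda>\<epsilon> w. - u \<epsilon> w" M] M' by blast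
  have equi': "\<exists>\<tau>>0. \<forall>\<epsilon>>0. \<forall>w\<in>?S. \<forall>w'\<in>?S. dist w w' \<le> \<tau> \<longrightarrow> \<bar>- u \<epsilon> w - - u \<epsilon> w'\<bar> \<le> \<eta>" if "0 < \<eta>" for \<eta>
    using equicontinuity[OF that] by (simp add: abs_minus_commute)
  have a0: "0 \<le> a x y" for x y using a_pos[of x y] by simp
  have subF: "viscosity_subsolution T K (\<lambda>x p l. - a x (inverse \<epsilon> *\<^sub>R x) * l + H x (inverse \<epsilon> *\<^sub>R x) p) (u \<epsilon>)"
    if "0 < \<epsilon>" for \<epsilon> using u_facts(1)[OF that] unfolding F_def .
  have subD: "viscosity_subsolution T K (\<lambda>x p l. - a x (inverse \<epsilon> *\<^sub>R x) * l + - H x (inverse \<epsilon> *\<^sub>R x) (- p)) (\<lambda>w. - u \<epsilon> w)"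
    if "0 < \<epsilon>" for \<epsilon>
  proof -
    have "ham_dual (F \<epsilon>) = (\<lambda>x p l. - a x (inverse \<epsilon> *\<^sub>R x) * l + - H x (inverse \<epsilon> *\<^sub>R x) (- p))"
      by (simp add: ham_dual_def F_def fun_eq_iff)
    then show ?thesis using u_dual[OF that] by simp
  qed
  have H_uc': "\<exists>\<kappa>>0. \<forall>x x' y y' p p'. norm p \<le> R \<longrightarrow> norm p' \<le> R \<longrightarrow> norm (x - x') \<le> \<kappa> \<longrightarrow> norm (y - y') \<le> \<kappa> \<longrightarrow>
      norm (p - p') \<le> \<kappa> \<longrightarrow> \<bar>- H x y (- p) - - H x' y' (- p')\<bar> \<le> \<eta>" if \<eta>: "0 < \<eta>" for R \<eta>
  proof -
    obtain \<kappa> where \<kappa>: "0 < \<kappa>" "\<And>x x' y y' p p'. norm p \<le> R \<Longrightarrow> norm p' \<le> R \<Longrightarrow>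
      norm (x - x') \<le> \<kappa> \<Longrightarrow> norm (y - y') \<le> \<kappa> \<Longrightarrow> norm (p - p') \<le> \<kappa> \<Longrightarrow> \<bar>H x y p - H x' y' p'\<bar> \<le> \<eta>"
      using H_uc_obtain[OF \<eta>] by blast
    have "\<bar>- H x y (- p) - - H x' y' (- p')\<bar> \<le> \<eta>"
      if "norm p \<le> R" "norm p' \<le> R" "norm (x - x') \<le> \<kappa>" "norm (y - y') \<le> \<kappa>" "norm (p - p') \<le> \<kappa>" for x x' y y' p p'
      using \<kappa>(2)[of "- p" "- p'" x x' y y'] that by (simp add: norm_minus_commute abs_minus_commute)
    then show ?thesis using \<kappa>(1) by blast
  qed
  have sub: "viscosity_subsolution T K ?Hb ub"
    by (rule perturbed_test_function[where u = u and amax = amax, OF T a0 a_bounds(3) a_uc H_uc subF u_facts(3) M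
          equicontinuity ub(1) ub(2) effective_hamiltonian_solvable])
  have celld: "cell_problem_solvable a (\<lambda>x y p. - H x y (- p)) x p l (ham_dual ?Hb x p l)" for x p l
    using cell_problem_solvable_dual[OF effective_hamiltonian_solvable, of x "- p" "- l"] by (simp add: ham_dual_def)
  have contm: "continuous_on ?S (\<lambda>w. - u \<epsilon> w)" if "0 < \<epsilon>" for \<epsilon>
    by (intro continuous_intros u_facts(3)[OF that])
  have "viscosity_subsolution T K (ham_dual ?Hb) nb"
    by (rule perturbed_test_function[where u = "\<lambda>\<epsilon> w. - u \<epsilon> w" and amax = amax, OF T a0 a_bounds(3) a_uc H_uc' subD contm M'
          equi' nb(1) nb(2) celld])
  then have super: "viscosity_supersolution T K ?Hb (\<lambda>w. - nb w)"
    by (intro subsolution_dual_imp_supersolution) simp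
  have adm: "admissible ?Hb" by (rule admissible_effective_hamiltonian)
  \<comment> \<open>Estimates against the initial data that hold for all \<epsilon> are inherited by
    the upper and the lower limit alike.\<close>
  have near: "\<bar>v w - u0 (fst w)\<bar> \<le> \<eta>"
    if v: "v = ub \<or> v = (\<lambda>w. - nb w)" and w: "w \<in> ?S" and h: "\<And>\<epsilon>. 0 < \<epsilon> \<Longrightarrow> \<bar>u \<epsilon> w - u0 (fst w)\<bar> \<le> \<eta>" for v w \<eta>
  proof -
    have b: "\<bar>v w - u0 (fst w)\<bar> \<le> \<eta> + e" if e: "0 < e" for e
    proof -
      obtain \<epsilon>1 where 1: "0 < \<epsilon>1" "ub w - e \<le> u \<epsilon>1 w" using ub(2)[OF w e zero_less_one] by blast
      obtain \<epsilon>2 where 2: "0 < \<epsilon>2" "nb w - e \<le> - u \<epsilon>2 w" using nb(2)[OF w e zero_less_one] by blast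
      obtain e3 where 3: "0 < e3" "\<forall>\<epsilon>. 0 < \<epsilon> \<and> \<epsilon> < e3 \<longrightarrow> u \<epsilon> w \<le> ub w + e" using ub(1)[OF w e] by blast
      obtain e4 where 4: "0 < e4" "\<forall>\<epsilon>. 0 < \<epsilon> \<and> \<epsilon> < e4 \<longrightarrow> - u \<epsilon> w \<le> nb w + e" using nb(1)[OF w e] by blast
      have "u (e3 / 2) w \<le> ub w + e" "- u (e4 / 2) w \<le> nb w + e" "0 < e3 / 2" "0 < e4 / 2" using 3 4 by auto
      moreover note h[OF 1(1)] h[OF 2(1)] h[OF \<open>0 < e3 / 2\<close>] h[OF \<open>0 < e4 / 2\<close>]
      ultimately show ?thesis using v 1(2) 2(2) by (elim disjE) (auto simp: abs_le_iff)
    qed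
    then show ?thesis by (rule field_le_epsilon)
  qed
  have init: "attains_initially T u0 v" if v: "v = ub \<or> v = (\<lambda>w. - nb w)" for v
    unfolding attains_initially_def
  proof (intro allI impI)
    fix \<eta> :: real assume "0 < \<eta>"
    obtain \<tau> where \<tau>: "0 < \<tau>" "\<And>\<epsilon> x t. 0 < \<epsilon> \<Longrightarrow> 0 \<le> t \<Longrightarrow> t \<le> T \<Longrightarrow> t \<le> \<tau> \<Longrightarrow> \<bar>u \<epsilon> (x, t) - u0 x\<bar> \<le> \<eta>"
      using initial_modulus[OF \<open>0 < \<eta>\<close>] by blast
    have "\<bar>v (x, t) - u0 x\<bar> \<le> \<eta>" if "0 \<le> t" "t \<le> T" "t \<le> \<tau>" for x t
      using near[OF v, of "(x, t)" \<eta>] \<tau>(2) that by (simp add: QT_bar_def)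
    then show "\<exists>\<tau>>0. \<forall>x t. 0 \<le> t \<longrightarrow> t \<le> T \<longrightarrow> t \<le> \<tau> \<longrightarrow> \<bar>v (x, t) - u0 x\<bar> \<le> \<eta>" using \<tau>(1) by blast
  qed
  define M2 where "M2 = M + 2 * B0"
  have vfacts: "continuous_on ?S v" "\<And>w. w \<in> ?S \<Longrightarrow> \<bar>v w\<bar> \<le> M2"
    if v: "v = ub \<or> v = (\<lambda>w. - nb w)" for v
  proof -
    have eq: "\<exists>\<tau>>0. \<forall>w\<in>?S. \<forall>w'\<in>?S. dist w w' \<le> \<tau> \<longrightarrow> \<bar>v w - v w'\<bar> \<le> \<eta>" if "0 < \<eta>" for \<eta>
      using v
    proof
      assume "v = ub"
      then show ?thesis using upper_relaxed_equicontinuous[of ?S u ub, OF equicontinuity ub(1) ub(2) that] by simp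
    next
      assume "v = (\<lambda>w. - nb w)"
      then show ?thesis
        using upper_relaxed_equicontinuous[of ?S "\<lambda>\<epsilon> w. - u \<epsilon> w" nb, OF equi' nb(1) nb(2) that]
        by (simp add: abs_minus_commute)
    qed
    show "continuous_on ?S v"
      unfolding continuous_on_iff
    proof (intro ballI allI impI)
      fix w :: "(real^'n) \<times> real" and e :: real assume w: "w \<in> ?S" and "0 < e"
      then obtain \<tau> where "0 < \<tau>" "\<forall>w\<in>?S. \<forall>w'\<in>?S. dist w w' \<le> \<tau> \<longrightarrow> \<bar>v w - v w'\<bar> \<le> e / 2"
        using eq[of "e / 2"] by auto
      then show "\<exists>d>0. \<forall>w'\<in>?S. dist w' w < d \<longrightarrow> dist (v w') (v w) < e"
        using w \<open>0 < e\<close> by (intro exI[of _ \<tau>]) (force simp: dist_real_def)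
    qed
    show "\<bar>v w\<bar> \<le> M2" if w: "w \<in> ?S" for w
    proof -
      have "\<bar>v w - u0 (fst w)\<bar> \<le> M + B0"
      proof (rule near[OF v w])
        show "\<bar>u \<epsilon> w - u0 (fst w)\<bar> \<le> M + B0" if "0 < \<epsilon>" for \<epsilon>
          using M[OF that w] B0[of "fst w"] by linarith
      qed
      then show ?thesis using B0[of "fst w"] unfolding M2_def by linarith
    qed
  qed
  define vb where "vb = (\<lambda>w. - nb w)"
  note ub_facts = vfacts[of ub, OF disjI1[OF refl]] init[of ub, OF disjI1[OF refl]]
  note vb_facts = vfacts[of "\<lambda>w. - nb w", OF disjI2[OF refl]] init[of "\<lambda>w. - nb w", OF disjI2[OF refl]]
  \<comment> \<open>This is the nontrivial inequality: the limsup is a subsolution, the liminf a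
    supersolution, and both attain the same data. The reverse one is immediate from the meaning of
    the two limits.\<close>
  have le1: "ub w \<le> vb w" if "w \<in> ?S" for w
    unfolding vb_def
    by (rule comparison_ivp[OF T adm sub super ub_facts(1) vb_facts(1) ub_facts(2) vb_facts(2)
          ub_facts(3) vb_facts(3) u0_uc that])
  have le2: "vb w \<le> ub w" if w: "w \<in> ?S" for w
  proof (rule field_le_epsilon)
    fix e :: real assume "0 < e"
    then have e2: "0 < e / 2" by simp
    obtain e3 where 3: "0 < e3" "\<forall>\<epsilon>. 0 < \<epsilon> \<and> \<epsilon> < e3 \<longrightarrow> u \<epsilon> w \<le> ub w + e / 2" using ub(1)[OF w e2] by blast
    obtain e4 where 4: "0 < e4" "\<forall>\<epsilon>. 0 < \<epsilon> \<and> \<epsilon> < e4 \<longrightarrow> - u \<epsilon> w \<le> nb w + e / 2" using nb(1)[OF w e2] by blast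
    have "0 < min e3 e4 / 2" "min e3 e4 / 2 < e3" "min e3 e4 / 2 < e4" using 3(1) 4(1) by auto
    then have "u (min e3 e4 / 2) w \<le> ub w + e / 2" "- u (min e3 e4 / 2) w \<le> nb w + e / 2"
      using 3(2) 4(2) by blast+
    then show "vb w \<le> ub w + e" unfolding vb_def by linarith
  qed
  \<comment> \<open>Equality holds outside \<open>?S\<close> too, so the supersolution property
    transfers by rewriting.\<close>
  have eq: "vb = ub"
  proof (rule ext)
    show "vb w = ub w" for w
      using le1[of w] le2[of w] ub(3)[of w] nb(3)[of w] by (cases "w \<in> ?S") (auto simp: vb_def)
  qed
  have super': "viscosity_supersolution T K ?Hb ub" using super eq unfolding vb_def by simp
  have cont: "continuous_on ?S ub" and bd: "\<And>w. w \<in> ?S \<Longrightarrow> \<bar>ub w\<bar> \<le> M2" and ini: "attains_initially T u0 ub"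
    using vfacts[of ub] init[of ub] by auto
  have QT_sub: "QT T \<subseteq> ?S" by (auto simp: QT_def QT_bar_def)
  have bS: "bounded (ub ` ?S)" using bd unfolding bounded_iff by (intro exI[of _ M2]) auto
  have sol: "viscosity_solution T K ?Hb ub"
    unfolding viscosity_solution_def
    using bounded_subset[OF bS image_mono[OF QT_sub]] continuous_on_subset[OF cont QT_sub] sub super' by blast
  have ivp: "viscosity_solution_ivp T K ?Hb u0 ub"
    unfolding viscosity_solution_ivp_def
    using bS cont sol attains_initially_at_0[OF ini less_imp_le[OF T]] by blast
  have M0: "0 \<le> M" using M[OF zero_less_one, of "(0, 0)"] T by (force simp: QT_bar_def)
  have B0M2: "\<bar>u0 x\<bar> \<le> M2" for x using B0[of x] M0 unfolding M2_def by linarith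
  have att: "attains_uniformly T u0 ub" by (rule attains_initially_imp_uniformly[OF T bd B0M2 ini])
  have lim: "uniform_limit S u ub (at_right 0)" if S: "compact S" "S \<subseteq> ?S" for S
    unfolding uniform_limit_iff
  proof (intro allI impI)
    fix e :: real assume "0 < e"
    then have e2: "0 < e / 2" by simp
    obtain e3 where 3: "0 < e3" "\<forall>\<epsilon>. 0 < \<epsilon> \<and> \<epsilon> < e3 \<longrightarrow> (\<forall>w\<in>S. u \<epsilon> w \<le> ub w + e / 2)"
      using upper_relaxed_uniform[of ?S u ub, OF equicontinuity ub(1) ub(2) e2 S] by blast
    obtain e4 where 4: "0 < e4" "\<forall>\<epsilon>. 0 < \<epsilon> \<and> \<epsilon> < e4 \<longrightarrow> (\<forall>w\<in>S. - u \<epsilon> w \<le> nb w + e / 2)"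
      using upper_relaxed_uniform[of ?S "\<lambda>\<epsilon> w. - u \<epsilon> w" nb, OF equi' nb(1) nb(2) e2 S] by blast
    have nbub: "nb w = - ub w" for w using eq unfolding vb_def by (metis minus_minus)
    show "\<forall>\<^sub>F \<epsilon> in at_right 0. \<forall>w\<in>S. dist (u \<epsilon> w) (ub w) < e"
      unfolding eventually_at_right_field
    proof (intro exI[of _ "min e3 e4"] conjI allI impI ballI)
      fix \<epsilon> w assume \<epsilon>: "0 < \<epsilon>" "\<epsilon> < min e3 e4" and w: "w \<in> S"
      have "u \<epsilon> w \<le> ub w + e / 2" "- u \<epsilon> w \<le> nb w + e / 2" using 3(2) 4(2) \<epsilon> w by auto
      then show "dist (u \<epsilon> w) (ub w) < e" using \<open>0 < e\<close> nbub[of w] unfolding dist_real_def by linarith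
    qed (use 3(1) 4(1) in simp)
  qed
  have uniq: "v w = ub w" if v: "viscosity_solution T K ?Hb v" "attains_uniformly T u0 v" and w: "w \<in> ?S" for v w
  proof -
    have v_ini: "attains_initially T u0 v" by (rule attains_uniformly_imp_initially[OF v(2)])
    have v_cont: "continuous_on ?S v"
      using v(1) continuous_on_QT_bar_if_attains[OF _ v_ini T u0_uc] unfolding viscosity_solution_def by blast
    obtain Mv where Mv: "\<And>w. w \<in> QT T \<Longrightarrow> \<bar>v w\<bar> \<le> Mv"
      using v(1) unfolding viscosity_solution_def bounded_iff by auto
    define M3 where "M3 = max M2 Mv"
    have bd3: "\<bar>v w\<bar> \<le> M3" "\<bar>ub w\<bar> \<le> M3" if "w \<in> ?S" for w
    proof -
      obtain x t where xt: "w = (x, t)" by (cases w)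
      have "w \<in> QT T \<or> w = (x, 0)" using that by (auto simp: xt QT_def QT_bar_def)
      moreover have "v (x, 0) = u0 x" by (rule attains_initially_at_0[OF v_ini less_imp_le[OF T]])
      ultimately show "\<bar>v w\<bar> \<le> M3" using Mv[of w] B0M2[of x] unfolding M3_def by auto
      show "\<bar>ub w\<bar> \<le> M3" using bd[OF that] unfolding M3_def by simp
    qed
    have vs: "viscosity_subsolution T K ?Hb v" "viscosity_supersolution T K ?Hb v"
      using v(1) unfolding viscosity_solution_def by auto
    have "v w \<le> ub w"
      by (rule comparison_ivp[OF T adm vs(1) super' v_cont cont bd3(1) bd3(2) v_ini ini u0_uc w])
    moreover have "ub w \<le> v w"
      by (rule comparison_ivp[OF T adm sub vs(2) cont v_cont bd3(2) bd3(1) ini v_ini u0_uc w])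
    ultimately show ?thesis by simp
  qed
  show ?thesis using lim ivp att uniq by (intro exI[of _ ub]) blast
qed

end

text \<open>Two steps: \<^term>\<open>\<mu> = 1 / norm p\<close> bounds \<^term>\<open>H\<close> below by a linear function, and then
  \<^term>\<open>\<mu> = 1 / 2\<close> yields the growth of order \<^term>\<open>m\<close>.\<close>
lemma superlinear_growth:
  fixes H :: "real^'n \<Rightarrow> real^'n \<Rightarrow> real^'n \<Rightarrow> real"
  assumes pos: "0 < b0" "0 < C0" "1 < m"
    and growth: "\<And>\<mu> x y p. 0 < \<mu> \<Longrightarrow> \<mu> < 1 \<Longrightarrow>
           \<mu> * H x y (inverse \<mu> *\<^sub>R p) - H x y p \<ge> (1 - \<mu>) * (b0 * norm p powr m - C0)"
    and C1: "\<And>x y p. norm p \<le> 1 \<Longrightarrow> \<bar>H x y p\<bar> \<le> C1"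
  shows "\<exists>r>0. \<forall>x y p. r \<le> norm p \<longrightarrow> A * norm p \<le> H x y p"
proof -
  have C1n: "0 \<le> C1" using C1[of 0 0 0] by simp
  have lin: "- (C1 + C0) * norm p \<le> H x y p" if p: "1 \<le> norm p" for x y p
  proof (cases "norm p = 1")
    case True
    then show ?thesis using C1[of p x y] pos(2) by simp
  next
    case False
    define s where "s = norm p"
    have s: "1 < s" using p False by (simp add: s_def)
    define e where "e = inverse s *\<^sub>R p"
    have e: "norm e = 1" using s by (simp add: e_def s_def[symmetric])
    have e': "inverse (inverse s) *\<^sub>R e = p" using s by (simp add: e_def)
    have "(1 - inverse s) * (b0 * norm e powr m - C0) \<le> inverse s * H x y (inverse (inverse s) *\<^sub>R e) - H x y e"
      using growth[of "inverse s" e x y] s by (simp add: inverse_less_1_iff)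
    moreover have "- C0 \<le> (1 - inverse s) * (b0 * norm e powr m - C0)"
    proof -
      have "(1 - inverse s) * (- C0) \<le> (1 - inverse s) * (b0 * norm e powr m - C0)"
        using s pos(1) e by (intro mult_left_mono) (auto simp: inverse_le_1_iff)
      moreover have "- C0 \<le> (1 - inverse s) * (- C0)" using s pos(2) by (simp add: algebra_simps)
      ultimately show ?thesis by linarith
    qed
    moreover have "- C1 \<le> H x y e" using C1[of e x y] e by simp
    ultimately have "- (C1 + C0) \<le> inverse s * H x y p" unfolding e' by linarith
    then have "s * (- (C1 + C0)) \<le> s * (inverse s * H x y p)" using s by (intro mult_left_mono) auto
    also have "s * (inverse s * H x y p) = H x y p" using s by simp
    finally show ?thesis by (simp only: s_def[symmetric] mult.commute)
  qed
  \<comment> \<open>Chosen so that, with \<open>norm p = 2 * s\<close>, the losses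
    \<open>C0 * s\<close> and \<open>2 * (C1 + C0) * s\<close> are paid from
    \<open>2 * A' * s\<close> and at least \<open>2 * \<bar>A\<bar> * s\<close> remains.\<close>
  define A' where "A' = \<bar>A\<bar> + C1 + 2 * C0"
  have A': "0 < A'" using pos(2) C1n by (simp add: A'_def)
  define X where "X = 2 * A' / b0"
  have X: "0 < X" using A' pos(1) by (simp add: X_def)
  \<comment> \<open>For \<open>s = norm p / 2\<close> this ensures \<open>s \<ge> 1\<close> and
    \<open>s powr (m - 1) \<ge> X\<close>, that is,
    \<open>b0 * s powr m \<ge> 2 * A' * s\<close>.\<close>
  define r where "r = max 2 (2 * X powr (1 / (m - 1)))"
  show ?thesis
  proof (intro exI[of _ r] conjI allI impI)
    show "0 < r" by (simp add: r_def)
    fix x y p assume p: "r \<le> norm (p :: real^'n)"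
    define s where "s = norm p / 2"
    have s: "1 \<le> s" "X powr (1 / (m - 1)) \<le> s" using p by (auto simp: s_def r_def)
    have "X = (X powr (1 / (m - 1))) powr (m - 1)" using X pos(3) by (simp add: powr_powr)
    also have "\<dots> \<le> s powr (m - 1)" using s(2) pos(3) by (intro powr_mono2) auto
    finally have "X * s \<le> s powr (m - 1) * s" using s(1) by (intro mult_right_mono) auto
    also have "s powr (m - 1) * s = s powr m" using s(1) powr_add[of s "m - 1" 1] by simp
    finally have "b0 * (X * s) \<le> b0 * s powr m" using pos(1) by (intro mult_left_mono) auto
    then have big: "2 * A' * s \<le> b0 * s powr m" using pos(1) by (simp add: X_def)
    define e where "e = (1 / 2 :: real) *\<^sub>R p"
    have e: "norm e = s" "inverse (1 / 2 :: real) *\<^sub>R e = p" by (simp_all add: e_def s_def)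
    have "(1 - 1 / 2) * (b0 * norm e powr m - C0) \<le> 1 / 2 * H x y (inverse (1 / 2) *\<^sub>R e) - H x y e"
      by (rule growth) auto
    then have "b0 * s powr m - C0 + 2 * H x y e \<le> H x y p" unfolding e by simp
    moreover have "- (C1 + C0) * s \<le> H x y e" using lin[of e x y] s(1) e(1) by simp
    moreover have "C0 \<le> C0 * s" using s(1) pos(2) by simp
    ultimately have "2 * A' * s - C0 * s - 2 * ((C1 + C0) * s) \<le> H x y p" using big by linarith
    moreover have "2 * A' * s - C0 * s - 2 * ((C1 + C0) * s) = 2 * \<bar>A\<bar> * s + C0 * s"
      by (simp add: A'_def algebra_simps)
    moreover have "A * norm p \<le> 2 * \<bar>A\<bar> * s"
      using mult_right_mono[of A "\<bar>A\<bar>" "norm p"] by (simp add: s_def)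
    moreover have "0 \<le> C0 * s" using s(1) pos(2) by simp
    ultimately show "A * norm p \<le> H x y p" by linarith
  qed
qed

section \<open>Verification of the structural conditions for the given data\<close>

lemma modulus_small:
  assumes "modulus_of_continuity \<omega>" "0 < \<eta>"
  obtains d where "0 < d" "\<And>t. 0 \<le> t \<Longrightarrow> t \<le> d \<Longrightarrow> \<omega> t \<le> \<eta>"
proof -
  have "\<omega> 0 = 0" "(\<omega> \<longlongrightarrow> 0) (at_right 0)" using assms(1) unfolding modulus_of_continuity_def by auto
  from order_tendstoD(2)[OF this(2) assms(2)]
  obtain b where b: "0 < b" "\<And>t. 0 < t \<Longrightarrow> t < b \<Longrightarrow> \<omega> t < \<eta>"
    unfolding eventually_at_right_field by auto
  show ?thesis
  proof (rule that[of "b / 2"])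
    show "\<omega> t \<le> \<eta>" if "0 \<le> t" "t \<le> b / 2" for t
      using b(2)[of t] that b(1) \<open>\<omega> 0 = 0\<close> assms(2) by (cases "t = 0") auto
  qed (use b(1) in simp)
qed

theorem theorem6p3:
  fixes T \<sigma> b0 C0 m :: real
    and a :: "real^'n \<Rightarrow> real^'n \<Rightarrow> real"
    and H :: "real^'n \<Rightarrow> real^'n \<Rightarrow> real^'n \<Rightarrow> real"
    and K kbar u0 :: "real^'n \<Rightarrow> real"
    and ueps :: "real \<Rightarrow> (real^'n) \<times> real \<Rightarrow> real"
  assumes "0 < T" and "0 < \<sigma>" and "\<sigma> < 1"
    and "uniformly_continuous_on UNIV (\<lambda>(x, y). a x y)"
    and "continuous_on UNIV (\<lambda>(x, y, p). H x y p)"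
    and "K \<in> borel_measurable lebesgue" and "\<And>z. 0 \<le> K z"
    and "\<exists>a0>0. \<forall>x y. a0 \<le> a x y \<and> a x y \<le> inverse a0"
    and "\<And>z. z \<noteq> 0 \<Longrightarrow> kbar z = K z * norm z powr (real CARD('n) + \<sigma>)"
    and "bounded (range kbar)" and "isCont kbar 0"
    and "kbar 0 = frac_laplacian_const TYPE('n) \<sigma>" and "frac_laplacian_const TYPE('n) \<sigma> > 0"
    and "bounded (range (\<lambda>(x, y). H x y 0))" and "bounded (range (\<lambda>(x, y). a x y))"
    and "\<And>x. Z_periodic (a x)" and "\<And>x p. Z_periodic (\<lambda>y. H x y p)"
    and "0 < b0" and "0 < C0" and "1 < m"
    and "\<And>\<mu> x y p. 0 < \<mu> \<Longrightarrow> \<mu> < 1 \<Longrightarrow>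
           \<mu> * H x y (inverse \<mu> *\<^sub>R p) - H x y p \<ge> (1 - \<mu>) * (b0 * norm p powr m - C0)"
    and "\<exists>\<omega>. modulus_of_continuity \<omega> \<and>
           (\<forall>R>0. \<forall>x x' y y' p p'. norm p \<le> R \<longrightarrow> norm p' \<le> R \<longrightarrow>
              \<bar>H x y p - H x' y' p'\<bar>
                \<le> \<omega> (norm (x - x') + norm (y - y')) * (1 + R powr m)
                   + \<omega> (norm (p - p')) * (1 + R powr (m - 1)))"
    and "bounded (range u0)" and "uniformly_continuous_on UNIV u0"
    and "\<And>\<epsilon>. 0 < \<epsilon> \<Longrightarrow>
           viscosity_solution_ivp T K
             (\<lambda>x p l. - a x (inverse \<epsilon> *\<^sub>R x) * l + H x (inverse \<epsilon> *\<^sub>R x) p) u0 (ueps \<epsilon>)"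
  shows "\<exists>u. (\<forall>S. compact S \<longrightarrow> S \<subseteq> QT_bar T \<longrightarrow> uniform_limit S ueps u (at_right 0)) \<and>
             viscosity_solution_ivp T K (effective_hamiltonian a H) u0 u \<and>
             attains_uniformly T u0 u \<and>
             (\<forall>v. viscosity_solution T K (effective_hamiltonian a H) v \<longrightarrow>
                  attains_uniformly T u0 v \<longrightarrow> (\<forall>w\<in>QT_bar T. v w = u w))"
proof -
  obtain a0 where a0: "0 < a0" "\<And>x y. a0 \<le> a x y" "\<And>x y. a x y \<le> inverse a0"
    using assms(8) by blast
  obtain \<omega> where \<omega>: "modulus_of_continuity \<omega>" and H4: "\<forall>R>0. \<forall>x x' y y' p p'. norm p \<le> R \<longrightarrow> norm p' \<le> R \<longrightarrow>
      \<bar>H x y p - H x' y' p'\<bar> \<le> \<omega> (norm (x - x') + norm (y - y')) * (1 + R powr m) + \<omega> (norm (p - p')) * (1 + R powr (m - 1))"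
    using assms(22) by blast
  have \<omega>0: "\<omega> 0 = 0" using \<omega> unfolding modulus_of_continuity_def by (elim conjE)
  have \<omega>m: "\<omega> s \<le> \<omega> t" if "0 \<le> s" "s \<le> t" for s t
  proof (rule mono_onD[of "{0..}" \<omega>])
    show "mono_on {0..} \<omega>" using \<omega> unfolding modulus_of_continuity_def by (elim conjE)
  qed (use that in auto)
  obtain CH where CH: "\<And>x y. \<bar>H x y 0\<bar> \<le> CH"
    using assms(14) unfolding bounded_iff by auto
  have H_bd: "\<exists>C. \<forall>x y p. norm p \<le> R \<longrightarrow> \<bar>H x y p\<bar> \<le> C" for R
  proof (intro exI allI impI)
    fix x y and p :: "real^'n" assume p: "norm p \<le> R"
    \<comment> \<open>The radius \<open>\<bar>R\<bar> + 1\<close> is positive, as the continuity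
      condition on \<open>H\<close> demands, whatever the sign of \<open>R\<close>.\<close>
    let ?R = "\<bar>R\<bar> + 1"
    have "\<bar>H x y p - H x y 0\<bar> \<le> \<omega> (norm (x - x) + norm (y - y)) * (1 + ?R powr m) + \<omega> (norm (p - 0)) * (1 + ?R powr (m - 1))"
      using p by (intro H4[rule_format]) auto
    also have "\<dots> = \<omega> (norm p) * (1 + ?R powr (m - 1))" using \<omega>0 by simp
    also have "\<dots> \<le> \<omega> ?R * (1 + ?R powr (m - 1))" using p by (intro mult_right_mono \<omega>m) (auto simp: add_nonneg_nonneg)
    finally show "\<bar>H x y p\<bar> \<le> CH + \<omega> ?R * (1 + ?R powr (m - 1))" using CH[of x y] by linarith
  qed
  interpret levy_kernel K
  proof
    show "K \<in> borel_measurable lebesgue" by (rule assms(6))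
    show "0 \<le> K z" for z by (rule assms(7))
    \<comment> \<open>A bound for \<open>kbar\<close> is a domination of \<open>K\<close>, off the
      origin, by a multiple of the fractional kernel.\<close>
    obtain C where C: "\<And>z. \<bar>kbar z\<bar> \<le> C" using assms(10) unfolding bounded_iff by auto
    show "integrable lebesgue (\<lambda>z. min 1 (norm z) * K z)"
    proof (rule integrable_levy_kernel[OF assms(6,7,2,3)])
      show "0 \<le> C" using C[of 0] by linarith
      fix z :: "real^'n" assume "z \<noteq> 0"
      then have n: "0 < norm z powr (real CARD('n) + \<sigma>)" by simp
      have "K z * norm z powr (real CARD('n) + \<sigma>) \<le> C" using assms(9)[OF \<open>z \<noteq> 0\<close>] C[of z] by linarith
      then have "K z \<le> C / norm z powr (real CARD('n) + \<sigma>)" using n by (simp add: pos_le_divide_eq)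
      then show "K z \<le> C * norm z powr - (real DIM(real^'n) + \<sigma>)"
        by (simp only: powr_minus divide_inverse DIM_cart DIM_real mult_1_right)
    qed
  qed
  interpret homogenization_data a H a0 "inverse a0"
  proof
    show "\<exists>\<kappa>>0. \<forall>x x' y y'. norm (x - x') \<le> \<kappa> \<longrightarrow> norm (y - y') \<le> \<kappa> \<longrightarrow> \<bar>a x y - a x' y'\<bar> \<le> \<eta>" if \<eta>: "0 < \<eta>" for \<eta>
    proof -
      obtain d where d: "0 < d" "\<And>w w'. dist w' w < d \<Longrightarrow> dist ((\<lambda>(x, y). a x y) w') ((\<lambda>(x, y). a x y) w) < \<eta>"
        by (rule uniformly_continuous_on_UNIV_obtain[OF assms(4) \<eta>]) (rule that)
      have "\<bar>a x y - a x' y'\<bar> \<le> \<eta>" if "norm (x - x') \<le> d / 3" "norm (y - y') \<le> d / 3" for x x' y y'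
      proof -
        have "dist (x, y) (x', y') < d" using dist_Pair_le[of x y x' y'] that d(1) by (simp add: dist_norm)
        from d(2)[OF this] show ?thesis by (simp add: dist_real_def)
      qed
      then show ?thesis using d(1) by (intro exI[of _ "d / 3"]) auto
    qed
    show "\<exists>\<kappa>>0. \<forall>x x' y y' p p'. norm p \<le> R \<longrightarrow> norm p' \<le> R \<longrightarrow> norm (x - x') \<le> \<kappa> \<longrightarrow> norm (y - y') \<le> \<kappa> \<longrightarrow>
        norm (p - p') \<le> \<kappa> \<longrightarrow> \<bar>H x y p - H x' y' p'\<bar> \<le> \<eta>" if \<eta>: "0 < \<eta>" for R \<eta>
    proof -
      define R' where "R' = \<bar>R\<bar> + 1"
      \<comment> \<open>The sum of the two weights at radius \<open>R'\<close>: if both values of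
        \<omega> are at most \<open>\<eta> / S\<close>, the right-hand side of the continuity
        condition is at most \<eta>.\<close>
      define S where "S = (1 + R' powr m) + (1 + R' powr (m - 1))"
      have S: "0 < S" unfolding S_def by (simp add: add_pos_nonneg)
      obtain d where d: "0 < d" "\<And>t. 0 \<le> t \<Longrightarrow> t \<le> d \<Longrightarrow> \<omega> t \<le> \<eta> / S"
        by (rule modulus_small[OF \<omega> divide_pos_pos[OF \<eta> S]]) (rule that)
      have "\<bar>H x y p - H x' y' p'\<bar> \<le> \<eta>"
        if b: "norm p \<le> R" "norm p' \<le> R" "norm (x - x') \<le> d / 2" "norm (y - y') \<le> d / 2" "norm (p - p') \<le> d / 2"
        for x x' y y' p p'
      proof -
        have "\<bar>H x y p - H x' y' p'\<bar> \<le> \<omega> (norm (x - x') + norm (y - y')) * (1 + R' powr m) + \<omega> (norm (p - p')) * (1 + R' powr (m - 1))"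
          using b unfolding R'_def by (intro H4[rule_format]) auto
        also have "\<dots> \<le> \<eta> / S * (1 + R' powr m) + \<eta> / S * (1 + R' powr (m - 1))"
          using b d(1) by (intro add_mono mult_right_mono d(2)) (auto simp: add_nonneg_nonneg)
        also have "\<dots> = \<eta> / S * S" unfolding S_def by (rule distrib_left[symmetric])
        also have "\<dots> = \<eta>" using S by simp
        finally show ?thesis .
      qed
      then show ?thesis using d(1) by (intro exI[of _ "d / 2"]) auto
    qed
    show "\<exists>r>0. \<forall>x y p. r \<le> norm p \<longrightarrow> A * norm p \<le> H x y p" for A
    proof -
      obtain C1 where C1: "\<And>x y p. norm p \<le> 1 \<Longrightarrow> \<bar>H x y p\<bar> \<le> C1" using H_bd[of 1] by blast
      show ?thesis by (rule superlinear_growth[OF assms(18-21) C1])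
    qed
  qed (use a0 H_bd assms(16,17) in auto)
  obtain B0 where B0: "\<And>x. \<bar>u0 x\<bar> \<le> B0" using assms(23) unfolding bounded_iff by auto
  interpret homogenization_problem K a H a0 "inverse a0" T u0 B0 ueps
    by standard (use assms(1) B0 assms(24,25) in auto)
  show ?thesis by (rule homogenization)
qed

end
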